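(* Let $n\ge1$, and let $p>1$ if $n=1,2$, and $1<p<\frac n{n-2}$ if $n\ge3$. Put $\gamma=\frac12$ if $n=1$ and $\gamma=1$ if $n\ge2$. Let $\lambda\in\mathbb{C}\setminus\{0\}$ with $\operatorname{Im}\lambda<0$ satisfy $\frac{p-1}{2\sqrt p}|\operatorname{Re}\lambda|\le|\operatorname{Im}\lambda|$. Let $\delta=1$, $\delta_*=1-\frac n2(p-1)$, and suppose that $\delta_*<\frac{\delta\theta}2$ with some $0<\theta<\frac n2(1-p)+\gamma p$. Let $$p_*(n)=\frac{n^2+3n+6+\sqrt{9n^2+28n+36}}{(n+2)^2},\qquad p_{**}(n)=\begin{cases}2,&n=1,\\ 1,&n=2,\\ \frac{4+n}{2+n},&n\ge3.\end{cases}$$ Then for any $u_0\in H^{1,1}(\mathbb{R}^n)$, the unique global solution $u\in C([0,\infty);H^{1,1}(\mathbb{R}^n))$ of $$ i\partial_tu+\tfrac12\Delta u=\lambda|u|^{p-1}u,\qquad u(0,x)=u_0(x),$$ satisfies, for some $C>0$ and all $t\ge T_0$, $$\|u(t)\|_{L^2}\le\begin{cases}C\,t^{-\frac{2\delta_*}{(p-1)(2+n)}},& p_*(n)\le p<1+\frac2n,\\[4pt] C\,t^{\delta_*-\frac{\delta\theta}2},& p_{**}(n)<p<p_*(n).\end{cases}$$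
   Context: Here $u=u(t,x):\mathbb{R}\times\mathbb{R}^n\to\mathbb{C}$. $H^{1,1}(\mathbb{R}^n)=\{f\in H^1(\mathbb{R}^n):\ \|f\|_{H^{1,1}}=\|\langle x\rangle f\|_{L^2}+\|\langle\nabla\rangle f\|_{L^2}<\infty\}$ with $\langle x\rangle=(1+|x|^2)^{1/2}$ and $\langle\nabla\rangle f=\mathcal F^{-1}[\langle\xi\rangle\widehat f\,]$. The theorem is the case $\sigma\equiv0$ of the equation $i\partial_tu-H_0(t)u=\lambda|u|^{p-1}u$, $H_0(t)=-\frac12\Delta+\frac{\sigma(t)}2|x|^2$; the fundamental solutions of $y''+\sigma y=0$ are then $y_1(t)=1$, $y_2(t)=t$. $T_0>0$ is a fixed time such that $|y_2(t)|\ge c_0>0$ and $|y_1(t)/y_2(t)|\le Ct^{-\delta}$ for $t\ge T_0$ (with $\delta=1$), and $\delta_*$ is the exponent for which $t^{1-\delta_*}|y_2(t)|^{-\frac n2(p-1)}$ tends to a positive constant as $t\to\infty$. *)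

theory Defs
  imports "HOL-Analysis.Analysis"
begin

(* Elements of L2, H^1 and H^{1,1} are represented by Borel functions on R^n and not by
   classes modulo null sets; every class contains a Borel function, and two functions are the
   same element iff they agree almost everywhere. *)

definition L2_space :: "('a::euclidean_space \<Rightarrow> complex) set" where
  "L2_space = {f. f \<in> borel_measurable lborel \<and> integrable lborel (\<lambda>x. (norm (f x))\<^sup>2)}"

(* Only meaningful on L2_space: a function outside it may get the junk value 0. *)
definition L2_norm :: "('a::euclidean_space \<Rightarrow> complex) \<Rightarrow> real" where
  "L2_norm f = sqrt (\<integral>x. (norm (f x))\<^sup>2 \<partial>lborel)"

definition fourier :: "('a::euclidean_space \<Rightarrow> complex) \<Rightarrow> 'a \<Rightarrow> complex" where
  "fourier f \<xi> = of_real ((2 * pi) powr (- real DIM('a) / 2)) *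
     (\<integral>x. exp (- \<i> * of_real (x \<bullet> \<xi>)) * f x \<partial>lborel)"

definition inverse_fourier :: "('a::euclidean_space \<Rightarrow> complex) \<Rightarrow> 'a \<Rightarrow> complex" where
  "inverse_fourier g x = of_real ((2 * pi) powr (- real DIM('a) / 2)) *
     (\<integral>\<xi>. exp (\<i> * of_real (x \<bullet> \<xi>)) * g \<xi> \<partial>lborel)"

(* Plancherel extension of an integral transform T from L1 \<inter> L2 to L2: the limit in L2 of
   T (f 1_{|x| \<le> R}) as R tends to infinity, determined up to a null set.  The explicit
   membership of the difference in L2_space keeps junk values of L2_norm out of the limit. *)
definition is_L2_extension ::
  "(('a::euclidean_space \<Rightarrow> complex) \<Rightarrow> 'a \<Rightarrow> complex) \<Rightarrow> ('a \<Rightarrow> complex) \<Rightarrow> ('a \<Rightarrow> complex) \<Rightarrow> bool"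
  where
  "is_L2_extension T f g \<longleftrightarrow>
     g \<in> L2_space \<and>
     (\<forall>R. (\<lambda>\<xi>. T (\<lambda>x. indicator (cball 0 R) x * f x) \<xi> - g \<xi>) \<in> L2_space) \<and>
     ((\<lambda>R. L2_norm (\<lambda>\<xi>. T (\<lambda>x. indicator (cball 0 R) x * f x) \<xi> - g \<xi>)) \<longlongrightarrow> 0) at_top"

definition L2_fourier :: "('a::euclidean_space \<Rightarrow> complex) \<Rightarrow> 'a \<Rightarrow> complex" where
  "L2_fourier f = (SOME g. is_L2_extension fourier f g)"

definition L2_inverse_fourier :: "('a::euclidean_space \<Rightarrow> complex) \<Rightarrow> 'a \<Rightarrow> complex" where
  "L2_inverse_fourier g = (SOME f. is_L2_extension inverse_fourier g f)"

definition japanese_bracket :: "'a::euclidean_space \<Rightarrow> real" where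
  "japanese_bracket x = sqrt (1 + (norm x)\<^sup>2)"

definition bracket_nabla :: "('a::euclidean_space \<Rightarrow> complex) \<Rightarrow> 'a \<Rightarrow> complex" where
  "bracket_nabla f = L2_inverse_fourier (\<lambda>\<xi>. of_real (japanese_bracket \<xi>) * L2_fourier f \<xi>)"

definition H1_space :: "('a::euclidean_space \<Rightarrow> complex) set" where
  "H1_space = {f. f \<in> L2_space \<and>
     (\<lambda>\<xi>. of_real (japanese_bracket \<xi>) * L2_fourier f \<xi>) \<in> L2_space}"

(* On H^1 the second term of the norm is finite, so finiteness of the norm only concerns the
   weighted term. *)
definition H11_space :: "('a::euclidean_space \<Rightarrow> complex) set" where
  "H11_space = {f. f \<in> H1_space \<and> (\<lambda>x. of_real (japanese_bracket x) * f x) \<in> L2_space}"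

definition H11_norm :: "('a::euclidean_space \<Rightarrow> complex) \<Rightarrow> real" where
  "H11_norm f = L2_norm (\<lambda>x. of_real (japanese_bracket x) * f x) + L2_norm (bracket_nabla f)"

(* C([0,\<infinity>); H^{1,1}); values at negative times are ignored. *)
definition continuous_into_H11 :: "(real \<Rightarrow> 'a::euclidean_space \<Rightarrow> complex) \<Rightarrow> bool" where
  "continuous_into_H11 u \<longleftrightarrow>
     (\<forall>t\<ge>0. u t \<in> H11_space \<and>
        ((\<lambda>s. H11_norm (\<lambda>x. u s x - u t x)) \<longlongrightarrow> 0) (at t within {0..}))"

definition directional_deriv ::
  "'a::euclidean_space \<Rightarrow> ('a \<Rightarrow> complex) \<Rightarrow> 'a \<Rightarrow> complex" where
  "directional_deriv v \<phi> x = frechet_derivative \<phi> (at x) v"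

primrec C_k :: "nat \<Rightarrow> ('a::euclidean_space \<Rightarrow> complex) \<Rightarrow> bool" where
  "C_k 0 \<phi> \<longleftrightarrow> continuous_on UNIV \<phi>"
| "C_k (Suc k) \<phi> \<longleftrightarrow> (\<forall>x. \<phi> differentiable (at x)) \<and> (\<forall>v. C_k k (directional_deriv v \<phi>))"

definition test_function :: "('a::euclidean_space \<Rightarrow> complex) \<Rightarrow> bool" where
  "test_function \<phi> \<longleftrightarrow> (\<forall>k. C_k k \<phi>) \<and> compact (closure {x. \<phi> x \<noteq> 0})"

definition laplacian :: "('a::euclidean_space \<Rightarrow> complex) \<Rightarrow> 'a \<Rightarrow> complex" where
  "laplacian \<phi> x = (\<Sum>b\<in>Basis. directional_deriv b (directional_deriv b \<phi>) x)"

definition power_nonlinearity :: "real \<Rightarrow> complex \<Rightarrow> complex" where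
  "power_nonlinearity p z = of_real (norm z powr (p - 1)) * z"

(* u is a solution in C([0,\<infinity>); H^{1,1}) of  i u_t + (1/2) \<Delta> u = lam |u|^{p-1} u,  u(0) = u0.
   The equation is an identity of distributions on R^n for every t \<ge> 0 (one-sided time
   derivative at t = 0); the Laplacian is moved to the test function because u(t) is only H^1.
   Integrability of the nonlinear term says that it is a distribution. *)
definition NLS_solution ::
  "complex \<Rightarrow> real \<Rightarrow> ('a::euclidean_space \<Rightarrow> complex) \<Rightarrow> (real \<Rightarrow> 'a \<Rightarrow> complex) \<Rightarrow> bool" where
  "NLS_solution lam p u0 u \<longleftrightarrow>
     continuous_into_H11 u \<and>
     (AE x in lborel. u 0 x = u0 x) \<and>
     (\<forall>\<phi>. test_function \<phi> \<longrightarrow> (\<forall>t\<ge>0.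
        integrable lborel (\<lambda>x. power_nonlinearity p (u t x) * \<phi> x) \<and>
        (\<exists>D. ((\<lambda>s. \<integral>x. u s x * \<phi> x \<partial>lborel) has_vector_derivative D) (at t within {0..}) \<and>
             \<i> * D + 1 / 2 * (\<integral>x. u t x * laplacian \<phi> x \<partial>lborel)
               = lam * (\<integral>x. power_nonlinearity p (u t x) * \<phi> x \<partial>lborel))))"

definition gamma_exponent :: "nat \<Rightarrow> real" where
  "gamma_exponent n = (if n = 1 then 1 / 2 else 1)"

definition p_star :: "nat \<Rightarrow> real" where
  "p_star n = (real n ^ 2 + 3 * real n + 6 + sqrt (9 * real n ^ 2 + 28 * real n + 36))
                / (real n + 2) ^ 2"

definition p_star_star :: "nat \<Rightarrow> real" where
  "p_star_star n = (if n = 1 then 2 else if n = 2 then 1 else (4 + real n) / (2 + real n))"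

end

(* Writing z(t) = U(-t) u(t) with the free propagator U turns the equation into the ordinary
   differential equation z' = -i lam U(-t) N(U(t) z) in L2, N(u) = |u|^(p-1) u.  On bounded sets of H^1
   the pairing <N(u) - N(v), U(t) (N(u') - N(v'))> is at most C |t|^(-b) |u - v| |u' - v'| with b < 1,
   by splitting into level sets and interpolating with the dispersive estimate; differentiating the
   squared norm of the Duhamel integral then gives a contraction in L2 without Strichartz estimates.

   The condition on lam makes N dissipative, so the distance of two solutions does not increase.
   Comparing a solution with its translates and its Galilean boosts shows that the H^1 norm and the
   weighted norm of z do not increase either; this gives global existence, continuity in H^{1,1}, and
   |x u(t)| <= C (1 + t) in L2.

   Testing the distributional equation with all translates of small bumps determines its Fourier
   transform almost everywhere, so every solution is mild, which gives uniqueness.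

   For the decay, y = |u(t)|^2 satisfies y' = 2 Im lam int |u|^(p+1).  Since most of the mass lies in a
   ball of radius C t / sqrt y, Hoelder's inequality gives y' <= -c y^(1+m) t^(-n(p-1)/2) with
   m = (p-1)(n+2)/4, and integration yields the first rate.  It is at least as good as the second
   one for p < p_star(n), whose defining quadratic is exactly the comparison of the two exponents. *)

theory Submission
 imports Defs "HOL-Probability.Probability"
begin

section \<open>The Hilbert space L2\<close>

text \<open>For n >= 2, H^1 gives no sup bound, so N is not Lipschitz in L2 on an H^1 ball;
  differences of N can only be controlled after pairing them with the propagator. Hence all
  distances are measured in L2, while H^1 enters as a closed set on which the bilinear estimate is
  uniform. The equation is never differentiated. Derivatives and weights are Lipschitz constants of
  h -> S_h z - z, with S_h a translation or a modulation. Both families commute with the flow of z,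
  so an L2 estimate for the difference of two curves, applied to S_h z and z, bounds the H^1 norm
  and the weighted norm as well. The weight on z is the operator x + i t grad acting on u, since
  U(t) x U(-t) = x + i t grad; this is why |x u(t)| grows at most linearly. Square integrable
  functions modulo null sets are made a type of their own, so that vector derivatives, integrals and
  fixed points of curves in a Banach space can be used directly.\<close>

abbreviation lborel_nn_integral :: "('a::euclidean_space => ennreal) => ennreal"  (binder \<open>NBINT \<close> 10)
 where "lborel_nn_integral f \<equiv> nn_integral lborel f"

lemma L2_spaceI:
 "f \<in> borel_measurable borel ==> integrable lborel (%x. (norm (f x))^2) ==> f \<in> L2_space"
 by (simp add: L2_space_def)

lemma L2_space_measurable[measurable_dest]: "f \<in> L2_space ==> f \<in> borel_measurable borel"
 by (simp add: L2_space_def)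

lemma L2_space_integrable: "f \<in> L2_space ==> integrable lborel (%x. (norm (f x))^2)"
 by (simp add: L2_space_def)

lemma L2_space_iff_nn:
 "f \<in> L2_space \<longleftrightarrow> f \<in> borel_measurable borel \<and> (NBINT x. ennreal ((norm (f x))^2)) < \<infinity>"
proof -
 have "f \<in> borel_measurable borel ==> (%x. (norm (f x))^2) \<in> borel_measurable lborel"
  by measurable
 then show ?thesis
  by (auto simp: L2_space_def integrable_iff_bounded)
qed

lemma L2_space_bound:
 assumes g: "g \<in> L2_space" and f: "f \<in> borel_measurable borel"
  and le: "AE x in lborel. norm (f x) \<le> norm (g x)"
 shows "f \<in> L2_space"
proof (rule L2_spaceI[OF f])
 show "integrable lborel (%x. (norm (f x))^2)"
 proof (rule Bochner_Integration.integrable_bound[OF L2_space_integrable[OF g]])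
  show "(%x. (norm (f x))^2) \<in> borel_measurable lborel" using f by measurable
  show "AE x in lborel. norm ((norm (f x))^2) \<le> norm ((norm (g x))^2)"
   using le by eventually_elim (auto intro: power_mono)
 qed
qed

lemma norm_add_sq_le: "(norm (a + b :: complex))^2 \<le> 2 * (norm a)^2 + 2 * (norm b)^2"
proof -
 have "(norm (a + b))^2 \<le> (norm a + norm b)^2"
  by (intro power_mono norm_triangle_ineq) auto
 also have "... \<le> 2 * (norm a)^2 + 2 * (norm b)^2"
  using sum_squares_bound[of "norm a" "norm b"] by (simp add: power2_sum)
 finally show ?thesis .
qed

lemma L2_space_add:
 assumes f: "f \<in> L2_space" and g: "g \<in> L2_space"
 shows "(%x. f x + g x) \<in> L2_space"
proof (rule L2_spaceI)
 note [measurable] = f[THEN L2_space_measurable] g[THEN L2_space_measurable]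
 show "(%x. f x + g x) \<in> borel_measurable borel" by measurable
 show "integrable lborel (%x. (norm (f x + g x))^2)"
 proof (rule Bochner_Integration.integrable_bound)
  show "integrable lborel (%x. 2 * (norm (f x))^2 + 2 * (norm (g x))^2)"
   using f g by (intro Bochner_Integration.integrable_add integrable_mult_right L2_space_integrable)
 qed (auto intro: norm_add_sq_le)
qed

lemma L2_space_mult:
 assumes f: "f \<in> L2_space" and m[measurable]: "m \<in> borel_measurable borel" and b: "\<And>x. norm (m x) \<le> B"
 shows "(%x. m x * f x) \<in> L2_space"
proof (rule L2_spaceI)
 note [measurable] = f[THEN L2_space_measurable]
 show "(%x. m x * f x) \<in> borel_measurable borel" by measurable
 show "integrable lborel (%x. (norm (m x * f x))^2)"
 proof (rule Bochner_Integration.integrable_bound)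
  show "integrable lborel (%x. B\<^sup>2 * (norm (f x))^2)"
   using f by (intro integrable_mult_right L2_space_integrable)
  show "AE x in lborel. norm ((norm (m x * f x))^2) \<le> norm (B\<^sup>2 * (norm (f x))^2)"
   by (auto simp: norm_mult power_mult_distrib intro!: mult_right_mono power_mono b)
 qed measurable
qed

lemma L2_space_cmult: "f \<in> L2_space ==> (%x. c * f x) \<in> L2_space"
 using L2_space_mult[of f "%_. c" "norm c"] by simp

lemma L2_space_zero: "(%_. 0) \<in> L2_space"
 by (rule L2_spaceI) auto

lemma L2_space_diff:
 assumes "f \<in> L2_space" "g \<in> L2_space"
 shows "(%x. f x - g x) \<in> L2_space"
 using L2_space_add[OF assms(1) L2_space_cmult[OF assms(2), of "-1"]] by simp

lemma L2_space_scaleR: "f \<in> L2_space ==> (%x. c *\<^sub>R f x) \<in> L2_space"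
 using L2_space_cmult[of f "of_real c"] by (simp add: scaleR_conv_of_real)

lemma integrable_L2_times:
 assumes "f \<in> L2_space" "g \<in> L2_space" shows "integrable lborel (%x. norm (f x) * norm (g x))"
proof (rule Bochner_Integration.integrable_bound)
 note [measurable] = assms[THEN L2_space_measurable]
 show "integrable lborel (%x. (norm (f x))^2 + (norm (g x))^2)"
  using assms by (intro Bochner_Integration.integrable_add L2_space_integrable)
 show "(%x. norm (f x) * norm (g x)) \<in> borel_measurable lborel" by measurable
 have "a * b \<le> a\<^sup>2 + b\<^sup>2" if "0 \<le> a" "0 \<le> b" for a b :: real
  using sum_squares_bound[of a b] mult_nonneg_nonneg[OF that] by linarith
 then show "AE x in lborel. norm (norm (f x) * norm (g x)) \<le> norm ((norm (f x))^2 + (norm (g x))^2)"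
  by auto
qed

lemma integrable_L2_bound:
 fixes h :: "'a::euclidean_space => 'b::{banach,second_countable_topology}"
 assumes "f \<in> L2_space" "g \<in> L2_space" "h \<in> borel_measurable borel"
  "\<And>x. norm (h x) \<le> norm (f x) * norm (g x)"
 shows "integrable lborel h"
 by (rule Bochner_Integration.integrable_bound[OF integrable_L2_times[OF assms(1,2)]]) (use assms in auto)

lemma integrable_L2_inner:
 assumes "f \<in> L2_space" "g \<in> L2_space" shows "integrable lborel (%x. f x \<bullet> g x)"
 using assms[THEN L2_space_measurable]
 by (intro integrable_L2_bound[OF assms]) (auto simp: Cauchy_Schwarz_ineq2)

lemma integrable_L2_prod:
 assumes "f \<in> L2_space" "g \<in> L2_space" shows "integrable lborel (%x. f x * g x)"
 using assms[THEN L2_space_measurable]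
 by (intro integrable_L2_bound[OF assms]) (auto simp: norm_mult)

text \<open>A global choice of one representative for each almost-everywhere class. The chosen
  function depends on f only through its class, so the functions fixed by the choice form a set with
  exactly one element per class; this set carries the type below.\<close>

definition canonical_rep :: "('a::euclidean_space => complex) => 'a => complex" where
 "canonical_rep f = (SOME g. g \<in> L2_space \<and> (AE x in lborel. g x = f x))"

lemma canonical_rep:
 assumes "f \<in> L2_space"
 shows "canonical_rep f \<in> L2_space" "AE x in lborel. canonical_rep f x = f x"
proof -
 have "canonical_rep f \<in> L2_space \<and> (AE x in lborel. canonical_rep f x = f x)"
  unfolding canonical_rep_def by (rule someI[where x=f]) (use assms in auto)
 then show "canonical_rep f \<in> L2_space" "AE x in lborel. canonical_rep f x = f x" by auto
qed

lemma canonical_rep_cong: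
 assumes "AE x in lborel. f x = g x" shows "canonical_rep f = canonical_rep g"
proof -
 have "(AE x in lborel. h x = f x) \<longleftrightarrow> (AE x in lborel. h x = g x)" for h
  using assms by (auto elim: AE_mp)
 then show ?thesis by (simp add: canonical_rep_def)
qed

typedef (overloaded) 'a L2 = "{f :: 'a::euclidean_space => complex. f \<in> L2_space \<and> canonical_rep f = f}"
 morphisms fn Abs_L2
 using canonical_rep[OF L2_space_zero] by (auto intro!: exI[of _ "canonical_rep (%_. 0)"] canonical_rep_cong)

definition cls :: "('a::euclidean_space => complex) => 'a L2" where
 "cls f = Abs_L2 (canonical_rep (if f \<in> L2_space then f else (%_. 0)))"

lemma fn_L2[simp]: "fn f \<in> L2_space"
 using fn[of f] by simp

lemma fn_measurable[measurable, simp]: "fn f \<in> borel_measurable borel"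
 using fn_L2 by (rule L2_space_measurable)

lemma fn_cls: "f \<in> L2_space ==> AE x in lborel. fn (cls f) x = f x"
 unfolding cls_def using canonical_rep[of f]
 by (subst Abs_L2_inverse) (auto intro: canonical_rep_cong)

lemma L2_eqI: "AE x in lborel. fn f x = fn g x ==> f = g"
 using fn[of f] fn[of g] canonical_rep_cong[of "fn f" "fn g"] by (simp add: fn_inject)

lemma cls_cong: "f \<in> L2_space ==> g \<in> L2_space ==> AE x in lborel. f x = g x ==> cls f = cls g"
 unfolding cls_def by (simp add: canonical_rep_cong)

lemma cls_eq_iff:
 assumes "f \<in> L2_space" "g \<in> L2_space"
 shows "cls f = cls g \<longleftrightarrow> (AE x in lborel. f x = g x)"
proof
 assume eq: "cls f = cls g"
 show "AE x in lborel. f x = g x"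
  using fn_cls[OF assms(1)] fn_cls[OF assms(2)] by eventually_elim (simp add: eq)
qed (intro cls_cong assms)

lemma cls_fn[simp]: "cls (fn f) = f"
 by (rule L2_eqI) (simp add: fn_cls)

instantiation L2 :: (euclidean_space) real_vector
begin

definition "0 = cls (%_. 0)"
definition "f + g = cls (%x. fn f x + fn g x)"
definition "- f = cls (%x. - fn f x)"
definition "f - g = cls (%x. fn f x - fn g x)"
definition "c *\<^sub>R f = cls (%x. c *\<^sub>R fn f x)"

lemma fn_zero: "AE x in lborel. fn 0 x = 0"
 unfolding zero_L2_def by (rule fn_cls[OF L2_space_zero])
lemma fn_add: "AE x in lborel. fn (f + g) x = fn f x + fn g x"
 unfolding plus_L2_def by (intro fn_cls L2_space_add) auto
lemma fn_diff: "AE x in lborel. fn (f - g) x = fn f x - fn g x"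
 unfolding minus_L2_def by (intro fn_cls L2_space_diff) auto
lemma fn_uminus: "AE x in lborel. fn (- f) x = - fn f x"
 unfolding uminus_L2_def using L2_space_cmult[of "fn f" "-1"] by (intro fn_cls) auto
lemma fn_scaleR: "AE x in lborel. fn (c *\<^sub>R f) x = c *\<^sub>R fn f x"
 unfolding scaleR_L2_def by (intro fn_cls L2_space_scaleR) auto

instance
proof
 fix f g h :: "'a L2" and a b :: real
 show "f + g + h = f + (g + h)"
  by (rule L2_eqI; use fn_add[of "f + g" h] fn_add[of f g] fn_add[of g h] fn_add[of f "g + h"] in eventually_elim) simp
 show "f + g = g + f"
  by (rule L2_eqI; use fn_add[of f g] fn_add[of g f] in eventually_elim) simp
 show "0 + f = f"
  by (rule L2_eqI; use fn_add[of 0 f] fn_zero in eventually_elim) simp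
 show "- f + f = 0"
  by (rule L2_eqI; use fn_add[of "- f" f] fn_uminus[of f] fn_zero in eventually_elim) simp
 show "f - g = f + - g"
  by (rule L2_eqI; use fn_add[of "f" "- g"] fn_uminus[of g] fn_diff[of f g] in eventually_elim) simp
 show "a *\<^sub>R (f + g) = a *\<^sub>R f + a *\<^sub>R g"
  by (rule L2_eqI; use fn_scaleR[of a "f + g"] fn_add[of f g] fn_add[of "a *\<^sub>R f" "a *\<^sub>R g"] fn_scaleR[of a f] fn_scaleR[of a g]
    in eventually_elim) (simp add: scaleR_add_right)
 show "(a + b) *\<^sub>R f = a *\<^sub>R f + b *\<^sub>R f"
  by (rule L2_eqI; use fn_scaleR[of "a + b" f] fn_add[of "a *\<^sub>R f" "b *\<^sub>R f"] fn_scaleR[of a f] fn_scaleR[of b f]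
    in eventually_elim) (simp add: scaleR_add_left)
 show "a *\<^sub>R b *\<^sub>R f = (a * b) *\<^sub>R f"
  by (rule L2_eqI; use fn_scaleR[of "a * b" f] fn_scaleR[of a "b *\<^sub>R f"] fn_scaleR[of b f]
    in eventually_elim) simp
 show "1 *\<^sub>R f = f"
  by (rule L2_eqI; use fn_scaleR[of 1 f] in eventually_elim) simp
qed
end

text \<open>Since the inner product on complex numbers is the real one, this is the real part of the
  Hermitian product. Complex scalars act later as constant multipliers, and the imaginary part is
  recovered by pairing with i times the second argument.\<close>

instantiation L2 :: (euclidean_space) real_inner
begin
definition "inner f g = (LBINT x. fn f x \<bullet> fn g x)"
definition "norm (f::'a L2) = sqrt (inner f f)"
definition "dist (f::'a L2) g = norm (f - g)"
definition "sgn (f::'a L2) = f /\<^sub>R norm f"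
definition "uniformity = (INF e\<in>{0 <..}. principal {(f, g::'a L2). dist f g < e})"
definition "open (U :: 'a L2 set) = (\<forall>x\<in>U. eventually (%(x', y). x' = x \<longrightarrow> y \<in> U) uniformity)"

instance
proof
 fix f g h :: "'a L2" and a :: real
 show "dist f g = norm (f - g)" by (simp add: dist_L2_def)
 show "sgn f = f /\<^sub>R norm f" by (simp add: sgn_L2_def)
 show "uniformity = (INF e\<in>{0 <..}. principal {(f, g::'a L2). dist f g < e})" by (rule uniformity_L2_def)
 show "open U = (\<forall>x\<in>U. eventually (%(x', y). x' = x \<longrightarrow> y \<in> U) uniformity)" for U :: "'a L2 set"
  by (rule open_L2_def)
 show "inner f g = inner g f" by (simp add: inner_L2_def inner_commute)
 have int: "integrable lborel (%x. fn f x \<bullet> fn h x)" for f h :: "'a L2" by (intro integrable_L2_inner) auto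
 show "inner (f + g) h = inner f h + inner g h"
 proof -
  have "inner (f + g) h = (LBINT x. fn f x \<bullet> fn h x + fn g x \<bullet> fn h x)"
   unfolding inner_L2_def
   by (rule integral_cong_AE; (measurable)?; use fn_add[of f g] in eventually_elim) (simp add: inner_add_left)
  then show ?thesis using int by (simp add: inner_L2_def)
 qed
 show "inner (a *\<^sub>R f) g = a * inner f g"
 proof -
  have "inner (a *\<^sub>R f) g = (LBINT x. a * (fn f x \<bullet> fn g x))"
   unfolding inner_L2_def
   by (rule integral_cong_AE; (measurable)?; use fn_scaleR[of a f] in eventually_elim) simp
  then show ?thesis by (simp add: inner_L2_def)
 qed
 show "0 \<le> inner f f" by (simp add: inner_L2_def)
 show "inner f f = 0 \<longleftrightarrow> f = 0"
 proof -
  have "inner f f = 0 \<longleftrightarrow> (AE x in lborel. fn f x \<bullet> fn f x = 0)"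
   unfolding inner_L2_def by (rule integral_nonneg_eq_0_iff_AE[OF int]) auto
  also have "... \<longleftrightarrow> (AE x in lborel. fn f x = fn 0 x)"
   using fn_zero by (auto elim: AE_mp)
  also have "... \<longleftrightarrow> f = 0" by (auto intro: L2_eqI)
  finally show ?thesis .
 qed
 show "norm f = sqrt (inner f f)" by (simp add: norm_L2_def)
qed
end

lemma norm_L2_sq: "(norm (f::'a::euclidean_space L2))^2 = (LBINT x. (norm (fn f x))^2)"
 by (simp add: power2_norm_eq_inner inner_L2_def)

lemma norm_L2_eq: "norm (f::'a::euclidean_space L2) = L2_norm (fn f)"
 by (simp add: L2_norm_def norm_L2_sq[symmetric])

lemma nn_norm_L2: "(NBINT x. ennreal ((norm (fn f x))^2)) = ennreal ((norm (f::'a::euclidean_space L2))^2)"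
 unfolding norm_L2_sq by (intro nn_integral_eq_integral L2_space_integrable) auto

lemma norm_cls_sq: "f \<in> L2_space ==> (norm (cls f))\<^sup>2 = (LBINT x. (norm (f x))^2)"
 unfolding norm_L2_sq
 by (rule integral_cong_AE; (measurable)?; (rule AE_mp[OF fn_cls])?) auto

lemma norm_cls: "f \<in> L2_space ==> norm (cls f) = L2_norm f"
 using norm_cls_sq[of f] by (metis L2_norm_def norm_ge_zero real_sqrt_unique)

lemma nn_norm_cls: "f \<in> L2_space ==> (NBINT x. ennreal ((norm (f x))^2)) = ennreal ((norm (cls f))^2)"
 unfolding norm_cls_sq by (intro nn_integral_eq_integral L2_space_integrable) auto

lemma inner_cls:
 assumes "f \<in> L2_space" "g \<in> L2_space" shows "inner (cls f) (cls g) = (LBINT x. f x \<bullet> g x)"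
 unfolding inner_L2_def using assms[THEN L2_space_measurable]
 by (intro integral_cong_AE; (measurable)?; (use fn_cls[OF assms(1)] fn_cls[OF assms(2)] in eventually_elim)?) auto

lemma inner_cls_right:
 assumes "g \<in> L2_space" shows "inner f (cls g) = (LBINT x. fn f x \<bullet> g x)"
 using inner_cls[OF fn_L2 assms, of f] by simp

lemma cls_add: "f \<in> L2_space ==> g \<in> L2_space ==> cls (%x. f x + g x) = cls f + cls g"
 unfolding plus_L2_def
 by (intro cls_cong L2_space_add; (rule AE_mp[OF fn_cls[of f] AE_mp[OF fn_cls[of g]]])?) auto

lemma cls_diff: "f \<in> L2_space ==> g \<in> L2_space ==> cls (%x. f x - g x) = cls f - cls g"
 unfolding minus_L2_def
 by (intro cls_cong L2_space_diff; (rule AE_mp[OF fn_cls[of f] AE_mp[OF fn_cls[of g]]])?) auto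

lemma cls_scaleR: "f \<in> L2_space ==> cls (%x. c *\<^sub>R f x) = c *\<^sub>R cls f"
 unfolding scaleR_L2_def
 by (intro cls_cong L2_space_scaleR; (rule AE_mp[OF fn_cls[of f]])?) auto

lemma fn_cls_diff: "f \<in> L2_space ==> AE x in lborel. fn (g - cls f) x = fn g x - f x"
 by (rule AE_mp[OF fn_diff[of g "cls f"] AE_mp[OF fn_cls[of f]]]) auto

lemma norm_L2_le_cls:
 assumes f: "f \<in> L2_space" and A: "0 \<le> A" and le: "(NBINT x. ennreal ((norm (f x))^2)) \<le> ennreal (A\<^sup>2)"
 shows "norm (cls f) \<le> A"
proof -
 have "(norm (cls f))^2 \<le> A\<^sup>2" using le nn_norm_cls[OF f] by (simp add: ennreal_le_iff)
 then show ?thesis using A by (rule power2_le_imp_le)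
qed

text \<open>Riesz-Fischer: a subsequence with distances below 4^(-k) converges almost everywhere,
  and Fatou's lemma shows that its pointwise limit is also its limit in norm.\<close>

instance L2 :: (euclidean_space) complete_space
proof
 fix X :: "nat => 'a L2" assume C: "Cauchy X"
 have "\<exists>N. \<forall>m\<ge>N. \<forall>n\<ge>N. norm (X m - X n) < (1/4)^k" for k
  using CauchyD[OF C, of "(1/4)^k"] by auto
 then obtain N where N: "\<And>k m n. m \<ge> N k ==> n \<ge> N k ==> norm (X m - X n) < (1/4)^k"
  by metis
 define r where "r = rec_nat (N 0) (%k a. max (Suc a) (N (Suc k)))"
 have r0: "r k \<ge> N k" for k by (cases k) (auto simp: r_def)
 have "r k < r (Suc k)" for k by (auto simp: r_def)
 then have sm: "strict_mono r" by (simp add: strict_mono_Suc_iff)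
 define Y where "Y k = X (r k)" for k
 let ?n = "%m k x. norm (fn (Y m) x - fn (Y k) x)"
 have YY: "norm (Y m - Y k) < (1/4)^k" if "m \<ge> k" for m k
  unfolding Y_def using r0[of k] sm that by (intro N) (auto simp: strict_mono_less_eq intro: order_trans)
 define h where "h k x = fn (Y (Suc k)) x - fn (Y k) x" for k x
 have hL: "h k \<in> L2_space" for k unfolding h_def by (intro L2_space_diff) auto
 note [measurable] = hL[THEN L2_space_measurable]
 have hn: "(NBINT x. ennreal ((norm (h k x))^2)) \<le> ennreal ((1/16)^k)" for k
 proof -
  have "cls (h k) = Y (Suc k) - Y k" unfolding h_def by (subst cls_diff) auto
  then have "norm (cls (h k)) \<le> (1/4)^k" using YY[of k "Suc k"] by simp
  then have "(norm (cls (h k)))^2 \<le> ((1/4)^k)^2" by (intro power_mono) auto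
  then show ?thesis using nn_norm_cls[OF hL, of k]
   by (simp add: power2_eq_square power_mult_distrib[symmetric])
 qed
 \<comment> \<open>The weight 4^k spends part of the decay 16^(-k) of the squared norms. The
   remaining sum converges, and its finiteness at x bounds the increments there by a multiple of
   2^(-k).\<close>
 have "(NBINT x. (\<Sum>k. ennreal (4^k * (norm (h k x))^2))) = (\<Sum>k. \<integral>\<^sup>+x. ennreal (4^k * (norm (h k x))^2) \<partial>lborel)"
  by (rule nn_integral_suminf) measurable
 also have "... \<le> (\<Sum>k. ennreal ((1/4)^k))"
 proof (intro suminf_le)
  fix k
  have "(NBINT x. ennreal (4^k * (norm (h k x))^2)) = ennreal (4^k) * (NBINT x. ennreal ((norm (h k x))^2))"
   by (simp add: ennreal_mult nn_integral_cmult)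
  also have "... \<le> ennreal (4^k) * ennreal ((1/16)^k)" by (intro mult_left_mono hn) auto
  also have "... = ennreal ((1/4)^k)"
   by (simp add: ennreal_mult[symmetric] power_mult_distrib[symmetric] del: ennreal_power)
  finally show "(NBINT x. ennreal (4^k * (norm (h k x))^2)) \<le> ennreal ((1/4)^k)" .
 qed auto
 also have "... = ennreal (\<Sum>k. (1/4)^k)"
  by (intro suminf_ennreal2 summable_geometric) auto
 also have "... < \<infinity>" by simp
 finally have fin: "(NBINT x. (\<Sum>k. ennreal (4^k * (norm (h k x))^2))) \<noteq> \<infinity>" by simp
 have "AE x in lborel. (\<Sum>k. ennreal (4^k * (norm (h k x))^2)) \<noteq> \<infinity>"
  by (rule nn_integral_PInf_AE[OF _ fin]) measurable
 then have conv: "AE x in lborel. convergent (%k. fn (Y k) x)"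
 proof eventually_elim
  fix x
  define S where "S = (\<Sum>k. ennreal (4^k * (norm (h k x))^2))"
  assume "(\<Sum>k. ennreal (4^k * (norm (h k x))^2)) \<noteq> \<infinity>"
  then have "S \<noteq> \<top>" by (simp add: S_def)
  then obtain B where B: "0 \<le> B" "S = ennreal B" by (cases S) auto
  have bd: "norm (h k x) \<le> sqrt B * (1/2)^k" for k
  proof -
   define e where "e j = ennreal (4^j * (norm (h j x))^2)" for j
   have "sum e {k} \<le> suminf e" by (rule sum_le_suminf) auto
   then have "e k \<le> S" by (simp add: S_def e_def[abs_def])
   then have "ennreal (4^k * (norm (h k x))^2) \<le> ennreal B" by (simp only: e_def B(2))
   then have "4^k * (norm (h k x))^2 \<le> B" using B(1) by (subst (asm) ennreal_le_iff)
   moreover have "((2::real)^k)^2 = 4^k" by (simp add: power2_eq_square power_mult_distrib[symmetric])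
   ultimately have "(2^k * norm (h k x))^2 \<le> B" by (simp only: power_mult_distrib)
   then have "2^k * norm (h k x) \<le> sqrt B" by (rule real_le_rsqrt)
   then have "2^k * norm (h k x) * (1/2)^k \<le> sqrt B * (1/2)^k" by (intro mult_right_mono) auto
   moreover have "2^k * norm (h k x) * (1/2)^k = norm (h k x)" by (simp add: power_one_over)
   ultimately show ?thesis by simp
  qed
  have "summable (%k. norm (h k x))"
   by (rule summable_comparison_test'[where N=0 and g="%k. sqrt B * (1/2)^k"])
     (auto intro!: summable_mult summable_geometric bd)
  then have "summable (%k. h k x)" by (rule summable_norm_cancel)
  then have "convergent (%n. \<Sum>k<n. h k x)" by (simp add: summable_iff_convergent)
  moreover have "(\<Sum>k<n. h k x) = fn (Y n) x - fn (Y 0) x" for n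
   unfolding h_def by (rule sum_lessThan_telescope)
  ultimately have "convergent (%n. fn (Y n) x - fn (Y 0) x)" by simp
  then show "convergent (%k. fn (Y k) x)" by (subst (asm) convergent_diff_const_right_iff)
 qed
 define f where "f x = lim (%k. fn (Y k) x)" for x
 have fm[measurable]: "f \<in> borel_measurable borel" unfolding f_def by measurable
 have lim: "AE x in lborel. (%k. fn (Y k) x) \<longlonglongrightarrow> f x"
  using conv by eventually_elim (simp add: f_def convergent_LIMSEQ_iff)
 \<comment> \<open>Fatou's lemma in m with k fixed: the Cauchy bound passes to the pointwise
   limit.\<close>
 have fat: "(NBINT x. ennreal ((norm (f x - fn (Y k) x))^2)) \<le> ennreal (((1/4)^k)^2)" for k
 proof -
  have "(NBINT x. ennreal ((norm (f x - fn (Y k) x))^2))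
   = (NBINT x. liminf (%m. ennreal ((?n m k x)^2)))"
  proof (intro nn_integral_cong_AE, use lim in eventually_elim)
   fix x assume "(%k. fn (Y k) x) \<longlonglongrightarrow> f x"
   then have "(%m. ennreal ((?n m k x)^2)) \<longlonglongrightarrow> ennreal ((norm (f x - fn (Y k) x))^2)"
    by (intro tendsto_ennrealI tendsto_intros)
   then show "ennreal ((norm (f x - fn (Y k) x))^2) = liminf (%m. ennreal ((?n m k x)^2))"
    using lim_imp_Liminf[OF sequentially_bot] by metis
  qed
  also have "... \<le> liminf (%m. \<integral>\<^sup>+x. ennreal ((?n m k x)^2) \<partial>lborel)"
   by (rule nn_integral_liminf) measurable
  also have "... \<le> ennreal (((1/4)^k)^2)"
  proof (rule Liminf_le[OF sequentially_bot])
   have "(NBINT x. ennreal ((?n m k x)^2)) \<le> ennreal (((1/4)^k)^2)" if "m \<ge> k" for m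
   proof -
    have "(NBINT x. ennreal ((?n m k x)^2)) = ennreal ((norm (cls (%x. fn (Y m) x - fn (Y k) x)))^2)"
     by (intro nn_norm_cls L2_space_diff) auto
    also have "... = ennreal ((norm (Y m - Y k))^2)" by (subst cls_diff) auto
    also have "... \<le> ennreal (((1/4)^k)^2)"
     using YY[OF that] by (intro ennreal_leI power_mono) auto
    finally show ?thesis .
   qed
   then show "\<forall>\<^sub>F m in sequentially. (NBINT x. ennreal ((?n m k x)^2)) \<le> ennreal (((1/4)^k)^2)"
    unfolding eventually_sequentially by blast
  qed
  finally show ?thesis .
 qed
 have "(%x. f x - fn (Y 0) x) \<in> L2_space"
  unfolding L2_space_iff_nn using fat[of 0] by (auto intro: le_less_trans)
 from L2_space_add[OF this fn_L2[of "Y 0"]] have fL: "f \<in> L2_space" by simp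
 have d: "norm (cls f - Y k) \<le> (1/4)^k" for k
 proof -
  have "cls (%x. f x - fn (Y k) x) = cls f - Y k" using fL by (subst cls_diff) auto
  then show ?thesis using norm_L2_le_cls[OF L2_space_diff[OF fL fn_L2] _ fat[of k]] by simp
 qed
 have "Y \<longlonglongrightarrow> cls f"
 proof (rule LIM_zero_cancel, rule tendsto_norm_zero_cancel, rule tendsto_0_le[where K=1])
  show "(%k. (1/4::real)^k) \<longlonglongrightarrow> 0" by (rule LIMSEQ_power_zero) auto
  show "\<forall>\<^sub>F k in sequentially. norm (norm (Y k - cls f)) \<le> norm ((1/4::real)^k) * 1"
   using d by (auto simp: norm_minus_commute)
 qed
 then have "(X \<circ> r) \<longlonglongrightarrow> cls f" by (simp add: Y_def[abs_def] o_def)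
 then have "X \<longlonglongrightarrow> cls f" using Cauchy_converges_subseq[OF C sm] by simp
 then show "convergent X" by (auto simp: convergent_def)
qed

instance L2 :: (euclidean_space) banach ..

text \<open>Dominated convergence for the squared difference, which is at most 4 |G|^2.\<close>

lemma cls_tendsto:
 assumes F: "\<And>k. F k \<in> L2_space" and f: "f \<in> borel_measurable borel" and G: "G \<in> L2_space"
  and lim: "AE x in lborel. (%k. F k x) \<longlonglongrightarrow> f x"
  and le: "\<And>k. AE x in lborel. norm (F k x) \<le> norm (G x)"
 shows "f \<in> L2_space" "(%k. cls (F k)) \<longlonglongrightarrow> cls f"
proof -
 note [measurable] = F[THEN L2_space_measurable] f G[THEN L2_space_measurable]
 have fG: "AE x in lborel. norm (f x) \<le> norm (G x)"
 proof -
  have "AE x in lborel. \<forall>k. norm (F k x) \<le> norm (G x)" using le by (simp add: AE_all_countable)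
  with lim show ?thesis by eventually_elim (auto intro!: LIMSEQ_le_const2[OF tendsto_norm])
 qed
 show fL: "f \<in> L2_space" by (rule L2_space_bound[OF G f fG])
 have "(%k. \<integral>x. (norm (F k x - f x))^2 \<partial>lborel) \<longlonglongrightarrow> (\<integral>x. 0 \<partial>(lborel::'a measure))"
 proof (rule integral_dominated_convergence)
  show "integrable lborel (%x. 4 * (norm (G x))^2)" using L2_space_integrable[OF G] by simp
  show "AE x in lborel. (%k. (norm (F k x - f x))^2) \<longlonglongrightarrow> 0"
   using lim by eventually_elim (auto intro!: tendsto_eq_intros simp: LIM_zero_iff)
  show "AE x in lborel. norm ((norm (F k x - f x))^2) \<le> 4 * (norm (G x))^2" for k
   using le[of k] fG
  proof eventually_elim
   fix x assume a: "norm (F k x) \<le> norm (G x)" "norm (f x) \<le> norm (G x)"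
   have "norm (F k x - f x) \<le> 2 * norm (G x)" using norm_triangle_ineq4[of "F k x" "f x"] a by linarith
   then have "(norm (F k x - f x))^2 \<le> (2 * norm (G x))^2" by (intro power_mono) auto
   then show "norm ((norm (F k x - f x))^2) \<le> 4 * (norm (G x))^2" by (simp add: power_mult_distrib)
  qed
 qed measurable
 moreover have "(LBINT x. (norm (F k x - f x))^2) = (norm (cls (F k) - cls f))^2" for k
  using norm_cls_sq[OF L2_space_diff[OF F fL]] by (simp add: cls_diff F fL)
 ultimately have "(%k. (norm (cls (F k) - cls f))^2) \<longlonglongrightarrow> 0" by simp
 from tendsto_real_sqrt[OF this] have "(%k. norm (cls (F k) - cls f)) \<longlonglongrightarrow> 0" by simp
 then show "(%k. cls (F k)) \<longlonglongrightarrow> cls f" by (simp add: tendsto_norm_zero_iff LIM_zero_iff)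
qed

section \<open>Translations and dilations of Lebesgue integrals\<close>

lemma nn_integral_shift:
 fixes h :: "'a::euclidean_space"
 assumes [measurable]: "f \<in> borel_measurable borel"
 shows "(NBINT x. f (x + h)) = (NBINT x. f x)"
proof -
 have "(\<integral>\<^sup>+x. f x \<partial>distr lborel borel ((+) h)) = (NBINT x. f (h + x))"
  by (rule nn_integral_distr) auto
 then show ?thesis by (simp add: lborel_distr_plus add.commute)
qed

lemma lborel_integral_shift:
 fixes h :: "'a::euclidean_space" and f :: "'a => 'b::{banach,second_countable_topology}"
 assumes [measurable]: "f \<in> borel_measurable borel"
 shows "(LBINT x. f (x + h)) = (LBINT x. f x)"
proof -
 have "(\<integral>x. f x \<partial>distr lborel borel ((+) h)) = (LBINT x. f (h + x))"
  by (rule integral_distr) auto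
 then show ?thesis by (simp add: lborel_distr_plus add.commute)
qed

lemma lborel_integrable_shift:
 fixes h :: "'a::euclidean_space" and f :: "'a => 'b::{banach,second_countable_topology}"
 assumes f: "integrable lborel f" shows "integrable lborel (%x. f (x + h))"
proof -
 have [measurable]: "f \<in> borel_measurable borel" using f by (simp add: integrable_iff_bounded)
 then have "integrable (distr lborel borel ((+) h)) f \<longleftrightarrow> integrable lborel (%x. f (h + x))"
  by (intro integrable_distr_eq) auto
 with f show ?thesis by (simp add: lborel_distr_plus add.commute)
qed

lemma AE_lborel_shift:
 fixes h :: "'a::euclidean_space"
 assumes "AE x in lborel. P x" shows "AE x in lborel. P (x + h)"
proof -
 obtain N where N: "{x. \<not> P x} \<subseteq> N" "emeasure lborel N = 0" "N \<in> sets borel"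
  using assms by (auto elim!: AE_E)
 have "AE x in lborel. x \<notin> N" using N by (auto intro!: AE_not_in)
 then have "AE x in distr lborel borel ((+) h). x \<notin> N" by (subst lborel_distr_plus)
 then have "AE x in lborel. h + x \<notin> N" using N(3) by (subst (asm) AE_distr_iff) auto
 then show ?thesis by eventually_elim (use N(1) in \<open>auto simp: add.commute\<close>)
qed

lemma lborel_integral_scale:
 fixes f :: "'a::euclidean_space => 'b::{banach,second_countable_topology}"
 assumes [measurable]: "f \<in> borel_measurable borel" and c: "c > 0"
 shows "(LBINT x. f x) = c ^ DIM('a) *\<^sub>R (LBINT x. f (c *\<^sub>R x))"
proof -
 have "(\<integral>x. f x \<partial>(lborel::'a measure)) = (\<integral>x. f x \<partial>density (distr lborel borel (%x. 0 + c *\<^sub>R x)) (%_. \<bar>c\<bar>^DIM('a)))"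
  using c lborel_affine[of c "0::'a"] by simp
 also have "... = (\<integral>x. (\<bar>c\<bar>^DIM('a)) *\<^sub>R f x \<partial>distr lborel borel (%x. 0 + c *\<^sub>R x))"
  using c by (intro integral_density) auto
 also have "... = (LBINT x. (\<bar>c\<bar>^DIM('a)) *\<^sub>R f (c *\<^sub>R x))"
  by (subst integral_distr) auto
 finally show ?thesis using c by simp
qed

lemma lborel_integrable_scale:
 fixes f :: "'a::euclidean_space => 'b::{banach,second_countable_topology}"
 assumes f: "integrable lborel f" and c: "c > 0"
 shows "integrable lborel (%x. f (c *\<^sub>R x))"
proof -
 have [measurable]: "f \<in> borel_measurable borel" using f by (simp add: integrable_iff_bounded)
 have "integrable (density (distr lborel borel (%x. 0 + c *\<^sub>R x)) (%_. \<bar>c\<bar>^DIM('a))) f"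
  using f c lborel_affine[of c "0::'a"] by simp
 then have "integrable (distr lborel borel (%x. 0 + c *\<^sub>R x)) (%x. (\<bar>c\<bar>^DIM('a)) *\<^sub>R f x)"
  using c by (subst (asm) integrable_density) auto
 then have "integrable lborel (%x. (\<bar>c\<bar>^DIM('a)) *\<^sub>R f (c *\<^sub>R x))"
  by (subst (asm) integrable_distr_eq) auto
 then have "integrable lborel (%x. (1 / \<bar>c\<bar>^DIM('a)) *\<^sub>R (\<bar>c\<bar>^DIM('a)) *\<^sub>R f (c *\<^sub>R x))"
  by (rule integrable_scaleR_right)
 then show ?thesis using c by simp
qed

section \<open>Bounded multipliers acting on L2\<close>

definition bmeas :: "('a::euclidean_space => complex) => bool" where
 "bmeas m \<longleftrightarrow> m \<in> borel_measurable borel \<and> (\<exists>B. \<forall>x. norm (m x) \<le> B)"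

lemma bmeasI: "m \<in> borel_measurable borel ==> (\<And>x. norm (m x) \<le> B) ==> bmeas m"
 by (auto simp: bmeas_def)

lemma bmeas_measurable[measurable_dest]: "bmeas m ==> m \<in> borel_measurable borel"
 by (simp add: bmeas_def)

lemma bmeas_mult: assumes "bmeas m" "bmeas k" shows "bmeas (%x. m x * k x)"
proof -
 obtain A B where "\<forall>x. norm (m x) \<le> A" "\<forall>x. norm (k x) \<le> B" using assms by (auto simp: bmeas_def)
 then show ?thesis using assms
  by (intro bmeasI[where B="A * B"]) (auto simp: norm_mult bmeas_def intro!: mult_mono order_trans[OF norm_ge_zero])
qed

lemma bmeas_cnj: "bmeas m ==> bmeas (%x. cnj (m x))"
 by (auto simp: bmeas_def intro: measurable_compose[OF _ borel_measurable_continuous_onI[OF continuous_on_cnj[OF continuous_on_id]]])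

lemma bmeas_const[simp]: "bmeas (%_. c)" by (auto simp: bmeas_def)

lemma bmeas_indicator[simp]: "A \<in> sets borel ==> bmeas (indicator A)"
 by (auto intro!: bmeasI[where B=1] simp: indicator_def)

lemma bmeas_diff: assumes "bmeas m" "bmeas k" shows "bmeas (%x. m x - k x)"
proof -
 obtain A B where "\<forall>x. norm (m x) \<le> A" "\<forall>x. norm (k x) \<le> B" using assms by (auto simp: bmeas_def)
 then have "norm (m x - k x) \<le> A + B" for x using norm_triangle_ineq4[of "m x" "k x"] by (meson add_mono order_trans)
 then show ?thesis using assms by (intro bmeasI) auto
qed

definition mlt :: "('a::euclidean_space => complex) => 'a L2 => 'a L2" where
 "mlt m f = cls (%x. m x * fn f x)"

lemma mlt_in_L2: "bmeas m ==> (%x. m x * fn f x) \<in> L2_space"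
 unfolding bmeas_def by (auto intro: L2_space_mult)

lemma fn_mlt: "bmeas m ==> AE x in lborel. fn (mlt m f) x = m x * fn f x"
 unfolding mlt_def by (intro fn_cls mlt_in_L2)

lemma mlt_cls:
 assumes m: "bmeas m" and f: "f \<in> L2_space" shows "mlt m (cls f) = cls (%x. m x * f x)"
 unfolding mlt_def
proof (rule cls_cong)
 show "(%x. m x * f x) \<in> L2_space" using m f by (auto simp: bmeas_def intro: L2_space_mult)
 show "AE x in lborel. m x * fn (cls f) x = m x * f x" using fn_cls[OF f] by eventually_elim simp
qed (rule mlt_in_L2[OF m])

lemma norm_mlt_le:
 assumes m: "bmeas m" and B: "\<And>x. norm (m x) \<le> B" shows "norm (mlt m f) \<le> B * norm f"
proof -
 have B0: "0 \<le> B" using order_trans[OF norm_ge_zero B] .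
 have "(norm (mlt m f))^2 = (LBINT x. (norm (m x * fn f x))^2)"
  unfolding mlt_def by (rule norm_cls_sq[OF mlt_in_L2[OF m]])
 also have "... \<le> (LBINT x. B\<^sup>2 * (norm (fn f x))^2)"
  using B by (intro integral_mono L2_space_integrable mlt_in_L2 m integrable_mult_right)
   (auto simp: norm_mult power_mult_distrib intro!: mult_right_mono power_mono)
 also have "... = (B * norm f)^2" by (simp add: norm_L2_sq power_mult_distrib)
 finally show ?thesis using B0 by (auto intro: power2_le_imp_le)
qed

lemma norm_mlt_unimod:
 assumes m: "bmeas m" and B: "\<And>x. norm (m x) = 1" shows "norm (mlt m f) = norm f"
proof -
 have "(norm (mlt m f))^2 = (LBINT x. (norm (m x * fn f x))^2)"
  unfolding mlt_def by (rule norm_cls_sq[OF mlt_in_L2[OF m]])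
 then have "(norm (mlt m f))^2 = (norm f)^2" using B by (simp add: norm_mult norm_L2_sq)
 then show ?thesis by (simp add: power2_eq_iff_nonneg)
qed

lemma bounded_linear_mlt:
 assumes m: "bmeas m" shows "bounded_linear (mlt m)"
proof -
 obtain B where B: "\<And>x. norm (m x) \<le> B" using m by (auto simp: bmeas_def)
 show ?thesis
 proof (rule bounded_linear_intro)
  show "mlt m (f + g) = mlt m f + mlt m g" for f g
   by (rule L2_eqI; use fn_mlt[OF m, of "f + g"] fn_mlt[OF m, of f] fn_mlt[OF m, of g]
     fn_add[of f g] fn_add[of "mlt m f" "mlt m g"] in eventually_elim) (simp add: ring_distribs)
  show "mlt m (c *\<^sub>R f) = c *\<^sub>R mlt m f" for c f
   by (rule L2_eqI; use fn_mlt[OF m, of "c *\<^sub>R f"] fn_mlt[OF m, of f]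
     fn_scaleR[of c f] fn_scaleR[of c "mlt m f"] in eventually_elim) simp
  show "norm (mlt m f) \<le> norm f * B" for f
   using norm_mlt_le[OF m B] by (simp add: mult.commute)
 qed
qed

lemmas mlt_add = bounded_linear_mlt[THEN bounded_linear.linear, THEN linear_add]
 and mlt_diff = bounded_linear_mlt[THEN bounded_linear.linear, THEN linear_diff]
 and mlt_scaleR = bounded_linear_mlt[THEN bounded_linear.linear, THEN linear_scale]
 and mlt_zero = bounded_linear_mlt[THEN bounded_linear.linear, THEN linear_0]

lemma mlt_mlt:
 assumes m: "bmeas m" and k: "bmeas k" shows "mlt m (mlt k f) = mlt (%x. m x * k x) f"
 by (rule L2_eqI; use fn_mlt[OF m, of "mlt k f"] fn_mlt[OF k, of f] fn_mlt[OF bmeas_mult[OF m k], of f]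
   in eventually_elim) simp

lemma mlt_commute:
 assumes m: "bmeas m" and k: "bmeas k" shows "mlt m (mlt k f) = mlt k (mlt m f)"
 by (simp add: mlt_mlt assms mult.commute)

lemma mlt_one: "mlt (%_. 1) f = f"
 by (simp add: mlt_def)

lemma inner_mlt:
 assumes m: "bmeas m" shows "inner (mlt m f) g = inner f (mlt (%x. cnj (m x)) g)"
 unfolding inner_L2_def
proof (rule integral_cong_AE; (measurable)?)
 show "AE x in lborel. fn (mlt m f) x \<bullet> fn g x = fn f x \<bullet> fn (mlt (%x. cnj (m x)) g) x"
  using fn_mlt[OF m, of f] fn_mlt[OF bmeas_cnj[OF m], of g]
  by eventually_elim (simp add: inner_complex_def algebra_simps)
qed

lemma mlt_tendsto:
 assumes mk: "\<And>k::nat. bmeas (m k)" and B: "\<And>k x. norm (m k x) \<le> B"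
  and m: "bmeas m'" and lim: "\<And>x. (%k. m k x) \<longlonglongrightarrow> m' x"
 shows "(%k. mlt (m k) f) \<longlonglongrightarrow> mlt m' f"
 unfolding mlt_def
proof (rule cls_tendsto(2))
 show "(%x. m' x * fn f x) \<in> borel_measurable borel" using m by measurable
 show "(%x. of_real B * fn f x) \<in> L2_space" by (intro L2_space_cmult) auto
 show "AE x in lborel. (%k. m k x * fn f x) \<longlonglongrightarrow> m' x * fn f x"
  by (intro AE_I2 tendsto_mult lim tendsto_const)
 have "0 \<le> B" using order_trans[OF norm_ge_zero B] .
 then show "AE x in lborel. norm (m k x * fn f x) \<le> norm (complex_of_real B * fn f x)" for k
  using B by (auto simp: norm_mult intro!: mult_right_mono)
qed (rule mlt_in_L2[OF mk])

section \<open>Translations acting on L2\<close>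

definition tr :: "'a::euclidean_space => 'a L2 => 'a L2" where
 "tr h f = cls (%x. fn f (x + h))"

lemma tr_in_L2: "f \<in> L2_space ==> (%x. f (x + h)) \<in> L2_space"
 using nn_integral_shift[of "%x. ennreal ((norm (f x))^2)" h]
 by (auto simp: L2_space_iff_nn)

lemma fn_tr: "AE x in lborel. fn (tr h f) x = fn f (x + h)"
 unfolding tr_def by (intro fn_cls tr_in_L2) auto

lemma tr_cls: "f \<in> L2_space ==> tr h (cls f) = cls (%x. f (x + h))"
 unfolding tr_def by (intro cls_cong tr_in_L2 AE_lborel_shift fn_cls) auto

lemma norm_tr[simp]: "norm (tr h f) = norm f"
proof -
 have "(norm (tr h f))^2 = (LBINT x. (norm (fn f (x + h)))^2)"
  unfolding tr_def by (intro norm_cls_sq tr_in_L2) auto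
 also have "... = (norm f)^2"
  using lborel_integral_shift[of "%x. (norm (fn f x))^2" h] by (simp add: norm_L2_sq)
 finally show ?thesis by (simp add: power2_eq_iff_nonneg)
qed

lemma bounded_linear_tr: "bounded_linear (tr h)"
proof (rule bounded_linear_intro)
 show "tr h (f + g) = tr h f + tr h g" for f g
  by (rule L2_eqI; use fn_tr[of h "f + g"] fn_tr[of h f] fn_tr[of h g]
    AE_lborel_shift[OF fn_add[of f g], of h] fn_add[of "tr h f" "tr h g"] in eventually_elim) simp
 show "tr h (c *\<^sub>R f) = c *\<^sub>R tr h f" for c f
  by (rule L2_eqI; use fn_tr[of h "c *\<^sub>R f"] fn_tr[of h f]
    AE_lborel_shift[OF fn_scaleR[of c f], of h] fn_scaleR[of c "tr h f"] in eventually_elim) simp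
 show "norm (tr h f) \<le> norm f * 1" for f by simp
qed

section \<open>Truncations and density of compactly supported continuous functions\<close>

definition L1_space :: "('a::euclidean_space => complex) set" where
 "L1_space = {f. integrable lborel f}"

lemma L1_space_measurable[measurable_dest]: "f \<in> L1_space ==> f \<in> borel_measurable borel"
 by (simp add: L1_space_def integrable_iff_bounded)

lemma integrable_indicator_cball[simp]: "integrable lborel (indicator (cball c R) :: 'a::euclidean_space => real)"
 by (rule integrable_real_indicator) (use emeasure_lborel_cball_finite[of c R] in simp_all)

lemma L2_indicator_L1:
 assumes f: "f \<in> L2_space" shows "(%x. indicator (cball 0 R) x * f x) \<in> L1_space" "(%x. indicator (cball 0 R) x * f x) \<in> L2_space"
proof -
 have I: "(indicator (cball 0 R) :: 'a => complex) \<in> L2_space"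
 proof (rule L2_spaceI)
  have "(%x. (norm (indicator (cball 0 R) x :: complex))^2) = (indicator (cball 0 R) :: 'a => real)"
   by (auto simp: indicator_def)
  then show "integrable lborel (%x::'a. (norm (indicator (cball 0 R) x :: complex))^2)"
   by simp
 qed (auto intro!: borel_measurable_indicator)
 show "(%x. indicator (cball 0 R) x * f x) \<in> L1_space"
  unfolding L1_space_def using integrable_L2_prod[OF I f] by simp
 show "(%x. indicator (cball 0 R) x * f x) \<in> L2_space"
  by (rule L2_space_mult[OF f, where B=1]) (auto simp: indicator_def)
qed

lemma indicator_cball_tendsto:
 fixes x :: "'a::euclidean_space"
 assumes that: "filterlim R at_top sequentially"
 shows "(%k. indicator (cball 0 (R k)) x :: complex) \<longlonglongrightarrow> 1"
proof (rule tendsto_eventually)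
 have "\<forall>\<^sub>F k in sequentially. R k \<ge> norm x" using that by (simp add: filterlim_at_top)
 then show "\<forall>\<^sub>F k in sequentially. indicator (cball 0 (R k)) x = (1::complex)"
  by eventually_elim simp
qed

lemma trunc_tendsto:
 assumes R: "filterlim R at_top sequentially"
 shows "(%k. mlt (indicator (cball 0 (R k))) f) \<longlonglongrightarrow> f"
proof -
 have "(%k. mlt (indicator (cball 0 (R k))) f) \<longlonglongrightarrow> mlt (%_. 1) f"
 proof (rule mlt_tendsto[where B=1, OF _ _ _ indicator_cball_tendsto[OF R]])
  show "norm (indicator (cball 0 (R k)) x :: complex) \<le> 1" for k x by (simp add: indicator_def)
 qed simp_all
 then show ?thesis by (simp add: mlt_one)
qed

definition Cc :: "('a::euclidean_space => complex) => bool" where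
 "Cc f \<longleftrightarrow> continuous_on UNIV f \<and> (\<exists>R. \<forall>x. norm x > R \<longrightarrow> f x = 0)"

lemma Cc_bounded: assumes "Cc f" obtains R B where "0 < R" "0 < B" "\<And>x. norm x > R ==> f x = 0" "\<And>x. norm (f x) \<le> B"
proof -
 obtain R where R: "\<And>x. norm x > R ==> f x = 0" and c: "continuous_on UNIV f" using assms by (auto simp: Cc_def)
 have "compact (f ` cball 0 \<bar>R\<bar>)" using c by (intro compact_continuous_image) (auto intro: continuous_on_subset)
 then obtain B where B: "\<And>x. norm x \<le> \<bar>R\<bar> ==> norm (f x) \<le> B"
  using compact_imp_bounded by (force simp: bounded_iff)
 show thesis
 proof
  show "f x = 0" if "norm x > \<bar>R\<bar> + 1" for x using R[of x] that by auto
  show "norm (f x) \<le> \<bar>B\<bar> + 1" for x using B[of x] R[of x] by (cases "norm x \<le> \<bar>R\<bar>") auto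
 qed auto
qed

lemma Cc_measurable: "Cc f ==> f \<in> borel_measurable borel"
 by (auto simp: Cc_def intro: borel_measurable_continuous_onI)

lemma bounded_support_space:
 assumes [measurable]: "f \<in> borel_measurable borel" and R: "\<And>x. norm x > R ==> f x = 0" and B: "\<And>x. norm (f x) \<le> B"
 shows "f \<in> L1_space" "f \<in> L2_space"
proof -
 have le: "norm (f x) \<le> B * indicator (cball 0 R) x" for x using R[of x] B[of x] by (auto simp: indicator_def)
 show "f \<in> L1_space" unfolding L1_space_def mem_Collect_eq
 proof (rule Bochner_Integration.integrable_bound[where f="%x. B * indicator (cball 0 R) x"])
  show "AE x in lborel. norm (f x) \<le> norm (B * indicator (cball 0 R) x)"
   by (rule AE_I2, rule order_trans[OF le]) simp
 qed (intro integrable_mult_right integrable_indicator_cball, measurable)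
 show "f \<in> L2_space"
 proof (rule L2_spaceI)
  show "integrable lborel (%x. (norm (f x))^2)"
  proof (rule Bochner_Integration.integrable_bound[where f="%x. B\<^sup>2 * indicator (cball 0 R) x"])
   show "AE x in lborel. norm ((norm (f x))^2) \<le> norm (B\<^sup>2 * indicator (cball 0 R) x)"
    using R B by (auto simp: indicator_def intro!: power_mono)
  qed (intro integrable_mult_right integrable_indicator_cball, measurable)
 qed measurable
qed

lemma Cc_spaces: assumes "Cc f" shows "f \<in> L1_space" "f \<in> L2_space"
 using Cc_bounded[OF assms] bounded_support_space[OF Cc_measurable[OF assms]] by metis+

text \<open>Density is phrased for closed sets so that an identity between bounded operators extends
  at once, with S the set where it holds. Truncating both the domain and the values reduces to
  bounded functions of bounded support, and such a function is an almost-everywhere limit of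
  continuous ones, which only have to be clipped.\<close>

lemma Cc_dense:
 assumes S: "closed S" and Cc: "\<And>f. Cc f ==> cls f \<in> S"
 shows "f \<in> S"
proof -
 have bs: "cls g \<in> S" if g[measurable]: "g \<in> borel_measurable borel" and R: "\<And>x. norm x > R ==> g x = 0"
  and B: "\<And>x. norm (g x) \<le> B" for g :: "'a => complex" and R B
 proof -
  have B0: "0 \<le> B" using order_trans[OF norm_ge_zero B] .
  have "g \<in> borel_measurable lebesgue" using g by (simp add: measurable_completion)
  then have "g measurable_on UNIV" by (rule lebesgue_measurable_imp_measurable_on) auto
  then obtain N u where N: "negligible N" and u: "\<And>n. continuous_on UNIV (u n)"
   and lim: "\<And>x. x \<notin> N ==> (%n. u n x) \<longlonglongrightarrow> g x" by (auto simp: measurable_on_def)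
  \<comment> \<open>\<open>w\<close> is a continuous cutoff equal to 1 on the ball of radius R, and
    \<open>c\<close> is the radial retraction onto the disc of radius B + 1. The margin 1 keeps the
    divisor positive when B = 0. Neither changes the limit g, and together they give a common
    majorant.\<close>
  define w :: "'a => real" where "w x = max 0 (min 1 (R + 1 - norm x))" for x
  define c :: "complex => complex" where "c z = z / of_real (max 1 (norm z / (B + 1)))" for z
  have c1: "norm (c z) \<le> B + 1" for z
  proof (cases "norm z \<le> B + 1")
   case True then show ?thesis using B0 by (simp add: c_def max_def norm_divide)
  next
   case False
   then have "max 1 (norm z / (B + 1)) = norm z / (B + 1)" using B0 by (simp add: field_simps)
   moreover have "norm z > 0" using False B0 by linarith
   ultimately show ?thesis using B0 unfolding c_def norm_divide norm_of_real by simp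
  qed
  have c2: "c z = z" if "norm z \<le> B" for z using that B0 by (simp add: c_def max_def)
  have cc: "continuous_on UNIV c" unfolding c_def
   using B0 by (intro continuous_intros) (auto simp: max_def field_simps)
  have cu: "continuous_on UNIV (%x. of_real (w x) * c (u n x))" for n
   unfolding w_def by (intro continuous_intros continuous_on_compose2[OF cc u]) auto
  have Ccu: "Cc (%x. of_real (w x) * c (u n x))" for n
   unfolding Cc_def using cu by (auto intro!: exI[of _ "R + 1"] simp: w_def)
  have le: "norm (of_real (w x) * c (u n x)) \<le> norm (complex_of_real (B + 1) * indicator (cball 0 (R + 1)) x)" for n x
  proof (cases "norm x \<le> R + 1")
   case True
   have "norm (of_real (w x) * c (u n x)) \<le> 1 * (B + 1)"
    unfolding norm_mult by (intro mult_mono c1) (auto simp: w_def)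
   then show ?thesis using True B0 by simp
  next
   case False then have "w x = 0" by (simp add: w_def)
   then show ?thesis by simp
  qed
  have "(%n. cls (%x. of_real (w x) * c (u n x))) \<longlonglongrightarrow> cls g"
  proof (rule cls_tendsto(2)[OF Cc_spaces(2)[OF Ccu] g])
   show "(%x. complex_of_real (B + 1) * indicator (cball 0 (R + 1)) x) \<in> L2_space"
    by (rule bounded_support_space(2)[where R="R + 1" and B="norm (complex_of_real (B + 1))"])
      (auto simp: indicator_def)
   show "AE x in lborel. (%n. of_real (w x) * c (u n x)) \<longlonglongrightarrow> g x"
   proof -
    have "AE x in lebesgue. x \<notin> N" using N by (auto simp: negligible_iff_null_sets intro!: AE_not_in)
    then have "AE x in lborel. x \<notin> N" by (simp add: AE_completion_iff)
    then show ?thesis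
    proof eventually_elim
     fix x assume "x \<notin> N"
     have "(%n. c (u n x)) \<longlonglongrightarrow> c (g x)"
      using cc lim[OF \<open>x \<notin> N\<close>] by (auto simp: continuous_on_eq_continuous_within intro: isCont_tendsto_compose)
     then have "(%n. of_real (w x) * c (u n x)) \<longlonglongrightarrow> of_real (w x) * g x"
      using c2[OF B] by (intro tendsto_mult tendsto_const) auto
     moreover have "of_real (w x) * g x = g x"
      using R[of x] by (cases "norm x > R") (auto simp: w_def)
     ultimately show "(%n. of_real (w x) * c (u n x)) \<longlonglongrightarrow> g x" by simp
    qed
   qed
  qed (use le in auto)
  then show ?thesis
   by (rule closed_sequentially[OF S Cc[OF Ccu]])
 qed
 define F where "F k x = indicator {x. norm x \<le> real k \<and> norm (fn f x) \<le> real k} x * fn f x" for k x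
 have [measurable]: "F k \<in> borel_measurable borel" for k unfolding F_def by measurable
 have "(%k. cls (F k)) \<longlonglongrightarrow> cls (fn f)"
 proof (rule cls_tendsto(2)[OF _ fn_measurable fn_L2[of f]])
  show "F k \<in> L2_space" for k
   by (rule L2_space_bound[OF fn_L2[of f]]) (auto simp: F_def norm_mult indicator_def)
  show "AE x in lborel. norm (F k x) \<le> norm (fn f x)" for k by (auto simp: F_def norm_mult indicator_def)
  show "AE x in lborel. (%k. F k x) \<longlonglongrightarrow> fn f x"
  proof (rule AE_I2, rule tendsto_eventually)
   fix x
   obtain n where n: "max (norm x) (norm (fn f x)) \<le> real n" using real_arch_simple by blast
   show "\<forall>\<^sub>F k in sequentially. F k x = fn f x"
    using eventually_ge_at_top[of n] by eventually_elim (use n in \<open>auto simp: F_def\<close>)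
  qed
 qed
 moreover have "cls (F k) \<in> S" for k
  by (rule bs[where R="real k" and B="real k"]) (auto simp: F_def indicator_def)
 ultimately have "cls (fn f) \<in> S" using closed_sequentially[OF S, of "%k. cls (F k)" "cls (fn f)"] by blast
 then show ?thesis by simp
qed

section \<open>Gaussian integrals\<close>

text \<open>Read off from the characteristic function of the standard normal distribution.\<close>

lemma gauss_1d:
 fixes t :: real
 shows "integrable lborel (%x. complex_of_real (exp (- x\<^sup>2 / 2)) * exp (\<i> * of_real (x * t)))"
  and "(LBINT x. complex_of_real (exp (- x\<^sup>2 / 2)) * exp (\<i> * of_real (x * t))) = of_real (sqrt (2 * pi) * exp (- t\<^sup>2 / 2))"
proof -
 have eq: "complex_of_real (std_normal_density x) * exp (\<i> * of_real (x * t))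
  = of_real (1 / sqrt (2 * pi)) * (complex_of_real (exp (- x\<^sup>2 / 2)) * exp (\<i> * of_real (x * t)))" for x
  by (simp add: std_normal_density_def)
 have "integrable lborel std_normal_density" by simp
 then have i1: "integrable lborel (%x. complex_of_real (std_normal_density x) * exp (\<i> * of_real (x * t)))"
  by (rule Bochner_Integration.integrable_bound) (auto simp: norm_mult)
 then show int: "integrable lborel (%x. complex_of_real (exp (- x\<^sup>2 / 2)) * exp (\<i> * of_real (x * t)))"
 proof -
  have "integrable lborel (%x. of_real (sqrt (2 * pi)) * (complex_of_real (std_normal_density x) * exp (\<i> * of_real (x * t))))"
   by (intro integrable_mult_right i1)
  moreover have "of_real (sqrt (2 * pi)) * (complex_of_real (std_normal_density x) * exp (\<i> * of_real (x * t)))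
   = complex_of_real (exp (- x\<^sup>2 / 2)) * exp (\<i> * of_real (x * t))" for x
   unfolding eq by simp
  ultimately show ?thesis by (simp only:)
 qed
 have "char std_normal_distribution t = (\<integral>x. exp (\<i> * of_real (t * x)) \<partial>density lborel std_normal_density)"
  by (simp add: char_def)
 also have "... = (LBINT x. std_normal_density x *\<^sub>R exp (\<i> * of_real (t * x)))"
  by (rule integral_density) auto
 also have "... = (LBINT x. of_real (1 / sqrt (2 * pi)) * (complex_of_real (exp (- x\<^sup>2 / 2)) * exp (\<i> * of_real (x * t))))"
  by (simp only: eq[symmetric] scaleR_conv_of_real mult.commute[of t])
 also have "... = of_real (1 / sqrt (2 * pi)) * (LBINT x. complex_of_real (exp (- x\<^sup>2 / 2)) * exp (\<i> * of_real (x * t)))"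
  by simp
 finally have "of_real (exp (- (t\<^sup>2) / 2)) = of_real (1 / sqrt (2 * pi)) * (LBINT x. complex_of_real (exp (- x\<^sup>2 / 2)) * exp (\<i> * of_real (x * t)))"
  by (simp add: char_std_normal_distribution)
 from arg_cong[OF this, of "%z. of_real (sqrt (2 * pi)) * z"]
 show "(LBINT x. complex_of_real (exp (- x\<^sup>2 / 2)) * exp (\<i> * of_real (x * t))) = of_real (sqrt (2 * pi) * exp (- t\<^sup>2 / 2))"
  by simp
qed

lemma lborel_prod_integral:
 fixes k :: "'a::euclidean_space => real => complex"
 assumes k: "\<And>b. b \<in> Basis ==> integrable lborel (k b)"
 shows "integrable lborel (%x::'a. \<Prod>b\<in>Basis. k b (x \<bullet> b))"
  and "(LBINT x. (\<Prod>b\<in>Basis. k b (x \<bullet> b))) = (\<Prod>b\<in>Basis. integral\<^sup>L lborel (k b))"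
proof -
 interpret product_sigma_finite "%_::'a. lborel :: real measure" ..
 have [measurable]: "b \<in> Basis ==> k b \<in> borel_measurable borel" for b
  using k[of b] by (simp add: integrable_iff_bounded)
 have m: "(%f. \<Sum>b\<in>Basis. f b *\<^sub>R b) \<in> measurable (\<Pi>\<^sub>M b\<in>(Basis::'a set). (lborel::real measure)) borel" by measurable
 have mk: "(%x::'a. \<Prod>b\<in>Basis. k b (x \<bullet> b)) \<in> borel_measurable borel" by measurable
 have eq: "(\<Prod>b\<in>Basis. k b ((\<Sum>b\<in>Basis. f b *\<^sub>R b) \<bullet> b)) = (\<Prod>b\<in>Basis. k b (f b))" for f
  by (intro prod.cong refl) (simp add: inner_sum_left inner_Basis if_distrib sum.If_cases cong: if_cong)
 show "integrable lborel (%x::'a. \<Prod>b\<in>Basis. k b (x \<bullet> b))"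
  by (subst lborel_eq, subst integrable_distr_eq[OF m mk]) (simp add: eq product_integrable_prod k)
 show "(LBINT x. (\<Prod>b\<in>Basis. k b (x \<bullet> b))) = (\<Prod>b\<in>Basis. integral\<^sup>L lborel (k b))"
  by (subst lborel_eq, subst integral_distr[OF m mk]) (simp add: eq product_integral_prod k)
qed

lemma gauss_std:
 fixes w :: "'a::euclidean_space"
 shows "integrable lborel (%x::'a. complex_of_real (exp (- (norm x)\<^sup>2 / 2)) * exp (\<i> * of_real (x \<bullet> w)))"
  and "(LBINT x. complex_of_real (exp (- (norm x)\<^sup>2 / 2)) * exp (\<i> * of_real (x \<bullet> w)))
   = of_real ((2 * pi) powr (DIM('a) / 2) * exp (- (norm w)\<^sup>2 / 2))"
proof -
 have nrm: "(norm y)^2 = (\<Sum>b\<in>Basis. (y \<bullet> b)^2)" for y :: 'a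
  by (subst power2_norm_eq_inner, subst euclidean_inner) (simp add: power2_eq_square)
 have eq: "complex_of_real (exp (- (norm x)\<^sup>2 / 2)) * exp (\<i> * of_real (x \<bullet> w))
  = (\<Prod>b\<in>Basis. complex_of_real (exp (- (x \<bullet> b)\<^sup>2 / 2)) * exp (\<i> * of_real ((x \<bullet> b) * (w \<bullet> b))))" for x
 proof -
  have "- (norm x)\<^sup>2 / 2 = (\<Sum>b\<in>Basis. - (x \<bullet> b)\<^sup>2 / 2)"
   by (simp add: nrm sum_negf sum_divide_distrib)
  then have "exp (- (norm x)\<^sup>2 / 2) = (\<Prod>b\<in>Basis. exp (- (x \<bullet> b)\<^sup>2 / 2))"
   by (simp only: exp_sum[OF finite_Basis])
  moreover have "\<i> * complex_of_real (x \<bullet> w) = (\<Sum>b\<in>Basis. \<i> * of_real ((x \<bullet> b) * (w \<bullet> b)))"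
   by (simp only: euclidean_inner[of x w] of_real_sum sum_distrib_left)
  then have "exp (\<i> * complex_of_real (x \<bullet> w)) = (\<Prod>b\<in>Basis. exp (\<i> * of_real ((x \<bullet> b) * (w \<bullet> b))))"
   by (simp only: exp_sum[OF finite_Basis])
  ultimately show ?thesis by (simp add: prod.distrib)
 qed
 show "integrable lborel (%x::'a. complex_of_real (exp (- (norm x)\<^sup>2 / 2)) * exp (\<i> * of_real (x \<bullet> w)))"
  unfolding eq by (rule lborel_prod_integral(1)[OF gauss_1d(1)])
 have "(LBINT x. complex_of_real (exp (- (norm x)\<^sup>2 / 2)) * exp (\<i> * of_real (x \<bullet> w)))
   = (\<Prod>b\<in>(Basis::'a set). of_real (sqrt (2 * pi) * exp (- (w \<bullet> b)\<^sup>2 / 2)))"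
  unfolding eq by (subst lborel_prod_integral(2)[OF gauss_1d(1)]) (simp only: gauss_1d(2))
 also have "... = of_real (sqrt (2 * pi) ^ DIM('a) * exp (\<Sum>b\<in>Basis. - (w \<bullet> b)\<^sup>2 / 2))"
  by (simp add: prod.distrib exp_sum)
 also have "(\<Sum>b\<in>Basis. - (w \<bullet> b)\<^sup>2 / 2) = - (norm w)\<^sup>2 / 2" by (simp add: nrm sum_negf sum_divide_distrib)
 also have "sqrt (2 * pi) ^ DIM('a) = (2 * pi) powr (DIM('a) / 2)"
  by (simp add: powr_half_sqrt[symmetric] powr_realpow[symmetric] powr_powr)
 finally show "(LBINT x. complex_of_real (exp (- (norm x)\<^sup>2 / 2)) * exp (\<i> * of_real (x \<bullet> w)))
   = of_real ((2 * pi) powr (DIM('a) / 2) * exp (- (norm w)\<^sup>2 / 2))" .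
qed

lemma gauss_ft:
 fixes w :: "'a::euclidean_space"
 assumes b: "b > 0"
 shows "integrable lborel (%x::'a. complex_of_real (exp (- b * (norm x)^2)) * exp (\<i> * of_real (x \<bullet> w)))"
  and "(LBINT x. complex_of_real (exp (- b * (norm x)^2)) * exp (\<i> * of_real (x \<bullet> w)))
   = of_real ((pi / b) powr (DIM('a) / 2) * exp (- (norm w)\<^sup>2 / (4 * b)))"
proof -
 define c where "c = sqrt (2 * b)"
 have c: "c > 0" "c\<^sup>2 = 2 * b" using b by (auto simp: c_def)
 let ?F = "%x::'a. complex_of_real (exp (- b * (norm x)^2)) * exp (\<i> * of_real (x \<bullet> w))"
 let ?G = "%x::'a. complex_of_real (exp (- (norm x)\<^sup>2 / 2)) * exp (\<i> * of_real (x \<bullet> (w /\<^sub>R c)))"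
 have eq: "?G (c *\<^sub>R x) = ?F x" for x
 proof -
  have "(c *\<^sub>R x) \<bullet> (w /\<^sub>R c) = x \<bullet> w" "- (norm (c *\<^sub>R x))\<^sup>2 / 2 = - b * (norm x)^2"
   using c by (simp_all add: power_mult_distrib)
  then show ?thesis by (simp only:)
 qed
 show "integrable lborel ?F"
  using lborel_integrable_scale[OF gauss_std(1)[of "w /\<^sub>R c"] c(1)] by (simp only: eq)
 have "(LBINT x. ?G x) = c ^ DIM('a) *\<^sub>R (LBINT x. ?G (c *\<^sub>R x))"
  by (rule lborel_integral_scale[OF _ c(1)]) measurable
 then have "of_real ((2 * pi) powr (DIM('a) / 2) * exp (- (norm (w /\<^sub>R c))\<^sup>2 / 2)) = c ^ DIM('a) *\<^sub>R (LBINT x. ?F x)"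
  by (simp only: eq gauss_std(2))
 then have "(LBINT x. ?F x) = of_real ((2 * pi) powr (DIM('a) / 2) * exp (- (norm (w /\<^sub>R c))\<^sup>2 / 2) / c ^ DIM('a))"
  using c(1) by (simp add: scaleR_conv_of_real field_simps)
 also have "(norm (w /\<^sub>R c))^2 / 2 = (norm w)^2 / (4 * b)"
  using c by (simp add: power_mult_distrib power_divide field_simps)
 moreover have "c ^ DIM('a) = (2 * b) powr (DIM('a) / 2)"
  using b by (simp add: c_def powr_half_sqrt[symmetric] powr_realpow[symmetric] powr_powr)
 moreover have "(2 * pi) powr (DIM('a) / 2) / (2 * b) powr (DIM('a) / 2) = (pi / b) powr (DIM('a) / 2)"
  using b by (simp add: powr_divide[symmetric])
 ultimately show "(LBINT x. ?F x) = of_real ((pi / b) powr (DIM('a) / 2) * exp (- (norm w)\<^sup>2 / (4 * b)))"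
  by (metis (no_types, lifting) minus_divide_left times_divide_eq_left)
qed

lemma gauss_real:
 assumes b: "b > 0"
 shows "integrable lborel (%x::'a::euclidean_space. exp (- b * (norm x)^2))"
  and "(\<integral>x. exp (- b * (norm x)^2) \<partial>(lborel::'a measure)) = (pi / b) powr (DIM('a) / 2)"
proof -
 have "integrable lborel (%x::'a. complex_of_real (exp (- b * (norm x)^2)))"
  using gauss_ft(1)[OF b, of "0::'a"] by simp
 then show i: "integrable lborel (%x::'a. exp (- b * (norm x)^2))" by (simp only: complex_of_real_integrable_eq)
 have "(\<integral>x. complex_of_real (exp (- b * (norm x)^2)) \<partial>(lborel::'a measure)) = of_real ((pi / b) powr (DIM('a) / 2))"
  using gauss_ft(2)[OF b, of "0::'a"] by simp
 then show "(\<integral>x. exp (- b * (norm x)^2) \<partial>(lborel::'a measure)) = (pi / b) powr (DIM('a) / 2)"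
  by (simp only: integral_complex_of_real of_real_eq_iff)
qed

lemma integrable_pair_mult:
 fixes f :: "'a::euclidean_space => 'c::{banach,second_countable_topology,real_normed_algebra}" and g :: "'b::euclidean_space => 'c"
 assumes f: "integrable lborel f" and g: "integrable lborel g"
 shows "integrable (lborel \<Otimes>\<^sub>M lborel) (%(x, y). f x * g y)"
proof -
 interpret pair_sigma_finite "lborel::'a measure" "lborel::'b measure" ..
 have [measurable]: "f \<in> borel_measurable borel" "g \<in> borel_measurable borel"
  using f g by (auto simp: integrable_iff_bounded)
 have "(\<integral>\<^sup>+z. ennreal (norm (case z of (x, y) => f x * g y)) \<partial>(lborel \<Otimes>\<^sub>M lborel))
  \<le> (\<integral>\<^sup>+z. (case z of (x, y) => ennreal (norm (f x)) * ennreal (norm (g y))) \<partial>(lborel \<Otimes>\<^sub>M lborel))"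
  by (intro nn_integral_mono) (auto simp: ennreal_mult[symmetric] norm_mult_ineq)
 also have "... = (\<integral>\<^sup>+x. \<integral>\<^sup>+y. ennreal (norm (f x)) * ennreal (norm (g y)) \<partial>lborel \<partial>lborel)"
  by (subst lborel.nn_integral_fst[symmetric]) auto
 also have "... = (NBINT x. ennreal (norm (f x))) * (NBINT y. ennreal (norm (g y)))"
  by (simp add: nn_integral_cmult nn_integral_multc)
 also have "... < \<infinity>" using f g by (auto simp: integrable_iff_bounded ennreal_mult_less_top)
 finally show ?thesis by (intro integrableI_bounded) auto
qed

lemma Fubini_mult_bound:
 fixes h :: "'a::euclidean_space => 'b::euclidean_space => complex" and f g :: "_ => real"
 assumes [measurable]: "case_prod h \<in> borel_measurable (borel \<Otimes>\<^sub>M borel)"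
  and f: "integrable lborel f" and g: "integrable lborel g" and le: "\<And>x y. norm (h x y) \<le> f x * g y"
 shows "integrable (lborel \<Otimes>\<^sub>M lborel) (case_prod h)"
  and "(\<integral>x. \<integral>y. h x y \<partial>lborel \<partial>lborel) = (\<integral>y. \<integral>x. h x y \<partial>lborel \<partial>lborel)"
proof -
 interpret pair_sigma_finite "lborel::'a measure" "lborel::'b measure" ..
 show i: "integrable (lborel \<Otimes>\<^sub>M lborel) (case_prod h)"
 proof (rule Bochner_Integration.integrable_bound[OF integrable_pair_mult[OF f g]])
  show "AE z in lborel \<Otimes>\<^sub>M lborel. norm (case_prod h z) \<le> norm (case z of (x, y) => f x * g y)"
   by (rule AE_I2) (auto split: prod.split intro: order_trans[OF le abs_ge_self])
 qed measurable
 show "(\<integral>x. \<integral>y. h x y \<partial>lborel \<partial>lborel) = (\<integral>y. \<integral>x. h x y \<partial>lborel \<partial>lborel)"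
  using lborel_pair.Fubini_integral[OF i] by simp
qed

text \<open>With a real parameter this is the damping factor in the proof of Plancherel's theorem;
  with a = eps - i t/2 it is the damped conjugate of the symbol of the free propagator.\<close>

definition cgauss :: "complex => 'a::euclidean_space => complex" where
 "cgauss a x = exp (- a * of_real ((norm x)^2))"

lemma norm_cgauss: "norm (cgauss a x) = exp (- Re a * (norm x)^2)"
 by (simp add: cgauss_def norm_exp_eq_Re)

lemma cgauss_measurable[measurable]: "cgauss a \<in> borel_measurable borel"
 unfolding cgauss_def by measurable

lemma cgauss_L1: "Re a > 0 ==> cgauss a \<in> L1_space"
 unfolding L1_space_def mem_Collect_eq
 by (rule Bochner_Integration.integrable_bound[OF gauss_real(1)[of "Re a"]]) (auto simp: norm_cgauss)

(* |K|^2 is a double integral; the substitution x = m + s/2, y = m - s/2 turns the inner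
  integral into the transform of a real Gaussian. *)
lemma cgauss_ft_bound:
 fixes z :: "'a::euclidean_space"
 assumes a: "Re a > 0"
 shows "norm (LBINT x. cgauss a x * exp (\<i> * of_real (x \<bullet> z))) \<le> (pi / norm a) powr (DIM('a) / 2)"
proof -
 define \<alpha> \<beta> where "\<alpha> = Re a" "\<beta> = Im a"
 let ?E = "%s::'a. ((pi / (2 * \<alpha>)) powr (DIM('a) / 2) * exp (- (norm ((- 2 * \<beta>) *\<^sub>R s))\<^sup>2 / (4 * (2 * \<alpha>)))) :: real" and ?g = "%s. cgauss (of_real (\<alpha> / 2)) s * exp (\<i> * of_real (s \<bullet> z))"
 have \<alpha>: "\<alpha> > 0" using a by (simp add: \<alpha>_\<beta>_def)
 let ?e = "%x::'a. cgauss a x * exp (\<i> * of_real (x \<bullet> z))"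
 have [measurable]: "?e \<in> borel_measurable borel" by measurable
 define K where "K = (LBINT x. ?e x)"
 define h where "h s y = ?e (y + s) * cnj (?e y)" for s y
 have hm: "(%(s, y). h s y) \<in> borel_measurable (borel \<Otimes>\<^sub>M borel)"
  unfolding h_def cgauss_def by (simp add: exp_cnj[symmetric] del: exp_cnj) (simp add: exp_cnj)
 have hm2: "h s \<in> borel_measurable borel" for s
  unfolding h_def[abs_def] cgauss_def by (simp add: exp_cnj)
 have hb: "norm (h s y) \<le> exp (- (\<alpha> / 4) * (norm s)^2) * exp (- (\<alpha> / 2) * (norm y)^2)" for s y
 proof -
  have "(norm s)^2 \<le> 2 * (norm (y + s))^2 + 2 * (norm y)^2"
  proof -
   have "norm s \<le> norm (y + s) + norm y" using norm_triangle_ineq4[of "y + s" y] by simp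
   then have "(norm s)^2 \<le> (norm (y + s) + norm y)^2" by (intro power_mono) auto
   also have "... \<le> 2 * (norm (y + s))^2 + 2 * (norm y)^2"
    using sum_squares_bound[of "norm (y + s)" "norm y"] by (simp add: power2_sum)
   finally show ?thesis .
  qed
  then have "(norm s)^2 / 4 + (norm y)^2 / 2 \<le> (norm (y + s))^2 + (norm y)^2"
   using zero_le_power2[of "norm (y + s)"] by linarith
  from mult_left_mono[OF this, of \<alpha>] show ?thesis
   using \<alpha> by (simp add: h_def norm_mult norm_cgauss exp_add[symmetric] \<alpha>_\<beta>_def field_simps)
 qed
 have "of_real ((norm K)^2) = K * cnj K" by (rule complex_norm_square)
 also have "... = (LBINT y. K * cnj (?e y))"
 proof -
  have "cnj K = (LBINT y. cnj (?e y))" unfolding K_def by (rule Bochner_Integration.integral_cnj[symmetric])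
  then show ?thesis by (simp only: integral_mult_right_zero)
 qed
 also have "... = (\<integral>y. \<integral>s. h s y \<partial>lborel \<partial>lborel)"
 proof (rule Bochner_Integration.integral_cong[OF refl])
  fix y :: 'a
  have "K = (LBINT s. ?e (s + y))" unfolding K_def by (rule lborel_integral_shift[symmetric]) measurable
  then show "K * cnj (?e y) = (LBINT s. h s y)" by (simp add: h_def add.commute)
 qed
 also have "... = (\<integral>s. \<integral>y. h s y \<partial>lborel \<partial>lborel)"
  using \<alpha> by (intro Fubini_mult_bound(2)[OF hm gauss_real(1) gauss_real(1) hb, symmetric]) auto
 also have "... = (\<integral>s. \<integral>m. h s (m + (- (1/2)) *\<^sub>R s) \<partial>lborel \<partial>lborel)"
 proof (rule Bochner_Integration.integral_cong[OF refl])
  fix s show "(LBINT y. h s y) = (LBINT m. h s (m + (- (1/2)) *\<^sub>R s))"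
   by (rule lborel_integral_shift[OF hm2, symmetric])
 qed
 also have "... = (LBINT s. (?g s) *
   of_real (?E s))"
 proof (rule Bochner_Integration.integral_cong[OF refl])
  fix s :: 'a
  have "h s (m + (- (1/2)) *\<^sub>R s) = (?g s) *
    (complex_of_real (exp (- (2 * \<alpha>) * (norm m)^2)) * exp (\<i> * of_real (m \<bullet> ((- 2 * \<beta>) *\<^sub>R s))))" for m
  proof -
   define p q where "p = m + (1/2) *\<^sub>R s" "q = m + (- (1/2)) *\<^sub>R s"
   have "s = (1/2) *\<^sub>R s + (1/2) *\<^sub>R s" by (simp flip: scaleR_left_distrib)
   then have ps: "q + s = p" unfolding p_q_def by (metis add.assoc add_minus_cancel scaleR_minus_left)
   have n1: "(norm p)^2 = (norm m)^2 + m \<bullet> s + (norm s)^2 / 4" "(norm q)^2 = (norm m)^2 - m \<bullet> s + (norm s)^2 / 4"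
    unfolding p_q_def power2_norm_eq_inner by (simp_all add: algebra_simps inner_commute)
   have n2: "p \<bullet> z - q \<bullet> z = s \<bullet> z" by (simp add: p_q_def algebra_simps)
   have ac: "a = of_real \<alpha> + \<i> * of_real \<beta>" by (simp add: \<alpha>_\<beta>_def complex_eq_iff)
   have "h s q = exp (- a * of_real ((norm p)^2) + \<i> * of_real (p \<bullet> z) + (- cnj a * of_real ((norm q)^2) - \<i> * of_real (q \<bullet> z)))"
    unfolding h_def ps cgauss_def by (simp add: exp_add exp_diff exp_cnj[symmetric] exp_minus field_simps del: exp_cnj) (simp add: exp_cnj exp_minus field_simps)
   also have "- a * of_real ((norm p)^2) + \<i> * of_real (p \<bullet> z) + (- cnj a * of_real ((norm q)^2) - \<i> * of_real (q \<bullet> z))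
    = - of_real (\<alpha> / 2) * of_real ((norm s)^2) + \<i> * of_real (s \<bullet> z) + (of_real (- (2 * \<alpha>) * (norm m)^2) + \<i> * of_real (m \<bullet> ((- 2 * \<beta>) *\<^sub>R s)))"
    unfolding n1 ac n2[symmetric] by (simp add: complex_eq_iff algebra_simps)
   finally show ?thesis unfolding p_q_def cgauss_def by (simp only: exp_add exp_of_real of_real_minus)
  qed
  then show "(LBINT m. h s (m + (- (1/2)) *\<^sub>R s)) = (?g s) *
   of_real (?E s)"
   using gauss_ft(2)[of "2 * \<alpha>" "(- 2 * \<beta>) *\<^sub>R s"] \<alpha> by simp
 qed
 finally have "(norm K)^2 = norm (LBINT s. (?g s) *
   of_real (?E s))"
  by (metis norm_of_real abs_of_nonneg zero_le_power2)
 also have "... \<le> (\<integral>s. norm ((?g s) *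
   of_real (?E s)) \<partial>(lborel::'a measure))"
  by (rule integral_norm_bound)
 also have "... = (\<integral>s. (pi / (2 * \<alpha>)) powr (DIM('a) / 2) * exp (- (\<alpha> / 2 + \<beta>\<^sup>2 / (2 * \<alpha>)) * (norm s)^2) \<partial>(lborel::'a measure))"
 proof (rule Bochner_Integration.integral_cong[OF refl])
  fix s :: 'a
  have "exp (- (\<alpha> / 2) * (norm s)^2) * exp (- (norm ((- 2 * \<beta>) *\<^sub>R s))\<^sup>2 / (4 * (2 * \<alpha>))) = exp (- (\<alpha> / 2 + \<beta>\<^sup>2 / (2 * \<alpha>)) * (norm s)^2)"
   unfolding exp_add[symmetric] using \<alpha> by (simp add: power_mult_distrib field_simps)
  then show "norm ((?g s) *
   of_real (?E s))
   = (pi / (2 * \<alpha>)) powr (DIM('a) / 2) * exp (- (\<alpha> / 2 + \<beta>\<^sup>2 / (2 * \<alpha>)) * (norm s)^2)"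
   unfolding norm_mult norm_cgauss norm_of_real by (simp add: abs_mult mult.assoc mult.left_commute)
 qed
 also have "... = (pi / (2 * \<alpha>)) powr (DIM('a) / 2) * (pi / (\<alpha> / 2 + \<beta>\<^sup>2 / (2 * \<alpha>))) powr (DIM('a) / 2)"
  using \<alpha> by (simp only: integral_mult_right_zero gauss_real(2)[of "\<alpha> / 2 + \<beta>\<^sup>2 / (2 * \<alpha>)"] add_pos_nonneg divide_pos_pos zero_less_numeral divide_nonneg_pos zero_le_power2 mult_pos_pos)
 \<comment> \<open>The two bases multiply to pi^2 / (alpha^2 + beta^2). Only |a| survives, which
   keeps the bound finite as Re a tends to 0.\<close>
 also have "... = ((pi / norm a)^2) powr (DIM('a) / 2)"
 proof -
  have "(norm a)^2 = \<alpha>\<^sup>2 + \<beta>\<^sup>2" by (simp add: \<alpha>_\<beta>_def cmod_power2)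
  moreover have "\<alpha>\<^sup>2 + \<beta>\<^sup>2 > 0" using \<alpha> by (simp add: add_pos_nonneg)
  ultimately have "pi / (2 * \<alpha>) * (pi / (\<alpha> / 2 + \<beta>\<^sup>2 / (2 * \<alpha>))) = (pi / norm a)^2"
   using \<alpha> by (simp add: power_divide field_simps power2_eq_square)
  then show ?thesis using \<alpha> by (simp add: powr_mult[symmetric])
 qed
 also have "... = ((pi / norm a) powr (DIM('a) / 2))^2"
  by (simp only: power2_eq_square powr_mult)
 finally show ?thesis unfolding K_def by (rule power2_le_imp_le) simp
qed

section \<open>The Fourier transform\<close>

definition ft_const :: "'a::euclidean_space itself => real" where
 "ft_const _ = (2 * pi) powr (- real DIM('a) / 2)"

lemma ft_const_pos[simp]: "ft_const TYPE('a::euclidean_space) > 0" "ft_const TYPE('a) \<ge> 0"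
 by (auto simp: ft_const_def)

text \<open>The sign s = -1 gives the Fourier transform and s = 1 its inverse. Carrying s as a
  parameter with s^2 = 1 lets each property be proved once for both.\<close>

definition ft :: "real => ('a::euclidean_space => complex) => 'a => complex" where
 "ft s f \<xi> = of_real (ft_const TYPE('a)) * (LBINT x. exp (\<i> * of_real (s * (x \<bullet> \<xi>))) * f x)"

lemma fourier_eq_ft: "fourier f = ft (-1) f"
 by (simp add: fun_eq_iff fourier_def ft_def ft_const_def)

lemma inverse_fourier_eq_ft: "inverse_fourier f = ft 1 f"
 by (simp add: fun_eq_iff inverse_fourier_def ft_def ft_const_def inner_commute)

lemma norm_exp_i[simp]: "norm (exp (\<i> * complex_of_real t)) = 1"
 by (simp add: norm_exp_i_times)

lemma L1_exp: 
 assumes "f \<in> L1_space" and [measurable]: "g \<in> borel_measurable borel"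
 shows "(%x. exp (\<i> * of_real (g x)) * f x) \<in> L1_space"
 unfolding L1_space_def mem_Collect_eq
proof (rule Bochner_Integration.integrable_bound)
 note [measurable] = L1_space_measurable[OF assms(1)]
 show "integrable lborel f" using assms by (simp add: L1_space_def)
 show "(%x. exp (\<i> * complex_of_real (g x)) * f x) \<in> borel_measurable lborel" by measurable
qed (simp add: norm_mult)

lemma ft_measurable[measurable]:
 assumes [measurable]: "f \<in> borel_measurable borel" shows "ft s f \<in> borel_measurable borel"
 unfolding ft_def[abs_def] by measurable

lemma norm_ft_le:
 "norm (ft s f \<xi>) \<le> ft_const TYPE('a) * (LBINT x. norm (f x))" for f :: "'a::euclidean_space => complex"
 unfolding ft_def norm_mult
 by (auto intro!: mult_left_mono order_trans[OF integral_norm_bound] simp: norm_mult)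

lemma ft_add: "f \<in> L1_space ==> g \<in> L1_space ==> ft s (%x. f x + g x) \<xi> = ft s f \<xi> + ft s g \<xi>"
 using L1_exp[of f "%x. s * (x \<bullet> \<xi>)"] L1_exp[of g "%x. s * (x \<bullet> \<xi>)"]
 by (simp add: ft_def ring_distribs L1_space_def)

lemma ft_cmult: "ft s (%x. c * f x) \<xi> = c * ft s f \<xi>"
proof -
 have "(LBINT x. exp (\<i> * of_real (s * (x \<bullet> \<xi>))) * (c * f x)) = (LBINT x. c * (exp (\<i> * of_real (s * (x \<bullet> \<xi>))) * f x))"
  by (simp add: mult.left_commute)
 then show ?thesis by (simp add: ft_def)
qed

lemma L1_space_cmult: "f \<in> L1_space ==> (%x. c * f x) \<in> L1_space"
 by (simp add: L1_space_def)

lemma L1_space_add: "f \<in> L1_space ==> g \<in> L1_space ==> (%x. f x + g x) \<in> L1_space"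
 by (simp add: L1_space_def)

lemma L1_space_diff: "f \<in> L1_space ==> g \<in> L1_space ==> (%x. f x - g x) \<in> L1_space"
 by (simp add: L1_space_def)

lemma L1_space_cnj: "f \<in> L1_space ==> (%x. cnj (f x)) \<in> L1_space"
 by (simp add: L1_space_def)

lemma ft_diff: "f \<in> L1_space ==> g \<in> L1_space ==> ft s (%x. f x - g x) \<xi> = ft s f \<xi> - ft s g \<xi>"
 using ft_add[of f "%x. (-1) * g x" s \<xi>] L1_space_cmult[of g "-1"] ft_cmult[of s "-1" g \<xi>] by simp

lemma ft_cnj: "ft s (%x. cnj (f x)) \<xi> = cnj (ft (- s) f \<xi>)"
proof -
 have "exp (\<i> * of_real (s * (x \<bullet> \<xi>))) * cnj (f x) = cnj (exp (\<i> * of_real ((- s) * (x \<bullet> \<xi>))) * f x)" for x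
  by (simp add: exp_cnj[symmetric] del: exp_cnj) (simp add: exp_cnj)
 then have "(LBINT x. exp (\<i> * of_real (s * (x \<bullet> \<xi>))) * cnj (f x)) = cnj (LBINT x. exp (\<i> * of_real ((- s) * (x \<bullet> \<xi>))) * f x)"
  unfolding Bochner_Integration.integral_cnj[symmetric] by (rule Bochner_Integration.integral_cong[OF refl])
 then show ?thesis by (simp only: ft_def complex_cnj_mult complex_cnj_complex_of_real)
qed

lemma L1_times_bounded:
 assumes f: "f \<in> L1_space" and [measurable]: "g \<in> borel_measurable borel" and B: "\<And>x. norm (g x) \<le> B"
 shows "(%x. g x * f x) \<in> L1_space"
 unfolding L1_space_def mem_Collect_eq
proof (rule Bochner_Integration.integrable_bound)
 note [measurable] = L1_space_measurable[OF f]
 show "integrable lborel (%x. B * norm (f x))" using f by (simp add: L1_space_def)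
 show "(%x. g x * f x) \<in> borel_measurable lborel" by measurable
 have "norm (g x * f x) \<le> norm (B * norm (f x))" for x
  unfolding norm_mult using B[of x] by (auto intro!: mult_right_mono)
 then show "AE x in lborel. norm (g x * f x) \<le> norm (B * norm (f x))" by simp
qed

lemma ft_multiplication:
 assumes f: "f \<in> L1_space" and k: "k \<in> L1_space"
 shows "(LBINT \<xi>. ft s f \<xi> * k \<xi>) = (\<integral>x. f x * ft s k x \<partial>(lborel::'a::euclidean_space measure))"
proof -
 note [measurable] = L1_space_measurable[OF f] L1_space_measurable[OF k]
 define h where "h x \<xi> = exp (\<i> * of_real (s * (x \<bullet> \<xi>))) * f x * k \<xi>" for x \<xi>
 have [measurable]: "case_prod h \<in> borel_measurable (borel \<Otimes>\<^sub>M borel)" unfolding h_def by measurable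
 have "(\<integral>x. \<integral>\<xi>. h x \<xi> \<partial>lborel \<partial>lborel) = (\<integral>\<xi>. \<integral>x. h x \<xi> \<partial>lborel \<partial>lborel)"
  using f k by (intro Fubini_mult_bound(2)[where f="%x. norm (f x)" and g="%x. norm (k x)"])
   (auto simp: L1_space_def h_def norm_mult)
 moreover have "(LBINT x. h x \<xi>) = (LBINT x. exp (\<i> * of_real (s * (x \<bullet> \<xi>))) * f x) * k \<xi>" for \<xi>
  unfolding h_def by (rule integral_mult_left_zero)
 moreover have "(LBINT \<xi>. h x \<xi>) = f x * (LBINT \<xi>. exp (\<i> * of_real (s * (\<xi> \<bullet> x))) * k \<xi>)" for x
  unfolding h_def by (subst integral_mult_right_zero[symmetric]) (simp add: mult_ac inner_commute)
 ultimately show ?thesis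
  by (simp add: ft_def mult.assoc mult.left_commute[of "f _"])
qed

text \<open>By Fubini a weight on the frequency side becomes a convolution with its transform. A
  real Gaussian weight yields Plancherel's theorem, an almost imaginary one the dispersive
  estimate.\<close>

lemma ft_triple:
 fixes f g w :: "'a::euclidean_space => complex"
 assumes f: "f \<in> L1_space" and g: "g \<in> L1_space" and w: "w \<in> L1_space"
 shows "(LBINT \<xi>. ft s f \<xi> * (ft (- s) g \<xi> * w \<xi>))
  = of_real (ft_const TYPE('a)) * (LBINT x. f x * (LBINT y. g y * ft s w (x - y)))"
proof -
 note [measurable] = L1_space_measurable[OF f] L1_space_measurable[OF g] L1_space_measurable[OF w]
 have k: "(%\<xi>. ft (- s) g \<xi> * w \<xi>) \<in> L1_space"
  by (rule L1_times_bounded[OF w _ norm_ft_le]) measurable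
 have "ft s (%\<xi>. ft (- s) g \<xi> * w \<xi>) x = of_real (ft_const TYPE('a)) * (LBINT y. g y * ft s w (x - y))" for x
 proof -
  have "ft s (%\<xi>. ft (- s) g \<xi> * w \<xi>) x = of_real (ft_const TYPE('a)) *
    (LBINT \<xi>. ft (- s) g \<xi> * (exp (\<i> * of_real (s * (\<xi> \<bullet> x))) * w \<xi>))"
   by (simp add: ft_def[of s] mult_ac)
  also have "... = of_real (ft_const TYPE('a)) * (LBINT y. g y * ft (- s) (%\<xi>. exp (\<i> * of_real (s * (\<xi> \<bullet> x))) * w \<xi>) y)"
  proof -
   have "(%\<xi>. exp (\<i> * of_real (s * (\<xi> \<bullet> x))) * w \<xi>) \<in> L1_space" by (rule L1_exp[OF w]) measurable
   then show ?thesis by (simp only: ft_multiplication[OF g])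
  qed
  finally have 1: "ft s (%\<xi>. ft (- s) g \<xi> * w \<xi>) x = of_real (ft_const TYPE('a)) *
    (LBINT y. g y * ft (- s) (%\<xi>. exp (\<i> * of_real (s * (\<xi> \<bullet> x))) * w \<xi>) y)" .
  have 2: "ft (- s) (%\<xi>. exp (\<i> * of_real (s * (\<xi> \<bullet> x))) * w \<xi>) y = ft s w (x - y)" for y
  proof -
   have "exp (\<i> * of_real (- s * (\<xi> \<bullet> y))) * (exp (\<i> * of_real (s * (\<xi> \<bullet> x))) * w \<xi>)
     = exp (\<i> * of_real (s * (\<xi> \<bullet> (x - y)))) * w \<xi>" for \<xi>
   proof -
    have e: "\<i> * of_real (- s * (\<xi> \<bullet> y)) + \<i> * of_real (s * (\<xi> \<bullet> x)) = \<i> * complex_of_real (s * (\<xi> \<bullet> (x - y)))"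
     by (simp add: inner_diff_right algebra_simps)
    show ?thesis unfolding mult.assoc[symmetric] exp_add[symmetric] e ..
   qed
   then show ?thesis by (simp only: ft_def)
  qed
  show ?thesis unfolding 1 2 ..
 qed
 then show ?thesis
  by (simp add: ft_multiplication[OF f k] mult.left_commute[of "f _"])
qed

lemma ft_triple_bound:
 fixes f g w :: "'a::euclidean_space => complex"
 assumes f: "f \<in> L1_space" and g: "g \<in> L1_space" and w: "w \<in> L1_space" and B: "\<And>z. norm (ft s w z) \<le> B"
 shows "norm (LBINT \<xi>. ft s f \<xi> * (ft (- s) g \<xi> * w \<xi>))
  \<le> ft_const TYPE('a) * B * (LBINT x. norm (f x)) * (LBINT x. norm (g x))"
proof -
 let ?c = "%x. LBINT y. g y * ft s w (x - y)"
 note [measurable] = L1_space_measurable[OF f] L1_space_measurable[OF g] L1_space_measurable[OF w]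
 have B0: "0 \<le> B" using order_trans[OF norm_ge_zero B] .
 have ing: "integrable lborel (%y. g y * ft s w (x - y))" for x
  using L1_times_bounded[OF g, of "%y. ft s w (x - y)" B] B by (simp add: L1_space_def mult.commute)
 have I: "norm (?c x) \<le> B * (LBINT x. norm (g x))" for x
 proof -
  have "norm (?c x) \<le> (LBINT y. norm (g y * ft s w (x - y)))"
   by (rule integral_norm_bound)
  also have "... \<le> (LBINT y. B * norm (g y))"
  proof (rule integral_mono)
   show "integrable lborel (%y. norm (g y * ft s w (x - y)))" by (rule integrable_norm[OF ing])
   show "norm (g y * ft s w (x - y)) \<le> B * norm (g y)" for y
    unfolding norm_mult mult.commute[of B] by (intro mult_left_mono B) auto
  qed (use g in \<open>simp add: L1_space_def\<close>)
  finally show ?thesis by simp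
 qed
 have "norm (LBINT x. f x * (?c x)) \<le> (LBINT x. norm (f x * (?c x)))"
  by (rule integral_norm_bound)
 also have "... \<le> (LBINT x. (B * (LBINT x. norm (g x))) * norm (f x))"
 proof (rule integral_mono)
  show "integrable lborel (%x. norm (f x * (?c x)))"
   using L1_times_bounded[OF f _ I] by (simp add: L1_space_def mult.commute)
  show "integrable lborel (%x. (B * (LBINT x. norm (g x))) * norm (f x))" using f by (simp add: L1_space_def)
  show "norm (f x * (?c x)) \<le> (B * (LBINT x. norm (g x))) * norm (f x)" for x
   unfolding norm_mult using mult_left_mono[OF I[of x], of "norm (f x)"] by (simp add: mult.commute)
 qed
 finally have "norm (LBINT x. f x * (?c x)) \<le> B * (LBINT x. norm (g x)) * (LBINT x. norm (f x))"
  by simp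
 from mult_left_mono[OF this, of "ft_const TYPE('a)"] show ?thesis
  unfolding ft_triple[OF f g w] norm_mult norm_of_real by (simp add: mult_ac)
qed

lemma ft_cgauss_eq:
 "ft s (cgauss a) z = of_real (ft_const TYPE('a)) * (\<integral>x. cgauss a x * exp (\<i> * of_real (x \<bullet> (s *\<^sub>R z))) \<partial>(lborel::'a::euclidean_space measure))"
 unfolding ft_def inner_scaleR_right by (simp only: mult.commute[of "exp _"])

text \<open>Bounding the modulus only, no branch of the complex power a^(-n/2) has to be
  chosen.\<close>

lemma ft_cgauss_bound:
 fixes z :: "'a::euclidean_space"
 assumes "Re a > 0"
 shows "norm (ft s (cgauss a) z) \<le> ft_const TYPE('a) * (pi / norm a) powr (DIM('a) / 2)"
 unfolding ft_cgauss_eq norm_mult norm_of_real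
 by (rule mult_mono[OF _ cgauss_ft_bound[OF assms]]) auto

lemma ft_gauss:
 fixes z :: "'a::euclidean_space"
 assumes b: "b > 0"
 shows "ft s (cgauss (of_real b)) z = of_real (ft_const TYPE('a) * (pi / b) powr (DIM('a) / 2) * exp (- s\<^sup>2 * (norm z)^2 / (4 * b)))"
proof -
 have "cgauss (of_real b) x = complex_of_real (exp (- b * (norm x)^2))" for x :: 'a
  by (simp add: cgauss_def exp_of_real[symmetric])
 moreover have "- (norm (s *\<^sub>R z))\<^sup>2 / (4 * b) = - s\<^sup>2 * (norm z)^2 / (4 * b)" by (simp add: power_mult_distrib)
 ultimately show ?thesis using gauss_ft(2)[OF b, of "s *\<^sub>R z"]
  by (simp only: ft_cgauss_eq of_real_mult mult.assoc)
qed

lemma integral_norm_bound_ennreal_le: "ennreal (norm (integral\<^sup>L M f)) \<le> (\<integral>\<^sup>+x. norm (f x) \<partial>M)"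
proof (cases "integrable M f")
 case True
 then show ?thesis by (rule integral_norm_bound_ennreal)
next
 case False
 then have "integral\<^sup>L M f = 0" by (rule not_integrable_integral_eq)
 then show ?thesis by (simp only: norm_zero ennreal_0) simp
qed

lemma ft_const_sq: "ft_const TYPE('a) * ft_const TYPE('a) = 1 / (2 * pi) ^ DIM('a::euclidean_space)"
proof -
 have "ft_const TYPE('a) * ft_const TYPE('a) = (2 * pi) powr (- real DIM('a))"
  unfolding ft_const_def powr_add[symmetric] by simp
 also have "... = 1 / (2 * pi) powr real DIM('a)" by (rule powr_minus_divide)
 also have "(2 * pi) powr real DIM('a) = (2 * pi) ^ DIM('a)" by (rule powr_realpow) simp
 finally show ?thesis .
qed

text \<open>The transform of a Gaussian, multiplied by the normalization left over in
  \<open>ft_triple\<close>, is a probability density. This is where the value of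
  \<open>ft_const\<close> matters.\<close>

lemma gauss_mass:
 assumes b: "b > 0"
 shows "ft_const TYPE('a) * (ft_const TYPE('a) * (pi / b) powr (DIM('a) / 2) * (pi / (1 / (4 * b))) powr (DIM('a::euclidean_space) / 2)) = 1"
proof -
 have "(pi / b) powr (DIM('a) / 2) * (pi / (1 / (4 * b))) powr (DIM('a) / 2) = ((2 * pi) * (2 * pi)) powr (DIM('a) / 2)"
 proof -
  have "(pi / b) * (pi / (1 / (4 * b))) = (2 * pi) * (2 * pi)" using b by (simp add: field_simps)
  then show ?thesis by (simp only: powr_mult[symmetric])
 qed
 also have "... = (2 * pi) ^ DIM('a)"
 proof -
  have *: "(c * c) powr (DIM('a) / 2) = c ^ DIM('a)" if "c > 0" for c :: real
   using that by (simp only: powr_mult powr_add[symmetric]) (simp add: powr_realpow)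
  show ?thesis by (rule *) simp
 qed
 finally have *: "(pi / b) powr (DIM('a) / 2) * (pi / (1 / (4 * b))) powr (DIM('a) / 2) = (2 * pi) ^ DIM('a)" .
 show ?thesis unfolding mult.assoc * by (simp only: mult.assoc[symmetric] ft_const_sq) simp
qed

(* Gaussian damping: the damped integral is a double integral against a Gaussian of mass one. *)
lemma ft_contraction:
 fixes f :: "'a::euclidean_space => complex"
 assumes s: "s\<^sup>2 = 1" and f1: "f \<in> L1_space" and f2: "f \<in> L2_space"
 shows "ft s f \<in> L2_space" "norm (cls (ft s f)) \<le> norm (cls f)"
proof -
 note [measurable] = L2_space_measurable[OF f2]
 let ?N = "\<integral>\<^sup>+x. ennreal ((norm (f x))^2) \<partial>lborel"
 let ?d = "%b \<xi>. (norm (ft s f \<xi>))^2 * exp (- b * (norm \<xi>)^2)"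
 have damp: "(NBINT \<xi>. ennreal (?d b \<xi>)) \<le> ?N" if b: "b > 0" for b
 proof -
  define G where "G z = ft_const TYPE('a) * ((pi / b) powr (DIM('a) / 2) * exp (- (1 / (4 * b)) * (norm z)^2))" for z :: 'a
 let ?h = "%x y. ennreal ((norm (f x))^2 / 2 * G (x - y))" and ?l = "%x y. ennreal ((norm (f y))^2 / 2 * G (x - y))" and ?c = "%x. LBINT y. cnj (f y) * of_real (G (x - y))"
  have G0: "G z \<ge> 0" for z by (simp add: G_def)
  have Gs: "G (- z) = G z" for z by (simp add: G_def)
  have [measurable]: "G \<in> borel_measurable borel" unfolding G_def by measurable
  have Gint: "integrable lborel G" unfolding G_def using b by (intro integrable_mult_right gauss_real(1)) simp
  have mass: "ennreal (ft_const TYPE('a)) * (NBINT z. ennreal (G z)) = 1"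
  proof -
   have "(LBINT z. G z) = ft_const TYPE('a) * (pi / b) powr (DIM('a) / 2) * (pi / (1 / (4 * b))) powr (DIM('a) / 2)"
   proof -
    have "1 / (4 * b) > 0" using b by simp
    from gauss_real(2)[OF this, where 'a='a] show ?thesis
     unfolding G_def by (simp only: integral_mult_right_zero mult.assoc)
   qed
   moreover have "(NBINT z. ennreal (G z)) = ennreal (LBINT z. G z)"
    using Gint G0 by (intro nn_integral_eq_integral) auto
   ultimately show ?thesis using gauss_mass[OF b, where 'a='a]
    by (simp add: ennreal_mult'[symmetric] mult.assoc)
  qed
  have wL: "cgauss (of_real b) \<in> (L1_space :: ('a => complex) set)" by (rule cgauss_L1) (use b in simp)
  have ftG: "ft s (cgauss (of_real b)) z = of_real (G z)" for z :: 'a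
   using ft_gauss[OF b, of s z] s by (simp add: G_def)
  have eq: "ft s f \<xi> * (ft (- s) (%x. cnj (f x)) \<xi> * cgauss (of_real b) \<xi>) = of_real (?d b \<xi>)" for \<xi>
  proof -
   have "cgauss (of_real b) \<xi> = of_real (exp (- b * (norm \<xi>)^2))" by (simp add: cgauss_def exp_of_real[symmetric])
   then show ?thesis using complex_norm_square[of "ft s f \<xi>"] by (simp add: ft_cnj mult.assoc[symmetric])
  qed
  have intd: "integrable lborel (%\<xi>. ?d b \<xi>)"
  proof (rule Bochner_Integration.integrable_bound)
   show "integrable lborel (%\<xi>::'a. (ft_const TYPE('a) * (LBINT x. norm (f x)))^2 * exp (- b * (norm \<xi>)^2))"
    using gauss_real(1)[OF b] by (intro integrable_mult_right)
   show "AE \<xi> in lborel. norm (?d b \<xi>) \<le> norm ((ft_const TYPE('a) * (LBINT x. norm (f x)))^2 * exp (- b * (norm \<xi>)^2))"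
   proof (rule AE_I2)
    fix \<xi> :: 'a
    have "(norm (ft s f \<xi>))^2 \<le> (ft_const TYPE('a) * (LBINT x. norm (f x)))^2"
     by (intro power_mono norm_ft_le) auto
    then show "norm (?d b \<xi>) \<le> norm ((ft_const TYPE('a) * (LBINT x. norm (f x)))^2 * exp (- b * (norm \<xi>)^2))"
     by (simp add: norm_mult mult_right_mono)
   qed
  qed measurable
  have "complex_of_real (LBINT \<xi>. ?d b \<xi>)
   = of_real (ft_const TYPE('a)) * (LBINT x. f x * (?c x))"
   using ft_triple[OF f1 L1_space_cnj[OF f1] wL, of s] unfolding eq ftG by (simp only: integral_complex_of_real)
  then have "(LBINT \<xi>. ?d b \<xi>)
   = norm (of_real (ft_const TYPE('a)) * (LBINT x. f x * (?c x)))"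
   by (metis (no_types, lifting) Bochner_Integration.integral_nonneg abs_of_nonneg exp_ge_zero mult_nonneg_nonneg norm_of_real zero_le_power2)
  then have "ennreal (LBINT \<xi>. ?d b \<xi>)
   = ennreal (ft_const TYPE('a)) * ennreal (norm (LBINT x. f x * (?c x)))"
   by (simp add: norm_mult ennreal_mult)
  also have "... \<le> ennreal (ft_const TYPE('a)) * (\<integral>\<^sup>+x. \<integral>\<^sup>+y. (?h x y + ?l x y) \<partial>lborel \<partial>lborel)"
  proof (rule mult_left_mono)
   have "ennreal (norm (LBINT x. f x * (?c x)))
    \<le> (NBINT x. norm (f x * (?c x)))"
    by (rule integral_norm_bound_ennreal_le)
   also have "... \<le> (\<integral>\<^sup>+x. \<integral>\<^sup>+y. (?h x y + ?l x y) \<partial>lborel \<partial>lborel)"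
   proof (rule nn_integral_mono)
    fix x
    have "ennreal (norm (f x * (?c x))) = ennreal (norm (f x)) * ennreal (norm (?c x))"
     by (simp add: norm_mult ennreal_mult)
    also have "... \<le> ennreal (norm (f x)) * (NBINT y. norm (cnj (f y) * of_real (G (x - y))))"
     by (intro mult_left_mono integral_norm_bound_ennreal_le) auto
    also have "... = (NBINT y. ennreal (norm (f x)) * ennreal (norm (cnj (f y) * of_real (G (x - y)))))"
     by (rule nn_integral_cmult[symmetric]) (simp add: norm_mult)
    \<comment> \<open>Schur's test: |f(x)| |f(y)| is split into |f(x)|^2/2 + |f(y)|^2/2. Each half
      then integrates out the even kernel \<open>G\<close>, whose mass cancels
      \<open>ft_const\<close>.\<close>
    also have "... \<le> (NBINT y. (?h x y + ?l x y))"
    proof (rule nn_integral_mono)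
     fix y
     have "norm (f x) * norm (f y) \<le> (norm (f x))^2 / 2 + (norm (f y))^2 / 2"
      using sum_squares_bound[of "norm (f x)" "norm (f y)"] by simp
     from mult_right_mono[OF this G0[of "x - y"]]
     have "norm (f x) * norm (cnj (f y) * of_real (G (x - y))) \<le> (norm (f x))^2 / 2 * G (x - y) + (norm (f y))^2 / 2 * G (x - y)"
      using G0[of "x - y"] by (simp add: norm_mult ring_distribs mult.assoc)
     then show "ennreal (norm (f x)) * ennreal (norm (cnj (f y) * of_real (G (x - y)))) \<le> ?h x y + ?l x y"
      unfolding ennreal_mult[OF norm_ge_zero norm_ge_zero, symmetric]
      by (subst ennreal_plus[symmetric]) (auto simp only: intro!: ennreal_leI mult_nonneg_nonneg G0 divide_nonneg_pos zero_le_power2 zero_less_numeral)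
    qed
    finally show "ennreal (norm (f x * (?c x))) \<le> (NBINT y. (?h x y + ?l x y))" .
   qed
   finally show "ennreal (norm (LBINT x. f x * (?c x)))
    \<le> (\<integral>\<^sup>+x. \<integral>\<^sup>+y. (?h x y + ?l x y) \<partial>lborel \<partial>lborel)" .
  qed simp
  also have "(\<integral>\<^sup>+x. \<integral>\<^sup>+y. (?h x y + ?l x y) \<partial>lborel \<partial>lborel)
   = (\<integral>\<^sup>+x. \<integral>\<^sup>+y. ?h x y \<partial>lborel \<partial>lborel) + (\<integral>\<^sup>+x. \<integral>\<^sup>+y. ?l x y \<partial>lborel \<partial>lborel)"
   by (simp add: nn_integral_add)
  also have "(\<integral>\<^sup>+x. \<integral>\<^sup>+y. ?l x y \<partial>lborel \<partial>lborel) = (\<integral>\<^sup>+y. \<integral>\<^sup>+x. ?l x y \<partial>lborel \<partial>lborel)"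
   by (rule lborel_pair.Fubini') measurable
  also have "(\<integral>\<^sup>+y. \<integral>\<^sup>+x. ?l x y \<partial>lborel \<partial>lborel) = (\<integral>\<^sup>+x. \<integral>\<^sup>+y. ?h x y \<partial>lborel \<partial>lborel)"
  proof (intro nn_integral_cong)
   fix x y
   have "G (y - x) = G (x - y)" using Gs[of "x - y"] by simp
   then show "ennreal ((norm (f x))^2 / 2 * G (y - x)) = ?h x y" by (simp only:)
  qed
  also have "(\<integral>\<^sup>+x. \<integral>\<^sup>+y. ?h x y \<partial>lborel \<partial>lborel) = (NBINT x. ennreal ((norm (f x))^2 / 2)) * (NBINT z. ennreal (G z))"
  proof -
   have "(NBINT y. ?h x y) = ennreal ((norm (f x))^2 / 2) * (NBINT z. ennreal (G z))" for x
   proof -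
    have "(NBINT y. ?h x y) = (NBINT y. ennreal ((norm (f x))^2 / 2) * ennreal (G (y + (- x))))"
    proof (rule nn_integral_cong)
     fix y
     have "G (x - y) = G (y + (- x))" using Gs[of "y - x"] by simp
     then show "?h x y = ennreal ((norm (f x))^2 / 2) * ennreal (G (y + (- x)))"
      by (simp only:) (rule ennreal_mult, simp_all add: G0)
    qed
    also have "... = ennreal ((norm (f x))^2 / 2) * (NBINT y. ennreal (G (y + (- x))))"
     by (rule nn_integral_cmult) measurable
    also have "(NBINT y. ennreal (G (y + (- x)))) = (NBINT z. ennreal (G z))"
     by (rule nn_integral_shift) measurable
    finally show ?thesis .
   qed
   then show ?thesis by (simp add: nn_integral_multc)
  qed
  also have "ennreal (ft_const TYPE('a)) * ((NBINT x. ennreal ((norm (f x))^2 / 2)) * (NBINT z. ennreal (G z)) +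
    (NBINT x. ennreal ((norm (f x))^2 / 2)) * (NBINT z. ennreal (G z)))
   = (ennreal (ft_const TYPE('a)) * (NBINT z. ennreal (G z))) * (2 * (NBINT x. ennreal ((norm (f x))^2 / 2)))"
   by (simp only: mult_2 distrib_left mult_ac)
  also have "2 * (NBINT x. ennreal ((norm (f x))^2 / 2)) = (NBINT x. 2 * ennreal ((norm (f x))^2 / 2))"
   by (rule nn_integral_cmult[symmetric]) measurable
  also have "... = ?N"
  proof (rule nn_integral_cong)
   fix x
   have "2 * ennreal ((norm (f x))^2 / 2) = ennreal 2 * ennreal ((norm (f x))^2 / 2)" by simp
   also have "... = ennreal ((norm (f x))^2)" by (subst ennreal_mult[symmetric]) auto
   finally show "2 * ennreal ((norm (f x))^2 / 2) = ennreal ((norm (f x))^2)" .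
  qed
  finally have "ennreal (LBINT \<xi>. ?d b \<xi>) \<le> ?N" by (simp add: mass)
  then show ?thesis using intd by (subst nn_integral_eq_integral) auto
 qed
 have "(NBINT \<xi>. ennreal ((norm (ft s f \<xi>))^2)) = (NBINT \<xi>. liminf (%k. ennreal (?d (inverse (real (Suc k))) \<xi>)))"
 proof (rule nn_integral_cong)
  fix \<xi>
  have "(%k. ?d (inverse (real (Suc k))) \<xi>) \<longlonglongrightarrow> (norm (ft s f \<xi>))\<^sup>2 * exp (- 0 * (norm \<xi>)^2)"
   by (intro tendsto_intros LIMSEQ_inverse_real_of_nat)
  then have "(%k. ennreal (?d (inverse (real (Suc k))) \<xi>)) \<longlonglongrightarrow> ennreal ((norm (ft s f \<xi>))^2)"
   by (intro tendsto_ennrealI) simp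
  from lim_imp_Liminf[OF sequentially_bot this]
  show "ennreal ((norm (ft s f \<xi>))^2) = liminf (%k. ennreal (?d (inverse (real (Suc k))) \<xi>))" by simp
 qed
 also have "... \<le> liminf (%k. \<integral>\<^sup>+\<xi>. ennreal (?d (inverse (real (Suc k))) \<xi>) \<partial>lborel)"
  by (rule nn_integral_liminf) measurable
 also have "... \<le> ?N"
  by (rule Liminf_le[OF sequentially_bot], rule always_eventually, rule allI, rule damp) simp
 finally have le: "(NBINT \<xi>. ennreal ((norm (ft s f \<xi>))^2)) \<le> ?N" .
 then show *: "ft s f \<in> L2_space"
  using f2 unfolding L2_space_iff_nn by (auto intro: le_less_trans)
 show "norm (cls (ft s f)) \<le> norm (cls f)"
  using le by (intro norm_L2_le_cls[OF *]) (auto simp: nn_norm_cls[OF f2])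
qed

lemma borel_measurable_cnj[measurable]:
 "f \<in> borel_measurable M ==> (%x. cnj (f x)) \<in> borel_measurable M"
 by (rule measurable_compose[OF _ borel_measurable_continuous_onI[OF continuous_on_cnj[OF continuous_on_id]]])

lemma ft_scaleR: "ft s (%x. c *\<^sub>R f x) \<xi> = c *\<^sub>R ft s f \<xi>"
 using ft_cmult[of s "of_real c" f \<xi>] by (simp add: scaleR_conv_of_real)

text \<open>After the substitution y = x + 2 sqrt b v the weight is fixed and b only moves the
  argument of f, so b -> 0 becomes a case of dominated convergence.\<close>

lemma gauss_scaled:
 fixes x :: "'a::euclidean_space"
 assumes b: "b > 0" and [measurable]: "f \<in> borel_measurable borel" and s: "s\<^sup>2 = 1"
 shows "of_real (ft_const TYPE('a)) * (LBINT y. f y * ft s (cgauss (of_real b)) (x - y))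
  = of_real (pi powr (- real DIM('a) / 2)) * (LBINT v. f (x + (2 * sqrt b) *\<^sub>R v) * of_real (exp (- (norm v)\<^sup>2)))"
proof -
 define K where "K = ft_const TYPE('a) * (pi / b) powr (DIM('a) / 2)"
 define H where "H z = complex_of_real (K * exp (- (norm z)\<^sup>2 / (4 * b)))" for z :: 'a
 define c where "c = 2 * sqrt b"
 have c: "c > 0" "c\<^sup>2 = 4 * b" using b by (auto simp: c_def power_mult_distrib)
 have [measurable]: "H \<in> borel_measurable borel" unfolding H_def by measurable
 have ftH: "ft s (cgauss (of_real b)) z = H z" for z :: 'a
  using ft_gauss[OF b, of s z] s by (simp add: H_def K_def)
 have HH: "H (- z) = H z" for z by (simp add: H_def)
 have "(LBINT y. f y * H (x - y)) = (LBINT y. f (y + x) * H (x - (y + x)))"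
  by (rule lborel_integral_shift[symmetric]) measurable
 also have "... = (LBINT y. f (x + y) * H y)"
  by (rule Bochner_Integration.integral_cong[OF refl]) (simp add: HH add.commute)
 also have "... = c ^ DIM('a) *\<^sub>R (LBINT v. f (x + c *\<^sub>R v) * H (c *\<^sub>R v))"
  by (rule lborel_integral_scale[OF _ c(1)]) measurable
 also have "(LBINT v. f (x + c *\<^sub>R v) * H (c *\<^sub>R v)) = (LBINT v. of_real K * (f (x + c *\<^sub>R v) * of_real (exp (- (norm v)\<^sup>2))))"
 proof (rule Bochner_Integration.integral_cong[OF refl])
  fix v :: 'a
  have "- (norm (c *\<^sub>R v))\<^sup>2 / (4 * b) = - (norm v)\<^sup>2" using b by (simp add: power_mult_distrib c(2))
  then show "f (x + c *\<^sub>R v) * H (c *\<^sub>R v) = of_real K * (f (x + c *\<^sub>R v) * of_real (exp (- (norm v)\<^sup>2)))"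
   by (simp only: H_def of_real_mult mult_ac)
 qed
 also have "... = of_real K * (LBINT v. f (x + c *\<^sub>R v) * of_real (exp (- (norm v)\<^sup>2)))"
  by (rule integral_mult_right_zero)
 finally have "of_real (ft_const TYPE('a)) * (LBINT y. f y * H (x - y))
  = of_real (ft_const TYPE('a) * (c ^ DIM('a) * K)) * (LBINT v. f (x + c *\<^sub>R v) * of_real (exp (- (norm v)\<^sup>2)))"
  by (simp add: scaleR_conv_of_real)
 moreover have "ft_const TYPE('a) * (c ^ DIM('a) * K) = pi powr (- real DIM('a) / 2)"
 proof -
  have c2: "c ^ DIM('a) = (4 * b) powr (DIM('a) / 2)"
  proof -
   have "(4 * b) powr (DIM('a) / 2) = (c powr 2) powr (DIM('a) / 2)" using c by (simp add: powr_numeral)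
   also have "... = c powr real DIM('a)" by (simp only: powr_powr) simp
   also have "... = c ^ DIM('a)" by (rule powr_realpow[OF c(1)])
   finally show ?thesis ..
  qed
  have "(pi / (1 / (4 * b))) powr (DIM('a) / 2) = c ^ DIM('a) * pi powr (DIM('a) / 2)"
   unfolding c2 powr_mult[symmetric] by (simp add: mult.commute)
  then have "ft_const TYPE('a) * (c ^ DIM('a) * K) * pi powr (DIM('a) / 2) = 1"
   using gauss_mass[OF b, where 'a='a] by (simp add: K_def mult_ac)
  then show ?thesis by (simp add: powr_minus_divide field_simps)
 qed
 ultimately show ?thesis by (simp only: ftH c_def)
qed

lemma gauss_one: "of_real (pi powr (- real DIM('a) / 2)) * (\<integral>v. z * complex_of_real (exp (- (norm v)\<^sup>2)) \<partial>(lborel::'a::euclidean_space measure)) = z"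
proof -
 have "(\<integral>v. z * complex_of_real (exp (- (norm v)\<^sup>2)) \<partial>(lborel::'a measure)) = z * of_real (\<integral>v. exp (- (norm v)\<^sup>2) \<partial>(lborel::'a measure))"
  by (simp only: integral_mult_right_zero integral_complex_of_real)
 also have "(\<integral>v. exp (- (norm v)\<^sup>2) \<partial>(lborel::'a measure)) = pi powr (DIM('a) / 2)"
  using gauss_real(2)[of 1, where 'a='a] by simp
 finally have "(\<integral>v. z * complex_of_real (exp (- (norm v)\<^sup>2)) \<partial>(lborel::'a measure)) = z * of_real (pi powr (DIM('a) / 2))" .
 then show ?thesis by (simp only:) (simp add: powr_minus_divide)
qed

lemma gauss_tendsto:
 fixes x :: "'a::euclidean_space"
 assumes c: "continuous_on UNIV f" and B: "\<And>x. norm (f x) \<le> B" and s: "s\<^sup>2 = 1"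
 shows "(%k. of_real (ft_const TYPE('a)) * (LBINT y. f y * ft s (cgauss (of_real (inverse (real (Suc k))))) (x - y))) \<longlonglongrightarrow> f x"
  and "norm (of_real (ft_const TYPE('a)) * (LBINT y. f y * ft s (cgauss (of_real (inverse (real (Suc k))))) (x - y))) \<le> B"
proof -
 have [measurable]: "f \<in> borel_measurable borel" using c by (rule borel_measurable_continuous_onI)
 let ?p = "complex_of_real (pi powr (- real DIM('a) / 2))"
 let ?h = "%k. 2 * sqrt (inverse (real (Suc k)))" and ?I = "%k. LBINT y. f y * ft s (cgauss (of_real (inverse (real (Suc k))))) (x - y)"
 have eq: "of_real (ft_const TYPE('a)) * (?I k)
   = ?p * (LBINT v. f (x + (?h k) *\<^sub>R v) * of_real (exp (- (norm v)\<^sup>2)))" for k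
  by (rule gauss_scaled[OF _ _ s]) auto
 have gi: "integrable lborel (%v::'a. B * exp (- (norm v)\<^sup>2))" using gauss_real(1)[of 1, where 'a='a] by simp
 have lim: "(%k. \<integral>v. f (x + (?h k) *\<^sub>R v) * of_real (exp (- (norm v)\<^sup>2)) \<partial>lborel)
  \<longlonglongrightarrow> (\<integral>v. f x * of_real (exp (- (norm v)\<^sup>2)) \<partial>(lborel::'a measure))"
 proof (rule integral_dominated_convergence[OF _ _ gi])
  show "AE v in lborel. (%k. f (x + (?h k) *\<^sub>R v) * of_real (exp (- (norm v)\<^sup>2))) \<longlonglongrightarrow> f x * of_real (exp (- (norm v)\<^sup>2))"
  proof (rule AE_I2)
   fix v :: 'a
   have "(%k. x + (?h k) *\<^sub>R v) \<longlonglongrightarrow> x + (2 * sqrt 0) *\<^sub>R v"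
    by (intro tendsto_intros LIMSEQ_inverse_real_of_nat)
   then have "(%k. x + (?h k) *\<^sub>R v) \<longlonglongrightarrow> x" by simp
   moreover have "isCont f x" using c by (simp add: continuous_on_eq_continuous_at)
   ultimately have "(%k. f (x + (?h k) *\<^sub>R v)) \<longlonglongrightarrow> f x"
    by (rule isCont_tendsto_compose[rotated])
   then show "(%k. f (x + (?h k) *\<^sub>R v) * of_real (exp (- (norm v)\<^sup>2))) \<longlonglongrightarrow> f x * of_real (exp (- (norm v)\<^sup>2))"
    by (rule tendsto_mult_right)
  qed
  show "AE v in lborel. norm (f (x + (?h k) *\<^sub>R v) * of_real (exp (- (norm v)\<^sup>2))) \<le> B * exp (- (norm v)\<^sup>2)" for k
   by (rule AE_I2) (simp add: norm_mult B mult_right_mono)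
 qed measurable
 from tendsto_mult_left[OF lim, of ?p]
 show "(%k. of_real (ft_const TYPE('a)) * (?I k)) \<longlonglongrightarrow> f x"
  by (simp only: eq gauss_one)
 have "norm (LBINT v. f (x + (?h k) *\<^sub>R v) * of_real (exp (- (norm v)\<^sup>2)))
   \<le> (\<integral>v. B * exp (- (norm v)\<^sup>2) \<partial>(lborel::'a measure))"
  by (rule order_trans[OF integral_norm_bound Bochner_Integration.integral_mono'[OF gi]])
    (auto simp: norm_mult B mult_right_mono order_trans[OF norm_ge_zero B])
 also have "... = B * pi powr (DIM('a) / 2)"
  using gauss_real(2)[of 1, where 'a='a] by simp
 finally have "norm (?p * (LBINT v. f (x + (?h k) *\<^sub>R v) * of_real (exp (- (norm v)\<^sup>2))))
   \<le> pi powr (- real DIM('a) / 2) * (B * pi powr (DIM('a) / 2))"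
  unfolding norm_mult norm_of_real by (simp add: mult_left_mono)
 also have "... = B" by (simp add: powr_minus_divide)
 finally show "norm (of_real (ft_const TYPE('a)) * (?I k)) \<le> B"
  by (simp only: eq)
qed

text \<open>Both sides of \<open>ft_triple\<close> converge as the damping is removed: the frequency
  side with majorant |ft s f|^2, integrable by \<open>ft_contraction\<close>, and the space side
  because Gaussian means of a bounded continuous function converge at every point.\<close>

lemma ft_isometry_Cc:
 fixes f :: "'a::euclidean_space => complex"
 assumes f: "Cc f" and s: "s\<^sup>2 = 1"
 shows "norm (cls (ft s f)) = norm (cls f)"
proof -
 obtain B where B: "\<And>x. norm (f x) \<le> B" using Cc_bounded[OF f] by metis
 have f1: "f \<in> L1_space" and f2: "f \<in> L2_space" using Cc_spaces[OF f] by auto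
 have F2: "ft s f \<in> L2_space" by (rule ft_contraction(1)[OF s f1 f2])
 have cf: "continuous_on UNIV (%x. cnj (f x))" using f by (auto simp: Cc_def intro: continuous_intros)
 note [measurable] = L2_space_measurable[OF f2]
 define w :: "nat => 'a => complex" where "w k = cgauss (of_real (inverse (real (Suc k))))" for k
 let ?w = "%k \<xi>. ft (- s) (%x. cnj (f x)) \<xi> * w k \<xi>"
 have wL: "w k \<in> L1_space" for k unfolding w_def by (rule cgauss_L1) simp
 have [measurable]: "w k \<in> borel_measurable borel" for k unfolding w_def by measurable
 have "(%k. \<integral>\<xi>. ft s f \<xi> * (?w k \<xi>) \<partial>lborel) \<longlonglongrightarrow> (LBINT \<xi>. of_real ((norm (ft s f \<xi>))^2))"
 proof (rule integral_dominated_convergence[OF _ _ L2_space_integrable[OF F2]])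
  show "AE \<xi> in lborel. (%k. ft s f \<xi> * (?w k \<xi>)) \<longlonglongrightarrow> of_real ((norm (ft s f \<xi>))^2)"
  proof (rule AE_I2)
   fix \<xi> :: 'a
   have "(%k. w k \<xi>) \<longlonglongrightarrow> exp (- of_real 0 * of_real ((norm \<xi>)^2))"
    unfolding w_def cgauss_def by (intro tendsto_intros LIMSEQ_inverse_real_of_nat)
   then have "(%k. ft s f \<xi> * (?w k \<xi>)) \<longlonglongrightarrow> ft s f \<xi> * (cnj (ft s f \<xi>) * 1)"
    by (intro tendsto_intros) (simp_all add: ft_cnj)
   then show "(%k. ft s f \<xi> * (?w k \<xi>)) \<longlonglongrightarrow> of_real ((norm (ft s f \<xi>))^2)"
    by (simp only: complex_norm_square mult_1_right)
  qed
  show "AE \<xi> in lborel. norm (ft s f \<xi> * (?w k \<xi>)) \<le> (norm (ft s f \<xi>))^2" for k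
  proof (rule AE_I2)
   fix \<xi> :: 'a
   have "norm (w k \<xi>) \<le> 1" by (simp add: w_def norm_cgauss)
   then have "(norm (ft s f \<xi>))^2 * norm (w k \<xi>) \<le> (norm (ft s f \<xi>))^2 * 1" by (intro mult_left_mono) auto
   then show "norm (ft s f \<xi> * (?w k \<xi>)) \<le> (norm (ft s f \<xi>))^2"
    by (simp add: norm_mult ft_cnj power2_eq_square mult.assoc)
  qed
 qed measurable
 moreover have "(%k. \<integral>\<xi>. ft s f \<xi> * (?w k \<xi>) \<partial>lborel) \<longlonglongrightarrow> (LBINT x. of_real ((norm (f x))^2))"
 proof -
  define J where "J k x = of_real (ft_const TYPE('a)) * (LBINT y. cnj (f y) * ft s (w k) (x - y))" for k x
  have [measurable]: "J k \<in> borel_measurable borel" for k unfolding J_def by measurable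
  have eq: "(LBINT \<xi>. ft s f \<xi> * (?w k \<xi>)) = (LBINT x. f x * J k x)" for k
   unfolding ft_triple[OF f1 L1_space_cnj[OF f1] wL] J_def by (simp add: mult.left_commute[of "f _"])
  have Jl: "(%k. J k x) \<longlonglongrightarrow> cnj (f x)" for x
   unfolding J_def w_def by (rule gauss_tendsto(1)[OF cf _ s, of B]) (simp add: B)
  have Jb: "norm (J k x) \<le> B" for k x
   unfolding J_def w_def by (rule gauss_tendsto(2)[OF cf _ s, of B]) (simp add: B)
  have fi: "integrable lborel (%x. B * norm (f x))" using f1 by (simp add: L1_space_def)
  have "(%k. \<integral>x. f x * J k x \<partial>lborel) \<longlonglongrightarrow> (LBINT x. f x * cnj (f x))"
  proof (rule integral_dominated_convergence[OF _ _ fi])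
   show "AE x in lborel. (%k. f x * J k x) \<longlonglongrightarrow> f x * cnj (f x)" by (intro AE_I2 tendsto_mult_left Jl)
   show "AE x in lborel. norm (f x * J k x) \<le> B * norm (f x)" for k
    unfolding norm_mult mult.commute[of B] by (intro AE_I2 mult_left_mono Jb) auto
  qed measurable
  then show ?thesis by (simp only: eq complex_norm_square)
 qed
 ultimately have "(LBINT \<xi>. complex_of_real ((norm (ft s f \<xi>))^2)) = (LBINT x. complex_of_real ((norm (f x))^2))"
  by (rule LIMSEQ_unique)
 then have "(norm (cls (ft s f)))^2 = (norm (cls f))^2"
  unfolding norm_cls_sq[OF F2] norm_cls_sq[OF f2] by (simp only: integral_complex_of_real of_real_eq_iff)
 then show ?thesis by (simp add: power2_eq_iff_nonneg)
qed

section \<open>The Fourier transform on L2 classes\<close>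

definition FT :: "real => 'a::euclidean_space L2 => 'a L2" where
 "FT s f = lim (%k. cls (ft s (%x. indicator (cball 0 (real k)) x * fn f x)))"

abbreviation cut :: "real => 'a::euclidean_space L2 => 'a => complex" where
 "cut R f \<equiv> %x. indicator (cball 0 R) x * fn f x"

lemma cut_spaces: "cut R f \<in> L1_space" "cut R f \<in> L2_space"
 by (rule L2_indicator_L1; simp)+

lemma cls_cut: "cls (cut R f) = mlt (indicator (cball 0 R)) f"
 by (simp add: mlt_def)

lemma cut_tendsto: "(%k. cls (cut (real k) f)) \<longlonglongrightarrow> f"
 unfolding cls_cut by (rule trunc_tendsto) (rule filterlim_real_sequentially)

lemma ft_cls_diff_le:
 assumes s: "s\<^sup>2 = 1" and f: "f \<in> L1_space" "f \<in> L2_space" and g: "g \<in> L1_space" "g \<in> L2_space"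
 shows "norm (cls (ft s f) - cls (ft s g)) \<le> norm (cls f - cls g)"
proof -
 have "ft s (%x. f x - g x) = (%\<xi>. ft s f \<xi> - ft s g \<xi>)" using f g by (simp add: fun_eq_iff ft_diff)
 then show ?thesis
  using ft_contraction(2)[OF s L1_space_diff[OF f(1) g(1)] L2_space_diff[OF f(2) g(2)]] f g
  by (simp add: cls_diff ft_contraction(1)[OF s])
qed

lemma FT_LIMSEQ:
 assumes s: "s\<^sup>2 = 1" shows "(%k. cls (ft s (cut (real k) f))) \<longlonglongrightarrow> FT s f"
proof -
 have C: "Cauchy (%k. cls (cut (real k) f))" using cut_tendsto by (rule LIMSEQ_imp_Cauchy)
 have "Cauchy (%k. cls (ft s (cut (real k) f)))"
 proof (rule CauchyI)
  fix e :: real assume "0 < e"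
  from CauchyD[OF C this] obtain M where "\<forall>m\<ge>M. \<forall>n\<ge>M. norm (cls (cut (real m) f) - cls (cut (real n) f)) < e" by blast
  then show "\<exists>M. \<forall>m\<ge>M. \<forall>n\<ge>M. norm (cls (ft s (cut (real m) f)) - cls (ft s (cut (real n) f))) < e"
   using ft_cls_diff_le[OF s cut_spaces cut_spaces] by (blast intro: le_less_trans)
 qed
 then show ?thesis unfolding FT_def by (simp add: Cauchy_convergent_iff convergent_LIMSEQ_iff)
qed

text \<open>Compares an explicit integral transform with the abstract limit. Hence \<open>FT\<close>
  can be computed along any approximation by functions in L1 and L2, and linearity needs no
  commutation with the cutoffs of the definition.\<close>

lemma FT_near:
 assumes s: "s\<^sup>2 = 1" and g: "g \<in> L1_space" "g \<in> L2_space"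
 shows "norm (cls (ft s g) - FT s f) \<le> norm (cls g - f)"
 by (rule LIMSEQ_le[OF tendsto_norm[OF tendsto_diff[OF tendsto_const FT_LIMSEQ[OF s]]] tendsto_norm[OF tendsto_diff[OF tendsto_const cut_tendsto]]])
   (auto intro: ft_cls_diff_le[OF s g cut_spaces])

lemma FT_cls:
 assumes s: "s\<^sup>2 = 1" and g: "g \<in> L1_space" "g \<in> L2_space" shows "FT s (cls g) = cls (ft s g)"
 using FT_near[OF assms, of "cls g"] by simp

lemma FT_tendsto_cut:
 assumes s: "s\<^sup>2 = 1" and g: "\<And>k. g k \<in> L1_space" "\<And>k. g k \<in> L2_space" and lim: "(%k::nat. cls (g k)) \<longlonglongrightarrow> f"
 shows "(%k. cls (ft s (g k))) \<longlonglongrightarrow> FT s f"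
proof (rule LIM_zero_cancel, rule tendsto_norm_zero_cancel, rule Lim_null_comparison)
 show "\<forall>\<^sub>F k in sequentially. norm (norm (cls (ft s (g k)) - FT s f)) \<le> norm (cls (g k) - f)"
  using FT_near[OF s g] by auto
 show "(%k. norm (cls (g k) - f)) \<longlonglongrightarrow> 0" using lim by (simp add: LIM_zero tendsto_norm_zero)
qed

lemma bounded_linear_FT:
 assumes s: "s\<^sup>2 = 1" shows "bounded_linear (FT s :: 'a::euclidean_space L2 => 'a L2)"
proof (rule bounded_linear_intro)
 show "FT s (f + g) = FT s f + FT s g" for f g
 proof (rule LIMSEQ_unique)
  let ?h = "%k x. cut (real k) f x + cut (real k) g x"
  show "(%k. cls (ft s (?h k))) \<longlonglongrightarrow> FT s (f + g)"
  proof (rule FT_tendsto_cut[OF s])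
   show "(%k. cls (?h k)) \<longlonglongrightarrow> f + g"
    unfolding cls_add[OF cut_spaces(2) cut_spaces(2)] by (intro tendsto_add cut_tendsto)
  qed (intro L1_space_add L2_space_add cut_spaces)+
  have "ft s (?h k) = (%\<xi>. ft s (cut (real k) f) \<xi> + ft s (cut (real k) g) \<xi>)" for k
   by (simp add: fun_eq_iff ft_add[OF cut_spaces(1) cut_spaces(1)])
  then have "cls (ft s (?h k)) = cls (ft s (cut (real k) f)) + cls (ft s (cut (real k) g))" for k
   by (simp only: cls_add[OF ft_contraction(1)[OF s cut_spaces] ft_contraction(1)[OF s cut_spaces]])
  then show "(%k. cls (ft s (?h k))) \<longlonglongrightarrow> FT s f + FT s g"
   by (simp only:) (intro tendsto_add FT_LIMSEQ s)
 qed
 show "FT s (c *\<^sub>R f) = c *\<^sub>R FT s f" for c f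
 proof (rule LIMSEQ_unique)
  let ?h = "%k x. c *\<^sub>R cut (real k) f x"
  show "(%k. cls (ft s (?h k))) \<longlonglongrightarrow> FT s (c *\<^sub>R f)"
  proof (rule FT_tendsto_cut[OF s])
   show "(%k. cls (?h k)) \<longlonglongrightarrow> c *\<^sub>R f"
    unfolding cls_scaleR[OF cut_spaces(2)] by (intro tendsto_scaleR tendsto_const cut_tendsto)
  next
   show "?h k \<in> L1_space" for k using cut_spaces(1)[of "real k" f] unfolding L1_space_def by simp
  qed (intro L2_space_scaleR cut_spaces)
  have "ft s (?h k) = (%\<xi>. c *\<^sub>R ft s (cut (real k) f) \<xi>)" for k
   by (rule ext) (rule ft_scaleR)
  then have "cls (ft s (?h k)) = c *\<^sub>R cls (ft s (cut (real k) f))" for k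
   by (simp only: cls_scaleR[OF ft_contraction(1)[OF s cut_spaces]])
  then show "(%k. cls (ft s (?h k))) \<longlonglongrightarrow> c *\<^sub>R FT s f"
   by (simp only:) (intro tendsto_scaleR tendsto_const FT_LIMSEQ s)
 qed
 show "norm (FT s f) \<le> norm f * 1" for f :: "'a L2"
 proof -
  have "ft s (%_::'a. 0) = (%_. 0 :: complex)" by (simp add: fun_eq_iff ft_def)
  moreover have "norm (cls (ft s (%_::'a. 0)) - FT s f) \<le> norm (cls (%_. 0) - f)"
   by (rule FT_near[OF s _ L2_space_zero]) (simp add: L1_space_def)
  ultimately show ?thesis by (simp add: zero_L2_def[symmetric])
 qed
qed

lemma norm_FT:
 assumes s: "s\<^sup>2 = 1" shows "norm (FT s f) = norm f"
proof -
 have "closed {f. norm (FT s f) = norm f}"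
  by (intro closed_Collect_eq continuous_on_norm continuous_on_id linear_continuous_on[OF bounded_linear_FT[OF s]])
 then have "f \<in> {f. norm (FT s f) = norm f}"
  by (rule Cc_dense) (simp add: FT_cls[OF s] Cc_spaces ft_isometry_Cc[OF _ s])
 then show ?thesis by simp
qed

lemma inner_FT_FT:
 assumes s: "s\<^sup>2 = 1" shows "inner (FT s f) (FT s g) = inner f g"
 using linear_add[OF bounded_linear.linear[OF bounded_linear_FT[OF s]]]
 by (simp add: dot_norm norm_FT[OF s] flip: linear_add[OF bounded_linear.linear[OF bounded_linear_FT[OF s]]])

lemma FT_adjoint:
 assumes s: "s\<^sup>2 = 1" shows "inner (FT s f) g = inner f (FT (- s) g)"
proof -
 have s': "(- s)^2 = 1" using s by simp
 have "(%k. inner (cls (ft s (cut (real k) f))) (cls (cut (real k) g))) \<longlonglongrightarrow> inner (FT s f) g"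
  by (intro tendsto_inner FT_LIMSEQ s cut_tendsto)
 moreover have "(%k. inner (cls (cut (real k) f)) (cls (ft (- s) (cut (real k) g)))) \<longlonglongrightarrow> inner f (FT (- s) g)"
  by (intro tendsto_inner FT_LIMSEQ s' cut_tendsto)
 moreover have "inner (cls (ft s a)) (cls b) = inner (cls a) (cls (ft (- s) b))"
  if a: "a \<in> L1_space" "a \<in> L2_space" and b: "b \<in> L1_space" "b \<in> L2_space" for a b :: "'a => complex"
 proof -
  have re: "x \<bullet> y = Re (x * cnj y)" for x y :: complex by (simp add: inner_complex_def)
  have L2cnj: "(%x. cnj (h x)) \<in> L2_space" if "h \<in> L2_space" for h :: "'a => complex"
   using that borel_measurable_cnj[of h borel] by (auto simp: L2_space_def)
  have "inner (cls (ft s a)) (cls b) = (LBINT x. Re (ft s a x * cnj (b x)))"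
   unfolding re[symmetric] by (rule inner_cls[OF ft_contraction(1)[OF s a] b(2)])
  also have "... = Re (LBINT x. ft s a x * cnj (b x))"
   by (rule integral_Re[OF integrable_L2_prod[OF ft_contraction(1)[OF s a] L2cnj[OF b(2)]]])
  also have "... = Re (LBINT x. a x * cnj (ft (- s) b x))"
   unfolding ft_multiplication[OF a(1) L1_space_cnj[OF b(1)]] ft_cnj ..
  also have "... = (LBINT x. Re (a x * cnj (ft (- s) b x)))"
   by (rule integral_Re[symmetric, OF integrable_L2_prod[OF a(2) L2cnj[OF ft_contraction(1)[OF s' b]]]])
  also have "... = inner (cls a) (cls (ft (- s) b))"
   unfolding re[symmetric] by (rule inner_cls[symmetric, OF a(2) ft_contraction(1)[OF s' b]])
  finally show ?thesis .
 qed
 ultimately show ?thesis by (simp only: cut_spaces) (rule LIMSEQ_unique)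
qed

text \<open>Inversion comes from unitarity: the adjoint of \<open>FT s\<close> is
  \<open>FT (- s)\<close> and inner products are preserved, so the composition has the same inner
  products as the identity. No pointwise inversion formula is involved.\<close>

lemma FT_inverse:
 assumes s: "s\<^sup>2 = 1" shows "FT (- s) (FT s f) = f"
proof -
 have "inner g (FT (- s) (FT s f)) = inner g f" for g
  unfolding FT_adjoint[OF s, symmetric] by (rule inner_FT_FT[OF s])
 then have "inner g (FT (- s) (FT s f) - f) = 0" for g by (simp add: inner_diff_right)
 from this[of "FT (- s) (FT s f) - f"] show ?thesis by simp
qed

lemma FT_inv1[simp]: "FT 1 (FT (-1) f) = f" "FT (-1) (FT 1 f) = f"
 using FT_inverse[of "-1" f] FT_inverse[of 1 f] by simp_all

text \<open>Limits in L2 are unique, so whatever function the choice operator picks in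
  \<open>L2_fourier\<close> and \<open>L2_inverse_fourier\<close> has the class given by
  \<open>FT\<close>. This connects the transforms of the statement with the operators of the
  proof.\<close>

lemma is_L2_extension_ft:
 assumes s: "s\<^sup>2 = 1" and f: "f \<in> L2_space"
 shows "is_L2_extension (ft s) f g \<longleftrightarrow> g \<in> L2_space \<and> cls g = FT s (cls f)"
proof -
 have cutf: "(%x. indicator (cball 0 R) x * f x) \<in> L1_space" "(%x. indicator (cball 0 R) x * f x) \<in> L2_space" for R
  by (rule L2_indicator_L1[OF f])+
 let ?T = "%R. ft s (%x. indicator (cball 0 R) x * f x)"
 have T2: "?T R \<in> L2_space" for R by (rule ft_contraction(1)[OF s cutf])
 have c: "cls (%x. indicator (cball 0 R) x * f x) = mlt (indicator (cball 0 R)) (cls f)" for R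
  using f by (simp add: mlt_cls)
 have lim: "((%R. cls (?T R)) \<longlongrightarrow> FT s (cls f)) at_top"
 proof (rule tendsto_at_topI_sequentially)
  fix X :: "nat => real" assume X: "filterlim X at_top sequentially"
  show "(%n. cls (?T (X n))) \<longlonglongrightarrow> FT s (cls f)"
   by (rule FT_tendsto_cut[OF s cutf]) (simp only: c trunc_tendsto[OF X])
 qed
 show ?thesis
 proof
  assume E: "is_L2_extension (ft s) f g"
  then have g: "g \<in> L2_space" and l: "((%R. L2_norm (%\<xi>. ?T R \<xi> - g \<xi>)) \<longlongrightarrow> 0) at_top"
   by (auto simp: is_L2_extension_def)
  have "L2_norm (%\<xi>. ?T R \<xi> - g \<xi>) = norm (cls (?T R) - cls g)" for R
   using norm_cls[OF L2_space_diff[OF T2 g]] by (simp add: cls_diff[OF T2 g])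
  with l have "((%R. cls (?T R)) \<longlongrightarrow> cls g) at_top" by (simp add: tendsto_norm_zero_iff LIM_zero_iff)
  with lim g show "g \<in> L2_space \<and> cls g = FT s (cls f)"
   using tendsto_unique[OF trivial_limit_at_top_linorder] by blast
 next
  assume g: "g \<in> L2_space \<and> cls g = FT s (cls f)"
  then have "L2_norm (%\<xi>. ?T R \<xi> - g \<xi>) = norm (cls (?T R) - FT s (cls f))" for R
   using norm_cls[OF L2_space_diff[OF T2, of g]] cls_diff[OF T2, of g] by simp
  moreover have "((%R. norm (cls (?T R) - FT s (cls f))) \<longlongrightarrow> 0) at_top"
   using lim by (simp add: LIM_zero tendsto_norm_zero)
  ultimately show "is_L2_extension (ft s) f g" using g T2 by (simp add: is_L2_extension_def L2_space_diff)
 qed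
qed

lemma L2_fourier:
 assumes f: "f \<in> L2_space" shows "L2_fourier f \<in> L2_space" "cls (L2_fourier f) = FT (-1) (cls f)"
proof -
 have "is_L2_extension (ft (-1)) f (fn (FT (-1) (cls f)))" by (subst is_L2_extension_ft[OF _ f]) auto
 then have "is_L2_extension (ft (-1)) f (L2_fourier f)" unfolding L2_fourier_def fourier_eq_ft[abs_def] by (rule someI[where P="is_L2_extension (ft (-1)) f"])
 then show "L2_fourier f \<in> L2_space" "cls (L2_fourier f) = FT (-1) (cls f)"
  using is_L2_extension_ft[of "-1", OF _ f] by auto
qed

lemma L2_inverse_fourier:
 assumes f: "f \<in> L2_space" shows "L2_inverse_fourier f \<in> L2_space" "cls (L2_inverse_fourier f) = FT 1 (cls f)"
proof -
 have "is_L2_extension (ft 1) f (fn (FT 1 (cls f)))" by (subst is_L2_extension_ft[OF _ f]) auto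
 then have "is_L2_extension (ft 1) f (L2_inverse_fourier f)" unfolding L2_inverse_fourier_def inverse_fourier_eq_ft[abs_def] by (rule someI[where P="is_L2_extension (ft 1) f"])
 then show "L2_inverse_fourier f \<in> L2_space" "cls (L2_inverse_fourier f) = FT 1 (cls f)"
  using is_L2_extension_ft[of 1, OF _ f] by auto
qed

section \<open>The free propagator and weighted norms\<close>

definition em :: "'a::euclidean_space => 'a => complex" where
 "em v x = exp (\<i> * of_real (x \<bullet> v))"

lemma norm_em[simp]: "norm (em v x) = 1" by (simp add: em_def)

lemma em_measurable[measurable]: "em v \<in> borel_measurable borel" unfolding em_def[abs_def] by measurable

lemma bmeas_em[simp]: "bmeas (em v)" by (rule bmeasI[where B=1]) auto

lemma cnj_em: "cnj (em v x) = em (- v) x"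
 by (simp add: em_def exp_cnj)

lemma ft_tr:
 assumes [measurable]: "f \<in> borel_measurable borel"
 shows "ft s (%x. f (x + h)) \<xi> = em (- s *\<^sub>R h) \<xi> * ft s f \<xi>"
proof -
 have "(LBINT x. exp (\<i> * of_real (s * (x \<bullet> \<xi>))) * f x) = (LBINT x. exp (\<i> * of_real (s * ((x + h) \<bullet> \<xi>))) * f (x + h))"
  by (rule lborel_integral_shift[symmetric]) measurable
 also have "... = (LBINT x. em (s *\<^sub>R h) \<xi> * (exp (\<i> * of_real (s * (x \<bullet> \<xi>))) * f (x + h)))"
 proof (rule Bochner_Integration.integral_cong[OF refl])
  fix x
  have "\<i> * of_real (s * ((x + h) \<bullet> \<xi>)) = \<i> * of_real (\<xi> \<bullet> (s *\<^sub>R h)) + \<i> * complex_of_real (s * (x \<bullet> \<xi>))"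
   by (simp add: inner_add_left algebra_simps inner_commute)
  then show "exp (\<i> * of_real (s * ((x + h) \<bullet> \<xi>))) * f (x + h) = em (s *\<^sub>R h) \<xi> * (exp (\<i> * of_real (s * (x \<bullet> \<xi>))) * f (x + h))"
   by (simp only: em_def exp_add mult.assoc)
 qed
 also have "... = em (s *\<^sub>R h) \<xi> * (LBINT x. exp (\<i> * of_real (s * (x \<bullet> \<xi>))) * f (x + h))"
  by (rule integral_mult_right_zero)
 finally have "ft s f \<xi> = em (s *\<^sub>R h) \<xi> * ft s (%x. f (x + h)) \<xi>" by (simp add: ft_def)
 moreover have "em (- s *\<^sub>R h) \<xi> * em (s *\<^sub>R h) \<xi> = 1" by (simp add: em_def exp_add[symmetric])
 ultimately show ?thesis by (simp add: mult.assoc[symmetric])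
qed

lemma ft_em:
 assumes s: "s\<^sup>2 = 1" shows "ft s (%x. em v x * f x) \<xi> = ft s f (\<xi> + s *\<^sub>R v)"
proof -
 have "exp (\<i> * of_real (s * (x \<bullet> \<xi>))) * (em v x * f x) = exp (\<i> * of_real (s * (x \<bullet> (\<xi> + s *\<^sub>R v)))) * f x" for x
 proof -
  have "s * (x \<bullet> (\<xi> + s *\<^sub>R v)) = s * (x \<bullet> \<xi>) + x \<bullet> v"
   using s by (simp add: inner_add_right ring_distribs mult.assoc[symmetric] power2_eq_square)
  then show ?thesis by (simp only: of_real_add ring_distribs exp_add em_def mult.assoc)
 qed
 then show ?thesis by (simp only: ft_def)
qed

lemma FT_closedI:
 assumes A: "bounded_linear A" and B: "bounded_linear B" and eq: "\<And>f. Cc f ==> A (cls f) = B (cls f)"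
 shows "A (g :: 'a::euclidean_space L2) = B g"
proof -
 have "closed {f. A f = B f}"
  by (intro closed_Collect_eq linear_continuous_on A B)
 then have "g \<in> {f. A f = B f}" by (rule Cc_dense) (simp add: eq)
 then show ?thesis by simp
qed

lemma FT_tr:
 assumes s: "s\<^sup>2 = 1" shows "FT s (tr h f) = mlt (em (- s *\<^sub>R h)) (FT s f)"
proof (rule FT_closedI[where A="%f. FT s (tr h f)" and B="%f. mlt (em (- s *\<^sub>R h)) (FT s f)"])
 fix f :: "'a => complex" assume f: "Cc f"
 note L = Cc_spaces[OF f]
 have "(%x. f (x + h)) \<in> L1_space" using L(1) by (simp add: L1_space_def lborel_integrable_shift)
 then show "FT s (tr h (cls f)) = mlt (em (- s *\<^sub>R h)) (FT s (cls f))"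
  using L by (simp add: tr_cls FT_cls[OF s] tr_in_L2 mlt_cls ft_contraction(1)[OF s] ft_tr[OF Cc_measurable[OF f], abs_def])
qed (intro bounded_linear_compose[OF bounded_linear_FT[OF s] bounded_linear_tr] bounded_linear_compose[OF bounded_linear_mlt bounded_linear_FT[OF s]] bmeas_em)+

lemma FT_em:
 assumes s: "s\<^sup>2 = 1" shows "FT s (mlt (em v) f) = tr (s *\<^sub>R v) (FT s f)"
proof (rule FT_closedI[where A="%f. FT s (mlt (em v) f)" and B="%f. tr (s *\<^sub>R v) (FT s f)"])
 fix f :: "'a => complex" assume f: "Cc f"
 note L = Cc_spaces[OF f]
 have "(%x. em v x * f x) \<in> L1_space" "(%x. em v x * f x) \<in> L2_space"
  by (rule L1_times_bounded[OF L(1), where B=1]; simp) (rule L2_space_mult[OF L(2), where B=1]; simp)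
 then show "FT s (mlt (em v) (cls f)) = tr (s *\<^sub>R v) (FT s (cls f))"
  using L by (simp add: mlt_cls FT_cls[OF s] tr_cls ft_contraction(1)[OF s] ft_em[OF s, abs_def])
qed (intro bounded_linear_compose[OF bounded_linear_tr bounded_linear_FT[OF s]] bounded_linear_compose[OF bounded_linear_FT[OF s] bounded_linear_mlt] bmeas_em)+

lemma bmeas_shift: "bmeas m ==> bmeas (%x. m (x + h))"
 by (auto simp: bmeas_def)

lemma tr_mlt:
 assumes m: "bmeas m" shows "tr h (mlt m f) = mlt (%x. m (x + h)) (tr h f)"
 by (rule L2_eqI; use fn_tr[of h "mlt m f"] AE_lborel_shift[OF fn_mlt[OF m, of f], of h]
   fn_mlt[OF bmeas_shift[OF m, of h], of "tr h f"] fn_tr[of h f] in eventually_elim) simp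

section \<open>The free propagator and its symmetries\<close>

definition Ep :: "real => 'a::euclidean_space => complex" where
 "Ep t \<xi> = exp (\<i> * of_real (- (t * (norm \<xi>)^2 / 2)))"

lemma norm_Ep[simp]: "norm (Ep t \<xi>) = 1" unfolding Ep_def by (rule norm_exp_i)

lemma Ep_measurable[measurable]: "Ep t \<in> borel_measurable borel" unfolding Ep_def[abs_def] by measurable

lemma bmeas_Ep[simp]: "bmeas (Ep t)" by (rule bmeasI[where B=1]) auto

lemma Ep_add: "Ep s \<xi> * Ep t \<xi> = Ep (s + t) \<xi>"
proof -
 have e: "\<i> * of_real (- (s * (norm \<xi>)^2 / 2)) + \<i> * of_real (- (t * (norm \<xi>)^2 / 2)) = \<i> * complex_of_real (- ((s + t) * (norm \<xi>)^2 / 2))"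
  by (simp add: algebra_simps add_divide_distrib)
 show ?thesis unfolding Ep_def exp_add[symmetric] e ..
qed

lemma Ep_0[simp]: "Ep 0 = (%_. 1)" by (simp add: Ep_def fun_eq_iff)

lemma cnj_Ep: "cnj (Ep t \<xi>) = Ep (- t) \<xi>" by (simp add: Ep_def exp_cnj)

lemma Ep_shift: "Ep t (\<xi> + v) = exp (\<i> * of_real (- (t * (norm v)^2 / 2))) * (em (- (t *\<^sub>R v)) \<xi> * Ep t \<xi>)"
proof -
 have "- (t * (norm (\<xi> + v))^2 / 2) = - (t * (norm v)^2 / 2) + (\<xi> \<bullet> (- (t *\<^sub>R v)) + - (t * (norm \<xi>)^2 / 2))"
  by (simp add: power2_norm_eq_inner algebra_simps inner_commute)
 then show ?thesis unfolding Ep_def em_def exp_add[symmetric] by (simp only: of_real_add ring_distribs)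
qed

definition U :: "real => 'a::euclidean_space L2 => 'a L2" where
 "U t f = FT 1 (mlt (Ep t) (FT (-1) f))"

lemma FT_U: "FT (-1) (U t f) = mlt (Ep t) (FT (-1) f)"
 by (simp add: U_def)

lemma bounded_linear_U: "bounded_linear (U t)"
 unfolding U_def[abs_def]
 by (intro bounded_linear_compose[OF bounded_linear_FT] bounded_linear_compose[OF bounded_linear_mlt] bounded_linear_FT) auto

lemmas U_diff = bounded_linear_U[THEN bounded_linear.linear, THEN linear_diff]
lemmas U_zero[simp] = bounded_linear_U[THEN bounded_linear.linear, THEN linear_0]

lemma norm_U[simp]: "norm (U t f) = norm f"
 by (simp add: U_def norm_FT norm_mlt_unimod)

lemma U_U: "U s (U t f) = U (s + t) f"
 by (simp add: U_def mlt_mlt Ep_add)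

lemma U_0[simp]: "U 0 f = f"
 by (simp add: U_def mlt_one)

lemma U_inverse[simp]: "U (- t) (U t f) = f" "U t (U (- t) f) = f"
 by (simp_all add: U_U)

lemma inner_U: "inner (U t f) g = inner f (U (- t) g)"
 using FT_adjoint[of 1 "mlt (Ep t) (FT (-1) f)" g] FT_adjoint[of "-1" f "mlt (Ep (- t)) (FT (-1) g)"]
 by (simp add: U_def inner_mlt cnj_Ep)

lemma U_tr: "U t (tr h f) = tr h (U t f)"
 using FT_em[of 1 h "mlt (Ep t) (FT (-1) f)"] FT_tr[of "-1" h f]
 by (simp add: U_def mlt_commute[of "Ep t" "em h"])

lemma mlt_const_tr: "mlt (%_. c) (tr h f) = tr h (mlt (%_. c) f)"
 by (simp add: tr_mlt)

lemma FT_const: 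
 assumes s: "s\<^sup>2 = 1" shows "FT s (mlt (%_. c) f) = mlt (%_. c) (FT s f)"
proof (rule FT_closedI[where A="%f. FT s (mlt (%_. c) f)" and B="%f. mlt (%_. c) (FT s f)"])
 fix f :: "'a => complex" assume f: "Cc f"
 note L = Cc_spaces[OF f]
 show "FT s (mlt (%_. c) (cls f)) = mlt (%_. c) (FT s (cls f))"
  using L by (simp add: mlt_cls FT_cls[OF s] ft_contraction(1)[OF s] L1_space_cmult L2_space_cmult ft_cmult[abs_def])
qed (intro bounded_linear_compose[OF bounded_linear_mlt bounded_linear_FT[OF s]] bounded_linear_compose[OF bounded_linear_FT[OF s] bounded_linear_mlt] bmeas_const)+

lemma U_const: "U t (mlt (%_. c) f) = mlt (%_. c) (U t f)"
 by (simp add: U_def FT_const mlt_commute[of "Ep t" "%_. c"])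

text \<open>On the Fourier side a modulation shifts the frequency. By \<open>Ep_shift\<close> the
  shifted quadratic phase differs from the original one by a linear phase, which is the translation
  by - t v, and by a constant.\<close>

lemma U_em: "U t (mlt (em v) f) = mlt (%_. exp (\<i> * of_real (- (t * (norm v)^2 / 2)))) (mlt (em v) (tr (- (t *\<^sub>R v)) (U t f)))"
proof -
 let ?c = "exp (\<i> * of_real (- (t * (norm v)^2 / 2)))"
 let ?F = "FT (-1) f"
 have "mlt (Ep t) (tr (- v) ?F) = tr (- v) (mlt (%\<xi>. Ep t (\<xi> + v)) ?F)"
  by (subst tr_mlt) (simp_all add: bmeas_shift)
 also have "mlt (%\<xi>. Ep t (\<xi> + v)) ?F = mlt (%_. ?c) (mlt (em (- (t *\<^sub>R v))) (mlt (Ep t) ?F))"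
  unfolding Ep_shift by (simp add: mlt_mlt bmeas_mult)
 finally have "mlt (Ep t) (FT (-1) (mlt (em v) f)) = tr (- v) (mlt (%_. ?c) (mlt (em (- (t *\<^sub>R v))) (mlt (Ep t) ?F)))"
  by (simp add: FT_em)
 then have "U t (mlt (em v) f) = mlt (em v) (mlt (%_. ?c) (tr (- (t *\<^sub>R v)) (U t f)))"
  by (simp add: U_def FT_tr FT_const FT_em)
 then show ?thesis unfolding mlt_commute[of "em v" "%_. ?c", OF bmeas_em bmeas_const] .
qed

lemma U_tendsto:
 assumes "t \<longlonglongrightarrow> t'" shows "(%k. U (t k) f) \<longlonglongrightarrow> U t' f"
 unfolding U_def
proof (rule bounded_linear.tendsto[OF bounded_linear_FT[of 1]], simp, rule mlt_tendsto[where B=1])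
 show "(%k. Ep (t k) x) \<longlonglongrightarrow> Ep t' x" for x :: 'a
  unfolding Ep_def by (intro tendsto_intros assms) simp
qed auto

text \<open>U is only strongly continuous in t; joint continuity holds because every U(t) is an
  isometry, so the error in z is carried over unchanged.\<close>

lemma U_joint_tendsto:
 assumes t: "t \<longlonglongrightarrow> t'" and z: "z \<longlonglongrightarrow> z'" shows "(%k. U (t k) (z k)) \<longlonglongrightarrow> U t' z'"
proof -
 have "(%k. U (t k) (z k - z')) \<longlonglongrightarrow> 0"
  by (rule tendsto_norm_zero_cancel) (use z in \<open>simp add: LIM_zero tendsto_norm_zero\<close>)
 from tendsto_add[OF this U_tendsto[OF t, of z']] show ?thesis by (simp add: U_diff)
qed

lemma continuous_on_U:
 fixes S :: "real set"
 assumes "continuous_on S t" "continuous_on S z" shows "continuous_on S (%s. U (t s) (z s))"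
 unfolding continuous_on_sequentially o_def
proof safe
 fix x a assume x: "\<forall>n. x n \<in> S" "a \<in> S" "x \<longlonglongrightarrow> a"
 have "(%n. t (x n)) \<longlonglongrightarrow> t a" "(%n. z (x n)) \<longlonglongrightarrow> z a"
  using x assms by (auto intro: continuous_on_tendsto_compose)
 then show "(%n. U (t (x n)) (z (x n))) \<longlonglongrightarrow> U (t a) (z a)" by (rule U_joint_tendsto)
qed

definition disp_const :: "'a::euclidean_space itself => real" where
 "disp_const _ = ft_const TYPE('a) * ft_const TYPE('a) * (2 * pi) powr (DIM('a) / 2)"

lemma disp_const_nonneg[simp]: "0 \<le> disp_const TYPE('a::euclidean_space)"
 by (simp add: disp_const_def)

text \<open>The L1 to sup estimate in dual form, which spares a definition of U outside L2. On the
  Fourier side the symbol is the limit of complex Gaussians with parameter eps - i t/2, whose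
  transforms are bounded by a multiple of |t|^(-n/2) uniformly in eps.\<close>

lemma dispersive:
 fixes f g :: "'a::euclidean_space => complex"
 assumes f: "f \<in> L1_space" "f \<in> L2_space" and g: "g \<in> L1_space" "g \<in> L2_space" and t: "t \<noteq> 0"
 shows "\<bar>inner (cls f) (U t (cls g))\<bar> \<le> disp_const TYPE('a) * \<bar>t\<bar> powr (- real DIM('a) / 2) * (LBINT x. norm (f x)) * (LBINT x. norm (g x))"
proof -
 have s: "(- 1 :: real)^2 = 1" by simp
 have F2: "ft (-1) f \<in> L2_space" and G2: "ft (-1) g \<in> L2_space" using ft_contraction(1)[OF s] f g by auto
 have cnjG: "(%x. cnj (ft (-1) g x)) \<in> L2_space" using G2 borel_measurable_cnj[of "ft (-1) g" borel] by (auto simp: L2_space_def)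
 note [measurable] = L2_space_measurable[OF F2] L2_space_measurable[OF G2]
 define a where "a k = complex_of_real (inverse (real (Suc k))) - \<i> * of_real (t / 2)" for k
 let ?w = "%k \<xi>. ft (- (-1)) (%x. cnj (g x)) \<xi> * cgauss (a k) \<xi>"
 have Ra: "Re (a k) > 0" for k by (simp add: a_def)
 have na: "norm (a k) \<ge> \<bar>t\<bar> / 2" for k
  using abs_Im_le_cmod[of "a k"] by (simp add: a_def)
 let ?I = "%\<xi>. ft (-1) f \<xi> * cnj (Ep t \<xi> * ft (-1) g \<xi>)"
 have fg: "integrable lborel (%\<xi>. norm (ft (-1) f \<xi>) * norm (ft (-1) g \<xi>))"
  by (rule integrable_L2_times[OF F2 G2])
 have Iint: "integrable lborel ?I"
  by (rule integrable_L2_bound[OF F2 G2]) (auto simp: norm_mult)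
 have "inner (cls f) (U t (cls g)) = inner (FT (-1) (cls f)) (mlt (Ep t) (FT (-1) (cls g)))"
  using FT_adjoint[of "-1" "cls f" "mlt (Ep t) (FT (-1) (cls g))"] by (simp add: U_def)
 also have "... = inner (cls (ft (-1) f)) (cls (%\<xi>. Ep t \<xi> * ft (-1) g \<xi>))"
  by (simp add: FT_cls f g mlt_cls G2)
 also have "... = (LBINT \<xi>. Re (?I \<xi>))"
  using L2_space_mult[OF G2, of "Ep t" 1] by (subst inner_cls[OF F2]) (simp_all add: inner_complex_def algebra_simps)
 also have "... = Re (LBINT \<xi>. ?I \<xi>)" by (rule integral_Re[OF Iint])
 finally have "\<bar>inner (cls f) (U t (cls g))\<bar> \<le> norm (LBINT \<xi>. ?I \<xi>)" using abs_Re_le_cmod by metis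
 also have "... \<le> disp_const TYPE('a) * \<bar>t\<bar> powr (- real DIM('a) / 2) * (LBINT x. norm (f x)) * (LBINT x. norm (g x))" (is "_ \<le> ?R")
 proof (rule LIMSEQ_le_const2)
  show "(%k. norm (LBINT \<xi>. ft (-1) f \<xi> * (?w k \<xi>))) \<longlonglongrightarrow> norm (LBINT \<xi>. ?I \<xi>)"
  proof (intro tendsto_norm integral_dominated_convergence[OF _ _ fg])
   show "AE \<xi> in lborel. (%k. ft (-1) f \<xi> * (?w k \<xi>)) \<longlonglongrightarrow> ?I \<xi>"
   proof (rule AE_I2)
    fix \<xi> :: 'a
    have "(%k. cgauss (a k) \<xi>) \<longlonglongrightarrow> exp (- (of_real 0 - \<i> * of_real (t / 2)) * of_real ((norm \<xi>)^2))"
     unfolding cgauss_def a_def by (intro tendsto_intros LIMSEQ_inverse_real_of_nat)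
    also have "exp (- (of_real 0 - \<i> * of_real (t / 2)) * of_real ((norm \<xi>)^2)) = cnj (Ep t \<xi>)"
     unfolding cnj_Ep unfolding Ep_def by (simp add: mult.assoc)
    finally have "(%k. ft (-1) f \<xi> * (cnj (ft (-1) g \<xi>) * cgauss (a k) \<xi>)) \<longlonglongrightarrow> ft (-1) f \<xi> * (cnj (ft (-1) g \<xi>) * cnj (Ep t \<xi>))"
     by (intro tendsto_intros)
    then show "(%k. ft (-1) f \<xi> * (?w k \<xi>)) \<longlonglongrightarrow> ?I \<xi>"
     by (simp add: ft_cnj mult.commute)
   qed
   show "AE \<xi> in lborel. norm (ft (-1) f \<xi> * (?w k \<xi>)) \<le> norm (ft (-1) f \<xi>) * norm (ft (-1) g \<xi>)" for k
   proof (rule AE_I2)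
    fix \<xi> :: 'a
    have "norm (cgauss (a k) \<xi>) \<le> 1" using Ra[of k] by (simp add: norm_cgauss)
    then have "norm (ft (-1) g \<xi>) * norm (cgauss (a k) \<xi>) \<le> norm (ft (-1) g \<xi>) * 1" by (intro mult_left_mono) auto
    then show "norm (ft (-1) f \<xi> * (?w k \<xi>)) \<le> norm (ft (-1) f \<xi>) * norm (ft (-1) g \<xi>)"
     by (simp add: norm_mult ft_cnj mult_left_mono)
   qed
   have [measurable]: "g \<in> borel_measurable borel" using g by auto
   show "(%\<xi>. ft (-1) f \<xi> * (?w k \<xi>)) \<in> borel_measurable lborel" for k by measurable
  qed measurable
  have "norm (LBINT \<xi>. ft (-1) f \<xi> * (?w k \<xi>)) \<le> ?R" for k
  proof -
   have "norm (LBINT \<xi>. ft (-1) f \<xi> * (?w k \<xi>))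
    \<le> ft_const TYPE('a) * (ft_const TYPE('a) * (pi / norm (a k)) powr (DIM('a) / 2)) * (LBINT x. norm (f x)) * (LBINT x. norm (cnj (g x)))"
    by (rule ft_triple_bound[OF f(1) L1_space_cnj[OF g(1)] cgauss_L1[OF Ra] ft_cgauss_bound[OF Ra]])
   also have "... \<le> ?R"
   proof -
    have "pi / norm (a k) \<le> pi / (\<bar>t\<bar> / 2)" using na[of k] t by (intro divide_left_mono) (auto intro!: mult_pos_pos)
    then have "(pi / norm (a k)) powr (DIM('a) / 2) \<le> (pi / (\<bar>t\<bar> / 2)) powr (DIM('a) / 2)"
     by (intro powr_mono2) auto
    also have "pi / (\<bar>t\<bar> / 2) = (2 * pi) / \<bar>t\<bar>" by simp
    also have "((2 * pi) / \<bar>t\<bar>) powr (DIM('a) / 2) = (2 * pi) powr (DIM('a) / 2) * \<bar>t\<bar> powr (- real DIM('a) / 2)"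
     by (simp add: powr_divide powr_minus_divide)
    finally have "ft_const TYPE('a) * (ft_const TYPE('a) * (pi / norm (a k)) powr (DIM('a) / 2)) \<le> disp_const TYPE('a) * \<bar>t\<bar> powr (- real DIM('a) / 2)"
     unfolding disp_const_def mult.assoc by (intro mult_left_mono) auto
    then show ?thesis unfolding complex_mod_cnj by (intro mult_right_mono) auto
   qed
   finally show ?thesis .
  qed
  then show "\<exists>N. \<forall>n\<ge>N. norm (LBINT \<xi>. ft (-1) f \<xi> * (ft (- (-1)) (%x. cnj (g x)) \<xi> * cgauss (a n) \<xi>)) \<le> ?R" by blast
 qed
 finally show ?thesis .
qed

section \<open>Weighted norms and difference quotients\<close>

definition Xw :: "'a::euclidean_space => 'a L2 => ennreal" where
 "Xw b g = (NBINT x. ennreal ((x \<bullet> b)^2 * (norm (fn g x))^2))"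

text \<open>The squared weighted norm, infinite outside the weighted space. Applied to
  \<open>FT (-1) f\<close> it is the squared H^1 norm of f; since it is a square, bounds are written
  with M^2.\<close>

definition Wj :: "'a::euclidean_space L2 => ennreal" where
 "Wj g = (NBINT x. ennreal ((japanese_bracket x * norm (fn g x))^2))"

lemma japanese_bracket_measurable[measurable]: "japanese_bracket \<in> borel_measurable borel"
 unfolding japanese_bracket_def[abs_def] by measurable

lemma japanese_bracket_sq: "(japanese_bracket x)^2 = 1 + (norm x)^2"
 by (simp add: japanese_bracket_def)

lemma japanese_bracket_ge1: "1 \<le> japanese_bracket x"
 by (simp add: japanese_bracket_def)

lemma Wj_eq: "Wj g = ennreal ((norm g)^2) + (\<Sum>b\<in>Basis. Xw b g)"
proof -
 have "ennreal ((japanese_bracket x * norm (fn g x))^2) = ennreal ((norm (fn g x))^2) + (\<Sum>b\<in>Basis. ennreal ((x \<bullet> b)^2 * (norm (fn g x))^2))" for x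
 proof -
  have "(norm x)^2 = (\<Sum>b\<in>Basis. (x \<bullet> b)^2)" by (subst power2_norm_eq_inner, subst euclidean_inner) (simp add: power2_eq_square)
  then have "(japanese_bracket x * norm (fn g x))^2 = (norm (fn g x))^2 + (\<Sum>b\<in>Basis. (x \<bullet> b)^2 * (norm (fn g x))^2)"
   by (simp add: power_mult_distrib japanese_bracket_sq ring_distribs sum_distrib_right)
  then show ?thesis by (simp add: sum_nonneg)
 qed
 then have "Wj g = (NBINT x. ennreal ((norm (fn g x))^2) + (\<Sum>b\<in>Basis. ennreal ((x \<bullet> b)^2 * (norm (fn g x))^2)))"
  unfolding Wj_def by (simp only:)
 also have "... = (NBINT x. ennreal ((norm (fn g x))^2)) + (NBINT x. (\<Sum>b\<in>Basis. ennreal ((x \<bullet> b)^2 * (norm (fn g x))^2)))"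
  by (rule nn_integral_add) measurable
 also have "(NBINT x. (\<Sum>b\<in>Basis. ennreal ((x \<bullet> b)^2 * (norm (fn g x))^2))) = (\<Sum>b\<in>Basis. Xw b g)"
  unfolding Xw_def by (rule nn_integral_sum) measurable
 finally show ?thesis by (simp only: nn_norm_L2)
qed

lemma Wj_cong: "AE x in lborel. norm (fn g x) = norm (fn h x) ==> Wj g = Wj h"
 unfolding Wj_def by (intro nn_integral_cong_AE) (auto elim: AE_mp)

lemma Xw_cong: "AE x in lborel. norm (fn g x) = norm (fn h x) ==> Xw b g = Xw b h"
 unfolding Xw_def by (intro nn_integral_cong_AE) (auto elim: AE_mp)

lemma norm_em_diff_le: "norm (em (h *\<^sub>R b) x - 1) \<le> \<bar>h\<bar> * \<bar>x \<bullet> b\<bar>"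
proof -
 have "norm (exp (\<i> * complex_of_real t) - 1) \<le> \<bar>t\<bar>" for t
  using iexp_approx1[of t 0] by simp
 from this[of "h * (x \<bullet> b)"] show ?thesis by (simp add: em_def abs_mult)
qed

lemma bmeas_em_diff[simp]: "bmeas (%x. em v x - 1)"
 by (intro bmeas_diff) auto

text \<open>Together with its converse \<open>Xw_le_em_diff\<close> this turns a weighted norm into
  the Lipschitz constant of the modulations, and on the Fourier side into that of the translations.
  Symmetries of the flow act on such differences.\<close>

lemma em_diff_le_Xw:
 assumes "Xw b g \<le> ennreal (A\<^sup>2)" "0 \<le> A" shows "norm (mlt (%x. em (h *\<^sub>R b) x - 1) g) \<le> A * \<bar>h\<bar>"
 unfolding mlt_def
proof (rule norm_L2_le_cls[OF mlt_in_L2])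
 have "(NBINT x. ennreal ((norm ((em (h *\<^sub>R b) x - 1) * fn g x))^2))
  \<le> (NBINT x. ennreal (h\<^sup>2) * ennreal ((x \<bullet> b)^2 * (norm (fn g x))^2))"
 proof (rule nn_integral_mono)
  fix x
  have "(norm ((em (h *\<^sub>R b) x - 1) * fn g x))^2 \<le> (\<bar>h\<bar> * \<bar>x \<bullet> b\<bar> * norm (fn g x))^2"
   unfolding norm_mult by (intro power_mono mult_right_mono norm_em_diff_le) auto
  then show "ennreal ((norm ((em (h *\<^sub>R b) x - 1) * fn g x))^2) \<le> ennreal (h\<^sup>2) * ennreal ((x \<bullet> b)^2 * (norm (fn g x))^2)"
   by (subst ennreal_mult[symmetric]) (auto simp: power_mult_distrib mult.assoc intro!: ennreal_leI)
 qed
 also have "... = ennreal (h\<^sup>2) * Xw b g" unfolding Xw_def by (rule nn_integral_cmult) measurable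
 also have "... \<le> ennreal (h\<^sup>2) * ennreal (A\<^sup>2)" by (intro mult_left_mono assms) auto
 also have "... = ennreal ((A * \<bar>h\<bar>)^2)" by (simp add: ennreal_mult[symmetric] power_mult_distrib mult.commute)
 finally show "(NBINT x. ennreal ((norm ((em (h *\<^sub>R b) x - 1) * fn g x))^2)) \<le> ennreal ((A * \<bar>h\<bar>)^2)" .
qed (use assms in auto)

(* Fatou along h -> 0: difference quotients bound the weighted norm. *)
lemma Xw_le_em_diff_seq:
 assumes h: "\<And>k. h k > 0" "h \<longlonglongrightarrow> 0" and A: "A \<longlonglongrightarrow> A'"
  and le: "\<And>k. norm (mlt (%x. em (h k *\<^sub>R b) x - 1) g) \<le> A k * h k"
 shows "Xw b g \<le> ennreal (A'\<^sup>2)"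
proof -
 let ?e = "%k x. em (h k *\<^sub>R b) x - 1" and ?q = "%k x. norm ((em (h k *\<^sub>R b) x - 1) * fn g x) / h k"
 have "Xw b g = (NBINT x. liminf (%k. ennreal ((?q k x)^2)))"
  unfolding Xw_def
 proof (rule nn_integral_cong)
  fix x
  have "(%k. (?q k x)^2) \<longlonglongrightarrow> (x \<bullet> b)\<^sup>2 * (norm (fn g x))^2"
  proof (cases "x \<bullet> b = 0")
   case True
   then show ?thesis by (simp add: em_def)
  next
   case False
   define z where "z k = \<i> * complex_of_real (h k * (x \<bullet> b))" for k
   have z0: "z k \<noteq> 0" for k using h(1)[of k] False by (simp add: z_def)
   have "z \<longlonglongrightarrow> \<i> * complex_of_real (0 * (x \<bullet> b))" unfolding z_def by (intro tendsto_intros h)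
   then have "filterlim z (at 0) sequentially" using z0 by (simp add: filterlim_at)
   moreover have "((%w::complex. (exp (0 + w) - exp 0) / w) \<longlongrightarrow> exp 0) (at 0)"
    using DERIV_exp[of "0::complex"] by (simp only: DERIV_def)
   ultimately have "(%k. (exp (0 + z k) - exp 0) / z k) \<longlonglongrightarrow> exp 0" by (rule filterlim_compose[rotated])
   then have "(%k. (norm ((exp (0 + z k) - exp 0) / z k))^2 * ((x \<bullet> b)^2 * (norm (fn g x))^2)) \<longlonglongrightarrow> (norm (exp 0 :: complex))\<^sup>2 * ((x \<bullet> b)^2 * (norm (fn g x))^2)"
    by (intro tendsto_intros)
   moreover have "(norm ((exp (0 + z k) - exp 0) / z k))^2 * ((x \<bullet> b)^2 * (norm (fn g x))^2) = (?q k x)^2" for k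
    using h(1)[of k] False by (simp add: em_def z_def norm_mult norm_divide power_mult_distrib power_divide)
   ultimately show ?thesis by simp
  qed
  from lim_imp_Liminf[OF sequentially_bot tendsto_ennrealI[OF this]]
  show "ennreal ((x \<bullet> b)^2 * (norm (fn g x))^2) = liminf (%k. ennreal ((?q k x)^2))" by simp
 qed
 also have "... \<le> liminf (%k. \<integral>\<^sup>+x. ennreal ((?q k x)^2) \<partial>lborel)"
  by (rule nn_integral_liminf) measurable
 also have "... \<le> liminf (%k. ennreal ((A k)^2))"
 proof (rule Liminf_mono, rule always_eventually, rule allI)
  fix k
  have hk: "h k > 0" by (rule h)
  have "(NBINT x. ennreal ((?q k x)^2))
    = (NBINT x. ennreal (1 / (h k)^2) * ennreal ((norm ((?e k x) * fn g x))^2))"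
   by (intro nn_integral_cong) (subst ennreal_mult[symmetric], auto simp: power_divide)
  also have "... = ennreal (1 / (h k)^2) * (NBINT x. ennreal ((norm ((?e k x) * fn g x))^2))"
   by (rule nn_integral_cmult) measurable
  also have "(NBINT x. ennreal ((norm ((?e k x) * fn g x))^2)) = ennreal ((norm (mlt (%x. em (h k *\<^sub>R b) x - 1) g))^2)"
   unfolding mlt_def by (rule nn_norm_cls[OF mlt_in_L2]) simp
  also have "ennreal (1 / (h k)^2) * ennreal ((norm (mlt (%x. em (h k *\<^sub>R b) x - 1) g))^2) \<le> ennreal (1 / (h k)^2) * ennreal ((A k * h k)^2)"
   by (intro mult_left_mono ennreal_leI power_mono le) auto
  also have "... = ennreal ((A k)^2)" using hk by (subst ennreal_mult[symmetric]) (auto simp: power_mult_distrib)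
  finally show "(NBINT x. ennreal ((?q k x)^2)) \<le> ennreal ((A k)^2)" .
 qed
 also have "liminf (%k. ennreal ((A k)^2)) = ennreal (A'\<^sup>2)"
  by (intro lim_imp_Liminf[OF sequentially_bot] tendsto_ennrealI tendsto_power A)
 finally show ?thesis .
qed

lemma Xw_le_em_diff:
 assumes le: "\<And>h. h > 0 ==> norm (mlt (%x. em (h *\<^sub>R b) x - 1) g) \<le> A * h"
 shows "Xw b g \<le> ennreal (A\<^sup>2)"
 by (rule Xw_le_em_diff_seq[where h="%k. inverse (real (Suc k))" and A="%_. A"])
   (auto intro: le LIMSEQ_inverse_real_of_nat simp del: of_nat_Suc)

lemma mlt_em_diff: "mlt (em v) f - f = mlt (%x. em v x - 1) f"
 by (rule L2_eqI; use fn_mlt[OF bmeas_em[of v], of f] fn_diff[of "mlt (em v) f" f]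
   fn_mlt[OF bmeas_em_diff[of v], of f] in eventually_elim) (simp add: left_diff_distrib)

lemma FT_tr_diff: "FT (-1) (tr h f - f) = mlt (%x. em h x - 1) (FT (-1) f)"
 using linear_diff[OF bounded_linear.linear[OF bounded_linear_FT[of "-1"]], of "tr h f" f]
 by (simp add: FT_tr mlt_em_diff)

lemma norm_tr_diff: "norm (tr h f - f) = norm (mlt (%x. em h x - 1) (FT (-1) f))"
 using norm_FT[of "-1" "tr h f - f"] by (simp add: FT_tr_diff)

lemma Wj_add: "Wj (f + g) \<le> 2 * Wj f + 2 * Wj g"
proof -
 have "Wj (f + g) \<le> (NBINT x. 2 * ennreal ((japanese_bracket x * norm (fn f x))^2) + 2 * ennreal ((japanese_bracket x * norm (fn g x))^2))"
  unfolding Wj_def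
 proof (rule nn_integral_mono_AE, use fn_add[of f g] in eventually_elim)
  fix x assume eq: "fn (f + g) x = fn f x + fn g x"
  have "(japanese_bracket x * norm (fn (f + g) x))^2 \<le> 2 * (japanese_bracket x * norm (fn f x))^2 + 2 * (japanese_bracket x * norm (fn g x))^2"
   using mult_left_mono[OF norm_add_sq_le[of "fn f x" "fn g x"], of "(japanese_bracket x)^2"]
   by (simp add: eq power_mult_distrib algebra_simps)
  then have "ennreal ((japanese_bracket x * norm (fn (f + g) x))^2) \<le> ennreal (2 * (japanese_bracket x * norm (fn f x))^2 + 2 * (japanese_bracket x * norm (fn g x))^2)"
   by (rule ennreal_leI)
  also have "... = 2 * ennreal ((japanese_bracket x * norm (fn f x))^2) + 2 * ennreal ((japanese_bracket x * norm (fn g x))^2)"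
   by (simp add: ennreal_mult)
  finally show "ennreal ((japanese_bracket x * norm (fn (f + g) x))^2) \<le> 2 * ennreal ((japanese_bracket x * norm (fn f x))^2) + 2 * ennreal ((japanese_bracket x * norm (fn g x))^2)" .
 qed
 also have "... = 2 * Wj f + 2 * Wj g" unfolding Wj_def by (simp add: nn_integral_add nn_integral_cmult)
 finally show ?thesis .
qed

definition jcut :: "real => 'a::euclidean_space => complex" where
 "jcut R x = indicator (cball 0 R) x * of_real (japanese_bracket x)"

lemma bmeas_jcut[simp]: "bmeas (jcut R :: 'a::euclidean_space => complex)"
proof (rule bmeasI[where B="sqrt (1 + R\<^sup>2)"])
 show "(jcut R :: 'a => complex) \<in> borel_measurable borel" unfolding jcut_def[abs_def]
  by (intro borel_measurable_times borel_measurable_indicator borel_closed closed_cball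
    measurable_compose[OF japanese_bracket_measurable borel_measurable_continuous_onI[OF continuous_on_of_real[OF continuous_on_id]]])
 show "norm (jcut R x) \<le> sqrt (1 + R\<^sup>2)" for x :: 'a
  by (auto simp: jcut_def indicator_def japanese_bracket_def norm_mult intro!: power_mono)
qed

text \<open>The weighted norm is a supremum of norms of bounded operators, by monotonicity in one
  direction and by Fatou's lemma in the other. Its sublevel sets are therefore closed in L2, as the
  fixed point argument requires.\<close>

lemma Wj_le_iff: "Wj g \<le> ennreal (M\<^sup>2) \<longleftrightarrow> (\<forall>k::nat. norm (mlt (jcut (real k)) g) \<le> \<bar>M\<bar>)"
proof -
 have n: "ennreal ((norm (mlt (jcut (real k)) g))^2) = (NBINT x. ennreal ((norm (jcut (real k) x * fn g x))^2))" for k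
  unfolding mlt_def by (rule nn_norm_cls[symmetric, OF mlt_in_L2]) simp
 have nn: "ennreal ((norm (mlt (jcut (real k)) g))^2) \<le> ennreal (M\<^sup>2) \<longleftrightarrow> norm (mlt (jcut (real k)) g) \<le> \<bar>M\<bar>" for k
  using abs_le_square_iff[of "norm (mlt (jcut (real k)) g)" M] by (simp add: ennreal_le_iff)
 show ?thesis
 proof
  assume W: "Wj g \<le> ennreal (M\<^sup>2)"
  show "\<forall>k::nat. norm (mlt (jcut (real k)) g) \<le> \<bar>M\<bar>"
  proof
   fix k :: nat
   have "ennreal ((norm (mlt (jcut (real k)) g))^2) \<le> Wj g"
    unfolding n Wj_def using japanese_bracket_ge1
    by (intro nn_integral_mono ennreal_leI) (auto simp: jcut_def indicator_def norm_mult power_mult_distrib)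
   then have "ennreal ((norm (mlt (jcut (real k)) g))^2) \<le> ennreal (M\<^sup>2)" using W by (rule order_trans)
   then show "norm (mlt (jcut (real k)) g) \<le> \<bar>M\<bar>" by (simp only: nn)
  qed
 next
  assume A: "\<forall>k::nat. norm (mlt (jcut (real k)) g) \<le> \<bar>M\<bar>"
  have "Wj g = (NBINT x. liminf (%k. ennreal ((norm (jcut (real k) x * fn g x))^2)))"
   unfolding Wj_def
  proof (rule nn_integral_cong)
   fix x :: 'a
   have "(%k. (norm (jcut (real k) x * fn g x))^2) \<longlonglongrightarrow> (norm (1 * complex_of_real (japanese_bracket x) * fn g x))\<^sup>2"
    unfolding jcut_def by (intro tendsto_intros indicator_cball_tendsto filterlim_real_sequentially)
   from lim_imp_Liminf[OF sequentially_bot tendsto_ennrealI[OF this]]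
   show "ennreal ((japanese_bracket x * norm (fn g x))^2) = liminf (%k. ennreal ((norm (jcut (real k) x * fn g x))^2))"
    by (simp add: norm_mult power_mult_distrib)
  qed
  also have "... \<le> liminf (%k. \<integral>\<^sup>+x. ennreal ((norm (jcut (real k) x * fn g x))^2) \<partial>lborel)"
   by (rule nn_integral_liminf) (use bmeas_jcut in measurable)
  also have "... \<le> ennreal (M\<^sup>2)"
   by (rule Liminf_le[OF sequentially_bot], rule always_eventually) (use A nn in \<open>simp add: n[symmetric]\<close>)
  finally show "Wj g \<le> ennreal (M\<^sup>2)" .
 qed
qed

lemma closed_Wj: 
 assumes "bounded_linear A" shows "closed {f. Wj (A f) \<le> ennreal (M\<^sup>2)}"
proof -
 have "{f. Wj (A f) \<le> ennreal (M\<^sup>2)} = (\<Inter>k::nat. {f. norm (mlt (jcut (real k)) (A f)) \<le> \<bar>M\<bar>})"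
  by (auto simp: Wj_le_iff)
 then show ?thesis
  by (simp only:) (intro closed_INT ballI closed_Collect_le continuous_on_norm continuous_on_const
    linear_continuous_on[OF bounded_linear_compose[OF bounded_linear_mlt[OF bmeas_jcut] assms]])
qed

section \<open>Sobolev embedding by level sets\<close>

lemma dyadic_below:
 fixes y :: real assumes "1 \<le> y" obtains k :: nat where "2 ^ k \<le> y" "y < 2 ^ Suc k"
proof -
 define k where "k = nat \<lfloor>log 2 y\<rfloor>"
 have l0: "0 \<le> log 2 y" using assms by simp
 then have k: "real k = of_int \<lfloor>log 2 y\<rfloor>" by (simp add: k_def)
 have "real k \<le> log 2 y" "log 2 y < real k + 1" unfolding k by linarith+
 then have "2 powr real k \<le> 2 powr (log 2 y)" "2 powr (log 2 y) < 2 powr (real (Suc k))" by auto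
 then have "2 ^ k \<le> y" "y < 2 ^ Suc k" using assms by (simp_all add: powr_realpow del: of_nat_Suc power_Suc)
 then show thesis by (rule that)
qed

lemma summable_2_powr:
 fixes e :: real assumes "e < 0" shows "summable (%k::nat. 2 powr (e * real k))"
proof -
 have "2 powr (e * real k) = (2 powr e) ^ k" for k by (simp add: powr_realpow[symmetric] powr_powr)
 moreover have "2 powr e < 2 powr 0" using assms by (simp only: powr_less_cancel_iff)
 ultimately show ?thesis by (simp add: summable_geometric)
qed

lemma suminf_ennreal_finite:
 assumes "\<And>k. 0 \<le> f k" "summable f" shows "(\<Sum>k. ennreal (f k)) = ennreal (suminf f)"
 using suminf_ennreal2[OF assms] .

lemma suminf_ge_term: "f k \<le> suminf f" for f :: "nat => ennreal"
 using sum_le_suminf[of f "{k}"] by simp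

text \<open>Points whose bracket lies between 2^k and 2^(k+1) fill at most a ball of radius 2^(k+1),
  so the integral is dominated by a geometric series with exponents (n - s) k; polar coordinates are
  avoided.\<close>

lemma jb_powr_integrable:
 assumes s: "s > real DIM('a)"
 shows "(\<integral>\<^sup>+x. ennreal (japanese_bracket x powr (- s)) \<partial>(lborel::'a::euclidean_space measure)) < \<infinity>"
proof -
 let ?\<omega> = "unit_ball_vol (real DIM('a))"
 have "(\<integral>\<^sup>+x. ennreal (japanese_bracket x powr (- s)) \<partial>(lborel::'a measure))
  \<le> (\<integral>\<^sup>+x. (\<Sum>k. ennreal (2 powr (- s * real k)) * indicator (cball 0 (2 ^ Suc k)) x) \<partial>(lborel::'a measure))"
 proof (rule nn_integral_mono)
  fix x :: 'a
  obtain k where k: "2 ^ k \<le> japanese_bracket x" "japanese_bracket x < 2 ^ Suc k"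
   using dyadic_below[OF japanese_bracket_ge1] by blast
  have "norm x \<le> japanese_bracket x" by (simp add: japanese_bracket_def real_le_rsqrt)
  then have "x \<in> cball 0 (2 ^ Suc k)" using k by simp
  moreover have "japanese_bracket x powr (- s) \<le> 2 powr (- s * real k)"
  proof -
   have "japanese_bracket x powr (- s) \<le> (2 ^ k) powr (- s)"
    using k s by (intro powr_mono2') auto
   also have "... = 2 powr (- s * real k)" by (simp add: powr_realpow[symmetric] powr_powr mult.commute)
   finally show ?thesis .
  qed
  ultimately have "ennreal (japanese_bracket x powr (- s)) \<le> ennreal (2 powr (- s * real k)) * indicator (cball 0 (2 ^ Suc k)) x"
   by (simp add: ennreal_leI del: power_Suc)
  also have "... \<le> (\<Sum>k. ennreal (2 powr (- s * real k)) * indicator (cball 0 (2 ^ Suc k)) x)"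
   by (rule suminf_ge_term[of "%k. ennreal (2 powr (- s * real k)) * indicator (cball 0 (2 ^ Suc k)) x"])
  finally show "ennreal (japanese_bracket x powr (- s)) \<le> (\<Sum>k. ennreal (2 powr (- s * real k)) * indicator (cball 0 (2 ^ Suc k)) x)" .
 qed
 also have "... = (\<Sum>k. \<integral>\<^sup>+x. ennreal (2 powr (- s * real k)) * indicator (cball 0 (2 ^ Suc k)) x \<partial>(lborel::'a measure))"
  by (rule nn_integral_suminf) (intro borel_measurable_times_ennreal borel_measurable_const borel_measurable_indicator, simp)
 also have "... = (\<Sum>k. ennreal ((?\<omega> * 2 ^ DIM('a)) * 2 powr ((real DIM('a) - s) * real k)))"
 proof (rule suminf_cong)
  fix k
  have "(\<integral>\<^sup>+x. ennreal (2 powr (- s * real k)) * indicator (cball 0 (2 ^ Suc k)) x \<partial>(lborel::'a measure))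
   = ennreal (2 powr (- s * real k)) * ennreal (?\<omega> * (2 ^ Suc k) ^ DIM('a))"
   by (subst nn_integral_cmult_indicator) (simp_all only: emeasure_cball[of "2 ^ Suc k" "0::'a"] zero_le_power zero_le_numeral, simp)
  also have "... = ennreal (2 powr (- s * real k) * (?\<omega> * (2 ^ Suc k) ^ DIM('a)))"
   by (rule ennreal_mult[symmetric]) auto
  also have "2 powr (- s * real k) * (?\<omega> * (2 ^ Suc k) ^ DIM('a)) = (?\<omega> * 2 ^ DIM('a)) * 2 powr ((real DIM('a) - s) * real k)"
  proof -
   have "((2::real) ^ Suc k) ^ DIM('a) = 2 ^ DIM('a) * 2 powr (real DIM('a) * real k)"
    by (simp add: power_mult_distrib powr_realpow[symmetric] powr_powr mult.commute)
   moreover have "2 powr (- s * real k) * 2 powr (real DIM('a) * real k) = 2 powr ((real DIM('a) - s) * real k)"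
    by (simp add: powr_add[symmetric] algebra_simps)
   ultimately show ?thesis by (simp add: mult_ac)
  qed
  finally show "(\<integral>\<^sup>+x. ennreal (2 powr (- s * real k)) * indicator (cball 0 (2 ^ Suc k)) x \<partial>(lborel::'a measure))
   = ennreal ((?\<omega> * 2 ^ DIM('a)) * 2 powr ((real DIM('a) - s) * real k))" .
 qed
 also have "... = ennreal (\<Sum>k. (?\<omega> * 2 ^ DIM('a)) * 2 powr ((real DIM('a) - s) * real k))"
  using s by (intro suminf_ennreal_finite summable_mult summable_2_powr) auto
 also have "... < \<infinity>" by simp
 finally show ?thesis .
qed

lemma emeasure_level_le:
 fixes g :: "'a::euclidean_space => real"
 assumes [measurable]: "g \<in> borel_measurable borel" and \<mu>: "\<mu> > 0" and q: "q > 0"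
  and le: "(NBINT x. ennreal (\<bar>g x\<bar> powr q)) \<le> ennreal K"
 shows "emeasure lborel {x. \<mu> \<le> \<bar>g x\<bar>} \<le> ennreal (K * \<mu> powr (- q))"
proof -
 have "emeasure lborel {x. \<mu> \<le> \<bar>g x\<bar>} = (NBINT x. indicator {x. \<mu> \<le> \<bar>g x\<bar>} x)"
  by (rule nn_integral_indicator[symmetric]) measurable
 also have "... \<le> (NBINT x. ennreal (\<mu> powr (- q)) * ennreal (\<bar>g x\<bar> powr q))"
 proof (rule nn_integral_mono)
  fix x
  show "indicator {x. \<mu> \<le> \<bar>g x\<bar>} x \<le> ennreal (\<mu> powr (- q)) * ennreal (\<bar>g x\<bar> powr q)"
  proof (cases "\<mu> \<le> \<bar>g x\<bar>")
   case True
   have "1 = \<mu> powr (- q) * \<mu> powr q" using \<mu> by (simp add: powr_add[symmetric])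
   also have "... \<le> \<mu> powr (- q) * \<bar>g x\<bar> powr q" using True \<mu> q by (intro mult_left_mono powr_mono2) auto
   finally have "ennreal 1 \<le> ennreal (\<mu> powr (- q) * \<bar>g x\<bar> powr q)" by (rule ennreal_leI)
   then show ?thesis using True by (simp add: ennreal_mult)
  qed simp
 qed
 also have "... = ennreal (\<mu> powr (- q)) * (NBINT x. ennreal (\<bar>g x\<bar> powr q))"
  by (rule nn_integral_cmult) measurable
 also have "... \<le> ennreal (\<mu> powr (- q)) * ennreal K" by (intro mult_left_mono le) auto
 also have "... = ennreal (K * \<mu> powr (- q))" by (simp add: ennreal_mult'' mult.commute)
 finally show ?thesis .
qed

lemma power2_powr: "0 \<le> x ==> x powr 2 = x\<^sup>2" for x :: real
 by (cases "x = 0") (auto simp: powr_numeral)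

text \<open>Cauchy-Schwarz with the inverse bracket on the ball. The factor R^kappa pays for
  replacing the power -2 of the bracket by -(2 + 2 kappa), which is integrable. Applied to a Fourier
  transform, it bounds the low frequencies in sup norm.\<close>

lemma L1_cut_bound:
 assumes \<kappa>: "\<kappa> > 0" "2 + 2 * \<kappa> > real DIM('a)"
 obtains C where "C > 0" "\<And>(g :: 'a::euclidean_space L2) M r. Wj g \<le> ennreal (M\<^sup>2) ==> 0 \<le> M ==> 0 \<le> r ==>
  (LBINT x. norm (cut r g x)) \<le> C * sqrt (1 + r\<^sup>2) powr \<kappa> * M"
proof -
 have fin: "(\<integral>\<^sup>+x. ennreal (japanese_bracket x powr (- (2 + 2 * \<kappa>))) \<partial>(lborel::'a measure)) < \<infinity>" by (rule jb_powr_integrable) fact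
 then obtain I where I: "0 \<le> I" "(\<integral>\<^sup>+x. ennreal (japanese_bracket x powr (- (2 + 2 * \<kappa>))) \<partial>(lborel::'a measure)) = ennreal I"
  by (cases "(\<integral>\<^sup>+x. ennreal (japanese_bracket x powr (- (2 + 2 * \<kappa>))) \<partial>(lborel::'a measure))") auto
 have bound: "(LBINT x. norm (cut r g x)) \<le> (sqrt I + 1) * sqrt (1 + r\<^sup>2) powr \<kappa> * M"
  if W: "Wj g \<le> ennreal (M\<^sup>2)" and M: "0 \<le> M" and r: "0 \<le> r" for g :: "'a L2" and M r
 proof -
  define u :: "'a => complex" where "u x = indicator (cball 0 r) x * of_real (1 / japanese_bracket x)" for x
  define v :: "'a => complex" where "v x = of_real (japanese_bracket x * norm (cut r g x))" for x
  let ?R = "sqrt (1 + r\<^sup>2)"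
  have jb0: "japanese_bracket x > 0" for x :: 'a using japanese_bracket_ge1[of x] by linarith
  have um: "u \<in> borel_measurable borel" unfolding u_def[abs_def]
   by (intro borel_measurable_times borel_measurable_indicator borel_closed closed_cball
    measurable_compose[OF _ borel_measurable_continuous_onI[OF continuous_on_of_real[OF continuous_on_id]]]) measurable
  have u2: "u \<in> L2_space"
   by (rule bounded_support_space(2)[OF um, of r 1])
     (use japanese_bracket_ge1 in \<open>auto simp: u_def indicator_def norm_divide divide_le_eq_1 jb0 abs_of_pos[OF jb0]\<close>)
  have [measurable]: "cut r g \<in> borel_measurable borel" using cut_spaces(2)[of r g] by (rule L2_space_measurable)
  have vm: "v \<in> borel_measurable borel" unfolding v_def[abs_def]
   by (intro measurable_compose[OF _ borel_measurable_continuous_onI[OF continuous_on_of_real[OF continuous_on_id]]]) measurable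
  have vn: "(NBINT x. ennreal ((norm (v x))^2)) \<le> ennreal (M\<^sup>2)"
  proof (rule order_trans[OF _ W], unfold Wj_def, rule nn_integral_mono, rule ennreal_leI)
   fix x show "(norm (v x))^2 \<le> (japanese_bracket x * norm (fn g x))^2"
    using jb0[of x] by (auto simp: v_def indicator_def abs_of_pos norm_mult)
  qed
  have v2: "v \<in> L2_space" unfolding L2_space_iff_nn using vm vn by (auto intro: le_less_trans)
  have nv: "norm (cls v) \<le> M" by (rule norm_L2_le_cls[OF v2 M vn])
  have un: "(NBINT x. ennreal ((norm (u x))^2)) \<le> ennreal ((sqrt I * ?R powr \<kappa>)^2)"
  proof -
   have "(NBINT x. ennreal ((norm (u x))^2)) \<le> (\<integral>\<^sup>+x. ennreal (?R powr (2 * \<kappa>)) * ennreal (japanese_bracket x powr (- (2 + 2 * \<kappa>))) \<partial>(lborel::'a measure))"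
   proof (rule nn_integral_mono)
    fix x :: 'a
    show "ennreal ((norm (u x))^2) \<le> ennreal (?R powr (2 * \<kappa>)) * ennreal (japanese_bracket x powr (- (2 + 2 * \<kappa>)))"
    proof (cases "x \<in> cball 0 r")
     case True
     have "japanese_bracket x \<le> ?R" using True r by (auto simp: japanese_bracket_def intro: power_mono)
     then have "japanese_bracket x powr (2 * \<kappa>) \<le> ?R powr (2 * \<kappa>)"
      using jb0[of x] \<kappa> by (intro powr_mono2) auto
     moreover have "(norm (u x))^2 = japanese_bracket x powr (2 * \<kappa>) * japanese_bracket x powr (- (2 + 2 * \<kappa>))"
     proof -
      have "japanese_bracket x powr (2 * \<kappa>) * japanese_bracket x powr (- (2 + 2 * \<kappa>)) = japanese_bracket x powr (- 2)"
       by (simp add: powr_add[symmetric])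
      also have "... = 1 / (japanese_bracket x)^2" using jb0[of x] by (simp add: powr_minus_divide powr_numeral)
      finally show ?thesis using True jb0[of x] by (simp add: u_def norm_divide power_divide)
     qed
     ultimately have "(norm (u x))^2 \<le> ?R powr (2 * \<kappa>) * japanese_bracket x powr (- (2 + 2 * \<kappa>))"
      by (simp add: mult_right_mono)
     then show ?thesis by (simp add: ennreal_mult[symmetric] ennreal_leI)
    qed (simp add: u_def)
   qed
   also have "... = ennreal (?R powr (2 * \<kappa>)) * ennreal I"
    unfolding I(2)[symmetric] by (rule nn_integral_cmult) measurable
   also have "... = ennreal ((sqrt I * ?R powr \<kappa>)^2)"
    using I(1) by (simp add: ennreal_mult[symmetric] power_mult_distrib mult.commute power2_eq_square[of "_ powr _"] powr_add[symmetric])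
   finally show ?thesis .
  qed
  have nu: "norm (cls u) \<le> sqrt I * ?R powr \<kappa>" by (rule norm_L2_le_cls[OF u2 _ un]) (use I in simp)
  have "norm (cut r g x) = u x \<bullet> v x" for x
   using jb0[of x] by (auto simp: u_def v_def inner_complex_def indicator_def)
  then have "(LBINT x. norm (cut r g x)) = inner (cls u) (cls v)" by (simp only: inner_cls[OF u2 v2])
  also have "... \<le> norm (cls u) * norm (cls v)" by (rule norm_cauchy_schwarz)
  also have "... \<le> (sqrt I * ?R powr \<kappa>) * M" using nu nv I by (intro mult_mono) auto
  also have "... \<le> (sqrt I + 1) * ?R powr \<kappa> * M" using M by (intro mult_right_mono) auto
  finally show ?thesis .
 qed
 show thesis by (rule that[of "sqrt I + 1"]) (use I bound in \<open>auto intro: add_nonneg_pos\<close>)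
qed

lemma high_freq_small:
 fixes g :: "'a::euclidean_space L2"
 assumes W: "Wj g \<le> ennreal (M\<^sup>2)" and M: "0 \<le> M" and r: "0 \<le> r"
 shows "norm (g - mlt (indicator (cball 0 r)) g) \<le> M / sqrt (1 + r\<^sup>2)"
proof -
 let ?R = "sqrt (1 + r\<^sup>2)"
 have R: "?R > 0" by (simp add: add_pos_nonneg)
 have L2: "(%x. fn g x - cut r g x) \<in> L2_space" by (intro L2_space_diff cut_spaces) auto
 have eq: "g - mlt (indicator (cball 0 r)) g = cls (%x. fn g x - cut r g x)"
  by (simp only: cls_diff[OF fn_L2 cut_spaces(2)] cls_fn cls_cut)
 have "(NBINT x. ennreal ((norm (fn g x - cut r g x))^2)) \<le> (NBINT x. ennreal (1 / ?R\<^sup>2) * ennreal ((japanese_bracket x * norm (fn g x))^2))"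
 proof (rule nn_integral_mono)
  fix x
  have "(norm (fn g x - cut r g x))^2 \<le> 1 / ?R\<^sup>2 * (japanese_bracket x * norm (fn g x))^2"
  proof (cases "x \<in> cball 0 r")
   case False
   then have "r\<^sup>2 \<le> (norm x)^2" using r by (intro power_mono) auto
   then have "?R\<^sup>2 \<le> (japanese_bracket x)^2" by (simp add: japanese_bracket_sq)
   then have "?R\<^sup>2 * (norm (fn g x))^2 \<le> (japanese_bracket x)^2 * (norm (fn g x))^2" by (rule mult_right_mono) simp
   then show ?thesis using False R by (simp add: power_mult_distrib pos_le_divide_eq mult.commute)
  qed simp
  then show "ennreal ((norm (fn g x - cut r g x))^2) \<le> ennreal (1 / ?R\<^sup>2) * ennreal ((japanese_bracket x * norm (fn g x))^2)"
   by (subst ennreal_mult[symmetric]) (auto intro: ennreal_leI)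
 qed
 also have "... = ennreal (1 / ?R\<^sup>2) * Wj g" unfolding Wj_def by (rule nn_integral_cmult) measurable
 also have "... \<le> ennreal (1 / ?R\<^sup>2) * ennreal (M\<^sup>2)" by (intro mult_left_mono W) auto
 also have "... = ennreal ((M / ?R)^2)" by (subst ennreal_mult[symmetric]) (auto simp: power_divide)
 finally show ?thesis unfolding eq using M by (intro norm_L2_le_cls[OF L2]) auto
qed

lemma nn_norm_powr2: "(NBINT x. ennreal (\<bar>norm (fn g x)\<bar> powr 2)) = ennreal ((norm g)^2)"
 unfolding nn_norm_L2[symmetric] by (simp add: power2_powr)

lemma Wj_norm_le:
 assumes "Wj g \<le> ennreal (M\<^sup>2)" "0 \<le> M" shows "norm g \<le> M"
proof -
 have "ennreal ((norm g)^2) \<le> Wj g" unfolding Wj_eq by simp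
 also note assms(1)
 finally have "(norm g)^2 \<le> M\<^sup>2" by (simp add: ennreal_le_iff)
 then show ?thesis using assms(2) by (rule power2_le_imp_le)
qed

text \<open>At height mu the frequencies are cut at R with R^kappa proportional to mu. The low part
  then stays below mu/2 everywhere, so the level set is seen by the high part, whose L2 norm is at
  most M/R. Chebyshev's inequality turns this into the exponent 2 + 2/kappa.\<close>

lemma sobolev_level:
 assumes \<kappa>: "\<kappa> > 0" "2 + 2 * \<kappa> > real DIM('a)" and M: "M > 0"
 obtains C \<mu>0 where "C > 0" "\<mu>0 > 0" "\<And>(f :: 'a::euclidean_space L2) \<mu>. Wj (FT (-1) f) \<le> ennreal (M\<^sup>2) ==> \<mu>0 \<le> \<mu> ==>
  emeasure lborel {x. \<mu> \<le> norm (fn f x)} \<le> ennreal (C * \<mu> powr (- (2 + 2 / \<kappa>)))"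
proof -
 obtain C1 where C1: "C1 > 0" and cutb: "\<And>(g :: 'a L2) M r. Wj g \<le> ennreal (M\<^sup>2) ==> 0 \<le> M ==> 0 \<le> r ==>
  (LBINT x. norm (cut r g x)) \<le> C1 * sqrt (1 + r\<^sup>2) powr \<kappa> * M"
  using L1_cut_bound[OF \<kappa>] by blast
 \<comment> \<open>With R^kappa = mu / B the sup bound of the low part is \<open>ft_const\<close> C1
   M mu / B. The factor 2 brings it to mu/2, and the added 1 makes the inequality strict.\<close>
 define B where "B = 2 * (ft_const TYPE('a) * C1 * M) + 1"
 have B: "B > 0" "ft_const TYPE('a) * C1 * M < B / 2" using C1 M by (auto simp: B_def add_nonneg_pos)
 define C where "C = 4 * M\<^sup>2 * B powr (2 / \<kappa>)"
 have lev: "emeasure lborel {x. \<mu> \<le> norm (fn f x)} \<le> ennreal (C * \<mu> powr (- (2 + 2 / \<kappa>)))"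
  if W: "Wj (FT (-1) f) \<le> ennreal (M\<^sup>2)" and \<mu>: "B \<le> \<mu>" for f :: "'a L2" and \<mu>
 proof -
  define R where "R = (\<mu> / B) powr (1 / \<kappa>)"
  have R1: "1 \<le> R" unfolding R_def using \<mu> B \<kappa> by (intro ge_one_powr_ge_zero) auto
  have R\<kappa>: "R powr \<kappa> = \<mu> / B" using \<mu> B \<kappa> by (simp add: R_def powr_powr)
  define r where "r = sqrt (R\<^sup>2 - 1)"
  have r: "0 \<le> r" "sqrt (1 + r\<^sup>2) = R" using R1 by (auto simp: r_def)
  define g where "g = FT (-1) f"
  define lo where "lo = cls (ft 1 (cut r g))"
  have lo: "lo = FT 1 (mlt (indicator (cball 0 r)) g)"
   unfolding lo_def cls_cut[symmetric] by (rule FT_cls[symmetric, OF _ cut_spaces]) simp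
  have "f - lo = FT 1 (g - mlt (indicator (cball 0 r)) g)"
   using linear_diff[OF bounded_linear.linear[OF bounded_linear_FT[of 1]], of g] by (simp add: lo g_def)
  then have hi: "norm (f - lo) \<le> M / R"
   using high_freq_small[OF _ less_imp_le[OF M] r(1), of g] W by (simp add: norm_FT r(2) g_def)
  have L: "ft 1 (cut r g) \<in> L2_space" by (rule ft_contraction(1)[OF _ cut_spaces]) simp
  have lob: "norm (ft 1 (cut r g) x) < \<mu> / 2" for x
  proof -
   have "norm (ft 1 (cut r g) x) \<le> ft_const TYPE('a) * (LBINT x. norm (cut r g x))" by (rule norm_ft_le)
   also have "... \<le> ft_const TYPE('a) * (C1 * R powr \<kappa> * M)"
    using cutb[OF W[folded g_def] less_imp_le[OF M] r(1)] by (intro mult_left_mono) (auto simp: r(2))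
   also have "... = (ft_const TYPE('a) * C1 * M) * (\<mu> / B)" by (simp add: R\<kappa> mult_ac)
   also have "... < B / 2 * (\<mu> / B)" using B \<mu> by (intro mult_strict_right_mono) auto
   also have "... = \<mu> / 2" using B by simp
   finally show ?thesis .
  qed
  have "emeasure lborel {x. \<mu> \<le> norm (fn f x)} \<le> emeasure lborel {x. \<mu> / 2 \<le> \<bar>norm (fn (f - lo) x)\<bar>}"
  proof (rule emeasure_mono_AE)
   show "AE x in lborel. x \<in> {x. \<mu> \<le> norm (fn f x)} \<longrightarrow> x \<in> {x. \<mu> / 2 \<le> \<bar>norm (fn (f - lo) x)\<bar>}"
    using fn_cls_diff[OF L, of f] unfolding lo_def
   proof eventually_elim
    fix x assume eq: "fn (f - cls (ft 1 (cut r g))) x = fn f x - ft 1 (cut r g) x"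
    show "x \<in> {x. \<mu> \<le> norm (fn f x)} \<longrightarrow> x \<in> {x. \<mu> / 2 \<le> \<bar>norm (fn (f - cls (ft 1 (cut r g))) x)\<bar>}"
     using lob[of x] norm_triangle_ineq2[of "fn f x" "ft 1 (cut r g) x"] by (auto simp: eq)
   qed
   show "{x. \<mu> / 2 \<le> \<bar>norm (fn (f - lo) x)\<bar>} \<in> sets lborel" by measurable
  qed
  also have "... \<le> ennreal ((M / R)^2 * (\<mu> / 2) powr (- 2))"
  proof (rule emeasure_level_le)
   show "(NBINT x. ennreal (\<bar>norm (fn (f - lo) x)\<bar> powr 2)) \<le> ennreal ((M / R)^2)"
    unfolding nn_norm_powr2 using hi by (intro ennreal_leI power_mono) auto
  qed (use \<mu> B in auto)
  also have "(M / R)^2 * (\<mu> / 2) powr (- 2) = C * \<mu> powr (- (2 + 2 / \<kappa>))"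
  proof -
   have \<mu>0: "\<mu> > 0" using \<mu> B by linarith
   have "R\<^sup>2 = R powr 2" using R1 by (simp add: powr_numeral)
   also have "... = (\<mu> / B) powr (2 / \<kappa>)" by (simp add: R_def powr_powr)
   also have "... = \<mu> powr (2 / \<kappa>) / B powr (2 / \<kappa>)" using \<mu>0 B by (simp add: powr_divide)
   finally have R2: "R\<^sup>2 = \<mu> powr (2 / \<kappa>) / B powr (2 / \<kappa>)" .
   have "(\<mu> / 2) powr (- 2) = 4 / \<mu>\<^sup>2" using \<mu>0 by (simp add: powr_minus_divide power2_powr power_divide)
   moreover have "\<mu> powr (- (2 + 2 / \<kappa>)) = 1 / (\<mu>\<^sup>2 * \<mu> powr (2 / \<kappa>))"
    using \<mu>0 by (simp only: powr_minus_divide powr_add power2_powr less_imp_le)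
   ultimately show ?thesis by (simp add: power_divide R2 C_def field_simps)
  qed
  finally show ?thesis .
 qed
 show thesis by (rule that[of C B]) (use B M lev in \<open>auto simp: C_def\<close>)
qed

definition Lp_nn :: "real => 'a::euclidean_space L2 => ennreal" where
 "Lp_nn q f = (NBINT x. ennreal (norm (fn f x) powr q))"

text \<open>Summing over dyadic heights, the level set bound with exponent 2 + 2/kappa > q gives a
  convergent series, while low heights are left to the L2 norm. A kappa with max(0, (n-2)/2) < kappa
  < 2/(q-2) exists precisely because q is subcritical.\<close>

lemma sobolev:
 assumes q: "q > 2" "DIM('a) \<ge> 3 \<longrightarrow> q < 2 * real DIM('a) / (real DIM('a) - 2)"
 obtains K where "K \<ge> 0" "\<And>f :: 'a::euclidean_space L2. Wj (FT (-1) f) \<le> ennreal (M\<^sup>2) ==> Lp_nn q f \<le> ennreal K"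
proof -
 let ?n = "real DIM('a)"
 have "max 0 ((?n - 2) / 2) < 2 / (q - 2)"
 proof -
  have "(?n - 2) / 2 < 2 / (q - 2)"
  proof (cases "DIM('a) \<ge> 3")
   case True
   then have "q * (?n - 2) < 2 * ?n" using q by (simp add: pos_less_divide_eq)
   then have "(?n - 2) * (q - 2) < 4" by (simp add: algebra_simps)
   then show ?thesis using q by (simp add: pos_less_divide_eq mult.commute)
  next
   case False
   then have "?n - 2 \<le> 0" by simp
   then have "(?n - 2) / 2 \<le> 0" by simp
   moreover have "0 < 2 / (q - 2)" using q by simp
   ultimately show ?thesis by linarith
  qed
  then show ?thesis using q by simp
 qed
 then obtain \<kappa> where \<kappa>': "max 0 ((?n - 2) / 2) < \<kappa>" "\<kappa> < 2 / (q - 2)" using dense by blast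
 then have \<kappa>: "\<kappa> > 0" "2 + 2 * \<kappa> > ?n" by auto
 define q1 where "q1 = 2 + 2 / \<kappa>"
 have q1: "q < q1"
 proof -
  have "\<kappa> * (q - 2) < 2" using \<kappa>' q by (simp add: pos_less_divide_eq)
  then have "q - 2 < 2 / \<kappa>" using \<kappa> by (simp add: pos_less_divide_eq mult.commute)
  then show ?thesis by (simp add: q1_def)
 qed
 define M' where "M' = \<bar>M\<bar> + 1"
 have M': "M' > 0" by (simp add: M'_def add_nonneg_pos)
 obtain C \<mu> where C: "C > 0" and \<mu>: "\<mu> > 0" and lev: "\<And>(f :: 'a L2) \<nu>. Wj (FT (-1) f) \<le> ennreal (M'\<^sup>2) ==> \<mu> \<le> \<nu> ==>
  emeasure lborel {x. \<nu> \<le> norm (fn f x)} \<le> ennreal (C * \<nu> powr (- q1))"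
  using sobolev_level[OF \<kappa> M'] unfolding q1_def by blast
 define K where "K = \<mu> powr (q - 2) * M'\<^sup>2 + (\<Sum>k. (2 * \<mu>) powr q * C * \<mu> powr (- q1) * 2 powr ((q - q1) * real k))"
 let ?I = "%(f :: 'a L2) k x. ennreal ((2 ^ Suc k * \<mu>) powr q) * indicator {x. 2 ^ k * \<mu> \<le> norm (fn f x)} x"
 have sm: "summable (%k. (2 * \<mu>) powr q * C * \<mu> powr (- q1) * 2 powr ((q - q1) * real k))"
  using q1 by (intro summable_mult summable_2_powr) simp
 have K0: "0 \<le> K" unfolding K_def using C by (intro add_nonneg_nonneg suminf_nonneg sm) auto
 have "Lp_nn q f \<le> ennreal K" if W: "Wj (FT (-1) f) \<le> ennreal (M\<^sup>2)" for f :: "'a L2"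
 proof -
  have "ennreal (M\<^sup>2) \<le> ennreal (M'\<^sup>2)" unfolding M'_def by (intro ennreal_leI) (auto simp: abs_le_square_iff[symmetric])
  then have W': "Wj (FT (-1) f) \<le> ennreal (M'\<^sup>2)" using W by (rule order_trans[rotated])
  have nf: "norm f \<le> M'" using Wj_norm_le[OF W'] M' by (simp add: norm_FT)
  have "Lp_nn q f \<le> (NBINT x. ennreal (\<mu> powr (q - 2)) * ennreal ((norm (fn f x))^2) + (\<Sum>k. ?I f k x))"
   unfolding Lp_nn_def
  proof (rule nn_integral_mono)
   fix x
   let ?y = "norm (fn f x)"
   show "ennreal (?y powr q) \<le> ennreal (\<mu> powr (q - 2)) * ennreal (?y\<^sup>2) + (\<Sum>k. ?I f k x)"
   proof (cases "?y \<le> \<mu>")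
    case True
    have "?y powr q = ?y powr (q - 2) * ?y\<^sup>2"
     by (cases "?y = 0") (simp_all add: powr_diff powr_numeral)
    also have "... \<le> \<mu> powr (q - 2) * ?y\<^sup>2" using True q by (intro mult_right_mono powr_mono2) auto
    finally have "ennreal (?y powr q) \<le> ennreal (\<mu> powr (q - 2)) * ennreal (?y\<^sup>2)" by (simp add: ennreal_mult[symmetric] ennreal_leI)
    then show ?thesis by (rule order_trans) simp
   next
    case False
    then have "1 \<le> ?y / \<mu>" using \<mu> by simp
    then obtain k where k: "2 ^ k \<le> ?y / \<mu>" "?y / \<mu> < 2 ^ Suc k" by (rule dyadic_below)
    then have k': "2 ^ k * \<mu> \<le> ?y" "?y \<le> 2 ^ Suc k * \<mu>" using \<mu> by (simp_all add: field_simps)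
    define e where "e k = ?I f k x" for k
    have "ennreal (?y powr q) \<le> ennreal ((2 ^ Suc k * \<mu>) powr q)" using k'(2) q by (intro ennreal_leI powr_mono2) auto
    also have "... = e k" using k'(1) by (simp add: e_def)
    also have "... \<le> suminf e" by (rule suminf_ge_term)
    finally show ?thesis unfolding e_def[abs_def] by (rule order_trans) simp
   qed
  qed
  also have "... = (NBINT x. ennreal (\<mu> powr (q - 2)) * ennreal ((norm (fn f x))^2)) + (NBINT x. (\<Sum>k. ?I f k x))"
   by (rule nn_integral_add) measurable
  also have "(NBINT x. ennreal (\<mu> powr (q - 2)) * ennreal ((norm (fn f x))^2)) = ennreal (\<mu> powr (q - 2)) * ennreal ((norm f)^2)"
   unfolding nn_norm_L2[symmetric] by (rule nn_integral_cmult) measurable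
  also have "... \<le> ennreal (\<mu> powr (q - 2) * M'\<^sup>2)"
   using nf by (subst ennreal_mult[symmetric]) (auto intro!: ennreal_leI mult_left_mono power_mono)
  also have "(NBINT x. (\<Sum>k. ?I f k x))
   = (\<Sum>k. \<integral>\<^sup>+x. ?I f k x \<partial>lborel)"
   by (rule nn_integral_suminf) measurable
  also have "... \<le> (\<Sum>k. ennreal ((2 * \<mu>) powr q * C * \<mu> powr (- q1) * 2 powr ((q - q1) * real k)))"
  proof (intro suminf_le)
   fix k
   have "\<mu> \<le> 2 ^ k * \<mu>" using \<mu> by simp
   have "(NBINT x. ?I f k x)
    = ennreal ((2 ^ Suc k * \<mu>) powr q) * emeasure lborel {x. 2 ^ k * \<mu> \<le> norm (fn f x)}"
    by (rule nn_integral_cmult_indicator) measurable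
   also have "... \<le> ennreal ((2 ^ Suc k * \<mu>) powr q) * ennreal (C * (2 ^ k * \<mu>) powr (- q1))"
    by (intro mult_left_mono lev[OF W' \<open>\<mu> \<le> 2 ^ k * \<mu>\<close>]) auto
   also have "... = ennreal ((2 ^ Suc k * \<mu>) powr q * (C * (2 ^ k * \<mu>) powr (- q1)))"
    using C by (subst ennreal_mult[symmetric]) auto
   also have "(2 ^ Suc k * \<mu>) powr q * (C * (2 ^ k * \<mu>) powr (- q1)) = (2 * \<mu>) powr q * C * \<mu> powr (- q1) * 2 powr ((q - q1) * real k)"
   proof -
    have a: "(2 ^ k) powr e = 2 powr (e * real k)" for e :: real by (simp add: powr_realpow[symmetric] powr_powr mult.commute)
    have "2 ^ Suc k * \<mu> = 2 ^ k * (2 * \<mu>)" by simp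
    then have "(2 ^ Suc k * \<mu>) powr q = 2 powr (q * real k) * (2 * \<mu>) powr q"
     using \<mu> by (simp only: powr_mult a)
    moreover have "(2 ^ k * \<mu>) powr (- q1) = 2 powr (- q1 * real k) * \<mu> powr (- q1)" by (simp only: powr_mult a)
    moreover have "2 powr ((q - q1) * real k) = 2 powr (q * real k) * 2 powr (- q1 * real k)" by (simp add: powr_add[symmetric] algebra_simps)
    ultimately show ?thesis by (simp only: mult_ac)
   qed
   finally show "(NBINT x. ?I f k x)
    \<le> ennreal ((2 * \<mu>) powr q * C * \<mu> powr (- q1) * 2 powr ((q - q1) * real k))" .
  qed auto
  also have "... = ennreal (\<Sum>k. (2 * \<mu>) powr q * C * \<mu> powr (- q1) * 2 powr ((q - q1) * real k))"
   using C by (intro suminf_ennreal_finite sm) auto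
  also have "ennreal (\<mu> powr (q - 2) * M'\<^sup>2) + ... = ennreal K"
   unfolding K_def using C by (intro ennreal_plus[symmetric] suminf_nonneg sm) auto
  finally show ?thesis by (simp add: add_mono)
 qed
 then show thesis using that K0 by blast
qed

section \<open>The nonlinearity\<close>

lemma pn_measurable[measurable]:
 assumes [measurable]: "f \<in> borel_measurable M" shows "(%x. power_nonlinearity p (f x)) \<in> borel_measurable M"
 unfolding power_nonlinearity_def by measurable

lemma pn_zero[simp]: "power_nonlinearity p 0 = 0" by (simp add: power_nonlinearity_def)

lemma norm_pn: "norm (power_nonlinearity p z) = norm z powr p" if "p > 1"
proof -
 have "norm (power_nonlinearity p z) = norm z powr (p - 1) * norm z" by (simp add: power_nonlinearity_def norm_mult)
 then show ?thesis using that by (cases "z = 0") (auto simp: powr_diff)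
qed

text \<open>By the mean value theorem the difference quotient is (p-1) z^(p-2) with s < z < r. The
  extra factor s <= z absorbs the singularity of z^(p-2) for p < 2.\<close>

lemma powr_diff_le:
 fixes r s p :: real
 assumes "p > 1" "0 \<le> s" "s \<le> r"
 shows "(r powr (p - 1) - s powr (p - 1)) * s \<le> (p - 1) * r powr (p - 1) * (r - s)"
proof (cases "0 < s \<and> s < r")
 case True
 have "\<exists>z>s. z < r \<and> r powr (p - 1) - s powr (p - 1) = (r - s) * ((p - 1) * z powr (p - 2))"
 proof (rule MVT2)
  show "s < r" using True by simp
  fix x assume "s \<le> x" "x \<le> r"
  then have "x > 0" using True by linarith
  from has_real_derivative_powr[OF this, of "p - 1"]
  show "((%t. t powr (p - 1)) has_real_derivative (p - 1) * x powr (p - 2)) (at x)" by simp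
 qed
 then obtain z where z: "s < z" "z < r" "r powr (p - 1) - s powr (p - 1) = (r - s) * ((p - 1) * z powr (p - 2))" by blast
 have "z powr (p - 2) * s \<le> z powr (p - 2) * z" using z by (intro mult_left_mono) auto
 also have "... = z powr (p - 1)" using z True by (simp add: powr_mult_base[symmetric] powr_diff power2_eq_square field_simps powr_numeral)
 also have "... \<le> r powr (p - 1)" using z True assms by (intro powr_mono2) auto
 finally have "(r - s) * (p - 1) * (z powr (p - 2) * s) \<le> (r - s) * (p - 1) * r powr (p - 1)"
  using assms by (intro mult_left_mono) auto
 then show ?thesis using z(3) by (simp add: mult_ac)
next
 case False
 then show ?thesis using assms by (cases "s = 0") auto
qed

lemma pn_diff_le:
 assumes p: "p > 1"
 shows "norm (power_nonlinearity p a - power_nonlinearity p b) \<le> p * max (norm a) (norm b) powr (p - 1) * norm (a - b)"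
proof -
 have *: "norm (power_nonlinearity p a - power_nonlinearity p b) \<le> p * norm a powr (p - 1) * norm (a - b)"
  if ab: "norm b \<le> norm a" for a b
 proof -
  have "power_nonlinearity p a - power_nonlinearity p b
   = of_real (norm a powr (p - 1)) * (a - b) + of_real (norm a powr (p - 1) - norm b powr (p - 1)) * b"
   by (simp add: power_nonlinearity_def algebra_simps)
  then have "norm (power_nonlinearity p a - power_nonlinearity p b)
   \<le> norm a powr (p - 1) * norm (a - b) + \<bar>norm a powr (p - 1) - norm b powr (p - 1)\<bar> * norm b"
   by (metis (no_types, lifting) norm_triangle_ineq norm_mult norm_of_real abs_of_nonneg powr_ge_zero)
  also have "\<bar>norm a powr (p - 1) - norm b powr (p - 1)\<bar> = norm a powr (p - 1) - norm b powr (p - 1)"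
   using ab p by (simp add: powr_mono2)
  also have "(norm a powr (p - 1) - norm b powr (p - 1)) * norm b \<le> (p - 1) * norm a powr (p - 1) * (norm a - norm b)"
   using ab p by (intro powr_diff_le) auto
  also have "... \<le> (p - 1) * norm a powr (p - 1) * norm (a - b)"
   using p norm_triangle_ineq2[of a b] by (intro mult_left_mono) auto
  finally show ?thesis by (simp add: algebra_simps)
 qed
 show ?thesis
 proof (cases "norm b \<le> norm a")
  case True
  then show ?thesis using *[OF True] by (simp add: max_def)
 next
  case False
  then show ?thesis using *[of a b] *[of b a] by (simp add: max_def norm_minus_commute)
 qed
qed

section \<open>The nonlinearity as a map on L2\<close>

definition NL :: "real => 'a::euclidean_space L2 => 'a L2" where
 "NL p f = cls (%x. power_nonlinearity p (fn f x))"

text \<open>H^1 balls enter the nonlinear estimates only through these two norms. A modulation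
  changes the H^1 norm but neither of these, so a boosted solution satisfies the same estimates with
  the same constants.\<close>

definition Bq :: "real => real => 'a::euclidean_space L2 set" where
 "Bq q K = {f. ennreal ((norm f)^2) \<le> ennreal K \<and> Lp_nn q f \<le> ennreal K}"

lemma Lp_nn_2: "Lp_nn 2 f = ennreal ((norm f)^2)"
 unfolding Lp_nn_def nn_norm_L2[symmetric] by (simp add: power2_powr)

lemma Lp_nn_cong: "AE x in lborel. norm (fn f x) = norm (fn g x) ==> Lp_nn q f = Lp_nn q g"
 unfolding Lp_nn_def by (intro nn_integral_cong_AE) (auto elim: AE_mp)

lemma Lp_nn_tr: "Lp_nn q (tr h f) = Lp_nn q f"
proof -
 have "Lp_nn q (tr h f) = (NBINT x. ennreal (norm (fn f (x + h)) powr q))"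
  unfolding Lp_nn_def by (intro nn_integral_cong_AE) (use fn_tr[of h f] in eventually_elim, simp)
 also have "... = Lp_nn q f"
  unfolding Lp_nn_def by (rule nn_integral_shift[of "%x. ennreal (norm (fn f x) powr q)"]) measurable
 finally show ?thesis .
qed

lemma Lp_nn_unimod:
 assumes "bmeas m" "\<And>x. norm (m x) = 1" shows "Lp_nn q (mlt m f) = Lp_nn q f"
 by (rule Lp_nn_cong) (use fn_mlt[OF assms(1), of f] in eventually_elim, simp add: norm_mult assms)

lemma Bq_tr[simp]: "tr h f \<in> Bq q K \<longleftrightarrow> f \<in> Bq q K" by (simp add: Bq_def Lp_nn_tr)

lemma Bq_unimod: "bmeas m ==> (\<And>x. norm (m x) = 1) ==> mlt m f \<in> Bq q K \<longleftrightarrow> f \<in> Bq q K"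
 by (simp add: Bq_def Lp_nn_unimod norm_mlt_unimod)

lemma powr_interp:
 fixes y :: real assumes "0 \<le> y" "2 \<le> r" "r \<le> q" shows "y powr r \<le> y\<^sup>2 + y powr q"
proof (cases "y \<le> 1")
 case True
 then have "y powr r \<le> y powr 2" using assms by (intro powr_mono') auto
 also have "... = y\<^sup>2" using assms by (intro power2_powr)
 finally show ?thesis by (simp add: add_increasing2)
next
 case False
 then have "y powr r \<le> y powr q" using assms by (intro powr_mono) auto
 then show ?thesis by (simp add: add_increasing)
qed

lemma cls_sum:
 assumes "finite S" "\<And>j. j \<in> S ==> f j \<in> L2_space"
 shows "(%x. \<Sum>j\<in>S. f j x) \<in> L2_space \<and> cls (%x. \<Sum>j\<in>S. f j x) = (\<Sum>j\<in>S. cls (f j))"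
 using assms
proof (induction S)
 case empty
 then show ?case by (simp add: L2_space_zero zero_L2_def)
next
 case (insert j S)
 then show ?case by (simp add: L2_space_add cls_add)
qed

lemma L1_support:
 assumes E: "E \<in> sets borel" and e: "emeasure lborel E \<le> ennreal (e\<^sup>2)" "0 \<le> e"
  and g: "g \<in> L2_space" and supp: "\<And>x. x \<notin> E ==> g x = 0"
 shows "g \<in> L1_space" "(LBINT x. norm (g x)) \<le> e * norm (cls g)"
proof -
 let ?i = "%x. indicator E x :: complex"
 note [measurable] = L2_space_measurable[OF g] E
 have n: "(NBINT x. ennreal ((norm (?i x))^2)) = emeasure lborel E"
 proof -
  have "(%x. ennreal ((norm (?i x))^2)) = indicator E" by (auto simp: indicator_def fun_eq_iff)
  then show ?thesis using E by simp
 qed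
 have im: "?i \<in> borel_measurable borel" by measurable
 have i2: "?i \<in> L2_space" unfolding L2_space_iff_nn n using im e by (auto intro: le_less_trans)
 have g': "(%x. complex_of_real (norm (g x))) \<in> L2_space"
  by (rule L2_space_bound[OF g]) (auto intro!: measurable_compose[OF _ borel_measurable_continuous_onI[OF continuous_on_of_real[OF continuous_on_id]]])
 have "norm (g x) = ?i x \<bullet> complex_of_real (norm (g x))" for x using supp[of x] by (auto simp: indicator_def inner_complex_def)
 then have eq: "(%x. norm (g x)) = (%x. ?i x \<bullet> complex_of_real (norm (g x)))" by (simp only: fun_eq_iff) blast
 have "integrable lborel (%x. norm (g x))" unfolding eq by (rule integrable_L2_inner[OF i2 g'])
 then show "g \<in> L1_space" unfolding L1_space_def by (simp add: integrable_norm_iff)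
 have "(LBINT x. norm (g x)) = inner (cls ?i) (cls (%x. complex_of_real (norm (g x))))"
  unfolding eq by (rule inner_cls[symmetric, OF i2 g'])
 also have "... \<le> norm (cls ?i) * norm (cls (%x. complex_of_real (norm (g x))))" by (rule norm_cauchy_schwarz)
 also have "norm (cls (%x. complex_of_real (norm (g x)))) = norm (cls g)"
  by (simp only: norm_cls[OF g] norm_cls[OF g'] L2_norm_def norm_of_real abs_norm_cancel)
 also have "norm (cls ?i) \<le> e" by (rule norm_L2_le_cls[OF i2 e(2)]) (simp only: n e)
 finally show "(LBINT x. norm (g x)) \<le> e * norm (cls g)" by (simp add: mult_right_mono)
qed

lemma int_sum_geometric:
 fixes \<rho> :: real assumes "0 \<le> \<rho>" "\<rho> < 1"
 shows "(\<Sum>j\<in>{- int J..int J}. \<rho> ^ nat \<bar>j\<bar>) \<le> 2 / (1 - \<rho>)"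
proof -
 have "(\<Sum>j\<in>{- int J..int J}. \<rho> ^ nat \<bar>j\<bar>) \<le> 2 * (\<Sum>k\<le>J. \<rho> ^ k)"
 proof (induction J)
  case (Suc J)
  have "{- int (Suc J)..int (Suc J)} = insert (int (Suc J)) (insert (- int (Suc J)) {- int J..int J})" by auto
  then have "(\<Sum>j\<in>{- int (Suc J)..int (Suc J)}. \<rho> ^ nat \<bar>j\<bar>) = 2 * \<rho> ^ Suc J + (\<Sum>j\<in>{- int J..int J}. \<rho> ^ nat \<bar>j\<bar>)"
   by (simp add: nat_add_distrib)
  then show ?case using Suc by simp
 qed (use assms in simp)
 also have "(\<Sum>k\<le>J. \<rho> ^ k) \<le> (\<Sum>k. \<rho> ^ k)"
  using assms by (intro sum_le_suminf summable_geometric) auto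
 also have "(\<Sum>k. \<rho> ^ k) = 1 / (1 - \<rho>)" using assms by (intro suminf_geometric) auto
 finally show ?thesis by simp
qed

(* q is a Sobolev exponent for H^1, and theta the weight with which the dispersive estimate is
   interpolated with the trivial L2 bound on each level set. *)
locale nls =
 fixes p q \<theta> :: real and lam :: complex and dom :: "'a::euclidean_space itself"
 assumes p1: "p > 1" and q2p: "2 * p < q"
  and qn: "DIM('a) \<ge> 3 \<longrightarrow> q < 2 * real DIM('a) / (real DIM('a) - 2)"
  and th: "0 < \<theta>" "\<theta> < 1" "\<theta> < p - 1" "2 * (p - 1) < q * \<theta>" "real DIM('a) * \<theta> < 2"
  and lam_neg: "Im lam < 0" and lam_cone: "(p - 1) / (2 * sqrt p) * \<bar>Re lam\<bar> \<le> \<bar>Im lam\<bar>"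
begin

lemma NL_L2:
 fixes f :: "'a L2" assumes f: "f \<in> Bq q K" shows "(%x. power_nonlinearity p (fn f x)) \<in> L2_space"
proof -
 have "(NBINT x. ennreal ((norm (power_nonlinearity p (fn f x)))^2))
  \<le> (NBINT x. ennreal ((norm (fn f x))^2) + ennreal (norm (fn f x) powr q))"
 proof (rule nn_integral_mono)
  fix x
  have "(norm (power_nonlinearity p (fn f x)))^2 = norm (fn f x) powr (2 * p)"
   by (simp add: norm_pn[OF p1] power2_eq_square powr_add[symmetric])
  also have "... \<le> (norm (fn f x))^2 + norm (fn f x) powr q" using p1 q2p by (intro powr_interp) auto
  finally show "ennreal ((norm (power_nonlinearity p (fn f x)))^2) \<le> ennreal ((norm (fn f x))^2) + ennreal (norm (fn f x) powr q)"
   using ennreal_leI by fastforce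
 qed
 also have "... = ennreal ((norm f)^2) + Lp_nn q f"
  unfolding Lp_nn_def nn_norm_L2[symmetric] by (rule nn_integral_add) measurable
 also have "... < \<infinity>" using f by (auto simp: Bq_def intro: le_less_trans)
 finally show ?thesis by (simp add: L2_space_iff_nn)
qed

lemma NL_zero[simp]: "NL p (0::'a L2) = 0"
proof -
 have "Lp_nn q (0::'a L2) = 0" unfolding Lp_nn_def
  by (subst nn_integral_0_iff_AE) (auto intro: AE_mp[OF fn_zero])
 then have "(0::'a L2) \<in> Bq q 1" by (simp add: Bq_def)
 then have "NL p (0::'a L2) = cls (%_. 0)" unfolding NL_def
  by (intro cls_cong[OF NL_L2 L2_space_zero]) (auto intro: AE_mp[OF fn_zero])
 then show ?thesis by (simp add: zero_L2_def)
qed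

lemma NL_diff_cls:
 fixes f g :: "'a L2" assumes "f \<in> Bq q K" "g \<in> Bq q K"
 shows "NL p f - NL p g = cls (%x. power_nonlinearity p (fn f x) - power_nonlinearity p (fn g x))"
 unfolding NL_def by (rule cls_diff[symmetric, OF NL_L2[OF assms(1)] NL_L2[OF assms(2)]])

text \<open>Split at height A. Below it, N is Lipschitz with constant p A^(p-1); above it, the power
  2p is at most A^(2p-q) times the power q because 2p < q. The 8 comes from |f - g| <= 2 max(|f|,
  |g|), squared, and from two functions. Letting A grow gives continuity of N, though no Lipschitz
  bound.\<close>

lemma NL_diff_bound:
 fixes f g :: "'a L2" assumes f: "f \<in> Bq q K" and g: "g \<in> Bq q K" and A: "A > 0" and K: "0 \<le> K"
 shows "(norm (NL p f - NL p g))^2 \<le> p\<^sup>2 * (A powr (2 * (p - 1)) * (norm (f - g))^2 + 8 * K * A powr (2 * p - q))"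
proof -
 let ?m = "%x. max (norm (fn f x)) (norm (fn g x))"
 let ?D = "%x. power_nonlinearity p (fn f x) - power_nonlinearity p (fn g x)"
 have D2: "?D \<in> L2_space" by (intro L2_space_diff NL_L2[OF f] NL_L2[OF g])
 let ?R = "p\<^sup>2 * (A powr (2 * (p - 1)) * (norm (f - g))^2 + 8 * K * A powr (2 * p - q))"
 have "ennreal ((norm (NL p f - NL p g))^2) = (NBINT x. ennreal ((norm (?D x))^2))"
  unfolding NL_diff_cls[OF f g] by (rule nn_norm_cls[symmetric, OF D2])
 also have "... \<le> (NBINT x. ennreal (p\<^sup>2 * A powr (2 * (p - 1))) * ennreal ((norm (fn f x - fn g x))^2)
   + ennreal (p\<^sup>2 * 4 * A powr (2 * p - q)) * (ennreal (norm (fn f x) powr q) + ennreal (norm (fn g x) powr q)))"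
 proof (rule nn_integral_mono)
  fix x
  let ?a = "norm (fn f x)" and ?b = "norm (fn g x)" and ?w = "norm (fn f x - fn g x)"
  have "(norm (?D x))^2 \<le> (p * ?m x powr (p - 1) * ?w)^2" by (intro power_mono pn_diff_le[OF p1]) auto
  also have "... = p\<^sup>2 * (?m x powr (2 * (p - 1)) * ?w\<^sup>2)"
   by (simp add: power_mult_distrib power2_eq_square[of "_ powr _"] powr_add[symmetric] algebra_simps)
  also have "... \<le> p\<^sup>2 * (A powr (2 * (p - 1)) * ?w\<^sup>2 + 4 * A powr (2 * p - q) * (?a powr q + ?b powr q))"
  proof (rule mult_left_mono)
   show "?m x powr (2 * (p - 1)) * ?w\<^sup>2 \<le> A powr (2 * (p - 1)) * ?w\<^sup>2 + 4 * A powr (2 * p - q) * (?a powr q + ?b powr q)"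
   proof (cases "?m x \<le> A")
    case True
    then have "?m x powr (2 * (p - 1)) * ?w\<^sup>2 \<le> A powr (2 * (p - 1)) * ?w\<^sup>2"
     using p1 by (intro mult_right_mono powr_mono2) (auto simp: le_max_iff_disj)
    then show ?thesis by (simp add: add_increasing2)
   next
    case False
    have m0: "?m x > 0" using False A by linarith
    have "?w \<le> ?a + ?b" by (rule norm_triangle_ineq4)
    also have "... \<le> 2 * ?m x" by simp
    finally have "?w\<^sup>2 \<le> (2 * ?m x)^2" by (intro power_mono) auto
    then have "?m x powr (2 * (p - 1)) * ?w\<^sup>2 \<le> ?m x powr (2 * (p - 1)) * (4 * (?m x)^2)"
     by (intro mult_left_mono) (auto simp: power_mult_distrib)
    also have "... = 4 * ?m x powr (2 * p)"
    proof -
     have "?m x powr (2 * (p - 1)) * ?m x powr 2 = ?m x powr (2 * p)" by (simp add: powr_add[symmetric])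
     then show ?thesis using m0 by (simp add: power2_powr)
    qed
    also have "?m x powr (2 * p) = ?m x powr (2 * p - q) * ?m x powr q" by (simp add: powr_add[symmetric])
    also have "... \<le> A powr (2 * p - q) * ?m x powr q"
     using False A q2p by (intro mult_right_mono powr_mono2') auto
    also have "A powr (2 * p - q) * ?m x powr q \<le> A powr (2 * p - q) * (?a powr q + ?b powr q)"
     by (intro mult_left_mono) (auto simp: max_def)
    finally have "?m x powr (2 * (p - 1)) * ?w\<^sup>2 \<le> 4 * (A powr (2 * p - q) * (?a powr q + ?b powr q))" by simp
    then show ?thesis by (simp add: add_increasing)
   qed
  qed simp
  finally have "(norm (?D x))^2 \<le> p\<^sup>2 * A powr (2 * (p - 1)) * ?w\<^sup>2 + p\<^sup>2 * 4 * A powr (2 * p - q) * (?a powr q + ?b powr q)"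
   by (simp add: algebra_simps)
  then have "ennreal ((norm (?D x))^2) \<le> ennreal (p\<^sup>2 * A powr (2 * (p - 1)) * ?w\<^sup>2 + p\<^sup>2 * 4 * A powr (2 * p - q) * (?a powr q + ?b powr q))"
   by (rule ennreal_leI)
  also have "... = ennreal (p\<^sup>2 * A powr (2 * (p - 1))) * ennreal (?w\<^sup>2) + ennreal (p\<^sup>2 * 4 * A powr (2 * p - q)) * (ennreal (?a powr q) + ennreal (?b powr q))"
   by (simp add: ennreal_mult)
  finally show "ennreal ((norm (?D x))^2) \<le> ennreal (p\<^sup>2 * A powr (2 * (p - 1))) * ennreal (?w\<^sup>2) + ennreal (p\<^sup>2 * 4 * A powr (2 * p - q)) * (ennreal (?a powr q) + ennreal (?b powr q))" .
 qed
 also have "... = ennreal (p\<^sup>2 * A powr (2 * (p - 1))) * (NBINT x. ennreal ((norm (fn f x - fn g x))^2))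
   + ennreal (p\<^sup>2 * 4 * A powr (2 * p - q)) * (Lp_nn q f + Lp_nn q g)"
  unfolding Lp_nn_def by (simp add: nn_integral_add nn_integral_cmult)
 also have "(NBINT x. ennreal ((norm (fn f x - fn g x))^2)) = ennreal ((norm (f - g))^2)"
  using nn_norm_cls[OF L2_space_diff[OF fn_L2 fn_L2], of f g] by (simp add: cls_diff)
 also have "ennreal (p\<^sup>2 * A powr (2 * (p - 1))) * ennreal ((norm (f - g))^2) + ennreal (p\<^sup>2 * 4 * A powr (2 * p - q)) * (Lp_nn q f + Lp_nn q g)
  \<le> ennreal (p\<^sup>2 * A powr (2 * (p - 1))) * ennreal ((norm (f - g))^2) + ennreal (p\<^sup>2 * 4 * A powr (2 * p - q)) * (ennreal K + ennreal K)"
  using f g by (intro add_mono mult_left_mono) (auto simp: Bq_def)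
 also have "... = ennreal ?R"
  using K by (simp add: ennreal_mult[symmetric] ennreal_plus[symmetric] algebra_simps del: ennreal_plus)
 finally show ?thesis using K by (subst (asm) ennreal_le_iff) auto
qed

lemma NL_tendsto:
 fixes f :: "nat => 'a L2"
 assumes f: "\<And>k. f k \<in> Bq q K" and g: "g \<in> Bq q K" and K: "0 \<le> K" and lim: "f \<longlonglongrightarrow> g"
 shows "(%k. NL p (f k)) \<longlonglongrightarrow> NL p g"
proof (rule LIM_zero_cancel, rule tendsto_norm_zero_cancel, rule LIMSEQ_I)
 fix e :: real assume e: "0 < e"
 have "((%A. p\<^sup>2 * (8 * K * A powr (2 * p - q))) \<longlongrightarrow> p\<^sup>2 * (8 * K * 0)) at_top"
  using q2p by (intro tendsto_intros tendsto_neg_powr filterlim_ident) auto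
 then have "\<forall>\<^sub>F A in at_top. p\<^sup>2 * (8 * K * A powr (2 * p - q)) < e\<^sup>2 / 2"
  by (rule order_tendstoD) (use e in simp)
 then have "\<forall>\<^sub>F A in at_top. p\<^sup>2 * (8 * K * A powr (2 * p - q)) < e\<^sup>2 / 2 \<and> A > 0"
  using eventually_gt_at_top[of 0] by eventually_elim auto
 then obtain A where A: "p\<^sup>2 * (8 * K * A powr (2 * p - q)) < e\<^sup>2 / 2" "A > 0"
  using eventually_happens'[OF trivial_limit_at_top_linorder] by blast
 have "(%k. p\<^sup>2 * (A powr (2 * (p - 1)) * (norm (f k - g))^2)) \<longlonglongrightarrow> p\<^sup>2 * (A powr (2 * (p - 1)) * (norm (g - g))^2)"
  by (intro tendsto_intros lim)
 then have "\<forall>\<^sub>F k in sequentially. p\<^sup>2 * (A powr (2 * (p - 1)) * (norm (f k - g))^2) < e\<^sup>2 / 2"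
  by (rule order_tendstoD) (use e in simp)
 then obtain N where N: "\<And>k. k \<ge> N ==> p\<^sup>2 * (A powr (2 * (p - 1)) * (norm (f k - g))^2) < e\<^sup>2 / 2"
  by (auto simp: eventually_sequentially)
 have "norm (norm (NL p (f k) - NL p g) - 0) < e" if "k \<ge> N" for k
 proof -
  have "(norm (NL p (f k) - NL p g))^2 < e\<^sup>2"
   using NL_diff_bound[OF f[of k] g A(2) K] N[OF that] A(1) unfolding ring_distribs by linarith
  then show ?thesis using e by (simp add: power2_less_imp_less)
 qed
 then show "\<exists>N. \<forall>k\<ge>N. norm (norm (NL p (f k) - NL p g) - 0) < e" by blast
qed

lemma continuous_on_NL:
 fixes u :: "real => 'a L2"
 assumes "continuous_on S u" "\<And>s. s \<in> S ==> u s \<in> Bq q K" "0 \<le> K"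
 shows "continuous_on S (%s. NL p (u s))"
 unfolding continuous_on_sequentially o_def
proof safe
 fix x a assume x: "\<forall>n. x n \<in> S" "a \<in> S" "x \<longlonglongrightarrow> a"
 have "(%n. u (x n)) \<longlonglongrightarrow> u a" using x assms(1) by (auto intro: continuous_on_tendsto_compose)
 then show "(%n. NL p (u (x n))) \<longlonglongrightarrow> NL p (u a)" using x assms by (intro NL_tendsto[of _ K]) auto
qed

section \<open>Decomposition of N(u) - N(v) over dyadic level sets\<close>

definition lev :: "'a L2 => 'a L2 => 'a => real" where
 "lev u v x = max (norm (fn u x)) (norm (fn v x))"

lemma lev_measurable[measurable]: "lev u v \<in> borel_measurable borel"
 unfolding lev_def[abs_def] by measurable

definition Elev :: "int => 'a L2 => 'a L2 => 'a set" where
 "Elev j u v = {x. 0 < lev u v x \<and> \<lfloor>log 2 (lev u v x)\<rfloor> = j}"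

lemma Elev_sets[measurable]: "Elev j u v \<in> sets borel"
 unfolding Elev_def by measurable

lemma Elev_bounds:
 assumes "x \<in> Elev j u v" shows "2 powr real_of_int j \<le> lev u v x" "lev u v x \<le> 2 powr (real_of_int j + 1)"
proof -
 have l: "0 < lev u v x" "\<lfloor>log 2 (lev u v x)\<rfloor> = j" using assms by (auto simp: Elev_def)
 have "real_of_int j \<le> log 2 (lev u v x)" "log 2 (lev u v x) \<le> real_of_int j + 1" using l(2) by linarith+
 then have "2 powr real_of_int j \<le> 2 powr log 2 (lev u v x)" "2 powr log 2 (lev u v x) \<le> 2 powr (real_of_int j + 1)" by auto
 then show "2 powr real_of_int j \<le> lev u v x" "lev u v x \<le> 2 powr (real_of_int j + 1)" using l(1) by simp_all
qed

definition piece :: "int => 'a L2 => 'a L2 => 'a => complex" where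
 "piece j u v x = indicator (Elev j u v) x * (power_nonlinearity p (fn u x) - power_nonlinearity p (fn v x))"

text \<open>The square root of a Chebyshev bound for the measure of the level set. Exponent 2 is the
  stronger one for j < 0, exponent q for j > 0.\<close>

definition ecoef :: "real => int => real" where
 "ecoef K j = sqrt (2 * K * min (2 powr (- 2 * real_of_int j)) (2 powr (- q * real_of_int j)))"

text \<open>The Lipschitz constant of N for values up to 2^(j+1).\<close>

definition acoef :: "int => real" where
 "acoef j = p * 2 powr ((real_of_int j + 1) * (p - 1))"

lemma acoef_nonneg[simp]: "0 \<le> acoef j" using p1 by (simp add: acoef_def)

lemma ecoef_nonneg[simp]: "0 \<le> K ==> 0 \<le> ecoef K j" by (simp add: ecoef_def min_def)

lemma Elev_emeasure:
 assumes u: "u \<in> Bq q K" and v: "v \<in> Bq q K" and K: "0 \<le> K"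
 shows "emeasure lborel (Elev j u v) \<le> ennreal ((ecoef K j)^2)"
proof -
 have gen: "emeasure lborel (Elev j u v) \<le> ennreal (2 * K * 2 powr (- r * real_of_int j))"
  if r: "r > 0" "Lp_nn r u \<le> ennreal K" "Lp_nn r v \<le> ennreal K" for r
 proof -
  have "emeasure lborel (Elev j u v) \<le> emeasure lborel ({x. 2 powr real_of_int j \<le> \<bar>norm (fn u x)\<bar>} \<union> {x. 2 powr real_of_int j \<le> \<bar>norm (fn v x)\<bar>})"
  proof (rule emeasure_mono)
   show "Elev j u v \<subseteq> {x. 2 powr real_of_int j \<le> \<bar>norm (fn u x)\<bar>} \<union> {x. 2 powr real_of_int j \<le> \<bar>norm (fn v x)\<bar>}"
    using Elev_bounds(1) by (auto simp: lev_def le_max_iff_disj)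
  qed measurable
  also have "... \<le> emeasure lborel {x. 2 powr real_of_int j \<le> \<bar>norm (fn u x)\<bar>} + emeasure lborel {x. 2 powr real_of_int j \<le> \<bar>norm (fn v x)\<bar>}"
   by (rule emeasure_subadditive) measurable
  also have "... \<le> ennreal (K * (2 powr real_of_int j) powr (- r)) + ennreal (K * (2 powr real_of_int j) powr (- r))"
   using r by (intro add_mono emeasure_level_le) (auto simp: Lp_nn_def)
  also have "... = ennreal (2 * K * 2 powr (- r * real_of_int j))"
   using K by (subst ennreal_plus[symmetric]) (auto simp: powr_powr mult.commute)
  finally show ?thesis .
 qed
 have "emeasure lborel (Elev j u v) \<le> min (ennreal (2 * K * 2 powr (- 2 * real_of_int j))) (ennreal (2 * K * 2 powr (- q * real_of_int j)))"
  using gen[of 2] gen[of q] u v p1 q2p by (simp add: Bq_def Lp_nn_2)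
 also have "... = ennreal ((ecoef K j)^2)"
  using K by (auto simp: ecoef_def min_def mult_left_mono ennreal_le_iff mult_le_cancel_left)
 finally show ?thesis .
qed

lemma piece_bounds:
 assumes u: "u \<in> Bq q K" and v: "v \<in> Bq q K" and K: "0 \<le> K"
 shows "piece j u v \<in> L2_space" "norm (cls (piece j u v)) \<le> acoef j * norm (u - v)"
  "piece j u v \<in> L1_space" "(LBINT x. norm (piece j u v x)) \<le> ecoef K j * (acoef j * norm (u - v))"
proof -
 have D2: "(%x. power_nonlinearity p (fn u x) - power_nonlinearity p (fn v x)) \<in> L2_space"
  by (intro L2_space_diff NL_L2[OF u] NL_L2[OF v])
 show 1: "piece j u v \<in> L2_space"
  unfolding piece_def[abs_def] by (rule L2_space_mult[OF D2, where B=1]) (auto simp: indicator_def)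
 have pt: "norm (piece j u v x) \<le> acoef j * norm (fn u x - fn v x)" for x
 proof (cases "x \<in> Elev j u v")
  case True
  have "norm (piece j u v x) \<le> p * lev u v x powr (p - 1) * norm (fn u x - fn v x)"
   using True pn_diff_le[OF p1] by (simp add: piece_def lev_def)
  also have "... \<le> acoef j * norm (fn u x - fn v x)"
  proof (rule mult_right_mono)
   have "lev u v x powr (p - 1) \<le> (2 powr (real_of_int j + 1)) powr (p - 1)"
    using Elev_bounds[OF True] p1 by (intro powr_mono2) (auto simp: lev_def le_max_iff_disj)
   then show "p * lev u v x powr (p - 1) \<le> acoef j" using p1 by (simp add: acoef_def powr_powr mult_left_mono)
  qed simp
  finally show ?thesis .
 qed (simp add: piece_def)
 have w: "(%x. fn u x - fn v x) \<in> L2_space" by (intro L2_space_diff) auto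
 show 2: "norm (cls (piece j u v)) \<le> acoef j * norm (u - v)"
 proof (rule norm_L2_le_cls[OF 1])
  have "(NBINT x. ennreal ((norm (piece j u v x))^2)) \<le> (NBINT x. ennreal ((acoef j)^2) * ennreal ((norm (fn u x - fn v x))^2))"
   by (intro nn_integral_mono) (use power_mono[OF pt] in \<open>auto simp: ennreal_mult[symmetric] power_mult_distrib intro!: ennreal_leI\<close>)
  also have "... = ennreal ((acoef j)^2) * (NBINT x. ennreal ((norm (fn u x - fn v x))^2))"
   by (rule nn_integral_cmult) measurable
  also have "... = ennreal ((acoef j * norm (u - v))^2)"
   using nn_norm_cls[OF w] by (simp add: cls_diff ennreal_mult[symmetric] power_mult_distrib)
  finally show "(NBINT x. ennreal ((norm (piece j u v x))^2)) \<le> ennreal ((acoef j * norm (u - v))^2)" .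
 qed simp
 note S = L1_support[OF Elev_sets[of j u v] Elev_emeasure[OF u v K, of j] ecoef_nonneg[OF K, of j] 1]
 show "piece j u v \<in> L1_space" by (rule S) (simp add: piece_def)
 have "(LBINT x. norm (piece j u v x)) \<le> ecoef K j * norm (cls (piece j u v))" by (rule S) (simp add: piece_def)
 also have "... \<le> ecoef K j * (acoef j * norm (u - v))" by (intro mult_left_mono 2) (simp add: K)
 finally show "(LBINT x. norm (piece j u v x)) \<le> ecoef K j * (acoef j * norm (u - v))" .
qed

lemma pieces_tendsto:
 assumes u: "u \<in> Bq q K" and v: "v \<in> Bq q K" and K: "0 \<le> K"
 shows "(%J. \<Sum>j\<in>{- int J..int J}. cls (piece j u v)) \<longlonglongrightarrow> NL p u - NL p v"
proof -
 let ?D = "%x. power_nonlinearity p (fn u x) - power_nonlinearity p (fn v x)"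
 have D2: "?D \<in> L2_space" by (intro L2_space_diff NL_L2[OF u] NL_L2[OF v])
 have s: "(%x. \<Sum>j\<in>{- int J..int J}. piece j u v x) \<in> L2_space \<and> cls (%x. \<Sum>j\<in>{- int J..int J}. piece j u v x) = (\<Sum>j\<in>{- int J..int J}. cls (piece j u v))" for J
  by (rule cls_sum) (auto intro: piece_bounds[OF u v K])
 have eq: "(\<Sum>j\<in>{- int J..int J}. piece j u v x) = (if 0 < lev u v x \<and> \<lfloor>log 2 (lev u v x)\<rfloor> \<in> {- int J..int J} then ?D x else 0)" for J x
 proof -
  have "(\<Sum>j\<in>{- int J..int J}. piece j u v x) = (\<Sum>j\<in>{- int J..int J}. if j = \<lfloor>log 2 (lev u v x)\<rfloor> then (if 0 < lev u v x then ?D x else 0) else 0)"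
   by (intro sum.cong refl) (auto simp: piece_def Elev_def indicator_def)
  then show ?thesis by (simp add: sum.delta')
 qed
 have "(%J. cls (%x. \<Sum>j\<in>{- int J..int J}. piece j u v x)) \<longlonglongrightarrow> cls ?D"
 proof (rule cls_tendsto(2)[OF _ _ D2])
  show "(%x. \<Sum>j\<in>{- int J..int J}. piece j u v x) \<in> L2_space" for J using s by blast
  show "?D \<in> borel_measurable borel" by measurable
  show "AE x in lborel. norm (\<Sum>j\<in>{- int J..int J}. piece j u v x) \<le> norm (?D x)" for J by (rule AE_I2) (simp add: eq)
  show "AE x in lborel. (%J. \<Sum>j\<in>{- int J..int J}. piece j u v x) \<longlonglongrightarrow> ?D x"
  proof (rule AE_I2, rule tendsto_eventually)
   fix x
   show "\<forall>\<^sub>F J in sequentially. (\<Sum>j\<in>{- int J..int J}. piece j u v x) = ?D x"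
   proof (cases "0 < lev u v x")
    case True
    show ?thesis using eventually_ge_at_top[of "nat \<bar>\<lfloor>log 2 (lev u v x)\<rfloor>\<bar>"]
     by eventually_elim (use True in \<open>auto simp: eq\<close>)
   next
    case False
    then have "fn u x = 0 \<and> fn v x = 0" by (auto simp: lev_def not_less max_def split: if_splits)
    then show ?thesis by (simp add: piece_def)
   qed
  qed
 qed
 then show ?thesis by (simp only: s NL_diff_cls[OF u v])
qed

text \<open>What remains of the dispersive decay |t|^(-n/2) after interpolation with weight theta;
  below 1, the singularity at t = 0 is integrable.\<close>

definition \<beta> :: real where "\<beta> = real DIM('a) * \<theta> / 2"

lemma \<beta>: "0 < \<beta>" "\<beta> < 1" using th by (auto simp: \<beta>_def)

text \<open>For j >= 0 the product is at most a multiple of 2^(j (p - 1 - q theta/2)), for j < 0 of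
  2^(j (p - 1 - theta)). The two conditions that tie theta to p and q make both decay as |j| grows;
  eta is the smaller rate.\<close>

lemma coef_bound:
 assumes K: "0 \<le> K"
 obtains c \<rho> where "0 \<le> c" "0 \<le> \<rho>" "\<rho> < 1" "\<And>j. acoef j * ecoef K j powr \<theta> \<le> c * \<rho> ^ nat \<bar>j\<bar>"
proof -
 define \<eta> where "\<eta> = min (q * \<theta> / 2 - (p - 1)) (p - 1 - \<theta>)"
 have \<eta>: "\<eta> > 0" using th by (auto simp: \<eta>_def)
 define \<rho> where "\<rho> = 2 powr (- \<eta>)"
 have \<rho>: "0 \<le> \<rho>" "\<rho> < 1"
 proof -
  have "2 powr (- \<eta>) < 2 powr 0" using \<eta> by (simp only: powr_less_cancel_iff)
  then show "\<rho> < 1" by (simp add: \<rho>_def)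
 qed (simp add: \<rho>_def)
 define c where "c = p * 2 powr (p - 1) * (2 * K) powr (\<theta> / 2)"
 have "acoef j * ecoef K j powr \<theta> \<le> c * \<rho> ^ nat \<bar>j\<bar>" for j
 proof -
  let ?j = "real_of_int j"
  have e: "ecoef K j powr \<theta> = (2 * K) powr (\<theta> / 2) * (min (2 powr (- 2 * ?j)) (2 powr (- q * ?j))) powr (\<theta> / 2)"
   using K by (simp add: ecoef_def powr_half_sqrt[symmetric] powr_powr powr_mult min_def)
  have mle: "2 powr (?j * (p - 1)) * (min (2 powr (- 2 * ?j)) (2 powr (- q * ?j))) powr (\<theta> / 2) \<le> 2 powr (?j * (p - 1)) * 2 powr (- r * ?j * (\<theta> / 2))"
   if "r = 2 \<or> r = q" for r
  proof -
   have "(min (2 powr (- 2 * ?j)) (2 powr (- q * ?j))) powr (\<theta> / 2) \<le> (2 powr (- r * ?j)) powr (\<theta> / 2)"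
    using that th by (intro powr_mono2) (auto simp: min_def)
   then show ?thesis by (simp add: powr_powr mult_left_mono)
  qed
  have "2 powr (?j * (p - 1)) * (min (2 powr (- 2 * ?j)) (2 powr (- q * ?j))) powr (\<theta> / 2) \<le> 2 powr (- \<eta> * real (nat \<bar>j\<bar>))"
  proof (cases "j \<ge> 0")
   case True
   have "2 powr (?j * (p - 1)) * 2 powr (- q * ?j * (\<theta> / 2)) = 2 powr (?j * (p - 1 - q * \<theta> / 2))"
    by (simp add: powr_add[symmetric] algebra_simps)
   also have "... \<le> 2 powr (- \<eta> * real (nat \<bar>j\<bar>))"
   proof (rule powr_mono)
    have "?j * (p - 1 - q * \<theta> / 2) \<le> ?j * (- \<eta>)" using True by (intro mult_left_mono) (auto simp: \<eta>_def)
    then show "?j * (p - 1 - q * \<theta> / 2) \<le> - \<eta> * real (nat \<bar>j\<bar>)" using True by (simp add: mult.commute)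
   qed simp
   finally show ?thesis by (rule order_trans[OF mle[OF disjI2[OF refl]]])
  next
   case False
   have "2 powr (?j * (p - 1)) * 2 powr (- 2 * ?j * (\<theta> / 2)) = 2 powr ((- ?j) * (- (p - 1 - \<theta>)))"
    by (simp add: powr_add[symmetric] algebra_simps)
   also have "... \<le> 2 powr (- \<eta> * real (nat \<bar>j\<bar>))"
   proof (rule powr_mono)
    have "(- ?j) * (- (p - 1 - \<theta>)) \<le> (- ?j) * (- \<eta>)" using False by (intro mult_left_mono) (auto simp: \<eta>_def)
    then show "(- ?j) * (- (p - 1 - \<theta>)) \<le> - \<eta> * real (nat \<bar>j\<bar>)" using False by (simp add: mult.commute)
   qed simp
   finally show ?thesis by (rule order_trans[OF mle[OF disjI1[OF refl]]])
  qed
  also have "2 powr (- \<eta> * real (nat \<bar>j\<bar>)) = \<rho> ^ nat \<bar>j\<bar>" by (simp add: \<rho>_def powr_realpow[symmetric] powr_powr)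
  finally have "c * (2 powr (?j * (p - 1)) * (min (2 powr (- 2 * ?j)) (2 powr (- q * ?j))) powr (\<theta> / 2)) \<le> c * \<rho> ^ nat \<bar>j\<bar>"
   using p1 by (intro mult_left_mono) (auto simp: c_def)
  moreover have "acoef j * ecoef K j powr \<theta> = c * (2 powr (?j * (p - 1)) * (min (2 powr (- 2 * ?j)) (2 powr (- q * ?j))) powr (\<theta> / 2))"
  proof -
   have "2 powr ((?j + 1) * (p - 1)) = 2 powr (p - 1) * 2 powr (?j * (p - 1))" by (simp add: powr_add[symmetric] algebra_simps)
   then show ?thesis unfolding acoef_def e c_def by (simp only: mult_ac)
  qed
  ultimately show ?thesis by simp
 qed
 then show thesis using p1 by (intro that[of c \<rho>] \<rho>) (auto simp: c_def)
qed

(* Bilinear interpolation between the L2 bound and the dispersive bound, level set by level set. *)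
lemma key_bilinear:
 assumes K: "0 \<le> K"
 obtains C where "0 \<le> C" "\<And>u1 u2 v1 v2 t. u1 \<in> Bq q K ==> u2 \<in> Bq q K ==> v1 \<in> Bq q K ==> v2 \<in> Bq q K ==> t \<noteq> 0 ==>
  \<bar>inner (NL p u1 - NL p u2) (U t (NL p v1 - NL p v2) :: 'a L2)\<bar> \<le> C * \<bar>t\<bar> powr (- \<beta>) * norm (u1 - u2) * norm (v1 - v2)"
proof -
 obtain c \<rho> where c: "0 \<le> c" "0 \<le> \<rho>" "\<rho> < 1" "\<And>j. acoef j * ecoef K j powr \<theta> \<le> c * \<rho> ^ nat \<bar>j\<bar>"
  using coef_bound[OF K] by blast
 define S where "S = c * (2 / (1 - \<rho>))"
 have S0: "0 \<le> S" using c by (simp add: S_def)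
 have sumS: "(\<Sum>j\<in>{- int J..int J}. acoef j * ecoef K j powr \<theta>) \<le> S" for J
 proof -
  have "(\<Sum>j\<in>{- int J..int J}. acoef j * ecoef K j powr \<theta>) \<le> c * (\<Sum>j\<in>{- int J..int J}. \<rho> ^ nat \<bar>j\<bar>)"
   unfolding sum_distrib_left by (intro sum_mono c)
  also have "... \<le> S" unfolding S_def using c by (intro mult_left_mono int_sum_geometric) auto
  finally show ?thesis .
 qed
 define d where "d = disp_const TYPE('a) powr \<theta>"
 have d0: "0 \<le> d" by (simp add: d_def)
 have main: "\<bar>inner (NL p u1 - NL p u2) (U t (NL p v1 - NL p v2) :: 'a L2)\<bar> \<le> d * S * S * \<bar>t\<bar> powr (- \<beta>) * norm (u1 - u2) * norm (v1 - v2)"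
  if u: "u1 \<in> Bq q K" "u2 \<in> Bq q K" and v: "v1 \<in> Bq q K" "v2 \<in> Bq q K" and t: "t \<noteq> 0" for u1 u2 v1 v2 t
 proof (rule LIMSEQ_le_const2)
  let ?F = "%j. cls (piece j u1 u2)" and ?G = "%j. cls (piece j v1 v2)"
  show "(%J. \<bar>inner (\<Sum>j\<in>{- int J..int J}. ?F j) (U t (\<Sum>j\<in>{- int J..int J}. ?G j))\<bar>) \<longlonglongrightarrow> \<bar>inner (NL p u1 - NL p u2) (U t (NL p v1 - NL p v2))\<bar>"
   by (intro tendsto_rabs tendsto_inner pieces_tendsto[OF u K] bounded_linear.tendsto[OF bounded_linear_U] pieces_tendsto[OF v K])
  have pw: "\<bar>inner (?F j) (U t (?G k))\<bar> \<le> (d * \<bar>t\<bar> powr (- \<beta>) * norm (u1 - u2) * norm (v1 - v2)) * ((acoef j * ecoef K j powr \<theta>) * (acoef k * ecoef K k powr \<theta>))" for j k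
  proof -
   let ?P = "(acoef j * norm (u1 - u2)) * (acoef k * norm (v1 - v2))"
   let ?y = "disp_const TYPE('a) * \<bar>t\<bar> powr (- real DIM('a) / 2) * (ecoef K j * ecoef K k)"
   have y0: "0 \<le> ?y" using K by simp
   have P0: "0 \<le> ?P" by simp
   have b1: "\<bar>inner (?F j) (U t (?G k))\<bar> \<le> ?P"
   proof -
    have "\<bar>inner (?F j) (U t (?G k))\<bar> \<le> norm (?F j) * norm (U t (?G k))" by (rule Cauchy_Schwarz_ineq2)
    also have "... \<le> ?P" unfolding norm_U by (intro mult_mono piece_bounds[OF u K] piece_bounds[OF v K]) auto
    finally show ?thesis .
   qed
   have b2: "\<bar>inner (?F j) (U t (?G k))\<bar> \<le> ?P * ?y"
   proof -
    have "\<bar>inner (?F j) (U t (?G k))\<bar> \<le> disp_const TYPE('a) * \<bar>t\<bar> powr (- real DIM('a) / 2) * (LBINT x. norm (piece j u1 u2 x)) * (LBINT x. norm (piece k v1 v2 x))"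
     by (intro dispersive piece_bounds[OF u K] piece_bounds[OF v K] t)
    also have "... \<le> disp_const TYPE('a) * \<bar>t\<bar> powr (- real DIM('a) / 2) * (ecoef K j * (acoef j * norm (u1 - u2))) * (ecoef K k * (acoef k * norm (v1 - v2)))"
     using K by (intro mult_mono piece_bounds[OF u K] piece_bounds[OF v K] order_refl) auto
    also have "... = ?P * ?y" by (simp only: mult_ac)
    finally show ?thesis .
   qed
   \<comment> \<open>Interpolation in its simplest form: min(1, y) <= y^theta for y >= 0 and 0 <
     theta < 1.\<close>
   have "\<bar>inner (?F j) (U t (?G k))\<bar> \<le> ?P * ?y powr \<theta>"
   proof (cases "?y \<le> 1")
    case True
    then have "?y \<le> ?y powr \<theta>"
     using y0 th powr_mono'[of \<theta> 1 ?y] by (cases "?y = 0") auto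
    then have "?P * ?y \<le> ?P * ?y powr \<theta>" using P0 by (intro mult_left_mono) auto
    then show ?thesis using b2 by linarith
   next
    case False
    then have "1 \<le> ?y powr \<theta>" using th by (intro ge_one_powr_ge_zero) auto
    then have "?P * 1 \<le> ?P * ?y powr \<theta>" using P0 by (intro mult_left_mono) auto
    then show ?thesis using b1 by linarith
   qed
   also have "?y powr \<theta> = d * \<bar>t\<bar> powr (- \<beta>) * (ecoef K j powr \<theta> * ecoef K k powr \<theta>)"
   proof -
    have "?y powr \<theta> = disp_const TYPE('a) powr \<theta> * (\<bar>t\<bar> powr (- real DIM('a) / 2)) powr \<theta> * (ecoef K j powr \<theta> * ecoef K k powr \<theta>)"
     using K by (simp add: powr_mult)
    moreover have "(\<bar>t\<bar> powr (- real DIM('a) / 2)) powr \<theta> = \<bar>t\<bar> powr (- \<beta>)" by (simp add: powr_powr \<beta>_def)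
    ultimately show ?thesis by (simp only: d_def)
   qed
   finally show ?thesis by (simp only: mult_ac)
  qed
  have "\<bar>inner (\<Sum>j\<in>{- int J..int J}. ?F j) (U t (\<Sum>j\<in>{- int J..int J}. ?G j))\<bar> \<le> d * S * S * \<bar>t\<bar> powr (- \<beta>) * norm (u1 - u2) * norm (v1 - v2)" for J
  proof -
   let ?I = "{- int J..int J}" and ?c = "%j. acoef j * ecoef K j powr \<theta>"
   let ?X = "d * \<bar>t\<bar> powr (- \<beta>) * norm (u1 - u2) * norm (v1 - v2)"
   have X0: "0 \<le> ?X" using d0 by simp
   have "inner (\<Sum>j\<in>?I. ?F j) (U t (\<Sum>j\<in>?I. ?G j)) = (\<Sum>j\<in>?I. \<Sum>k\<in>?I. inner (?F j) (U t (?G k)))"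
    by (simp only: linear_sum[OF bounded_linear.linear[OF bounded_linear_U]], subst inner_sum_left) (simp only: inner_sum_right)
   also have "\<bar>...\<bar> \<le> (\<Sum>j\<in>?I. \<Sum>k\<in>?I. \<bar>inner (?F j) (U t (?G k))\<bar>)"
    by (rule order_trans[OF sum_abs]) (intro sum_mono sum_abs)
   also have "... \<le> (\<Sum>j\<in>?I. \<Sum>k\<in>?I. ?X * (?c j * ?c k))" by (intro sum_mono pw)
   also have "... = ?X * ((\<Sum>j\<in>?I. ?c j) * (\<Sum>k\<in>?I. ?c k))"
    by (subst sum_product) (simp only: sum_distrib_left)
   also have "... \<le> ?X * (S * S)"
    using X0 S0 by (intro mult_left_mono mult_mono sumS sum_nonneg) auto
   finally show ?thesis by (simp only: mult_ac)
  qed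
  then show "\<exists>N. \<forall>n\<ge>N. \<bar>inner (\<Sum>j\<in>{- int n..int n}. ?F j) (U t (\<Sum>j\<in>{- int n..int n}. ?G j))\<bar> \<le> d * S * S * \<bar>t\<bar> powr (- \<beta>) * norm (u1 - u2) * norm (v1 - v2)"
   by blast
 qed
 show thesis by (rule that[of "d * S * S"]) (use main d0 S0 in auto)
qed

end

section \<open>Solutions in the interaction picture\<close>

lemma has_integral_singular:
 fixes a t \<beta> :: real
 assumes "a \<le> t" "\<beta> < 1"
 shows "((%s. (t - s) powr (- \<beta>)) has_integral (t - a) powr (1 - \<beta>) / (1 - \<beta>)) {a..t}"
proof -
 have "((%s. (t - s) powr (- \<beta>)) has_integral (- ((t - t) powr (1 - \<beta>) / (1 - \<beta>)) - (- ((t - a) powr (1 - \<beta>) / (1 - \<beta>))))) {a..t}"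
 proof (rule fundamental_theorem_of_calculus_interior[OF assms(1)])
  show "continuous_on {a..t} (%s. - ((t - s) powr (1 - \<beta>) / (1 - \<beta>)))"
   using assms(2) by (intro continuous_intros continuous_on_powr') auto
  fix s assume "s \<in> {a<..<t}"
  then have pos: "t - s > 0" by simp
  have "((%s. t - s) has_real_derivative - 1) (at s)" by (auto intro!: derivative_eq_intros)
  from DERIV_chain2[OF has_real_derivative_powr[OF pos] this]
  have "((%s. (t - s) powr (1 - \<beta>)) has_real_derivative (1 - \<beta>) * (t - s) powr (1 - \<beta> - 1) * - 1) (at s)" .
  from DERIV_minus[OF DERIV_cdivide[OF this, of "1 - \<beta>"]]
  have "((%s. - ((t - s) powr (1 - \<beta>) / (1 - \<beta>))) has_real_derivative (t - s) powr (- \<beta>)) (at s)"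
   using assms(2) by simp
  then show "((%s. - ((t - s) powr (1 - \<beta>) / (1 - \<beta>))) has_vector_derivative (t - s) powr (- \<beta>)) (at s)"
   by (simp add: has_real_derivative_iff_has_vector_derivative)
 qed
 then show ?thesis by simp
qed

(* Differentiating the squared norm of the primitive of g leaves a one-dimensional integrable singularity. *)
lemma tt_star:
 fixes g :: "real => 'b::{real_inner,banach}"
 assumes ab: "a \<le> b" and g: "continuous_on {a..b} g" and C: "0 \<le> C" and \<beta>: "\<beta> < 1"
  and le: "\<And>s t. a \<le> s ==> s < t ==> t \<le> b ==> inner (g t) (g s) \<le> C * (t - s) powr (- \<beta>)"
 shows "(norm (integral {a..b} g))^2 \<le> 2 * C / (1 - \<beta>) * (b - a) powr (2 - \<beta>)"
proof -
 define E where "E t = integral {a..t} g" for t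
 have E': "(E has_vector_derivative g t) (at t within {a..b})" if "t \<in> {a..b}" for t
  unfolding E_def[abs_def] by (rule integral_has_vector_derivative[OF g that])
 have h': "((%t. inner (E t) (E t)) has_vector_derivative 2 * inner (g t) (E t)) (at t within {a..b})" if "t \<in> {a..b}" for t
  using bounded_bilinear.has_vector_derivative[OF bounded_bilinear_inner E'[OF that] E'[OF that]]
  by (simp add: inner_commute)
 have ftc: "((%t. 2 * inner (g t) (E t)) has_integral (inner (E b) (E b) - inner (E a) (E a))) {a..b}"
  by (rule fundamental_theorem_of_calculus[OF ab h'])
 have bd: "2 * inner (g t) (E t) \<le> 2 * C / (1 - \<beta>) * (b - a) powr (1 - \<beta>)" if t: "t \<in> {a..b}" for t
 proof -
  have gt: "continuous_on {a..t} g" using g t by (auto intro: continuous_on_subset)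
  have "((%s. inner (g t) (g s)) has_integral inner (g t) (E t)) {a..t}"
   unfolding E_def using has_integral_linear[OF integrable_integral[OF integrable_continuous_real[OF gt]] bounded_linear_inner_right[of "g t"]]
   by (simp add: o_def)
  \<comment> \<open>At s = t the power of zero evaluates to 0, whereas the square of |g t| may be
    positive; the majorant is changed at this single point so that the comparison holds
    everywhere.\<close>
  moreover have "((%s. if s = t then inner (g t) (g t) else C * (t - s) powr (- \<beta>)) has_integral C * ((t - a) powr (1 - \<beta>) / (1 - \<beta>))) {a..t}"
  proof (rule has_integral_spike_finite[of "{t}"])
   show "((%s. C * (t - s) powr (- \<beta>)) has_integral C * ((t - a) powr (1 - \<beta>) / (1 - \<beta>))) {a..t}"
    using t \<beta> by (intro has_integral_mult_right has_integral_singular) auto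
  qed auto
  ultimately have "inner (g t) (E t) \<le> C * ((t - a) powr (1 - \<beta>) / (1 - \<beta>))"
   by (rule has_integral_le) (use le t in auto)
  also have "... \<le> C * ((b - a) powr (1 - \<beta>) / (1 - \<beta>))"
   using t \<beta> C by (intro mult_left_mono divide_right_mono powr_mono2) auto
  finally show ?thesis by simp
 qed
 have "((%_. 2 * C / (1 - \<beta>) * (b - a) powr (1 - \<beta>)) has_integral (b - a) *\<^sub>R (2 * C / (1 - \<beta>) * (b - a) powr (1 - \<beta>))) {a..b}"
  using has_integral_const_real[of "2 * C / (1 - \<beta>) * (b - a) powr (1 - \<beta>)" a b] ab by simp
 then have "inner (E b) (E b) - inner (E a) (E a) \<le> (b - a) *\<^sub>R (2 * C / (1 - \<beta>) * (b - a) powr (1 - \<beta>))"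
  by (rule has_integral_le[OF ftc]) (rule bd)
 moreover have "E a = 0" by (simp add: E_def)
 ultimately have "(norm (E b))^2 \<le> (b - a) * (2 * C / (1 - \<beta>) * (b - a) powr (1 - \<beta>))"
  using ab by (simp add: power2_norm_eq_inner)
 also have "... = 2 * C / (1 - \<beta>) * ((b - a) powr 1 * (b - a) powr (1 - \<beta>))" using ab by (cases "a = b") auto
 also have "(b - a) powr 1 * (b - a) powr (1 - \<beta>) = (b - a) powr (1 + (1 - \<beta>))" by (rule powr_add[symmetric])
 also have "1 + (1 - \<beta>) = 2 - \<beta>" by simp
 finally show ?thesis by (simp add: E_def)
qed

lemma inner_mlt_const: "inner (mlt (%_. c) f) (mlt (%_. c) g) = (norm c)^2 * inner f g"
proof -
 have "mlt (%_. cnj c * c) g = (norm c)^2 *\<^sub>R g"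
 proof (rule L2_eqI, use fn_mlt[OF bmeas_const[of "cnj c * c"], of g] fn_scaleR[of "(norm c)^2" g] in eventually_elim)
  fix x assume "fn (mlt (%_. cnj c * c) g) x = cnj c * c * fn g x" "fn ((norm c)^2 *\<^sub>R g) x = (norm c)^2 *\<^sub>R fn g x"
  then show "fn (mlt (%_. cnj c * c) g) x = fn ((norm c)^2 *\<^sub>R g) x"
   using complex_norm_square[of c] by (simp add: scaleR_conv_of_real mult.commute)
 qed
 then show ?thesis by (simp add: inner_mlt mlt_mlt)
qed

(* The cone condition on lam is exactly what makes -i lam |z|^(p-1) z dissipative
  (Liskevich and Perelmuter): along a segment avoiding 0 the derivative is a quadratic form. *)
lemma pn_monotone:
 fixes a b lam :: complex
 assumes p: "p > 1" and lam: "Im lam < 0" "(p - 1) / (2 * sqrt p) * \<bar>Re lam\<bar> \<le> \<bar>Im lam\<bar>"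
 shows "(a - b) \<bullet> (- \<i> * lam * (power_nonlinearity p a - power_nonlinearity p b)) \<le> 0"
proof (cases "Im (a * cnj b) = 0")
 \<comment> \<open>Here a and b are real multiples of one number and the segment between them may
   pass through 0, where N need not be differentiable. The cross term with Re lam vanishes, and
   monotonicity of r -> r^p suffices.\<close>
 case True
 let ?r = "norm a" and ?s = "norm b"
 let ?P = "?r powr (p - 1)" and ?Q = "?s powr (p - 1)"
 define X where "X = ?P * ?r\<^sup>2 + ?Q * ?s\<^sup>2 - (?P + ?Q) * Re (a * cnj b)"
 have "(a - b) \<bullet> (- \<i> * lam * (power_nonlinearity p a - power_nonlinearity p b)) = Im lam * X + Re lam * ((?Q - ?P) * Im (a * cnj b))"
  unfolding X_def power_nonlinearity_def inner_complex_def cmod_power2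
  by (simp add: algebra_simps power2_eq_square)
 also have "... = Im lam * X" using True by simp
 also have "... \<le> 0"
 proof (rule mult_nonpos_nonneg)
  have "Re (a * cnj b) \<le> ?r * ?s" using complex_Re_le_cmod[of "a * cnj b"] by (simp add: norm_mult)
  then have "(?P + ?Q) * Re (a * cnj b) \<le> (?P + ?Q) * (?r * ?s)" by (intro mult_left_mono) auto
  moreover have "0 \<le> (?P * ?r - ?Q * ?s) * (?r - ?s)"
  proof (cases "?s \<le> ?r")
   case True
   then have "?Q \<le> ?P" using p by (intro powr_mono2) auto
   then have "?Q * ?s \<le> ?P * ?r" using True by (intro mult_mono) auto
   then show ?thesis using True by simp
  next
   case False
   then have "?P \<le> ?Q" using p by (intro powr_mono2) auto
   then have "?P * ?r \<le> ?Q * ?s" using False by (intro mult_mono) auto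
   then show ?thesis using False by (intro mult_nonpos_nonpos) auto
  qed
  ultimately show "0 \<le> X" by (simp add: X_def algebra_simps power2_eq_square)
 qed (use lam in simp)
 finally show ?thesis .
next
 case False
 define w where "w = a - b"
 define z where "z t = b + of_real t * w" for t
 define N where "N t = (norm (z t))^2" for t
 have z0: "z t \<noteq> 0" for t
 proof
  assume "z t = 0"
  then have b: "b = - of_real t * w" by (simp add: z_def add_eq_0_iff)
  have "a = w + b" by (simp add: w_def)
  also have "... = of_real (1 - t) * w" by (subst b) (simp add: algebra_simps)
  finally have a: "a = of_real (1 - t) * w" .
  have "a * cnj b = of_real (- t * (1 - t)) * (w * cnj w)" by (subst a, subst b) (simp add: algebra_simps)
  then have "Im (a * cnj b) = 0" by (simp add: complex_norm_square[symmetric] del: of_real_mult)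
  then show False using False by simp
 qed
 have N0: "N t > 0" for t using z0 by (simp add: N_def)
 have Neq: "N t = (Re b + t * Re w)^2 + (Im b + t * Im w)^2" for t by (simp add: N_def z_def cmod_power2)
 define \<phi> where "\<phi> t = w \<bullet> (- \<i> * lam * power_nonlinearity p (z t))" for t
 have pnz: "power_nonlinearity p (z t) = of_real (N t powr ((p - 1) / 2)) * z t" for t
 proof -
  have "norm (z t) powr (p - 1) = N t powr ((p - 1) / 2)"
  proof -
   have "N t = norm (z t) powr 2" by (simp add: N_def power2_powr)
   then have "N t powr ((p - 1) / 2) = norm (z t) powr (2 * ((p - 1) / 2))" by (simp only: powr_powr)
   also have "2 * ((p - 1) / 2) = p - 1" by simp
   finally show ?thesis ..
  qed
  then show ?thesis by (simp add: power_nonlinearity_def)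
 qed
 define \<psi> where "\<psi> t = Im lam * (Re w * (Re b + t * Re w) + Im w * (Im b + t * Im w)) + Re lam * (Re w * (Im b + t * Im w) - Im w * (Re b + t * Re w))" for t
 have \<phi>: "\<phi> t = N t powr ((p - 1) / 2) * \<psi> t" for t
  unfolding \<phi>_def pnz \<psi>_def by (simp add: z_def inner_complex_def algebra_simps)
 \<comment> \<open>These are the components of z along and across w, each multiplied by |w|, so
   their squares add up to |z|^2 |w|^2. They diagonalize the derivative of N.\<close>
 define \<alpha> \<delta> where "\<alpha> t = Re w * (Re b + t * Re w) + Im w * (Im b + t * Im w)" and "\<delta> t = Re w * (Im b + t * Im w) - Im w * (Re b + t * Re w)" for t
 have \<psi>_eq: "\<psi> t = Im lam * \<alpha> t + Re lam * \<delta> t" for t by (simp add: \<psi>_def \<alpha>_def \<delta>_def)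
 have w2: "N t * ((Re w)^2 + (Im w)^2) = (\<alpha> t)^2 + (\<delta> t)^2" for t unfolding Neq \<alpha>_def \<delta>_def by algebra
 have dN: "(N has_real_derivative 2 * \<alpha> t) (at t)" for t
  unfolding Neq[abs_def] \<alpha>_def \<delta>_def by (auto intro!: derivative_eq_intros simp: algebra_simps power2_eq_square)
 have d\<psi>: "(\<psi> has_real_derivative Im lam * ((Re w)^2 + (Im w)^2)) (at t)" for t
  unfolding \<psi>_def[abs_def] by (auto intro!: derivative_eq_intros simp: algebra_simps power2_eq_square)
 have d\<phi>: "(\<phi> has_real_derivative N t powr ((p - 1) / 2 - 1) * (Im lam * (p * (\<alpha> t)^2 + (\<delta> t)^2) + (p - 1) * Re lam * (\<alpha> t * \<delta> t))) (at t)" for t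
 proof -
  have 1: "((%t. N t powr ((p - 1) / 2)) has_real_derivative ((p - 1) / 2) * N t powr ((p - 1) / 2 - 1) * (2 * \<alpha> t)) (at t)"
   by (rule DERIV_chain'[OF dN has_real_derivative_powr[OF N0], THEN DERIV_cong]) simp
  have Np: "N t powr ((p - 1) / 2) = N t powr ((p - 1) / 2 - 1) * N t" using N0[of t] by (simp add: powr_diff)
  have "((%t. N t powr ((p - 1) / 2) * \<psi> t) has_real_derivative
   (((p - 1) / 2) * N t powr ((p - 1) / 2 - 1) * (2 * \<alpha> t)) * \<psi> t + (Im lam * ((Re w)^2 + (Im w)^2)) * N t powr ((p - 1) / 2)) (at t)"
   by (rule DERIV_mult[OF 1 d\<psi>])
  moreover have "(((p - 1) / 2) * N t powr ((p - 1) / 2 - 1) * (2 * \<alpha> t)) * \<psi> t + (Im lam * ((Re w)^2 + (Im w)^2)) * N t powr ((p - 1) / 2)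
   = N t powr ((p - 1) / 2 - 1) * (Im lam * (p * (\<alpha> t)^2 + (\<delta> t)^2) + (p - 1) * Re lam * (\<alpha> t * \<delta> t))"
  proof -
   have "(Im lam * ((Re w)^2 + (Im w)^2)) * N t powr ((p - 1) / 2) = N t powr ((p - 1) / 2 - 1) * (Im lam * (N t * ((Re w)^2 + (Im w)^2)))"
    unfolding Np by (simp only: mult_ac)
   moreover define Y where "Y = N t powr ((p - 1) / 2 - 1)"
   ultimately show ?thesis unfolding w2 \<psi>_eq Y_def[symmetric]
    by (simp add: add_divide_distrib diff_divide_distrib algebra_simps power2_eq_square)
  qed
  ultimately show ?thesis unfolding \<phi>[abs_def] by simp
 qed
 \<comment> \<open>By the arithmetic-geometric mean inequality 2 sqrt p |x y| <= p x^2 + y^2, and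
   the cone condition reads (p-1) |Re lam| <= 2 sqrt p |Im lam|.\<close>
 have neg: "Im lam * (p * x\<^sup>2 + y\<^sup>2) + (p - 1) * Re lam * (x * y) \<le> 0" for x y :: real
 proof -
  have "2 * (sqrt p * \<bar>x\<bar>) * \<bar>y\<bar> \<le> (sqrt p * \<bar>x\<bar>)^2 + \<bar>y\<bar>\<^sup>2" by (rule sum_squares_bound)
  then have 1: "2 * sqrt p * \<bar>x * y\<bar> \<le> p * x\<^sup>2 + y\<^sup>2" using p by (simp add: power_mult_distrib abs_mult mult_ac)
  have 2: "(p - 1) * \<bar>Re lam\<bar> \<le> \<bar>Im lam\<bar> * (2 * sqrt p)"
   using lam(2) p by (simp add: pos_divide_le_eq)
  have "(p - 1) * Re lam * (x * y) \<le> \<bar>(p - 1) * Re lam * (x * y)\<bar>" by simp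
  also have "... = ((p - 1) * \<bar>Re lam\<bar>) * \<bar>x * y\<bar>" using p by (simp add: abs_mult)
  also have "... \<le> (\<bar>Im lam\<bar> * (2 * sqrt p)) * \<bar>x * y\<bar>" by (intro mult_right_mono 2) auto
  also have "... = \<bar>Im lam\<bar> * (2 * sqrt p * \<bar>x * y\<bar>)" by simp
  also have "... \<le> \<bar>Im lam\<bar> * (p * x\<^sup>2 + y\<^sup>2)" by (intro mult_left_mono 1) auto
  finally show ?thesis using lam(1) by simp
 qed
 have "\<phi> 1 \<le> \<phi> 0"
 proof (rule DERIV_nonpos_imp_nonincreasing[of 0 1 \<phi>])
  fix t :: real
  show "\<exists>y. DERIV \<phi> t :> y \<and> y \<le> 0"
   by (rule exI, rule conjI, rule d\<phi>) (rule mult_nonneg_nonpos[OF powr_ge_zero neg])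
 qed simp
 then have "w \<bullet> (- \<i> * lam * power_nonlinearity p a) - w \<bullet> (- \<i> * lam * power_nonlinearity p b) \<le> 0"
  by (simp add: \<phi>_def z_def w_def)
 then show ?thesis by (simp only: w_def right_diff_distrib inner_diff_right)
qed

lemma Wj_FT_U: "Wj (FT (-1) (U s f)) = Wj (FT (-1) f)"
 unfolding FT_U by (rule Wj_cong) (use fn_mlt[OF bmeas_Ep[of s], of "FT (-1) f"] in eventually_elim, simp add: norm_mult)

lemma Xw_le_Wj: "b \<in> Basis ==> Xw b g \<le> Wj g"
 unfolding Wj_eq by (rule order_trans[OF member_le_sum[of b Basis "%b. Xw b g"]]) auto

lemma ennreal_sq_obtain:
 assumes "(x::ennreal) < \<infinity>" obtains A where "0 \<le> A" "x = ennreal (A\<^sup>2)"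
proof -
 obtain r where r: "0 \<le> r" "x = ennreal r" using assms by (cases x) auto
 show thesis by (rule that[of "sqrt r"]) (use r in auto)
qed

context nls
begin

section \<open>The evolution equation for z and its contraction property\<close>

definition vf :: "real => 'a L2 => 'a L2" where
 "vf s z = mlt (%_. - \<i> * lam) (U (- s) (NL p (U s z)))"

lemma vf_zero[simp]: "vf s 0 = 0" by (simp add: vf_def mlt_zero)

lemma continuous_on_vf:
 assumes z: "continuous_on S z" and B: "\<And>s. s \<in> S ==> U s (z s) \<in> Bq q K" and K: "0 \<le> K"
 shows "continuous_on S (%s. vf s (z s))"
 unfolding vf_def
 by (intro bounded_linear.continuous_on[OF bounded_linear_mlt[OF bmeas_const]] continuous_on_U continuous_on_NL[OF _ B K] z continuous_intros)

text \<open>As U is unitary, the inner product of the integrand at times t and s is |lam|^2 times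
  the pairing of two differences of N through U(t-s), which is the quantity in
  \<open>key_bilinear\<close>. Then \<open>tt_star\<close> yields the square of the bound.\<close>

lemma duhamel_bound:
 assumes K: "0 \<le> K"
 obtains C where "0 \<le> C" "\<And>a b z1 z2 A. a \<le> b ==> continuous_on {a..b} z1 ==> continuous_on {a..b} z2 ==>
  (\<And>s. s \<in> {a..b} ==> U s (z1 s) \<in> Bq q K) ==> (\<And>s. s \<in> {a..b} ==> U s (z2 s) \<in> Bq q K) ==>
  0 \<le> A ==> (\<And>s. s \<in> {a..b} ==> norm (z1 s - z2 s) \<le> A) ==>
  norm (integral {a..b} (%s. vf s (z1 s) - vf s (z2 s))) \<le> C * A * (b - a) powr (1 - \<beta> / 2)"
proof -
 obtain C where C: "0 \<le> C" and key: "\<And>u1 u2 v1 v2 t. u1 \<in> Bq q K ==> u2 \<in> Bq q K ==> v1 \<in> Bq q K ==> v2 \<in> Bq q K ==> t \<noteq> 0 ==>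
  \<bar>inner (NL p u1 - NL p u2) (U t (NL p v1 - NL p v2) :: 'a L2)\<bar> \<le> C * \<bar>t\<bar> powr (- \<beta>) * norm (u1 - u2) * norm (v1 - v2)"
  using key_bilinear[OF K] by blast
 define C' where "C' = (norm lam)^2 * C"
 have C'0: "0 \<le> C'" using C by (simp add: C'_def)
 have main: "norm (integral {a..b} (%s. vf s (z1 s) - vf s (z2 s))) \<le> sqrt (2 * C' / (1 - \<beta>)) * A * (b - a) powr (1 - \<beta> / 2)"
  if ab: "a \<le> b" and z: "continuous_on {a..b} z1" "continuous_on {a..b} z2"
   and B1: "\<And>s. s \<in> {a..b} ==> U s (z1 s) \<in> Bq q K" and B2: "\<And>s. s \<in> {a..b} ==> U s (z2 s) \<in> Bq q K"
   and A: "0 \<le> A" and zA: "\<And>s. s \<in> {a..b} ==> norm (z1 s - z2 s) \<le> A" for a b z1 z2 A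
 proof -
  let ?g = "%s. vf s (z1 s) - vf s (z2 s)"
  have g: "?g s = mlt (%_. - \<i> * lam) (U (- s) (NL p (U s (z1 s)) - NL p (U s (z2 s))))" for s
   by (simp add: vf_def U_diff mlt_diff)
  have "(norm (integral {a..b} ?g))^2 \<le> 2 * (C' * A\<^sup>2) / (1 - \<beta>) * (b - a) powr (2 - \<beta>)"
  proof (rule tt_star[OF ab])
   show "continuous_on {a..b} ?g" by (intro continuous_on_diff continuous_on_vf[OF z(1) B1 K] continuous_on_vf[OF z(2) B2 K])
   fix s t assume st: "a \<le> s" "s < t" "t \<le> b"
   let ?D = "%s. NL p (U s (z1 s)) - NL p (U s (z2 s))"
   have "inner (?g t) (?g s) = (norm lam)^2 * inner (?D t) (U (t - s) (?D s))"
    unfolding g inner_mlt_const by (simp add: inner_U U_U norm_mult)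
   also have "... \<le> (norm lam)^2 * (C * \<bar>t - s\<bar> powr (- \<beta>) * norm (U t (z1 t) - U t (z2 t)) * norm (U s (z1 s) - U s (z2 s)))"
    using key[OF B1[of t] B2[of t] B1[of s] B2[of s], of "t - s"] st
    by (intro mult_left_mono) auto
   also have "... = (norm lam)^2 * (C * (t - s) powr (- \<beta>) * norm (z1 t - z2 t) * norm (z1 s - z2 s))"
    using st by (simp flip: U_diff)
   also have "... \<le> (norm lam)^2 * (C * (t - s) powr (- \<beta>) * A * A)"
    using st C A by (intro mult_left_mono mult_mono zA order_refl) auto
   finally show "inner (?g t) (?g s) \<le> C' * A\<^sup>2 * (t - s) powr (- \<beta>)"
    by (simp add: C'_def power2_eq_square mult_ac)
  qed (use C'0 \<beta> in auto)
  also have "... = (sqrt (2 * C' / (1 - \<beta>)) * A * (b - a) powr (1 - \<beta> / 2))^2"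
  proof -
   have "((b - a) powr (1 - \<beta> / 2))^2 = (b - a) powr (2 - \<beta>)" by (simp add: power2_eq_square powr_add[symmetric])
   then show ?thesis using C'0 \<beta> by (simp add: power_mult_distrib)
  qed
  finally show ?thesis by (rule power2_le_imp_le) (use A C'0 \<beta> in simp)
 qed
 show thesis by (rule that[of "sqrt (2 * C' / (1 - \<beta>))"]) (use main C'0 \<beta> in auto)
qed

lemma NL_monotone:
 fixes u v :: "'a L2" assumes u: "u \<in> Bq q K" and v: "v \<in> Bq q K"
 shows "inner (u - v) (mlt (%_. - \<i> * lam) (NL p u - NL p v)) \<le> 0"
proof -
 let ?D = "%x. power_nonlinearity p (fn u x) - power_nonlinearity p (fn v x)"
 have D2: "?D \<in> L2_space" by (intro L2_space_diff NL_L2[OF u] NL_L2[OF v])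
 have "inner (u - v) (mlt (%_. - \<i> * lam) (NL p u - NL p v)) = inner (cls (%x. fn u x - fn v x)) (cls (%x. - \<i> * lam * ?D x))"
  unfolding NL_diff_cls[OF u v] mlt_cls[OF bmeas_const D2] by (simp add: cls_diff)
 also have "... = (LBINT x. (fn u x - fn v x) \<bullet> (- \<i> * lam * ?D x))"
  by (intro inner_cls L2_space_diff L2_space_cmult D2) auto
 also have "... \<le> 0"
 proof -
  have "0 \<le> (LBINT x. - ((fn u x - fn v x) \<bullet> (- \<i> * lam * ?D x)))"
   using pn_monotone[OF p1 lam_neg lam_cone] by (intro Bochner_Integration.integral_nonneg) simp
  then show ?thesis by simp
 qed
 finally show ?thesis .
qed

(* Interaction picture: z(t) = U(-t) u(t) solves the ordinary differential equation z' = vf t z in L2. *)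
definition sol :: "real => real => (real => 'a L2) => bool" where
 "sol a b z \<longleftrightarrow> (\<exists>K\<ge>0. \<forall>s\<in>{a..b}. U s (z s) \<in> Bq q K) \<and>
   (\<forall>t\<in>{a..b}. (z has_vector_derivative vf t (z t)) (at t within {a..b}))"

lemma sol_continuous: "sol a b z ==> continuous_on {a..b} z"
 by (auto simp: sol_def intro: continuous_on_vector_derivative)

lemma sol_Bq: assumes "sol a b z" obtains K where "0 \<le> K" "\<And>s. s \<in> {a..b} ==> U s (z s) \<in> Bq q K"
 using assms by (auto simp: sol_def)

lemma Bq_mono: "K \<le> K' ==> f \<in> Bq q K ==> f \<in> Bq q K'"
 by (auto simp: Bq_def intro: order_trans ennreal_leI)

lemma sol_subset: "sol a b z ==> a \<le> a' ==> b' \<le> b ==> sol a' b' z"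
 unfolding sol_def
 by (elim conjE exE, intro conjI, force, intro ballI has_vector_derivative_within_subset[of _ _ _ "{a..b}" "{a'..b'}"]) auto

text \<open>The derivative of the squared distance is twice the inner product of u1 - u2 with -i lam
  (N(u1) - N(u2)), because U(t) moves across the inner product; it is at most 0 by
  \<open>NL_monotone\<close>.\<close>

lemma sol_contraction:
 assumes z1: "sol a b z1" and z2: "sol a b z2" and st: "a \<le> s" "s \<le> t" "t \<le> b"
 shows "norm (z1 t - z2 t) \<le> norm (z1 s - z2 s)"
proof -
 obtain K1 K2 where K: "0 \<le> K1" "\<And>s. s \<in> {a..b} ==> U s (z1 s) \<in> Bq q K1" "0 \<le> K2" "\<And>s. s \<in> {a..b} ==> U s (z2 s) \<in> Bq q K2"
  using sol_Bq[OF z1] sol_Bq[OF z2] by metis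
 have B: "U s (z1 s) \<in> Bq q (max K1 K2)" "U s (z2 s) \<in> Bq q (max K1 K2)" if "s \<in> {a..b}" for s
  by (rule Bq_mono[OF max.cobounded1 K(2)[OF that]], rule Bq_mono[OF max.cobounded2 K(4)[OF that]])
 let ?w = "%t. z1 t - z2 t" and ?w' = "%t. vf t (z1 t) - vf t (z2 t)"
 have d: "(?w has_vector_derivative ?w' r) (at r within {s..t})" if r: "r \<in> {s..t}" for r
  using r sol_subset[OF z1 st(1,3)] sol_subset[OF z2 st(1,3)] unfolding sol_def
  by (intro has_vector_derivative_diff) auto
 have "((%r. inner (?w r) (?w r)) has_vector_derivative 2 * inner (?w r) (?w' r)) (at r within {s..t})" if "r \<in> {s..t}" for r
  using bounded_bilinear.has_vector_derivative[OF bounded_bilinear_inner d[OF that] d[OF that]] by (simp add: inner_commute)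
 then have "((%r. 2 * inner (?w r) (?w' r)) has_integral (inner (?w t) (?w t) - inner (?w s) (?w s))) {s..t}"
  by (rule fundamental_theorem_of_calculus[OF st(2)])
 then have "inner (?w t) (?w t) - inner (?w s) (?w s) \<le> 0"
 proof (rule has_integral_le[OF _ has_integral_0])
  fix r assume r: "r \<in> {s..t}"
  then have "r \<in> {a..b}" using st by auto
  note B' = B[OF this]
  have "inner (?w r) (?w' r) = inner (?w r) (U (- r) (mlt (%_. - \<i> * lam) (NL p (U r (z1 r)) - NL p (U r (z2 r)))))"
   by (simp add: vf_def U_const[symmetric] U_diff mlt_diff)
  also have "... = inner (U r (z1 r) - U r (z2 r)) (mlt (%_. - \<i> * lam) (NL p (U r (z1 r)) - NL p (U r (z2 r))))"
   by (simp only: inner_U[of r, symmetric] U_diff)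
  also have "... \<le> 0" by (rule NL_monotone[OF B'])
  finally show "2 * inner (?w r) (?w' r) \<le> 0" by simp
 qed
 then have "(norm (?w t))^2 \<le> (norm (?w s))^2" by (simp add: power2_norm_eq_inner)
 then show ?thesis by (rule power2_le_imp_le) simp
qed

lemma sol_zero: "sol a b (%_. 0)"
proof -
 have "Lp_nn q (0::'a L2) = 0" unfolding Lp_nn_def
  by (subst nn_integral_0_iff_AE) (auto intro: AE_mp[OF fn_zero])
 then have "(0::'a L2) \<in> Bq q 0" by (simp add: Bq_def)
 then show ?thesis unfolding sol_def by (intro conjI exI[of _ 0]) auto
qed

(* Linear maps that commute with the flow; applied to S z and z, the contraction estimate then
   controls S z - z. *)
definition symm :: "('a L2 => 'a L2) => bool" where
 "symm S \<longleftrightarrow> bounded_linear S \<and> (\<forall>s z K. U s z \<in> Bq q K \<longrightarrow> U s (S z) \<in> Bq q K \<and> vf s (S z) = S (vf s z))"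

lemma NL_tr:
 fixes u :: "'a L2" assumes u: "u \<in> Bq q K" shows "NL p (tr h u) = tr h (NL p u)"
 unfolding NL_def tr_cls[OF NL_L2[OF u]]
proof (rule cls_cong)
 show "(%x. power_nonlinearity p (fn (tr h u) x)) \<in> L2_space" using u by (intro NL_L2[of _ K]) simp
 show "(%x. power_nonlinearity p (fn u (x + h))) \<in> L2_space" by (rule tr_in_L2[OF NL_L2[OF u]])
 show "AE x in lborel. power_nonlinearity p (fn (tr h u) x) = power_nonlinearity p (fn u (x + h))"
  using fn_tr[of h u] by eventually_elim simp
qed

lemma NL_unimod:
 fixes u :: "'a L2" assumes u: "u \<in> Bq q K" and m: "bmeas m" "\<And>x. norm (m x) = 1"
 shows "NL p (mlt m u) = mlt m (NL p u)"
 unfolding NL_def mlt_cls[OF m(1) NL_L2[OF u]]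
proof (rule cls_cong)
 show "(%x. power_nonlinearity p (fn (mlt m u) x)) \<in> L2_space" using u by (intro NL_L2[of _ K]) (simp add: Bq_unimod m)
 show "(%x. m x * power_nonlinearity p (fn u x)) \<in> L2_space" using L2_space_mult[OF NL_L2[OF u], of m 1] m by (auto simp: bmeas_def)
 show "AE x in lborel. power_nonlinearity p (fn (mlt m u) x) = m x * power_nonlinearity p (fn u x)"
  using fn_mlt[OF m(1), of u] by eventually_elim (simp add: power_nonlinearity_def norm_mult m(2))
qed

lemma symm_tr: "symm (tr h)"
 unfolding symm_def
proof (intro conjI allI impI)
 fix s K and z :: "'a L2" assume "U s z \<in> Bq q K"
 then show "U s (tr h z) \<in> Bq q K" "vf s (tr h z) = tr h (vf s z)"
  by (simp_all add: U_tr vf_def NL_tr mlt_const_tr)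
qed (rule bounded_linear_tr)

(* Galilean invariance. *)
lemma symm_em: "symm (mlt (em v))"
 unfolding symm_def
proof (intro conjI allI impI)
 show "bounded_linear (mlt (em v))" by (rule bounded_linear_mlt) simp
 fix s K and z :: "'a L2" assume B: "U s z \<in> Bq q K"
 let ?c = "%_::'a. exp (\<i> * complex_of_real (- (s * (norm v)^2 / 2)))" and ?h = "- (s *\<^sub>R v)"
 have c: "bmeas ?c" "norm (?c x) = 1" for x by (simp, rule norm_exp_i)
 have e: "bmeas (em v)" "norm (em v x) = 1" for x :: 'a by auto
 have B1: "tr ?h (U s z) \<in> Bq q K" using B by simp
 have B2: "mlt (em v) (tr ?h (U s z)) \<in> Bq q K" using B1 by (simp only: Bq_unimod[OF e])
 show "U s (mlt (em v) z) \<in> Bq q K" unfolding U_em using B2 by (simp only: Bq_unimod[OF c])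
 have "NL p (U s (mlt (em v) z)) = mlt ?c (mlt (em v) (tr ?h (NL p (U s z))))"
  unfolding U_em by (simp only: NL_unimod[OF B2 c] NL_unimod[OF B1 e] NL_tr[OF B])
 also have "... = U s (mlt (em v) (U (- s) (NL p (U s z))))"
  unfolding U_em by simp
 finally have "U (- s) (NL p (U s (mlt (em v) z))) = mlt (em v) (U (- s) (NL p (U s z)))" by simp
 then show "vf s (mlt (em v) z) = mlt (em v) (vf s z)" by (simp add: vf_def mlt_commute[of "em v" "%_. _"])
qed

lemma sol_symm:
 assumes S: "symm S" and z: "sol a b z" shows "sol a b (%t. S (z t))"
proof -
 obtain K where K: "0 \<le> K" "\<And>s. s \<in> {a..b} ==> U s (z s) \<in> Bq q K" using sol_Bq[OF z] by metis
 have bl: "bounded_linear S" and S': "\<And>s z K. U s z \<in> Bq q K ==> U s (S z) \<in> Bq q K" "\<And>s z K. U s z \<in> Bq q K ==> vf s (S z) = S (vf s z)"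
  using S unfolding symm_def by blast+
 have "((%t. S (z t)) has_vector_derivative vf t (S (z t))) (at t within {a..b})" if "t \<in> {a..b}" for t
 proof -
  have "(z has_vector_derivative vf t (z t)) (at t within {a..b})" using z that by (simp add: sol_def)
  then have "((%t. S (z t)) has_vector_derivative S (vf t (z t))) (at t within {a..b})"
   by (rule bounded_linear.has_vector_derivative[OF bl])
  then show ?thesis by (simp only: S'[OF K(2)[OF that]])
 qed
 moreover have "U s (S (z s)) \<in> Bq q K" if "s \<in> {a..b}" for s by (rule S'(1)[OF K(2)[OF that]])
 ultimately show ?thesis using K(1) unfolding sol_def by blast
qed

section \<open>Propagation of H^1 and weighted bounds\<close>

lemma sol_norm_le: "sol a b z ==> a \<le> t ==> t \<le> b ==> norm (z t) \<le> norm (z a)"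
 using sol_contraction[OF _ sol_zero, of a b z a t] by simp

lemma sol_Xw_FT_le:
 assumes z: "sol a b z" and t: "a \<le> t" "t \<le> b" and A: "Xw e (FT (-1) (z a)) \<le> ennreal (A\<^sup>2)" "0 \<le> A"
 shows "Xw e (FT (-1) (z t)) \<le> ennreal (A\<^sup>2)"
proof (rule Xw_le_em_diff)
 fix h :: real assume h: "h > 0"
 have "norm (mlt (%x. em (h *\<^sub>R e) x - 1) (FT (-1) (z t))) = norm (tr (h *\<^sub>R e) (z t) - z t)" by (rule norm_tr_diff[symmetric])
 also have "... \<le> norm (tr (h *\<^sub>R e) (z a) - z a)" using t by (intro sol_contraction[OF sol_symm[OF symm_tr z] z]) auto
 also have "... \<le> A * \<bar>h\<bar>" unfolding norm_tr_diff by (rule em_diff_le_Xw[OF A])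
 finally show "norm (mlt (%x. em (h *\<^sub>R e) x - 1) (FT (-1) (z t))) \<le> A * h" using h by simp
qed

text \<open>The curve modulated by a fixed plane wave is again a solution, being the boosted
  solution seen in the interaction picture, so its distance to z does not increase. For u this is
  monotonicity of the norm of (x + i t grad) u in the direction e.\<close>

lemma sol_Xw_le:
 assumes z: "sol a b z" and t: "a \<le> t" "t \<le> b" and A: "Xw e (z a) \<le> ennreal (A\<^sup>2)" "0 \<le> A"
 shows "Xw e (z t) \<le> ennreal (A\<^sup>2)"
proof (rule Xw_le_em_diff)
 fix h :: real assume h: "h > 0"
 have "norm (mlt (em (h *\<^sub>R e)) (z t) - z t) \<le> norm (mlt (em (h *\<^sub>R e)) (z a) - z a)"
  using t by (intro sol_contraction[OF sol_symm[OF symm_em z] z]) auto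
 also have "... \<le> A * \<bar>h\<bar>" unfolding mlt_em_diff by (rule em_diff_le_Xw[OF A])
 finally show "norm (mlt (%x. em (h *\<^sub>R e) x - 1) (z t)) \<le> A * h" using h by (simp add: mlt_em_diff)
qed

lemma sol_Wj_FT_le:
 assumes z: "sol a b z" and t: "a \<le> t" "t \<le> b" and fin: "Wj (FT (-1) (z a)) < \<infinity>"
 shows "Wj (FT (-1) (z t)) \<le> Wj (FT (-1) (z a))"
 unfolding Wj_eq norm_FT[of "-1", simplified]
proof (intro add_mono sum_mono)
 show "ennreal ((norm (z t))^2) \<le> ennreal ((norm (z a))^2)" using sol_norm_le[OF z t] by (intro ennreal_leI power_mono) auto
 fix e :: 'a assume "e \<in> Basis"
 then have "Xw e (FT (-1) (z a)) < \<infinity>" using Xw_le_Wj fin by (blast intro: le_less_trans)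
 then obtain A where "0 \<le> A" "Xw e (FT (-1) (z a)) = ennreal (A\<^sup>2)" by (rule ennreal_sq_obtain)
 then show "Xw e (FT (-1) (z t)) \<le> Xw e (FT (-1) (z a))" using sol_Xw_FT_le[OF z t, of e A] by simp
qed

end

section \<open>Global existence\<close>

lemma Xw_sum_le_Wj:
 fixes B :: real assumes n: "norm g \<le> B" and X: "\<And>e. e \<in> Basis ==> Xw e g \<le> ennreal (B\<^sup>2)"
 shows "Wj (g :: 'a::euclidean_space L2) \<le> ennreal ((1 + DIM('a)) * B\<^sup>2)"
proof -
 have "Wj g \<le> ennreal (B\<^sup>2) + (\<Sum>e\<in>(Basis::'a set). ennreal (B\<^sup>2))"
  unfolding Wj_eq using n by (intro add_mono sum_mono X ennreal_leI power_mono) auto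
 also have "... = ennreal (B\<^sup>2 + (\<Sum>e\<in>(Basis::'a set). B\<^sup>2))"
  by (subst ennreal_plus) (auto intro!: sum_nonneg simp: sum_ennreal simp del: sum_constant)
 also have "B\<^sup>2 + (\<Sum>e\<in>(Basis::'a set). B\<^sup>2) = (1 + DIM('a)) * B\<^sup>2" by (simp add: algebra_simps)
 finally show ?thesis .
qed

lemma Wj_FT_leI:
 fixes B :: real assumes "norm f \<le> B" and h: "\<And>e h. e \<in> Basis ==> h > 0 ==> norm (tr (h *\<^sub>R e) f - f) \<le> B * h"
 shows "Wj (FT (-1) f :: 'a::euclidean_space L2) \<le> ennreal ((1 + DIM('a)) * B\<^sup>2)"
proof (rule Xw_sum_le_Wj)
 show "norm (FT (-1) f) \<le> B" using assms(1) by (simp add: norm_FT)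
 show "Xw e (FT (-1) f) \<le> ennreal (B\<^sup>2)" if "e \<in> Basis" for e
  by (rule Xw_le_em_diff) (use h[OF that] in \<open>simp add: norm_tr_diff\<close>)
qed

lemma tr_diff_le_Wj:
 assumes W: "Wj (FT (-1) f) \<le> ennreal (M\<^sup>2)" and M: "0 \<le> M" and e: "e \<in> Basis"
 shows "norm (tr (h *\<^sub>R e) f - f) \<le> M * \<bar>h\<bar>"
 unfolding norm_tr_diff by (rule em_diff_le_Xw[OF order_trans[OF Xw_le_Wj[OF e] W] M])

lemma powr_below:
 fixes \<alpha> e K :: real
 assumes "0 < \<alpha>" "0 < e" "0 \<le> K" obtains T where "0 < T" "\<And>t. 0 \<le> t ==> t \<le> T ==> K * t powr \<alpha> \<le> e"
proof
 define T where "T = (e / (K + 1)) powr (1 / \<alpha>)"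
 show "0 < T" using assms by (simp add: T_def)
 fix t assume t: "0 \<le> t" "t \<le> T"
 have "K * t powr \<alpha> \<le> K * T powr \<alpha>" using assms t by (intro mult_left_mono powr_mono2) auto
 also have "T powr \<alpha> = e / (K + 1)" using assms by (simp add: T_def powr_powr)
 also have "K * (e / (K + 1)) \<le> (K + 1) * (e / (K + 1))" using assms by (intro mult_right_mono) auto
 also have "... = e" using assms by simp
 finally show "K * t powr \<alpha> \<le> e" .
qed

context nls
begin

text \<open>The Hoelder exponent in time that \<open>duhamel_bound\<close> provides.\<close>

definition \<alpha> :: real where "\<alpha> = 1 - \<beta> / 2"
lemma \<alpha>: "0 < \<alpha>" "\<alpha> < 1" using \<beta> by (auto simp: \<alpha>_def)

lemma Wj_imp_Bq:
 assumes "0 \<le> M"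
 obtains K where "0 \<le> K" "\<And>f :: 'a L2. Wj (FT (-1) f) \<le> ennreal (M\<^sup>2) ==> f \<in> Bq q K"
proof -
 have q2: "q > 2" using p1 q2p by simp
 obtain K where K: "K \<ge> 0" "\<And>f :: 'a L2. Wj (FT (-1) f) \<le> ennreal (M\<^sup>2) ==> Lp_nn q f \<le> ennreal K"
  using sobolev[OF q2 qn] by blast
 show thesis
 proof (rule that[of "max K (M\<^sup>2)"])
  fix f :: "'a L2" assume W: "Wj (FT (-1) f) \<le> ennreal (M\<^sup>2)"
  have "(norm f)^2 \<le> M\<^sup>2" using Wj_norm_le[OF W assms] by (intro power_mono) (auto simp: norm_FT)
  moreover have "Lp_nn q f \<le> ennreal (max K (M\<^sup>2))" by (rule order_trans[OF K(2)[OF W] ennreal_leI]) simp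
  ultimately show "f \<in> Bq q (max K (M\<^sup>2))" by (simp add: Bq_def le_max_iff_disj ennreal_leI)
 qed (use K in auto)
qed

text \<open>With S = 0 the difference S z - z is -z, so plain norm bounds become an instance of the
  estimates for symmetries.\<close>

lemma symm_zero: "symm (%_. 0)"
proof -
 have "Lp_nn q (0::'a L2) = 0" unfolding Lp_nn_def
  by (subst nn_integral_0_iff_AE) (auto intro: AE_mp[OF fn_zero])
 then show ?thesis by (simp add: symm_def bounded_linear_zero Bq_def)
qed

text \<open>S commutes with the Duhamel integral and with the vector field, so
  \<open>duhamel_bound\<close> for S z and z controls S d - d, where d is the integral. This is the
  source of H^1 and weighted bounds on d. S z has to lie in \<open>Bq\<close> only, not in the H^1
  ball.\<close>

lemma duhamel_symm:
 assumes M: "0 \<le> M"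
 obtains C where "0 \<le> C" "\<And>S a b z A. symm S ==> a \<le> b ==> continuous_on {a..b} z ==>
  (\<And>s. s \<in> {a..b} ==> Wj (FT (-1) (z s)) \<le> ennreal (M\<^sup>2)) ==> 0 \<le> A ==>
  (\<And>s. s \<in> {a..b} ==> norm (S (z s) - z s) \<le> A) ==>
  norm (S (integral {a..b} (%s. vf s (z s))) - integral {a..b} (%s. vf s (z s))) \<le> C * A * (b - a) powr \<alpha>"
  "\<And>a b z1 z2 A. a \<le> b ==> continuous_on {a..b} z1 ==> continuous_on {a..b} z2 ==>
  (\<And>s. s \<in> {a..b} ==> Wj (FT (-1) (z1 s)) \<le> ennreal (M\<^sup>2)) ==> (\<And>s. s \<in> {a..b} ==> Wj (FT (-1) (z2 s)) \<le> ennreal (M\<^sup>2)) ==>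
  0 \<le> A ==> (\<And>s. s \<in> {a..b} ==> norm (z1 s - z2 s) \<le> A) ==>
  norm (integral {a..b} (%s. vf s (z1 s)) - integral {a..b} (%s. vf s (z2 s))) \<le> C * A * (b - a) powr \<alpha>"
  "\<And>a b z. continuous_on {a..b} z ==> (\<And>s. s \<in> {a..b} ==> Wj (FT (-1) (z s)) \<le> ennreal (M\<^sup>2)) ==> continuous_on {a..b} (%s. vf s (z s))"
proof -
 obtain K where K: "0 \<le> K" "\<And>f :: 'a L2. Wj (FT (-1) f) \<le> ennreal (M\<^sup>2) ==> f \<in> Bq q K" using Wj_imp_Bq[OF M] by blast
 have B: "U s z \<in> Bq q K" if "Wj (FT (-1) z) \<le> ennreal (M\<^sup>2)" for s and z :: "'a L2"
  using that by (intro K(2)) (simp add: Wj_FT_U)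
 obtain C where C: "0 \<le> C" and le: "\<And>a b z1 z2 A. a \<le> b ==> continuous_on {a..b} z1 ==> continuous_on {a..b} z2 ==>
  (\<And>s. s \<in> {a..b} ==> U s (z1 s) \<in> Bq q K) ==> (\<And>s. s \<in> {a..b} ==> U s (z2 s) \<in> Bq q K) ==>
  0 \<le> A ==> (\<And>s. s \<in> {a..b} ==> norm (z1 s - z2 s) \<le> A) ==>
  norm (integral {a..b} (%s. vf s (z1 s) - vf s (z2 s))) \<le> C * A * (b - a) powr (1 - \<beta> / 2)"
  using duhamel_bound[OF K(1)] by blast
 have ct: "continuous_on {a..b} (%s. vf s (z s))" if "continuous_on {a..b} z" "\<And>s. s \<in> {a..b} ==> U s (z s) \<in> Bq q K" for a b z
  by (rule continuous_on_vf[OF that K(1)])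
 have le': "norm (integral {a..b} (%s. vf s (z1 s)) - integral {a..b} (%s. vf s (z2 s))) \<le> C * A * (b - a) powr \<alpha>"
  if "a \<le> b" "continuous_on {a..b} z1" "continuous_on {a..b} z2"
  "\<And>s. s \<in> {a..b} ==> U s (z1 s) \<in> Bq q K" "\<And>s. s \<in> {a..b} ==> U s (z2 s) \<in> Bq q K"
  "0 \<le> A" "\<And>s. s \<in> {a..b} ==> norm (z1 s - z2 s) \<le> A" for a b z1 z2 A
  using le[OF that] ct[OF that(2,4)] ct[OF that(3,5)] unfolding \<alpha>_def
  by (subst integral_diff[symmetric]) (auto intro: integrable_continuous_real)
 show thesis
 proof (rule that[OF C])
  fix S a b z A assume S: "symm S" and ab: "a \<le> (b::real)" and z: "continuous_on {a..b} z"
   "\<And>s. s \<in> {a..b} ==> Wj (FT (-1) (z s)) \<le> ennreal (M\<^sup>2)" and A: "0 \<le> A" "\<And>s. s \<in> {a..b} ==> norm (S (z s) - z s) \<le> A"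
  have bl: "bounded_linear S" and S': "\<And>s z K. U s z \<in> Bq q K ==> U s (S z) \<in> Bq q K" "\<And>s z K. U s z \<in> Bq q K ==> vf s (S z) = S (vf s z)"
   using S unfolding symm_def by blast+
  have Bz: "U s (z s) \<in> Bq q K" if "s \<in> {a..b}" for s by (rule B[OF z(2)[OF that]])
  have "S (integral {a..b} (%s. vf s (z s))) = integral {a..b} (S \<circ> (%s. vf s (z s)))"
   by (rule integral_linear[symmetric, OF integrable_continuous_real[OF ct[OF z(1) Bz]] bl])
  also have "... = integral {a..b} (%s. vf s (S (z s)))"
   by (rule Henstock_Kurzweil_Integration.integral_cong) (simp add: S'(2)[OF Bz])
  finally show "norm (S (integral {a..b} (%s. vf s (z s))) - integral {a..b} (%s. vf s (z s))) \<le> C * A * (b - a) powr \<alpha>"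
   by (simp only:) (rule le'[OF ab bounded_linear.continuous_on[OF bl z(1)] z(1) S'(1)[OF Bz] Bz A])
 next
  fix a b A :: real and z1 z2 :: "real => 'a L2" assume "a \<le> b" "continuous_on {a..b} z1" "continuous_on {a..b} z2"
   and W: "\<And>s. s \<in> {a..b} ==> Wj (FT (-1) (z1 s)) \<le> ennreal (M\<^sup>2)" "\<And>s. s \<in> {a..b} ==> Wj (FT (-1) (z2 s)) \<le> ennreal (M\<^sup>2)"
   and "0 \<le> A" "\<And>s. s \<in> {a..b} ==> norm (z1 s - z2 s) \<le> A"
  then show "norm (integral {a..b} (%s. vf s (z1 s)) - integral {a..b} (%s. vf s (z2 s))) \<le> C * A * (b - a) powr \<alpha>"
   by (intro le' B[OF W(1)] B[OF W(2)])
 next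
  fix a b :: real and z :: "real => 'a L2" assume "continuous_on {a..b} z"
   and W: "\<And>s. s \<in> {a..b} ==> Wj (FT (-1) (z s)) \<le> ennreal (M\<^sup>2)"
  then show "continuous_on {a..b} (%s. vf s (z s))" by (intro ct B[OF W])
 qed
qed

text \<open>A contraction for the sup norm of L2 on curves with values in a closed H^1 ball. The
  length T depends on M alone and not on the starting time, so the step can be repeated.\<close>

lemma local_existence:
 assumes M: "0 \<le> M"
 obtains T where "0 < T" "\<And>a z0. Wj (FT (-1) z0) \<le> ennreal (M\<^sup>2) ==> \<exists>z. sol a (a + T) z \<and> z a = z0"
proof -
 \<comment> \<open>\<open>Wj_add\<close> doubles the squared norm of the data, and the Duhamel term
   is arranged to have squared norm at most 1; hence 2 M^2 + 2.\<close>
 define M1 where "M1 = sqrt (2 * M\<^sup>2 + 2)"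
 have M1: "0 \<le> M1" "M1\<^sup>2 = 2 * M\<^sup>2 + 2" by (simp_all add: M1_def)
 obtain K where K: "0 \<le> K" "\<And>f :: 'a L2. Wj (FT (-1) f) \<le> ennreal (M1\<^sup>2) ==> f \<in> Bq q K" using Wj_imp_Bq[OF M1(1)] by blast
 show thesis
 proof (rule duhamel_symm[OF M1(1)], goal_cases)
 case (1 C)
 note C = 1(1) and d1 = 1(2) and d2 = 1(3) and ct = 1(4)
 \<comment> \<open>Two requirements: (1 + n) eps^2 <= 1 puts the Duhamel term into the unit ball of
   H^1 through \<open>Wj_FT_leI\<close>, and eps <= 1/2 is the contraction factor.\<close>
 define \<epsilon> where "\<epsilon> = 1 / (2 * (1 + real DIM('a)))"
 have \<epsilon>: "0 < \<epsilon>" "\<epsilon> \<le> 1 / 2" "(1 + real DIM('a)) * \<epsilon>\<^sup>2 \<le> 1"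
 proof -
  show "0 < \<epsilon>" by (simp add: \<epsilon>_def add_pos_nonneg)
  show e: "\<epsilon> \<le> 1 / 2" by (simp add: \<epsilon>_def divide_simps)
  have "(1 + real DIM('a)) * \<epsilon> = 1 / 2" by (simp add: \<epsilon>_def add_pos_nonneg less_imp_neq[symmetric])
  then have "(1 + real DIM('a)) * \<epsilon>\<^sup>2 = \<epsilon> / 2" by (simp add: power2_eq_square mult.assoc[symmetric])
  then show "(1 + real DIM('a)) * \<epsilon>\<^sup>2 \<le> 1" using e by simp
 qed
 \<comment> \<open>The factor 1 + M1 serves two purposes: with A = M1 h the bound must be at most
   eps h, for the H^1 ball, and with A a distance at most eps A, for the contraction.\<close>
 obtain T where T: "0 < T" "\<And>t. 0 \<le> t ==> t \<le> T ==> C * (1 + M1) * t powr \<alpha> \<le> \<epsilon>"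
  using powr_below[of \<alpha> \<epsilon> "C * (1 + M1)"] \<alpha> \<epsilon> C M1 by auto
 show thesis
 proof (rule that[OF T(1)])
  fix a and z0 :: "'a L2" assume z0: "Wj (FT (-1) z0) \<le> ennreal (M\<^sup>2)"
  define F :: "(real \<Rightarrow>\<^sub>C 'a L2) => real => 'a L2" where "F z t = z0 + integral {a..t} (%s. vf s (z s))" for z t
  \<comment> \<open>An H^1 ball is closed in L2 by \<open>closed_Wj\<close>, so these curves form a
    complete space for the sup norm of L2.\<close>
  define Y :: "(real \<Rightarrow>\<^sub>C 'a L2) set" where "Y = PiC UNIV (%_. {f :: 'a L2. Wj (FT (-1) f) \<le> ennreal (M1\<^sup>2)})"
  have Yc: "closed Y" unfolding Y_def using closed_PiC[of UNIV "%_::real. {f :: 'a L2. Wj (FT (-1) f) \<le> ennreal (M1\<^sup>2)}"] closed_Wj[OF bounded_linear_FT[of "-1"], of M1] by simp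
  have YD: "Wj (FT (-1) (apply_bcontfun z s)) \<le> ennreal (M1\<^sup>2)" if "z \<in> Y" for z s
   using that by (auto simp: Y_def mem_PiC_iff)
  have small: "C * A * (t - a) powr \<alpha> \<le> \<epsilon> * (A / (1 + M1))" if "t \<in> {a..a+T}" "0 \<le> A" for t A
  proof -
   have "C * A * (t - a) powr \<alpha> = (C * (1 + M1) * (t - a) powr \<alpha>) * (A / (1 + M1))" using M1 by simp
   also have "... \<le> \<epsilon> * (A / (1 + M1))" using that M1 by (intro mult_right_mono T(2)) auto
   finally show ?thesis .
  qed
  have small': "C * A * (t - a) powr \<alpha> \<le> \<epsilon> * A" if "t \<in> {a..a+T}" "0 \<le> A" for t A
  proof (rule order_trans[OF small[OF that] mult_left_mono])
   show "A / (1 + M1) \<le> A" using that M1 mult_nonneg_nonneg[of A M1] by (simp add: pos_divide_le_eq algebra_simps)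
  qed (use \<epsilon> in simp)
  have smallM: "C * (M1 * h) * (t - a) powr \<alpha> \<le> \<epsilon> * h" if "t \<in> {a..a+T}" "0 \<le> h" for t h
  proof (rule order_trans[OF small[OF that(1)] mult_left_mono])
   show "0 \<le> M1 * h" using M1 that by simp
   show "M1 * h / (1 + M1) \<le> h" using that M1 by (simp add: pos_divide_le_eq algebra_simps)
  qed (use \<epsilon> in simp)
  have FW: "Wj (FT (-1) (F z t)) \<le> ennreal (M1\<^sup>2)" if z: "z \<in> Y" and t: "t \<in> {a..a+T}" for z t
  proof -
   let ?d = "integral {a..t} (%s. vf s (z s))"
   have 1: "norm (S ?d - ?d) \<le> C * A * (t - a) powr \<alpha>" if "symm S" "0 \<le> A" "\<And>s. norm (S (z s) - z s) \<le> A" for S A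
    using t by (intro d1 that YD z) auto
   have "norm ?d \<le> \<epsilon>"
    using order_trans[OF 1[OF symm_zero, of M1] smallM[OF t, of 1, simplified]] M1 YD[OF z] Wj_norm_le[of "FT (-1) (z _)" M1]
    by (simp add: norm_FT)
   moreover have "norm (tr (h *\<^sub>R e) ?d - ?d) \<le> \<epsilon> * h" if e: "e \<in> Basis" and h: "h > 0" for e h
    using order_trans[OF 1[OF symm_tr[of "h *\<^sub>R e"], of "M1 * h"] smallM[OF t, of h]] M1 h tr_diff_le_Wj[OF YD[OF z] M1(1) e, of h]
    by simp
   ultimately have "Wj (FT (-1) ?d) \<le> ennreal ((1 + DIM('a)) * \<epsilon>\<^sup>2)" by (rule Wj_FT_leI)
   also have "... \<le> ennreal 1" using \<epsilon> by (intro ennreal_leI) simp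
   finally have d: "Wj (FT (-1) ?d) \<le> 1" by simp
   have "Wj (FT (-1) (F z t)) = Wj (FT (-1) z0 + FT (-1) ?d)"
    unfolding F_def by (simp add: linear_add[OF bounded_linear.linear[OF bounded_linear_FT]])
   also have "... \<le> 2 * Wj (FT (-1) z0) + 2 * Wj (FT (-1) ?d)" by (rule Wj_add)
   also have "... \<le> 2 * ennreal (M\<^sup>2) + 2 * 1" by (intro add_mono mult_left_mono z0 d) auto
   also have "... = ennreal (M1\<^sup>2)" unfolding M1(2) by (simp add: ennreal_plus ennreal_mult)
   finally show ?thesis .
  qed
  have Fc: "continuous_on {a..a+T} (F z)" if z: "z \<in> Y" for z
   unfolding F_def by (intro continuous_intros indefinite_integral_continuous_1 integrable_continuous_real ct YD z) auto
  \<comment> \<open>The fixed point space consists of bounded continuous functions on the whole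
    line; clamping time to the interval extends the Duhamel map to it.\<close>
  define \<Phi> where "\<Phi> z = Bcontfun (%t. F z (clamp a (a + T) t))" for z
  have cl: "clamp a (a + T) t \<in> {a..a+T}" for t using T clamp_in_interval[of a "a + T" t] by (simp add: cbox_interval)
  have \<Phi>: "apply_bcontfun (\<Phi> z) = (%t. F z (clamp a (a + T) t))" if z: "z \<in> Y" for z
  proof -
   have "(%t. F z (clamp a (a + T) t)) \<in> bcontfun"
    unfolding bcontfun_def
    using clamp_continuous_on[of a "a + T" "F z" UNIV] clamp_bounded[of "F z" a "a + T"] Fc[OF z]
    by (auto simp: cbox_interval intro: compact_imp_bounded compact_continuous_image)
   then show ?thesis by (simp add: \<Phi>_def Bcontfun_inverse)
  qed
  have "\<exists>!z\<in>Y. \<Phi> z = z"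
  proof (rule Banach_fix[of _ "1 / 2"])
   show "Topological_Spaces.complete Y" using Yc by (simp add: complete_eq_closed)
   have "M\<^sup>2 \<le> M1\<^sup>2" unfolding M1 by simp
   then have "const_bcontfun z0 \<in> Y" using order_trans[OF z0 ennreal_leI] by (auto simp: Y_def mem_PiC_iff)
   then show "Y \<noteq> {}" by blast
   show "\<Phi> ` Y \<subseteq> Y" using \<Phi> FW cl by (auto simp: Y_def mem_PiC_iff)
   fix z1 z2 assume z: "z1 \<in> Y" "z2 \<in> Y"
   show "dist (\<Phi> z1) (\<Phi> z2) \<le> 1 / 2 * dist z1 z2"
   proof (rule dist_bound)
    fix t
    let ?t = "clamp a (a + T) t"
    have "norm (F z1 ?t - F z2 ?t) = norm (integral {a..?t} (%s. vf s (z1 s)) - integral {a..?t} (%s. vf s (z2 s)))"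
     by (simp add: F_def)
    also have "... \<le> C * dist z1 z2 * (?t - a) powr \<alpha>"
     using cl[of t] dist_bounded[of z1 _ z2] by (intro d2 YD z) (auto simp: dist_norm)
    also have "... \<le> \<epsilon> * dist z1 z2" by (rule small'[OF cl]) simp
    also have "... \<le> 1 / 2 * dist z1 z2" using \<epsilon> by (intro mult_right_mono) auto
    finally show "dist (\<Phi> z1 t) (\<Phi> z2 t) \<le> 1 / 2 * dist z1 z2" by (simp add: \<Phi> z dist_norm)
   qed
  qed auto
  then obtain z where z: "z \<in> Y" "\<Phi> z = z" by blast
  have zF: "apply_bcontfun z t = F z (clamp a (a + T) t)" for t using \<Phi>[OF z(1)] z(2) by simp
  have zt: "apply_bcontfun z t = F z t" if "t \<in> {a..a+T}" for t
   by (subst zF, subst clamp_cancel_cbox) (use that in \<open>auto simp: cbox_interval\<close>)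
  have Fd: "(F z has_vector_derivative vf t (z t)) (at t within {a..a+T})" if "t \<in> {a..a+T}" for t
   unfolding F_def
   using has_vector_derivative_add[OF has_vector_derivative_const integral_has_vector_derivative[OF ct that, of z]] YD[OF z(1)]
   by auto
  have "(apply_bcontfun z has_vector_derivative vf t (z t)) (at t within {a..a+T})" if "t \<in> {a..a+T}" for t
   by (rule has_vector_derivative_transform[OF that zt Fd[OF that]])
  moreover have "U s (z s) \<in> Bq q K" for s
   using YD[OF z(1), of s] by (intro K(2)) (simp add: Wj_FT_U)
  moreover have "apply_bcontfun z a = z0" using zt[of a] T by (simp add: F_def)
  ultimately show "\<exists>z. sol a (a + T) z \<and> z a = z0" using K(1) unfolding sol_def by blast
 qed
 qed
qed

section \<open>Gluing, uniqueness and continuation\<close>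

lemma sol_cong:
 assumes z: "sol a b z" and eq: "\<And>t. t \<in> {a..b} ==> z' t = z t" shows "sol a b z'"
proof -
 have "(z' has_vector_derivative vf t (z' t)) (at t within {a..b})" if t: "t \<in> {a..b}" for t
  unfolding eq[OF t] by (rule has_vector_derivative_transform[OF t eq]) (use z t in \<open>auto simp: sol_def\<close>)
 then show ?thesis using z eq by (auto simp: sol_def)
qed

lemma sol_glue:
 assumes z1: "sol a b z1" and z2: "sol b c z2" and ab: "a \<le> b" "b \<le> c" and eq: "z1 b = z2 b"
 shows "sol a c (%t. if t \<in> {a..b} then z1 t else z2 t)"
proof -
 obtain K1 K2 where K: "0 \<le> K1" "\<And>s. s \<in> {a..b} ==> U s (z1 s) \<in> Bq q K1" "0 \<le> K2" "\<And>s. s \<in> {b..c} ==> U s (z2 s) \<in> Bq q K2"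
  using sol_Bq[OF z1] sol_Bq[OF z2] by metis
 have 1: "U s (if s \<in> {a..b} then z1 s else z2 s) \<in> Bq q (max K1 K2)" if "s \<in> {a..c}" for s
  using Bq_mono[OF max.cobounded1 K(2)] Bq_mono[OF max.cobounded2 K(4)] that by auto
 have 2: "((%t. if t \<in> {a..b} then z1 t else z2 t) has_vector_derivative
   (if t \<in> {a..b} then vf t (z1 t) else vf t (z2 t))) (at t within {a..c})" if t: "t \<in> {a..c}" for t
 proof (rule has_vector_derivative_If_within_closures)
  have i: "{a..b} \<union> closure {a..b} \<inter> closure {b..c} = {a..b}" "{b..c} \<union> closure {a..b} \<inter> closure {b..c} = {b..c}" using ab by auto
  show "t \<in> {a..b} \<union> {b..c}" "{a..c} = {a..b} \<union> {b..c}" using t ab by auto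
  show "(z1 has_vector_derivative vf t (z1 t)) (at t within {a..b} \<union> closure {a..b} \<inter> closure {b..c})"
   if "t \<in> {a..b} \<union> closure {a..b} \<inter> closure {b..c}" using z1 that unfolding sol_def i by blast
  show "(z2 has_vector_derivative vf t (z2 t)) (at t within {b..c} \<union> closure {a..b} \<inter> closure {b..c})"
   if "t \<in> {b..c} \<union> closure {a..b} \<inter> closure {b..c}" using z2 that unfolding sol_def i by blast
  show "z1 t = z2 t" "vf t (z1 t) = vf t (z2 t)" if "t \<in> closure {a..b}" "t \<in> closure {b..c}"
  proof -
   have "t = b" using that by simp
   then show "z1 t = z2 t" "vf t (z1 t) = vf t (z2 t)" using eq by simp_all
  qed
 qed
 have 3: "(if t \<in> {a..b} then vf t (z1 t) else vf t (z2 t)) = vf t (if t \<in> {a..b} then z1 t else z2 t)" for t by simp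
 show ?thesis unfolding sol_def using 1 2 K(1,3) unfolding 3 by (intro conjI exI[of _ "max K1 K2"]) auto
qed

lemma sol_unique:
 assumes "sol a b z1" "sol a b z2" "z1 a = z2 a" "a \<le> t" "t \<le> b" shows "z1 t = z2 t"
 using sol_contraction[OF assms(1,2) order_refl assms(4,5)] assms(3) by simp

lemma global_existence:
 assumes fin: "Wj (FT (-1) z0) < \<infinity>"
 obtains z where "z 0 = z0" "\<And>b. sol 0 b z"
proof -
 obtain M where M: "0 \<le> M" "Wj (FT (-1) z0) = ennreal (M\<^sup>2)" by (rule ennreal_sq_obtain[OF fin])
 obtain T where T: "0 < T" "\<And>a z0. Wj (FT (-1) z0) \<le> ennreal (M\<^sup>2) ==> \<exists>z. sol a (a + T) z \<and> z a = z0"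
  using local_existence[OF M(1)] by blast
 have "\<exists>z. sol 0 (real k * T) z \<and> z 0 = z0" for k
 proof (induction k)
  case 0
  obtain z where "sol 0 (0 + T) z" "z 0 = z0" using T(2)[of z0 0] M by auto
  moreover have "sol 0 (real 0 * T) z" using sol_subset[OF calculation(1), of 0 0] T by simp
  ultimately show ?case by blast
 next
  case (Suc k)
  then obtain z1 where z1: "sol 0 (real k * T) z1" "z1 0 = z0" by blast
  have kT: "0 \<le> real k * T" using T by simp
  \<comment> \<open>The H^1 norm has not grown, so the next step has the same length T.\<close>
  have "Wj (FT (-1) (z1 (real k * T))) \<le> ennreal (M\<^sup>2)"
   using sol_Wj_FT_le[OF z1(1) kT order_refl] z1 M fin by simp
  from T(2)[OF this] obtain z2 where z2: "sol (real k * T) (real k * T + T) z2" "z2 (real k * T) = z1 (real k * T)" by blast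
  have "sol 0 (real k * T + T) (%t. if t \<in> {0..real k * T} then z1 t else z2 t)"
   using sol_glue[OF z1(1) z2(1)] kT T z2 by simp
  then show ?case using z1(2) kT by (intro exI[of _ "%t. if t \<in> {0..real k * T} then z1 t else z2 t"]) (simp add: algebra_simps)
 qed
 then obtain w where w: "\<And>k. sol 0 (real k * T) (w k)" "\<And>k. w k 0 = z0" by metis
 \<comment> \<open>At time t the solution is read off from a piece that lives up to a multiple of T
   beyond t; by uniqueness all pieces agree wherever two of them are defined.\<close>
 define N where "N t = nat \<lceil>t / T\<rceil>" for t
 have N: "t \<le> real (N t) * T" for t
 proof -
  have "t / T \<le> real (N t)" unfolding N_def by (rule real_nat_ceiling_ge)
  then show ?thesis using T by (simp add: pos_divide_le_eq)
 qed
 show thesis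
 proof (rule that[of "%t. w (N t) t"])
  show "w (N 0) 0 = z0" by (rule w)
  show "sol 0 b (%t. w (N t) t)" for b
  proof (rule sol_cong[OF sol_subset[OF w(1) order_refl N]])
   fix t assume t: "t \<in> {0..b}"
   have m: "min (real (N t) * T) (real (N b) * T) \<le> real (N t) * T" "min (real (N t) * T) (real (N b) * T) \<le> real (N b) * T" by auto
   show "w (N t) t = w (N b) t"
    using sol_unique[OF sol_subset[OF w(1) order_refl m(1)] sol_subset[OF w(1) order_refl m(2)], of t] t N[of t] N[of b]
    by (simp add: w(2))
  qed
 qed
qed

end

section \<open>Continuity in the weighted space\<close>

lemma Wj_cls:
 assumes f: "f \<in> L2_space"
 shows "Wj (cls f) = (NBINT x. ennreal ((norm (of_real (japanese_bracket x) * f x))^2))"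
 unfolding Wj_def
proof (rule nn_integral_cong_AE)
 have "0 \<le> japanese_bracket x" for x :: 'a by (rule order_trans[OF _ japanese_bracket_ge1]) simp
 then show "AE x in lborel. ennreal ((japanese_bracket x * norm (fn (cls f) x))^2) = ennreal ((norm (of_real (japanese_bracket x) * f x))^2)"
  using fn_cls[OF f] by (auto simp: norm_mult elim!: eventually_mono)
qed

lemma jb_times_L2_iff:
 assumes f: "f \<in> L2_space"
 shows "(%x. of_real (japanese_bracket x) * f x) \<in> L2_space \<longleftrightarrow> Wj (cls f) < \<infinity>"
 using L2_space_measurable[OF f] unfolding L2_space_iff_nn Wj_cls[OF f] by simp

lemma L2_norm_jb:
 assumes f: "f \<in> L2_space" and fin: "Wj (cls f) < \<infinity>"
 shows "ennreal ((L2_norm (%x. of_real (japanese_bracket x) * f x))^2) = Wj (cls f)"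
proof -
 have j: "(%x. of_real (japanese_bracket x) * f x) \<in> L2_space" using fin jb_times_L2_iff[OF f] by simp
 show ?thesis unfolding Wj_cls[OF f] nn_norm_cls[OF j] norm_cls[OF j] ..
qed

lemma H1_space_iff: "f \<in> H1_space \<longleftrightarrow> f \<in> L2_space \<and> Wj (FT (-1) (cls f)) < \<infinity>"
 unfolding H1_space_def using jb_times_L2_iff[OF L2_fourier(1), of f] by (auto simp: L2_fourier(2))

lemma H11_space_iff: "f \<in> H11_space \<longleftrightarrow> f \<in> L2_space \<and> Wj (cls f) < \<infinity> \<and> Wj (FT (-1) (cls f)) < \<infinity>"
 unfolding H11_space_def by (auto simp: H1_space_iff jb_times_L2_iff)

lemma L2_norm_nonneg[simp]: "0 \<le> L2_norm f" by (simp add: L2_norm_def)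

lemma L2_norm_bracket_nabla:
 assumes f: "f \<in> L2_space" and fin: "Wj (FT (-1) (cls f)) < \<infinity>"
 shows "ennreal ((L2_norm (bracket_nabla f))^2) = Wj (FT (-1) (cls f))"
proof -
 let ?g = "%\<xi>. of_real (japanese_bracket \<xi>) * L2_fourier f \<xi>"
 have g: "?g \<in> L2_space" using f fin by (simp add: jb_times_L2_iff L2_fourier)
 have "L2_norm (bracket_nabla f) = norm (FT 1 (cls ?g))"
  unfolding bracket_nabla_def using L2_inverse_fourier[OF g] norm_cls by metis
 also have "... = L2_norm ?g" by (simp add: norm_FT norm_cls g)
 finally show ?thesis using L2_norm_jb[OF L2_fourier(1)[OF f]] fin by (simp add: L2_fourier(2)[OF f])
qed

lemma H11_norm_le:
 assumes f: "f \<in> L2_space" and W: "Wj (cls f) \<le> ennreal a" "Wj (FT (-1) (cls f)) \<le> ennreal b" and ab: "0 \<le> a" "0 \<le> b"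
 shows "f \<in> H11_space" "H11_norm f \<le> sqrt a + sqrt b"
proof -
 have fin: "Wj (cls f) < \<infinity>" "Wj (FT (-1) (cls f)) < \<infinity>" using W by (auto intro: le_less_trans)
 then show "f \<in> H11_space" using f by (simp add: H11_space_iff)
 show "H11_norm f \<le> sqrt a + sqrt b"
  using W ab unfolding H11_norm_def L2_norm_jb[OF f fin(1), symmetric] L2_norm_bracket_nabla[OF f fin(2), symmetric]
  by (intro add_mono real_le_rsqrt) auto
qed

lemma H11_norm_nonneg: "0 \<le> H11_norm f" by (simp add: H11_norm_def)

lemma Wj_FT_le_H11_norm:
 assumes "f \<in> H11_space" shows "Wj (FT (-1) (cls f)) \<le> ennreal ((H11_norm f)^2)" "norm (cls f) \<le> H11_norm f"
proof -
 have f: "f \<in> L2_space" "Wj (FT (-1) (cls f)) < \<infinity>" using assms by (auto simp: H11_space_iff)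
 show 1: "Wj (FT (-1) (cls f)) \<le> ennreal ((H11_norm f)^2)"
  unfolding L2_norm_bracket_nabla[OF f, symmetric] by (intro ennreal_leI power_mono) (auto simp: H11_norm_def)
 show "norm (cls f) \<le> H11_norm f" using Wj_norm_le[OF 1 H11_norm_nonneg] by (simp add: norm_FT)
qed

lemma H11_space_diff:
 assumes f: "f \<in> H11_space" and g: "g \<in> H11_space" shows "(%x. f x - g x) \<in> H11_space"
proof -
 have L: "f \<in> L2_space" "g \<in> L2_space" using assms by (auto simp: H11_space_iff)
 have neg: "Wj (- h) = Wj h" for h :: "'a L2" by (rule Wj_cong) (use fn_uminus[of h] in eventually_elim, simp)
 have *: "Wj (a - b) < \<infinity>" if "Wj a < \<infinity>" "Wj b < \<infinity>" for a b :: "'a L2"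
 proof -
  have "Wj (a - b) \<le> 2 * Wj a + 2 * Wj b" using Wj_add[of a "- b"] by (simp add: neg)
  also have "... < \<infinity>" using that by (simp add: ennreal_mult_less_top)
  finally show ?thesis .
 qed
 have "Wj (cls f - cls g) < \<infinity>" "Wj (FT (-1) (cls f) - FT (-1) (cls g)) < \<infinity>"
  using assms by (auto simp: H11_space_iff simp del: infinity_ennreal_def intro!: *)
 then show ?thesis
  by (simp add: H11_space_iff L2_space_diff L cls_diff linear_diff[OF bounded_linear.linear[OF bounded_linear_FT]])
qed

section \<open>The propagator and the weights\<close>

lemma em_mlt_U: "mlt (em v) (U t f) = mlt (%_. exp (\<i> * of_real (t * (norm v)^2 / 2))) (U t (mlt (em v) (tr (t *\<^sub>R v) f)))"
proof -
 have tt: "tr (- (t *\<^sub>R v)) (tr (t *\<^sub>R v) (U t f)) = U t f"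
  by (rule L2_eqI) (use fn_tr[of "- (t *\<^sub>R v)" "tr (t *\<^sub>R v) (U t f)"] AE_lborel_shift[OF fn_tr[of "t *\<^sub>R v" "U t f"], of "- (t *\<^sub>R v)"] in eventually_elim, simp)
 have "mlt (%_. exp (\<i> * of_real (t * (norm v)^2 / 2))) (U t (mlt (em v) (tr (t *\<^sub>R v) f)))
  = mlt (%x. exp (\<i> * of_real (t * (norm v)^2 / 2)) * exp (\<i> * of_real (- (t * (norm v)^2 / 2)))) (mlt (em v) (tr (- (t *\<^sub>R v)) (tr (t *\<^sub>R v) (U t f))))"
  by (simp only: U_em U_tr mlt_mlt[OF bmeas_const bmeas_const])
 also have "... = mlt (em v) (U t f)" unfolding tt by (simp add: exp_add[symmetric] mlt_one)
 finally show ?thesis ..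
qed

lemma norm_const_diff: "norm (mlt (%_. exp (\<i> * of_real y)) f - f) \<le> \<bar>y\<bar> * norm f"
proof -
 have "mlt (%_. exp (\<i> * of_real y)) f - f = mlt (%_. exp (\<i> * of_real y) - 1) f"
 proof (rule L2_eqI, use fn_diff[of "mlt (%_. exp (\<i> * of_real y)) f" f] fn_mlt[OF bmeas_const[of "exp (\<i> * of_real y)"], of f]
   fn_mlt[OF bmeas_const[of "exp (\<i> * of_real y) - 1"], of f] in eventually_elim)
 qed (simp only: left_diff_distrib mult_1_left)
 then show ?thesis
  using norm_mlt_le[OF bmeas_const[of "exp (\<i> * of_real y) - 1"], of "\<bar>y\<bar>" f] iexp_approx1[of y 0] by simp
qed

(* The commutator of U(t) with a modulation is a small translation. *)
lemma commutator_bound: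
 assumes A: "norm (tr (t *\<^sub>R v) f - f) \<le> A"
 shows "norm (mlt (em v) (U t f) - U t (mlt (em v) f)) \<le> \<bar>t\<bar> * (norm v)^2 / 2 * norm f + A"
proof -
 let ?c = "mlt (%_. exp (\<i> * of_real (t * (norm v)^2 / 2)))"
 let ?g = "U t (mlt (em v) (tr (t *\<^sub>R v) f))"
 have e: "norm (mlt (em v) g) = norm g" for g by (rule norm_mlt_unimod) auto
 have "norm (mlt (em v) (U t f) - U t (mlt (em v) f)) = norm ((?c ?g - ?g) + (?g - U t (mlt (em v) f)))"
  by (simp add: em_mlt_U)
 also have "... \<le> norm (?c ?g - ?g) + norm (?g - U t (mlt (em v) f))" by (rule norm_triangle_ineq)
 also have "norm (?c ?g - ?g) \<le> \<bar>t * (norm v)^2 / 2\<bar> * norm ?g" by (rule norm_const_diff)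
 also have "norm ?g = norm f" by (simp add: e)
 also have "?g - U t (mlt (em v) f) = U t (mlt (em v) (tr (t *\<^sub>R v) f - f))" by (simp add: U_diff mlt_diff)
 also have "norm ... = norm (tr (t *\<^sub>R v) f - f)" by (simp add: e)
 finally show ?thesis using A by (simp add: abs_mult)
qed

text \<open>The relation x U(t) = U(t) (x - i t grad) in difference form: a modulation of size h
  commutes with U(t) up to a translation by t h, which costs A |t| h, and a phase of order h^2 that
  disappears in the limit.\<close>

lemma Xw_U:
 assumes e: "e \<in> Basis" and A: "Xw e (FT (-1) f) \<le> ennreal (A\<^sup>2)" "0 \<le> A" and B: "Xw e f \<le> ennreal (B\<^sup>2)" "0 \<le> B"
 shows "Xw e (U t f) \<le> ennreal ((A * \<bar>t\<bar> + B)^2)"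
proof (rule Xw_le_em_diff_seq[where h = "%k. inverse (real (Suc k))"])
 show "(%k. inverse (real (Suc k))) \<longlonglongrightarrow> 0" by (rule LIMSEQ_inverse_real_of_nat)
 have "(%k. \<bar>t\<bar> * inverse (real (Suc k)) / 2 * norm f + (A * \<bar>t\<bar> + B)) \<longlonglongrightarrow> \<bar>t\<bar> * 0 / 2 * norm f + (A * \<bar>t\<bar> + B)"
  by (intro tendsto_intros LIMSEQ_inverse_real_of_nat) simp
 then show "(%k. \<bar>t\<bar> * inverse (real (Suc k)) / 2 * norm f + (A * \<bar>t\<bar> + B)) \<longlonglongrightarrow> A * \<bar>t\<bar> + B" by simp
 fix k
 define h where "h = inverse (real (Suc k))"
 have h: "h > 0" by (simp add: h_def)
 let ?v = "h *\<^sub>R e"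
 have 1: "norm (tr (t *\<^sub>R ?v) f - f) \<le> A * \<bar>t\<bar> * h"
  unfolding norm_tr_diff using em_diff_le_Xw[OF A, of "t * h"] h by (simp add: abs_mult mult_ac)
 have "mlt (em ?v) (U t f) - U t f = (mlt (em ?v) (U t f) - U t (mlt (em ?v) f)) + U t (mlt (em ?v) f - f)" by (simp add: U_diff)
 then have "norm (mlt (em ?v) (U t f) - U t f) \<le> norm (mlt (em ?v) (U t f) - U t (mlt (em ?v) f)) + norm (mlt (em ?v) f - f)"
  using norm_triangle_ineq[of "mlt (em ?v) (U t f) - U t (mlt (em ?v) f)" "U t (mlt (em ?v) f - f)"] by (simp only: norm_U)
 also have "... \<le> (\<bar>t\<bar> * (norm ?v)^2 / 2 * norm f + A * \<bar>t\<bar> * h) + B * h"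
  using em_diff_le_Xw[OF B, of h] h by (intro add_mono commutator_bound[OF 1]) (simp add: mlt_em_diff)
 also have "... = (\<bar>t\<bar> * h / 2 * norm f + (A * \<bar>t\<bar> + B)) * h" using e h by (simp add: power2_eq_square algebra_simps)
 finally show "norm (mlt (%x. em (inverse (real (Suc k)) *\<^sub>R e) x - 1) (U t f)) \<le> (\<bar>t\<bar> * inverse (real (Suc k)) / 2 * norm f + (A * \<bar>t\<bar> + B)) * inverse (real (Suc k))"
  by (simp add: h_def mlt_em_diff)
qed simp

lemma em_quotient_tendsto:
 "(%k. of_real (real (Suc k)) * (em (inverse (real (Suc k)) *\<^sub>R e) x - 1)) \<longlonglongrightarrow> \<i> * of_real (x \<bullet> e)"
proof -
 let ?h = "%k. inverse (real (Suc k))" and ?y = "x \<bullet> e"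
 have ap: "norm (exp (\<i> * complex_of_real u) - (1 + \<i> * of_real u)) \<le> u\<^sup>2 / 2" for u
  using iexp_approx1[of u 1] by (simp add: power2_eq_square)
 have "(%k. of_real (real (Suc k)) * (em (?h k *\<^sub>R e) x - 1) - \<i> * of_real ?y) \<longlonglongrightarrow> 0"
 proof (rule Lim_null_comparison[OF always_eventually], rule allI)
  fix k
  define n where "n = real (Suc k)"
  have n: "n > 0" by (simp add: n_def)
  have "of_real n * (em (inverse n *\<^sub>R e) x - 1) - \<i> * of_real ?y
    = of_real n * (exp (\<i> * complex_of_real (inverse n * ?y)) - (1 + \<i> * of_real (inverse n * ?y)))"
   using n by (simp add: em_def algebra_simps)
  also have "norm ... \<le> n * ((inverse n * ?y)^2 / 2)"
   unfolding norm_mult using n by (intro mult_mono ap) auto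
  also have "... = ?y\<^sup>2 / 2 * inverse n" using n by (simp add: power2_eq_square field_simps)
  finally show "norm (of_real (real (Suc k)) * (em (?h k *\<^sub>R e) x - 1) - \<i> * of_real ?y) \<le> ?y\<^sup>2 / 2 * ?h k"
   by (simp only: n_def)
  next
  show "(%k. ?y\<^sup>2 / 2 * ?h k) \<longlonglongrightarrow> 0" by (rule tendsto_mult_right_zero[OF LIMSEQ_inverse_real_of_nat])
 qed
 then show ?thesis by (rule LIM_zero_cancel)
qed

text \<open>The limit is i (x . e) f; only its existence in L2 is recorded, because it is used as
  the point at which U is strongly continuous. The majorant is |x . e| |f|.\<close>

lemma em_derivative:
 assumes f: "Xw e f < \<infinity>"
 obtains g where "(%k. real (Suc k) *\<^sub>R (mlt (em (inverse (real (Suc k)) *\<^sub>R e)) f - f)) \<longlonglongrightarrow> g"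
proof -
 let ?e = "%k. em (inverse (real (Suc k)) *\<^sub>R e)"
 define F where "F k x = of_real (real (Suc k)) * (?e k x - 1) * fn f x" for k x
 have G: "(%x. of_real (x \<bullet> e) * fn f x) \<in> L2_space"
  unfolding L2_space_iff_nn using f by (simp add: Xw_def norm_mult power_mult_distrib)
 have bm: "bmeas (%x. of_real (real (Suc k)) * (?e k x - 1))" for k by (intro bmeas_mult) auto
 have le: "norm (F k x) \<le> norm (of_real (x \<bullet> e) * fn f x)" for k x
 proof -
  have "norm (?e k x - 1) \<le> inverse (real (Suc k)) * \<bar>x \<bullet> e\<bar>"
   using norm_em_diff_le[of "inverse (real (Suc k))" e x] by simp
  then have "real (Suc k) * norm (?e k x - 1) \<le> real (Suc k) * (inverse (real (Suc k)) * \<bar>x \<bullet> e\<bar>)"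
   by (rule mult_left_mono) simp
  also have "... = \<bar>x \<bullet> e\<bar>" by (simp add: mult.assoc[symmetric] del: of_nat_Suc)
  finally have "real (Suc k) * norm (?e k x - 1) * norm (fn f x) \<le> \<bar>x \<bullet> e\<bar> * norm (fn f x)"
   by (rule mult_right_mono) simp
  then show ?thesis by (simp add: F_def norm_mult del: of_nat_Suc)
 qed
 have lim: "(%k. F k x) \<longlonglongrightarrow> \<i> * of_real (x \<bullet> e) * fn f x" for x
 proof -
  from tendsto_mult_right[OF em_quotient_tendsto[of e x], of "fn f x"]
  show ?thesis unfolding F_def .
 qed
 have FL: "F k \<in> L2_space" for k unfolding F_def[abs_def] by (rule mlt_in_L2[OF bm])
 have m: "(%x. \<i> * of_real (x \<bullet> e) * fn f x) \<in> borel_measurable borel" by measurable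
 have "(%k. cls (F k)) \<longlonglongrightarrow> cls (%x. \<i> * of_real (x \<bullet> e) * fn f x)"
  by (rule cls_tendsto(2)[OF _ m G]) (use lim le FL in auto)
 moreover have "cls (F k) = real (Suc k) *\<^sub>R (mlt (?e k) f - f)" for k
 proof -
  have "cls (F k) = mlt (%x. of_real (real (Suc k)) * (?e k x - 1)) f" unfolding F_def[abs_def] mlt_def ..
  also have "... = real (Suc k) *\<^sub>R mlt (%x. ?e k x - 1) f"
  proof (rule L2_eqI, use fn_mlt[OF bm, of k f] fn_mlt[OF bmeas_em_diff, of "inverse (real (Suc k)) *\<^sub>R e" f]
    fn_scaleR[of "real (Suc k)" "mlt (%x. ?e k x - 1) f"] in eventually_elim)
  qed (simp add: scaleR_conv_of_real)
  finally show ?thesis by (simp add: mlt_em_diff)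
 qed
 ultimately show thesis by (intro that) simp
qed

text \<open>Modulating U(t) f - f produces the commutator, of size A |t| h, and U(t) - 1 applied to
  the modulation difference of f. Divided by h, the latter tends to U(t) g - g, so smallness for t
  -> 0 is strong continuity of U at g.\<close>

lemma Xw_U_diff:
 assumes e: "e \<in> Basis" and A: "Xw e (FT (-1) f) \<le> ennreal (A\<^sup>2)" "0 \<le> A"
  and g: "(%k. real (Suc k) *\<^sub>R (mlt (em (inverse (real (Suc k)) *\<^sub>R e)) f - f)) \<longlonglongrightarrow> g"
 shows "Xw e (U t f - f) \<le> ennreal ((A * \<bar>t\<bar> + norm (U t g - g))^2)"
proof (rule Xw_le_em_diff_seq[where h = "%k. inverse (real (Suc k))"])
 let ?d = "%k. real (Suc k) *\<^sub>R (mlt (em (inverse (real (Suc k)) *\<^sub>R e)) f - f)"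
 show "(%k. inverse (real (Suc k))) \<longlonglongrightarrow> 0" by (rule LIMSEQ_inverse_real_of_nat)
 have "(%k. \<bar>t\<bar> * inverse (real (Suc k)) / 2 * norm f + (A * \<bar>t\<bar> + norm (U t (?d k) - ?d k))) \<longlonglongrightarrow> \<bar>t\<bar> * 0 / 2 * norm f + (A * \<bar>t\<bar> + norm (U t g - g))"
  by (intro tendsto_intros LIMSEQ_inverse_real_of_nat bounded_linear.tendsto[OF bounded_linear_U] g) simp
 then show "(%k. \<bar>t\<bar> * inverse (real (Suc k)) / 2 * norm f + (A * \<bar>t\<bar> + norm (U t (?d k) - ?d k))) \<longlonglongrightarrow> A * \<bar>t\<bar> + norm (U t g - g)" by simp
 fix k
 define h where "h = inverse (real (Suc k))"
 have h: "h > 0" "real (Suc k) = inverse h" by (simp_all add: h_def)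
 let ?v = "h *\<^sub>R e"
 have 1: "norm (tr (t *\<^sub>R ?v) f - f) \<le> A * \<bar>t\<bar> * h"
  unfolding norm_tr_diff using em_diff_le_Xw[OF A, of "t * h"] h by (simp add: abs_mult mult_ac)
 let ?D = "mlt (em ?v) f - f"
 have "mlt (em ?v) (U t f - f) - (U t f - f) = (mlt (em ?v) (U t f) - U t (mlt (em ?v) f)) + (U t ?D - ?D)"
  by (simp add: U_diff mlt_diff)
 then have "norm (mlt (em ?v) (U t f - f) - (U t f - f)) \<le> norm (mlt (em ?v) (U t f) - U t (mlt (em ?v) f)) + norm (U t ?D - ?D)"
  by (simp only: norm_triangle_ineq)
 also have "... \<le> (\<bar>t\<bar> * (norm ?v)^2 / 2 * norm f + A * \<bar>t\<bar> * h) + norm (U t ?D - ?D)"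
  by (intro add_mono commutator_bound[OF 1] order_refl)
 also have "norm (U t ?D - ?D) = norm (h *\<^sub>R (U t (inverse h *\<^sub>R ?D) - inverse h *\<^sub>R ?D))"
  using h(1) by (simp only: linear_scale[OF bounded_linear.linear[OF bounded_linear_U]] scaleR_diff_right[symmetric] scaleR_scaleR) simp
 also have "... = h * norm (U t (?d k) - ?d k)" using h(1) unfolding h(2) by (simp add: h_def)
 also have "(\<bar>t\<bar> * (norm ?v)^2 / 2 * norm f + A * \<bar>t\<bar> * h) + h * norm (U t (?d k) - ?d k)
   = (\<bar>t\<bar> * h / 2 * norm f + (A * \<bar>t\<bar> + norm (U t (?d k) - ?d k))) * h" using e h(1) by (simp add: power2_eq_square algebra_simps)
 finally show "norm (mlt (%x. em (inverse (real (Suc k)) *\<^sub>R e) x - 1) (U t f - f)) \<le> (\<bar>t\<bar> * inverse (real (Suc k)) / 2 * norm f + (A * \<bar>t\<bar> + norm (U t (?d k) - ?d k))) * inverse (real (Suc k))"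
  unfolding h_def by (simp add: mlt_em_diff)
qed simp

lemma Wj_FT_U_diff:
 fixes f :: "'a::euclidean_space L2"
 assumes f: "Wj (FT (-1) f) < \<infinity>" and r: "r \<longlonglongrightarrow> 0"
 obtains b where "b \<longlonglongrightarrow> (0::real)" "\<And>k. 0 \<le> b k" "\<And>k. Wj (FT (-1) (U (r k) f - f)) = ennreal ((b k)^2)"
proof -
 let ?j = "%\<xi>. of_real (japanese_bracket \<xi>) * fn (FT (-1) f) \<xi>"
 have j: "?j \<in> L2_space" using jb_times_L2_iff[of "fn (FT (-1) f)"] f by simp
 define b where "b k = norm (mlt (%\<xi>. Ep (r k) \<xi> - 1) (cls ?j))" for k
 have bm: "bmeas (%\<xi>. Ep t \<xi> - 1)" for t by (intro bmeas_diff) auto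
 show thesis
 proof (rule that[of b])
  have "(%k. mlt (%\<xi>. Ep (r k) \<xi> - 1) (cls ?j)) \<longlonglongrightarrow> mlt (%_. 0) (cls ?j)"
  proof (rule mlt_tendsto[where B = 2])
   show "norm (Ep (r k) x - 1) \<le> 2" for k and x :: 'a using norm_triangle_ineq4[of "Ep (r k) x" 1] by simp
   fix x :: 'a
   have "(%k. exp (\<i> * of_real (- (r k * (norm x)^2 / 2))) - 1) \<longlonglongrightarrow> exp (\<i> * of_real (- (0 * (norm x)^2 / 2))) - 1"
    by (intro tendsto_intros r) auto
   then show "(%k. Ep (r k) x - 1) \<longlonglongrightarrow> 0" by (simp add: Ep_def)
  qed (use bm in auto)
  also have "mlt (%_. 0) (cls ?j) = 0" by (rule L2_eqI) (use fn_mlt[OF bmeas_const[of 0], of "cls ?j"] fn_zero in eventually_elim, simp)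
  finally show "b \<longlonglongrightarrow> 0" unfolding b_def by (rule tendsto_norm_zero)
  show "0 \<le> b k" for k by (simp add: b_def)
  fix k
  have "FT (-1) (U (r k) f - f) = mlt (%\<xi>. Ep (r k) \<xi> - 1) (FT (-1) f)"
   unfolding linear_diff[OF bounded_linear.linear[OF bounded_linear_FT[of "-1", simplified]]] FT_U
  proof (rule L2_eqI, use fn_diff[of "mlt (Ep (r k)) (FT (-1) f)" "FT (-1) f"] fn_mlt[OF bmeas_Ep, of "r k" "FT (-1) f"]
    fn_mlt[OF bm, of "r k" "FT (-1) f"] in eventually_elim)
  qed (simp only: left_diff_distrib mult_1_left)
  then have "Wj (FT (-1) (U (r k) f - f)) = Wj (cls (%\<xi>. (Ep (r k) \<xi> - 1) * fn (FT (-1) f) \<xi>))" by (simp add: mlt_def)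
  also have "... = (NBINT x. ennreal ((norm ((Ep (r k) x - 1) * ?j x))^2))"
   by (subst Wj_cls[OF mlt_in_L2[OF bm]]) (simp add: mult_ac)
  also have "... = ennreal ((b k)^2)"
  proof -
   have L: "(%x. (Ep (r k) x - 1) * ?j x) \<in> L2_space" using mlt_in_L2[OF bm, of "r k" "cls ?j"]
    by (intro L2_space_mult[OF j, where B=2]) (use bm norm_triangle_ineq4[of "Ep (r k) _" 1] in \<open>auto simp: bmeas_def\<close>)
   show ?thesis by (subst nn_norm_cls[OF L]) (simp add: b_def mlt_cls[OF bm j])
  qed
  finally show "Wj (FT (-1) (U (r k) f - f)) = ennreal ((b k)^2)" .
 qed
qed

lemma norm_le_Wj_FT: "Wj (FT (-1) f) \<le> ennreal (b\<^sup>2) ==> 0 \<le> b ==> norm f \<le> b"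
 using Wj_norm_le[of "FT (-1) f" b] by (simp add: norm_FT)

lemma Wj_U_le:
 fixes B :: real and f :: "'a::euclidean_space L2"
 assumes "norm f \<le> B" "\<And>e. e \<in> Basis ==> Xw e (FT (-1) f) \<le> ennreal (B\<^sup>2)" "\<And>e. e \<in> Basis ==> Xw e f \<le> ennreal (B\<^sup>2)"
 shows "Wj (U t f) \<le> ennreal ((1 + DIM('a)) * ((1 + \<bar>t\<bar>) * B)^2)"
proof (rule Xw_sum_le_Wj)
 have B: "0 \<le> B" using assms(1) norm_ge_zero[of f] by linarith
 show "norm (U t f) \<le> (1 + \<bar>t\<bar>) * B" using assms(1) B by (simp add: distrib_right add_increasing2)
 show "Xw e (U t f) \<le> ennreal (((1 + \<bar>t\<bar>) * B)^2)" if "e \<in> Basis" for e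
  using Xw_U[OF that assms(2)[OF that] B assms(3)[OF that] B, of t] by (simp add: algebra_simps)
qed

lemma U_strongly_continuous_weighted:
 fixes f :: "'a::euclidean_space L2"
 assumes f: "Wj (FT (-1) f) < \<infinity>" "Wj f < \<infinity>" and r: "r \<longlonglongrightarrow> 0"
 obtains c where "c \<longlonglongrightarrow> (0::real)" "\<And>k. norm (U (r k) f - f) \<le> c k"
  "\<And>k e. e \<in> Basis ==> Xw e (FT (-1) (U (r k) f - f)) \<le> ennreal ((c k)^2)" "\<And>k e. e \<in> Basis ==> Xw e (U (r k) f - f) \<le> ennreal ((c k)^2)"
  "\<And>k. Wj (FT (-1) (U (r k) f - f)) \<le> ennreal ((c k)^2)"
proof -
 obtain b where b: "b \<longlonglongrightarrow> (0::real)" "\<And>k. 0 \<le> b k" "\<And>k. Wj (FT (-1) (U (r k) f - f)) = ennreal ((b k)^2)"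
  using Wj_FT_U_diff[OF f(1) r] by blast
 obtain A where A: "0 \<le> A" "Wj (FT (-1) f) = ennreal (A\<^sup>2)" by (rule ennreal_sq_obtain[OF f(1)])
 have XA: "Xw e (FT (-1) f) \<le> ennreal (A\<^sup>2)" if "e \<in> Basis" for e using Xw_le_Wj[OF that, of "FT (-1) f"] A by simp
 have "\<forall>e\<in>(Basis::'a set). \<exists>g. (%k. real (Suc k) *\<^sub>R (mlt (em (inverse (real (Suc k)) *\<^sub>R e)) f - f)) \<longlonglongrightarrow> g"
  using em_derivative[OF le_less_trans[OF Xw_le_Wj f(2)]] by blast
 from bchoice[OF this] obtain g where "\<forall>e\<in>(Basis::'a set). (%k. real (Suc k) *\<^sub>R (mlt (em (inverse (real (Suc k)) *\<^sub>R e)) f - f)) \<longlonglongrightarrow> g e" ..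
 note g = bspec[OF this]
 define c where "c k = b k + (\<Sum>e\<in>Basis. A * \<bar>r k\<bar> + norm (U (r k) (g e) - g e))" for k
 have cb: "b k \<le> c k" for k using A by (auto simp: c_def intro!: sum_nonneg)
 have c0: "0 \<le> c k" for k using cb[of k] b(2)[of k] by linarith
 show thesis
 proof (rule that[of c])
  have "c \<longlonglongrightarrow> 0 + (\<Sum>e\<in>(Basis::'a set). A * \<bar>0\<bar> + norm (U 0 (g e) - g e))"
   unfolding c_def by (intro tendsto_intros b r U_tendsto)
  then show "c \<longlonglongrightarrow> 0" by simp
  show W: "Wj (FT (-1) (U (r k) f - f)) \<le> ennreal ((c k)^2)" for k
   unfolding b(3) using b(2) cb by (intro ennreal_leI power_mono) auto
  show "norm (U (r k) f - f) \<le> c k" for k by (rule norm_le_Wj_FT[OF W c0])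
  show "Xw e (FT (-1) (U (r k) f - f)) \<le> ennreal ((c k)^2)" if "e \<in> Basis" for k e
   by (rule order_trans[OF Xw_le_Wj[OF that] W])
  show "Xw e (U (r k) f - f) \<le> ennreal ((c k)^2)" if e: "e \<in> Basis" for k e
  proof (rule order_trans[OF Xw_U_diff[OF e XA[OF e] A(1) g[OF e]] ennreal_leI[OF power_mono]])
   have "A * \<bar>r k\<bar> + norm (U (r k) (g e) - g e) \<le> (\<Sum>e\<in>Basis. A * \<bar>r k\<bar> + norm (U (r k) (g e) - g e))"
    using e A by (intro member_le_sum) auto
   then show "A * \<bar>r k\<bar> + norm (U (r k) (g e) - g e) \<le> c k" using b(2)[of k] by (simp add: c_def)
  qed (use A in simp)
 qed
qed

lemma has_vector_derivative_iff_quotient: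
 fixes f :: "real => 'b::real_normed_vector"
 shows "(f has_vector_derivative d) (at x within S) \<longleftrightarrow> ((%y. (f y - f x) /\<^sub>R (y - x)) \<longlongrightarrow> d) (at x within S)"
proof -
 have eq: "norm ((f y - f x) - (y - x) *\<^sub>R d) / norm (y - x) = norm ((f y - f x) /\<^sub>R (y - x) - d)" if "y \<noteq> x" for y
 proof -
  have "(f y - f x) - (y - x) *\<^sub>R d = (y - x) *\<^sub>R ((f y - f x) /\<^sub>R (y - x) - d)" using that by (simp add: scaleR_diff_right)
  then show ?thesis using that by (simp only: norm_scaleR) simp
 qed
 have "(f has_vector_derivative d) (at x within S) \<longleftrightarrow> ((%y. norm ((f y - f x) - (y - x) *\<^sub>R d) / norm (y - x)) \<longlongrightarrow> 0) (at x within S)"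
  by (simp add: has_vector_derivative_def has_derivative_iff_norm bounded_linear_scaleR_left)
 also have "... \<longleftrightarrow> ((%y. norm ((f y - f x) /\<^sub>R (y - x) - d)) \<longlongrightarrow> 0) (at x within S)"
  by (intro filterlim_cong refl) (use eq in \<open>auto simp: eventually_at_filter\<close>)
 finally show ?thesis unfolding tendsto_norm_zero_iff by (simp add: LIM_zero_iff)
qed

lemma has_vector_derivative_quotient_seq:
 fixes f :: "real => 'b::real_normed_vector"
 assumes "(f has_vector_derivative d) (at x within S)" "\<And>k. h k \<noteq> 0" "\<And>k. x + h k \<in> S" "h \<longlonglongrightarrow> 0"
 shows "(%k. (f (x + h k) - f x) /\<^sub>R h k) \<longlonglongrightarrow> d"
proof -
 have "(%k. x + h k) \<longlonglongrightarrow> x + 0" by (intro tendsto_add tendsto_const assms)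
 then show ?thesis
  using assms(1)[unfolded has_vector_derivative_iff_quotient tendsto_at_iff_sequentially, rule_format, of "%k. x + h k"] assms(2,3)
  by (simp add: o_def)
qed

context nls
begin

section \<open>Hoelder continuity in time and continuity in the weighted space\<close>

lemma sol_increment:
 assumes z: "sol a b z" and t: "a \<le> t" "t \<le> s" "s \<le> b"
 shows "z s - z t = integral {t..s} (%r. vf r (z r))"
 using fundamental_theorem_of_calculus[OF t(2), of z "%r. vf r (z r)"] sol_subset[OF z t(1,3)]
 by (auto simp: sol_def dest: integral_unique)

text \<open>Bounds in L2, H^1 and the weighted space with one common constant that scales linearly
  with f, so that a single Hoelder estimate covers all three.\<close>

definition incr_bound :: "'a L2 => real => bool" where
 "incr_bound f B \<longleftrightarrow> norm f \<le> B \<and> (\<forall>e\<in>Basis. Xw e (FT (-1) f) \<le> ennreal (B\<^sup>2) \<and> Xw e f \<le> ennreal (B\<^sup>2))"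

lemma incr_bound_uminus: "incr_bound (- f) B \<longleftrightarrow> incr_bound f B"
proof -
 have "Xw e (- h) = Xw e h" for e and h :: "'a L2" by (rule Xw_cong) (use fn_uminus[of h] in eventually_elim, simp)
 then show ?thesis by (simp add: incr_bound_def linear_neg[OF bounded_linear.linear[OF bounded_linear_FT]])
qed

text \<open>An increment of z is a Duhamel integral over a short interval.
  \<open>duhamel_symm\<close> with S zero, a translation and a modulation gives the same power of
  the length in the three norms.\<close>

lemma sol_hoelder:
 assumes z: "\<And>b. sol 0 b z" and fin: "Wj (FT (-1) (z 0)) < \<infinity>" "Wj (z 0) < \<infinity>"
 obtains C where "0 \<le> C" "\<And>s t. 0 \<le> s ==> 0 \<le> t ==> incr_bound (z s - z t) (C * \<bar>s - t\<bar> powr \<alpha>)"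
proof -
 obtain M1 where M1: "0 \<le> M1" "Wj (FT (-1) (z 0)) = ennreal (M1\<^sup>2)" by (rule ennreal_sq_obtain[OF fin(1)])
 obtain M2 where M2: "0 \<le> M2" "Wj (z 0) = ennreal (M2\<^sup>2)" by (rule ennreal_sq_obtain[OF fin(2)])
 define M where "M = max M1 M2"
 have M: "0 \<le> M" "Wj (FT (-1) (z 0)) \<le> ennreal (M\<^sup>2)" "Wj (z 0) \<le> ennreal (M\<^sup>2)"
  using M1 M2 by (auto simp: M_def intro!: power_mono)
 have W: "Wj (FT (-1) (z s)) \<le> ennreal (M\<^sup>2)" if "0 \<le> s" for s
  using sol_Wj_FT_le[OF z that order_refl fin(1)] M(2) by simp
 have X: "Xw e (z s) \<le> ennreal (M\<^sup>2)" if "0 \<le> s" "e \<in> Basis" for s e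
  by (rule sol_Xw_le[OF z that(1) order_refl order_trans[OF Xw_le_Wj[OF that(2)] M(3)] M(1)])
 show thesis
 proof (rule duhamel_symm[OF M(1)], goal_cases)
  case (1 C)
  have le: "norm (S (z s - z t) - (z s - z t)) \<le> C * A * (s - t) powr \<alpha>"
   if "symm S" "0 \<le> A" "\<And>r. r \<in> {t..s} ==> norm (S (z r) - z r) \<le> A" "0 \<le> t" "t \<le> s" for S A s t
   unfolding sol_increment[OF z that(4,5) order_refl]
  proof (rule 1(2)[OF that(1,5) _ _ that(2,3)])
   show "continuous_on {t..s} z" using sol_continuous[OF z[of s]] that(4) by (auto intro: continuous_on_subset)
   show "Wj (FT (-1) (z r)) \<le> ennreal (M\<^sup>2)" if "r \<in> {t..s}" for r using W that \<open>0 \<le> t\<close> by simp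
  qed
  have bd: "incr_bound (z s - z t) (C * M * (s - t) powr \<alpha>)" if st: "0 \<le> t" "t \<le> s" for s t
  proof -
   have "norm (z s - z t) \<le> C * M * (s - t) powr \<alpha>"
    using le[OF symm_zero M(1) _ st] norm_le_Wj_FT[OF W M(1)] st by (simp add: norm_minus_commute)
   moreover have "Xw e (FT (-1) (z s - z t)) \<le> ennreal ((C * M * (s - t) powr \<alpha>)^2)" if e: "e \<in> Basis" for e
   proof (rule Xw_le_em_diff)
    fix h :: real assume h: "h > 0"
    show "norm (mlt (%x. em (h *\<^sub>R e) x - 1) (FT (-1) (z s - z t))) \<le> C * M * (s - t) powr \<alpha> * h"
     unfolding norm_tr_diff[symmetric]
     using le[OF symm_tr[of "h *\<^sub>R e"] _ _ st, of "M * h"] tr_diff_le_Wj[OF W M(1) e, of _ h] h M st by (simp add: mult_ac)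
   qed
   moreover have "Xw e (z s - z t) \<le> ennreal ((C * M * (s - t) powr \<alpha>)^2)" if e: "e \<in> Basis" for e
   proof (rule Xw_le_em_diff)
    fix h :: real assume h: "h > 0"
    show "norm (mlt (%x. em (h *\<^sub>R e) x - 1) (z s - z t)) \<le> C * M * (s - t) powr \<alpha> * h"
     unfolding mlt_em_diff[symmetric]
     using le[OF symm_em[of "h *\<^sub>R e"] _ _ st, of "M * h"] em_diff_le_Xw[OF X[OF _ e] M(1), of _ h] h M st by (simp add: mult_ac mlt_em_diff)
   qed
   ultimately show ?thesis by (simp add: incr_bound_def)
  qed
  show thesis
  proof (rule that[of "C * M"])
   fix s t :: real assume "0 \<le> s" "0 \<le> t"
   then show "incr_bound (z s - z t) (C * M * \<bar>s - t\<bar> powr \<alpha>)"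
    using bd[of t s] bd[of s t] incr_bound_uminus[of "z s - z t"] by (cases "t \<le> s") (simp_all add: abs_if)
  qed (use 1(1) M in simp)
 qed
qed

text \<open>u(s) - u(t) is split into U(s) (z(s) - z(t)) and U(t) (U(s-t) z(t) - z(t)). The first
  part is small by \<open>sol_hoelder\<close>, the second by strong continuity of U in the weighted
  space at the fixed element z(t).\<close>

lemma continuous_into_H11_sol:
 assumes z: "\<And>b. sol 0 b z" and fin: "Wj (FT (-1) (z 0)) < \<infinity>" "Wj (z 0) < \<infinity>"
 shows "continuous_into_H11 (%t. fn (U t (z t)))"
proof -
 obtain C where C: "0 \<le> C" "\<And>s t. 0 \<le> s ==> 0 \<le> t ==> incr_bound (z s - z t) (C * \<bar>s - t\<bar> powr \<alpha>)"
  using sol_hoelder[OF z fin] by blast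
 have F: "Wj (FT (-1) (z t)) < \<infinity>" if t: "0 \<le> t" for t using sol_Wj_FT_le[OF z t order_refl fin(1)] fin(1) by (rule le_less_trans)
 have X: "Xw e (z t) < \<infinity>" if t: "0 \<le> t" and e: "e \<in> Basis" for t e
 proof -
  obtain A where "0 \<le> A" "Xw e (z 0) = ennreal (A\<^sup>2)" using ennreal_sq_obtain[OF le_less_trans[OF Xw_le_Wj[OF e] fin(2)]] .
  then show ?thesis using sol_Xw_le[OF z t order_refl, of e A] by (auto intro: le_less_trans)
 qed
 have F': "Wj (z t) < \<infinity>" if t: "0 \<le> t" for t using X[OF t] by (auto simp: Wj_eq)
 define N where "N = real (1 + DIM('a))"
 have N0: "0 \<le> N" by (simp add: N_def)
 show ?thesis unfolding continuous_into_H11_def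
 proof (intro allI impI conjI)
  fix t :: real assume t: "0 \<le> t"
  obtain B1 where B1: "0 \<le> B1" "Wj (FT (-1) (z t)) = ennreal (B1\<^sup>2)" by (rule ennreal_sq_obtain[OF F[OF t]])
  obtain B2 where B2: "0 \<le> B2" "Wj (z t) = ennreal (B2\<^sup>2)" by (rule ennreal_sq_obtain[OF F'[OF t]])
  define B where "B = max B1 B2"
  have B: "Wj (FT (-1) (z t)) \<le> ennreal (B\<^sup>2)" "Wj (z t) \<le> ennreal (B\<^sup>2)" "0 \<le> B" using B1 B2 by (auto simp: B_def intro!: power_mono)
  have "Wj (U t (z t)) \<le> ennreal ((1 + DIM('a)) * ((1 + \<bar>t\<bar>) * B)^2)"
   by (intro Wj_U_le norm_le_Wj_FT B) (use Xw_le_Wj B in \<open>blast intro: order_trans\<close>)+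
  then have "Wj (U t (z t)) < \<infinity>" by (auto intro: le_less_trans)
  then show "fn (U t (z t)) \<in> H11_space" using F[OF t] by (simp add: H11_space_iff Wj_FT_U)
  show "((%s. H11_norm (%x. fn (U s (z s)) x - fn (U t (z t)) x)) \<longlongrightarrow> 0) (at t within {0..})"
   unfolding tendsto_at_iff_sequentially comp_def
  proof (intro allI impI)
   fix s assume s0: "\<forall>k. s k \<in> {0..} - {t}" and s: "s \<longlonglongrightarrow> t"
   have r: "(%k. s k - t) \<longlonglongrightarrow> 0" using tendsto_diff[OF s tendsto_const[of t]] by simp
   obtain c where c: "c \<longlonglongrightarrow> (0::real)" "\<And>k. norm (U (s k - t) (z t) - z t) \<le> c k"
    "\<And>k e. e \<in> Basis ==> Xw e (FT (-1) (U (s k - t) (z t) - z t)) \<le> ennreal ((c k)^2)" "\<And>k e. e \<in> Basis ==> Xw e (U (s k - t) (z t) - z t) \<le> ennreal ((c k)^2)"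
    "\<And>k. Wj (FT (-1) (U (s k - t) (z t) - z t)) \<le> ennreal ((c k)^2)"
    using U_strongly_continuous_weighted[OF F[OF t] F'[OF t] r] by blast
   define a where "a k = C * \<bar>s k - t\<bar> powr \<alpha>" for k
 let ?a = "%k. (1 + \<bar>s k\<bar>) * a k" and ?c = "%k. (1 + \<bar>t\<bar>) * c k"
   have a: "incr_bound (z (s k) - z t) (a k)" for k unfolding a_def using s0 t by (intro C) auto
   have "a \<longlonglongrightarrow> C * \<bar>0\<bar> powr \<alpha>"
    unfolding a_def using \<alpha> r by (intro tendsto_intros tendsto_powr') auto
   then have a0: "a \<longlonglongrightarrow> 0" by simp
   let ?D = "%k. z (s k) - z t" and ?E = "%k. U (s k - t) (z t) - z t"
   have w: "U (s k) (z (s k)) - U t (z t) = U (s k) (?D k) + U t (?E k)" for k by (simp add: U_diff U_U)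
   have add: "ennreal (2 * x + 2 * y) = 2 * ennreal x + 2 * ennreal y" if "0 \<le> x" "0 \<le> y" for x y
    using that by (simp add: ennreal_plus ennreal_mult)
   have W1: "Wj (U (s k) (z (s k)) - U t (z t)) \<le> ennreal (2 * (N * (?a k)^2) + 2 * (N * (?c k)^2))" for k
   proof -
    have "Wj (U (s k) (?D k) + U t (?E k)) \<le> 2 * Wj (U (s k) (?D k)) + 2 * Wj (U t (?E k))" by (rule Wj_add)
    also have "... \<le> 2 * ennreal (N * (?a k)^2) + 2 * ennreal (N * (?c k)^2)"
     unfolding N_def using a[of k] by (intro add_mono mult_left_mono Wj_U_le c) (auto simp: incr_bound_def)
    finally show ?thesis unfolding w by (subst add) (simp_all add: N_def)
   qed
   have W2: "Wj (FT (-1) (U (s k) (z (s k)) - U t (z t))) \<le> ennreal (2 * (N * (a k)^2) + 2 * (c k)^2)" for k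
   proof -
    have "Wj (FT (-1) (U (s k) (?D k) + U t (?E k))) = Wj (FT (-1) (U (s k) (?D k)) + FT (-1) (U t (?E k)))"
     by (simp add: linear_add[OF bounded_linear.linear[OF bounded_linear_FT]])
    also have "... \<le> 2 * Wj (FT (-1) (U (s k) (?D k))) + 2 * Wj (FT (-1) (U t (?E k)))" by (rule Wj_add)
    also have "... \<le> 2 * ennreal (N * (a k)^2) + 2 * ennreal ((c k)^2)"
     unfolding Wj_FT_U N_def using a[of k] by (intro add_mono mult_left_mono c Xw_sum_le_Wj) (auto simp: incr_bound_def norm_FT)
    finally show ?thesis unfolding w by (subst add) (simp_all add: N_def)
   qed
   have cl: "cls (%x. fn (U (s k) (z (s k))) x - fn (U t (z t)) x) = U (s k) (z (s k)) - U t (z t)" for k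
    by (simp add: cls_diff)
   have "H11_norm (%x. fn (U (s k) (z (s k))) x - fn (U t (z t)) x)
     \<le> sqrt (2 * (N * (?a k)^2) + 2 * (N * (?c k)^2)) + sqrt (2 * (N * (a k)^2) + 2 * (c k)^2)" for k
    by (rule H11_norm_le(2)) (use W1[of k] W2[of k] N0 in \<open>simp_all add: cl L2_space_diff\<close>)
   then have le: "norm (H11_norm (%x. fn (U (s k) (z (s k))) x - fn (U t (z t)) x))
     \<le> sqrt (2 * (N * (?a k)^2) + 2 * (N * (?c k)^2)) + sqrt (2 * (N * (a k)^2) + 2 * (c k)^2)" for k
    by (simp only: real_norm_def abs_of_nonneg[OF H11_norm_nonneg])
   have sq: "(%k. m * (f k)^2) \<longlonglongrightarrow> 0" if "f \<longlonglongrightarrow> 0" for f and m :: real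
    using tendsto_mult[OF tendsto_const[of m] tendsto_power[OF that, of 2]] by simp
   have 1: "(%k. (1 + \<bar>s k\<bar>) * a k) \<longlonglongrightarrow> 0"
    using tendsto_mult[OF tendsto_add[OF tendsto_const[of 1] tendsto_rabs[OF s]] a0] by simp
   have 2: "(%k. (1 + \<bar>t\<bar>) * c k) \<longlonglongrightarrow> 0"
    using tendsto_mult[OF tendsto_const[of "1 + \<bar>t\<bar>"] c(1)] by simp
   have r1: "(%k. sqrt (2 * (N * (?a k)^2) + 2 * (N * (?c k)^2))) \<longlonglongrightarrow> 0"
    using tendsto_real_sqrt[OF tendsto_add[OF sq[OF 1, of "2 * N"] sq[OF 2, of "2 * N"]]] by (simp only: mult.assoc add_0_left real_sqrt_zero)
   have r2: "(%k. sqrt (2 * (N * (a k)^2) + 2 * (c k)^2)) \<longlonglongrightarrow> 0"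
    using tendsto_real_sqrt[OF tendsto_add[OF sq[OF a0, of "2 * N"] sq[OF c(1), of 2]]] by (simp only: mult.assoc add_0_left real_sqrt_zero)
   have "(%k. sqrt (2 * (N * (?a k)^2) + 2 * (N * (?c k)^2)) + sqrt (2 * (N * (a k)^2) + 2 * (c k)^2)) \<longlonglongrightarrow> 0"
    using tendsto_add[OF r1 r2] by (simp only: add_0_left)
   then show "(%k. H11_norm (%x. fn (U (s k) (z (s k))) x - fn (U t (z t)) x)) \<longlonglongrightarrow> 0"
    by (rule Lim_null_comparison[OF always_eventually[OF allI[OF le]]])
  qed
 qed
qed

end

section \<open>Test functions\<close>

text \<open>The case m = 0 is the usual flat function exp(-1/s). The powers of 1/s are included to
  make the family closed under differentiation.\<close>

definition bump_profile :: "nat => real => real" where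
 "bump_profile m s = (if s > 0 then inverse s ^ m * exp (- inverse s) else 0)"

lemma power_le_fact_exp: "(u::real) ^ n \<le> fact n * exp u" if "0 \<le> u"
proof -
 have "(%n. u ^ n /\<^sub>R fact n) sums exp u" by (rule exp_converges)
 then have "u ^ n /\<^sub>R fact n \<le> exp u"
  using sum_le_suminf[of "%n. u ^ n /\<^sub>R fact n" "{n}"] that by (auto simp: sums_iff)
 then show ?thesis by (simp add: field_simps)
qed

text \<open>Put u = 1/s in u^(m+2) <= (m+2)! exp u. A quadratic bound is enough for the derivative
  at 0 to exist and vanish.\<close>

lemma bump_profile_le: "\<bar>bump_profile m s\<bar> \<le> fact (m + 2) * s\<^sup>2"
proof (cases "s > 0")
 case True
 define u where "u = inverse s"
 have u: "u > 0" "s = inverse u" using True by (simp_all add: u_def)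
 have "u ^ m * exp (- u) * u\<^sup>2 = u ^ (m + 2) * exp (- u)" by (simp add: power_add power2_eq_square)
 also have "... \<le> fact (m + 2) * exp u * exp (- u)"
  by (intro mult_right_mono power_le_fact_exp) (use u in auto)
 also have "... = fact (m + 2)" by (simp add: mult.assoc exp_add[symmetric] del: fact_Suc)
 finally have "u ^ m * exp (- u) * u\<^sup>2 \<le> fact (m + 2)" .
 then have "u ^ m * exp (- u) \<le> fact (m + 2) / u\<^sup>2" using u by (simp add: pos_le_divide_eq del: fact_Suc)
 then show ?thesis using True u by (simp add: bump_profile_def u_def[symmetric] divide_inverse power_inverse del: fact_Suc)
qed (simp add: bump_profile_def)

lemma bump_profile_DERIV:
 "(bump_profile m has_real_derivative bump_profile (m + 2) s - real m * bump_profile (m + 1) s) (at s)"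
proof -
 consider "s > 0" | "s < 0" | "s = 0" by linarith
 then show ?thesis
 proof cases
  case 1
  have "((%s. inverse s ^ m * exp (- inverse s)) has_real_derivative bump_profile (m + 2) s - real m * bump_profile (m + 1) s) (at s)"
  proof (cases m)
   case (Suc k)
   have i: "(inverse has_real_derivative - (inverse s ^ Suc (Suc 0))) (at s)" using 1 by (intro DERIV_inverse) simp
   have e: "((%s. exp (- inverse s)) has_real_derivative exp (- inverse s) * - (- (inverse s ^ Suc (Suc 0)))) (at s)"
    by (rule DERIV_fun_exp[OF DERIV_minus[OF i]])
   show ?thesis using DERIV_mult[OF DERIV_power[OF i, of "Suc k"] e] 1 Suc by (simp add: bump_profile_def algebra_simps)
  qed (use 1 in \<open>auto intro!: derivative_eq_intros simp: bump_profile_def power2_eq_square field_simps\<close>)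
  then show ?thesis
   by (rule has_field_derivative_transform_within_open[of _ _ _ "{0<..}"]) (use 1 in \<open>auto simp: bump_profile_def\<close>)
 next
  case 2
  have "((%s. 0) has_real_derivative bump_profile (m + 2) s - real m * bump_profile (m + 1) s) (at s)"
   using 2 by (simp add: bump_profile_def)
  then show ?thesis
   by (rule has_field_derivative_transform_within_open[of _ _ _ "{..<0}"]) (use 2 in \<open>auto simp: bump_profile_def\<close>)
 next
  case 3
  have "((%h. (bump_profile m (0 + h) - bump_profile m 0) / h) \<longlongrightarrow> 0) (at 0)"
  proof (rule Lim_null_comparison[OF always_eventually], rule allI)
   fix h :: real
   have "\<bar>bump_profile m h\<bar> / \<bar>h\<bar> \<le> fact (m + 2) * \<bar>h\<bar>"
    using bump_profile_le[of m h] by (cases "h = 0") (auto simp: divide_simps power2_eq_square abs_mult simp del: fact_Suc)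
   then show "norm ((bump_profile m (0 + h) - bump_profile m 0) / h) \<le> fact (m + 2) * \<bar>h\<bar>"
    by (simp add: bump_profile_def[of m 0] del: fact_Suc)
  next
   show "((%h::real. fact (m + 2) * \<bar>h\<bar>) \<longlongrightarrow> 0) (at 0)" by (auto intro!: tendsto_eq_intros)
  qed
  then show ?thesis using 3 by (simp add: DERIV_def bump_profile_def)
 qed
qed

(* Closed under directional derivatives, so all its members are smooth. *)
inductive bump_algebra :: "real => 'a::euclidean_space => ('a => complex) => bool" for r y where
 profile: "bump_algebra r y (%x. of_real (bump_profile m (r - (x - y) \<bullet> (x - y))))"
| const: "bump_algebra r y (%_. c)"
| linear: "bump_algebra r y (%x. of_real ((x - y) \<bullet> w))"
| add: "bump_algebra r y f ==> bump_algebra r y g ==> bump_algebra r y (%x. f x + g x)"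
| mult: "bump_algebra r y f ==> bump_algebra r y g ==> bump_algebra r y (%x. f x * g x)"

lemma bump_algebra_derivative:
 "bump_algebra r y f ==> \<exists>f'. (\<forall>x. (f has_derivative f' x) (at x)) \<and> (\<forall>v. bump_algebra r y (%x. f' x v))"
proof (induction rule: bump_algebra.induct)
 case (profile m)
 let ?s = "%x. r - (x - y) \<bullet> (x - y)"
 let ?f' = "%x v. (of_real (bump_profile (m + 2) (?s x)) + complex_of_real (- real m) * of_real (bump_profile (m + 1) (?s x))) * (complex_of_real (- 2) * of_real ((x - y) \<bullet> v))"
 have "((%x. complex_of_real (bump_profile m (?s x))) has_derivative ?f' x) (at x)" for x
 proof -
  have "(?s has_derivative (%v. - 2 * ((x - y) \<bullet> v))) (at x)"
   by (auto intro!: derivative_eq_intros simp: inner_commute)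
  from has_derivative_compose[OF this bump_profile_DERIV[unfolded has_field_derivative_def]]
  have "((%x. bump_profile m (?s x)) has_derivative (%v. (bump_profile (m + 2) (?s x) - real m * bump_profile (m + 1) (?s x)) * (- 2 * ((x - y) \<bullet> v)))) (at x)" .
  from has_derivative_of_real[OF this, where ?'a = complex] show ?thesis by simp
 qed
 moreover have "bump_algebra r y (%x. ?f' x v)" for v by (intro bump_algebra.intros)
 ultimately show ?case by (intro exI[of _ ?f']) blast
next
 case (const c)
 show ?case by (intro exI[of _ "%x v. 0"]) (auto intro: bump_algebra.const)
next
 case (linear w)
 have "((%x. complex_of_real ((x - y) \<bullet> w)) has_derivative (%v. of_real (v \<bullet> w))) (at x)" for x
  by (auto intro!: derivative_eq_intros)
 then show ?case by (intro exI[of _ "%x v. of_real (v \<bullet> w)"]) (auto intro: bump_algebra.const)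
next
 case (add f g)
 then obtain f' g' where f': "\<And>x. (f has_derivative f' x) (at x)" "\<And>v. bump_algebra r y (%x. f' x v)"
  and g': "\<And>x. (g has_derivative g' x) (at x)" "\<And>v. bump_algebra r y (%x. g' x v)" by metis
 show ?case
  by (intro exI[of _ "%x v. f' x v + g' x v"] conjI allI has_derivative_add f' g' bump_algebra.add)
next
 case (mult f g)
 then obtain f' g' where f': "\<And>x. (f has_derivative f' x) (at x)" "\<And>v. bump_algebra r y (%x. f' x v)"
  and g': "\<And>x. (g has_derivative g' x) (at x)" "\<And>v. bump_algebra r y (%x. g' x v)" by metis
 show ?case
  by (intro exI[of _ "%x v. f x * g' x v + f' x v * g x"] conjI allI has_derivative_mult f' g' bump_algebra.add bump_algebra.mult mult.hyps)
qed

lemma bump_algebra_C_k: "bump_algebra r y f ==> C_k k f"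
proof (induction k arbitrary: f)
 case 0
 then obtain f' where "\<And>x. (f has_derivative f' x) (at x)" using bump_algebra_derivative by blast
 then show ?case by (auto intro!: continuous_at_imp_continuous_on has_derivative_continuous)
next
 case (Suc k)
 then obtain f' where f': "\<And>x. (f has_derivative f' x) (at x)" "\<And>v. bump_algebra r y (%x. f' x v)"
  using bump_algebra_derivative by blast
 have "directional_deriv v f = (%x. f' x v)" for v
  by (simp add: directional_deriv_def fun_eq_iff frechet_derivative_at[OF f'(1), symmetric])
 then show ?case using f' Suc.IH by (auto simp: differentiable_def)
qed

section \<open>Bumps and Fourier transforms of test functions\<close>

definition bump :: "real => 'a::euclidean_space => 'a => complex" where
 "bump r y x = of_real (bump_profile 0 (r\<^sup>2 - (norm (x - y))\<^sup>2))"

lemma bump_zero: "0 \<le> r ==> r \<le> norm (x - y) ==> bump r y x = 0"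
 using power_mono[of r "norm (x - y)" 2] by (simp add: bump_def bump_profile_def not_less)

lemma test_function_bump:
 assumes r: "0 \<le> r" shows "test_function (bump r y)"
proof -
 have "{x. bump r y x \<noteq> 0} \<subseteq> cball y r"
 proof
  fix x assume "x \<in> {x. bump r y x \<noteq> 0}"
  then have "norm (x - y) < r" using bump_zero[OF r, of x y] by (cases "r \<le> norm (x - y)") auto
  then show "x \<in> cball y r" by (simp add: dist_norm norm_minus_commute)
 qed
 then have "compact (closure {x. bump r y x \<noteq> 0})"
  by (meson bounded_cball bounded_subset compact_closure)
 moreover have "bump r y = (%x. of_real (bump_profile 0 (r\<^sup>2 - (x - y) \<bullet> (x - y))))"
  by (simp add: bump_def fun_eq_iff power2_norm_eq_inner)
 ultimately show ?thesis by (auto simp: test_function_def intro: bump_algebra_C_k bump_algebra.profile)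
qed

lemma test_function_Cc:
 assumes "test_function \<phi>" shows "Cc \<phi>"
proof -
 have "C_k 0 \<phi>" using assms by (simp only: test_function_def)
 moreover have "bounded {x. \<phi> x \<noteq> 0}" using assms by (auto simp: test_function_def compact_closure)
 then obtain R where "\<And>x. \<phi> x \<noteq> 0 ==> norm x \<le> R" unfolding bounded_iff by blast
 then have "\<forall>x. norm x > R \<longrightarrow> \<phi> x = 0" by (auto simp: not_le[symmetric])
 ultimately show ?thesis by (auto simp: Cc_def)
qed

lemma test_function_differentiable: "test_function \<phi> ==> \<phi> differentiable (at x)"
proof -
 assume "test_function \<phi>"
 then have "C_k (Suc 0) \<phi>" by (simp only: test_function_def)
 then show ?thesis by simp
qed

lemma test_function_directional_deriv:
 assumes "test_function \<phi>" shows "test_function (directional_deriv v \<phi>)"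
proof -
 have "C_k (Suc k) \<phi>" for k using assms by (simp only: test_function_def)
 then have "C_k k (directional_deriv v \<phi>)" for k by simp
 moreover have "{x. directional_deriv v \<phi> x \<noteq> 0} \<subseteq> closure {x. \<phi> x \<noteq> 0}"
 proof (rule subsetI, rule ccontr)
  fix x assume x: "x \<in> {x. directional_deriv v \<phi> x \<noteq> 0}" "x \<notin> closure {x. \<phi> x \<noteq> 0}"
  have "((%_. 0) has_derivative (%_. 0)) (at x)" by (rule has_derivative_const)
  then have "(\<phi> has_derivative (%_. 0)) (at x)"
   by (rule has_derivative_transform_within_open[of _ _ _ _ "- closure {x. \<phi> x \<noteq> 0}"])
    (use x closure_subset[of "{x. \<phi> x \<noteq> 0}"] in auto)
  then show False using x by (simp add: directional_deriv_def frechet_derivative_at[symmetric])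
 qed
 then have "closure {x. directional_deriv v \<phi> x \<noteq> 0} \<subseteq> closure {x. \<phi> x \<noteq> 0}" by (simp add: closure_minimal)
 then have "compact (closure {x. directional_deriv v \<phi> x \<noteq> 0})"
  using assms unfolding test_function_def by (meson closed_closure compact_Int_closed inf.absorb_iff2 compact_closure bounded_subset compact_imp_bounded closure_subset)
 ultimately show ?thesis by (simp add: test_function_def)
qed

text \<open>Difference quotients replace integration by parts: their transforms are explicit by
  \<open>ft_tr\<close>, they are bounded by the sup of the derivative, and their supports stay in
  one ball, so dominated convergence applies.\<close>

lemma ft_directional_deriv:
 fixes \<phi> :: "'a::euclidean_space => complex"
 assumes \<phi>: "test_function \<phi>"
 shows "ft s (directional_deriv e \<phi>) \<xi> = - \<i> * of_real s * of_real (\<xi> \<bullet> e) * ft s \<phi> \<xi>"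
proof -
 let ?h = "%k. inverse (real (Suc k))"
 define D where "D k x = of_real (real (Suc k)) * (\<phi> (x + ?h k *\<^sub>R e) - \<phi> x)" for k x
 have Cc: "Cc \<phi>" "Cc (directional_deriv e \<phi>)" using \<phi> by (auto intro: test_function_Cc test_function_directional_deriv)
 have [measurable]: "\<phi> \<in> borel_measurable borel" "directional_deriv e \<phi> \<in> borel_measurable borel" using Cc Cc_measurable by auto
 obtain R1 B1 where R1: "0 < R1" "0 < B1" "\<And>x. norm x > R1 ==> \<phi> x = 0" "\<And>x. norm (\<phi> x) \<le> B1" using Cc_bounded[OF Cc(1)] by blast
 obtain R2 B where R2: "0 < R2" "0 < B" "\<And>x. norm x > R2 ==> directional_deriv e \<phi> x = 0" "\<And>x. norm (directional_deriv e \<phi> x) \<le> B" using Cc_bounded[OF Cc(2)] by blast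
 have der: "((%t. \<phi> (x + t *\<^sub>R e)) has_vector_derivative directional_deriv e \<phi> (x + t *\<^sub>R e)) (at t within S)" for x t S
 proof -
  have 1: "(\<phi> has_derivative frechet_derivative \<phi> (at (x + t *\<^sub>R e))) (at (x + t *\<^sub>R e))"
   using test_function_differentiable[OF \<phi>] frechet_derivative_works by blast
  have 2: "((%t. x + t *\<^sub>R e) has_derivative (%h. h *\<^sub>R e)) (at t within S)" by (auto intro!: derivative_eq_intros)
  have "((%t. \<phi> (x + t *\<^sub>R e)) has_derivative (%h. frechet_derivative \<phi> (at (x + t *\<^sub>R e)) (h *\<^sub>R e))) (at t within S)"
   by (rule has_derivative_compose[OF 2 1])
  then show ?thesis
   unfolding has_vector_derivative_def directional_deriv_def
   by (simp add: linear_scale[OF bounded_linear.linear[OF has_derivative_bounded_linear[OF 1]]])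
 qed
 have le: "norm (\<phi> (x + t *\<^sub>R e) - \<phi> x) \<le> B * t" if "0 \<le> t" for x t
 proof (cases "t = 0")
  case False
  have "norm (\<phi> (x + t *\<^sub>R e) - \<phi> (x + 0 *\<^sub>R e)) \<le> B * t - B * 0"
  proof (rule differentiable_bound_general[where f = "%t. \<phi> (x + t *\<^sub>R e)" and \<phi> = "%t. B * t"])
   show "0 < t" using that False by simp
   show "continuous_on {0..t} (%t. \<phi> (x + t *\<^sub>R e))" by (rule continuous_on_vector_derivative[OF der])
   show "((%t. \<phi> (x + t *\<^sub>R e)) has_vector_derivative directional_deriv e \<phi> (x + r *\<^sub>R e)) (at r)" for r by (rule der)
   show "((%t. B * t) has_vector_derivative B) (at r)" for r
    by (auto intro!: derivative_eq_intros simp: has_real_derivative_iff_has_vector_derivative[symmetric])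
  qed (use R2 in \<open>auto intro: continuous_intros\<close>)
  then show ?thesis by simp
 qed simp
 have Dle: "norm (D k x) \<le> B" for k x
 proof -
  have "norm (D k x) \<le> real (Suc k) * (B * ?h k)" unfolding D_def norm_mult
   unfolding norm_of_real by (intro mult_mono le) auto
  also have "... = B" by (simp del: of_nat_Suc)
  finally show ?thesis .
 qed
 have Dsupp: "D k x = 0" if "norm x > R1 + norm e" for k x
 proof -
  have "norm x \<le> norm (x + ?h k *\<^sub>R e) + norm (?h k *\<^sub>R e)" using norm_triangle_ineq4[of "x + ?h k *\<^sub>R e" "?h k *\<^sub>R e"] by simp
  also have "norm (?h k *\<^sub>R e) \<le> 1 * norm e" unfolding norm_scaleR by (intro mult_right_mono) (auto simp: divide_simps)
  finally have "norm (x + ?h k *\<^sub>R e) > R1" using that by simp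
  moreover have "norm x > R1" using that norm_ge_zero[of e] by linarith
  ultimately show ?thesis using R1(3) by (simp add: D_def)
 qed
 have lim: "(%k. D k x) \<longlonglongrightarrow> directional_deriv e \<phi> x" for x
 proof -
  have "(%k. (\<phi> (x + (0 + ?h k) *\<^sub>R e) - \<phi> (x + 0 *\<^sub>R e)) /\<^sub>R ?h k) \<longlonglongrightarrow> directional_deriv e \<phi> (x + 0 *\<^sub>R e)"
   by (rule has_vector_derivative_quotient_seq[OF der[of x 0 UNIV] _ _ LIMSEQ_inverse_real_of_nat]) auto
  then show ?thesis by (simp add: D_def scaleR_conv_of_real del: of_nat_Suc)
 qed
 have "(%k. ft s (D k) \<xi>) \<longlonglongrightarrow> ft s (directional_deriv e \<phi>) \<xi>"
  unfolding ft_def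
 proof (intro tendsto_mult_left integral_dominated_convergence[where w = "%x. B * indicator (cball 0 (R1 + norm e)) x"])
  show "AE x in lborel. (%k. exp (\<i> * of_real (s * (x \<bullet> \<xi>))) * D k x) \<longlonglongrightarrow> exp (\<i> * of_real (s * (x \<bullet> \<xi>))) * directional_deriv e \<phi> x"
   by (intro AE_I2 tendsto_mult_left lim)
  show "AE x in lborel. norm (exp (\<i> * of_real (s * (x \<bullet> \<xi>))) * D k x) \<le> B * indicator (cball 0 (R1 + norm e)) x" for k
   using Dle[of k] Dsupp[of _ k] by (intro AE_I2) (auto simp: norm_mult indicator_def)
 qed (auto simp: D_def)
 moreover have "ft s (D k) \<xi> = of_real (real (Suc k)) * (em (?h k *\<^sub>R (- s *\<^sub>R e)) \<xi> - 1) * ft s \<phi> \<xi>" for k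
 proof -
  have L: "\<phi> \<in> L1_space" "(%x. \<phi> (x + ?h k *\<^sub>R e)) \<in> L1_space"
   using Cc_spaces[OF Cc(1)] lborel_integrable_shift[of \<phi>] by (auto simp: L1_space_def)
  show ?thesis unfolding D_def ft_cmult ft_diff[OF L(2,1)]
   by (subst ft_tr) (auto simp: algebra_simps)
 qed
 ultimately have "(%k. of_real (real (Suc k)) * (em (?h k *\<^sub>R (- s *\<^sub>R e)) \<xi> - 1) * ft s \<phi> \<xi>) \<longlonglongrightarrow> ft s (directional_deriv e \<phi>) \<xi>" by simp
 moreover have "(%k. of_real (real (Suc k)) * (em (?h k *\<^sub>R (- s *\<^sub>R e)) \<xi> - 1) * ft s \<phi> \<xi>) \<longlonglongrightarrow> \<i> * of_real (\<xi> \<bullet> (- s *\<^sub>R e)) * ft s \<phi> \<xi>"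
  by (rule tendsto_mult_right[OF em_quotient_tendsto])
 ultimately show ?thesis by (auto dest: LIMSEQ_unique)
qed

lemma Cc_laplacian:
 assumes "test_function \<phi>" shows "Cc (laplacian \<phi>)"
proof -
 let ?d = "%b. directional_deriv b (directional_deriv b \<phi>)"
 have t: "Cc (?d b)" for b using assms by (intro test_function_Cc test_function_directional_deriv)
 obtain R where R: "\<And>b x. norm x > R b ==> ?d b x = 0" using t unfolding Cc_def by metis
 have "continuous_on UNIV (laplacian \<phi>)"
  unfolding laplacian_def[abs_def] using t by (intro continuous_on_sum) (simp add: Cc_def)
 moreover have "laplacian \<phi> x = 0" if "norm x > Max (R ` (Basis::'a set))" for x
  unfolding laplacian_def
 proof (rule sum.neutral, rule ballI)
  fix b :: 'a assume "b \<in> Basis"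
  then have "R b \<le> Max (R ` (Basis::'a set))" by (intro Max_ge) auto
  then show "?d b x = 0" using that by (intro R) linarith
 qed
 ultimately show ?thesis unfolding Cc_def by blast
qed

lemma ft_laplacian:
 fixes \<phi> :: "'a::euclidean_space => complex"
 assumes \<phi>: "test_function \<phi>" and s: "s\<^sup>2 = 1"
 shows "ft s (laplacian \<phi>) \<xi> = - of_real ((norm \<xi>)^2) * ft s \<phi> \<xi>"
proof -
 let ?d = "%b. directional_deriv b (directional_deriv b \<phi>)"
 have t: "?d b \<in> L1_space" for b using \<phi> by (intro Cc_spaces test_function_Cc test_function_directional_deriv)
 have "ft s (laplacian \<phi>) \<xi> = (\<Sum>b\<in>Basis. ft s (?d b) \<xi>)"
  unfolding ft_def laplacian_def sum_distrib_left
  by (subst Bochner_Integration.integral_sum) (use L1_exp[OF t, of "%x. s * (x \<bullet> \<xi>)"] in \<open>auto simp: L1_space_def sum_distrib_left\<close>)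
 also have "... = (\<Sum>b\<in>Basis. - of_real ((\<xi> \<bullet> b)^2) * ft s \<phi> \<xi>)"
 proof (rule sum.cong)
  fix b :: 'a
  have "ft s (?d b) \<xi> = (\<i> * \<i>) * (of_real (s\<^sup>2) * (of_real ((\<xi> \<bullet> b)^2) * ft s \<phi> \<xi>))"
   by (simp add: ft_directional_deriv \<phi> test_function_directional_deriv power2_eq_square mult_ac)
  then show "ft s (?d b) \<xi> = - of_real ((\<xi> \<bullet> b)^2) * ft s \<phi> \<xi>" by (simp only: s) simp
 qed simp
 also have "... = - of_real ((norm \<xi>)^2) * ft s \<phi> \<xi>"
 proof -
  have "(norm \<xi>)^2 = (\<Sum>b\<in>Basis. (\<xi> \<bullet> b)^2)" by (subst power2_norm_eq_inner, subst euclidean_inner) (simp add: power2_eq_square)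
  then show ?thesis by (simp only: of_real_sum sum_negf[symmetric] sum_distrib_right)
 qed
 finally show ?thesis .
qed

text \<open>Where the bump is positive, |x . xi| < 1 < pi/2, so the real part of the integrand is
  positive on the ball and zero outside.\<close>

lemma ft_bump_nonzero:
 fixes \<xi> :: "'a::euclidean_space"
 assumes r: "r > 0" "norm \<xi> * r < 1"
 shows "ft (-1) (bump r 0) \<xi> \<noteq> 0"
proof
 assume z: "ft (-1) (bump r 0) \<xi> = 0"
 let ?g = "%x::'a. cos (x \<bullet> \<xi>) * bump_profile 0 (r\<^sup>2 - (norm x)\<^sup>2)"
 have t: "test_function (bump r (0::'a))" using r by (intro test_function_bump) simp
 have L: "bump r (0::'a) \<in> L1_space" by (rule Cc_spaces[OF test_function_Cc[OF t]])
 have I: "integrable lborel (%x. exp (\<i> * of_real (- 1 * (x \<bullet> \<xi>))) * bump r 0 x)"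
  using L1_exp[OF L, of "%x. - 1 * (x \<bullet> \<xi>)"] by (simp add: L1_space_def)
 have Re: "Re (exp (\<i> * of_real (- 1 * (x \<bullet> \<xi>))) * bump r 0 x) = ?g x" for x
  by (simp add: bump_def Re_exp)
 have "(LBINT x. ?g x) = 0"
 proof -
  have "(LBINT x. exp (\<i> * of_real (- 1 * (x \<bullet> \<xi>))) * bump r 0 x) = 0"
   using z ft_const_pos(1)[where 'a='a] by (simp add: ft_def)
  then show ?thesis using integral_Re[OF I] unfolding Re by simp
 qed
 moreover have g0: "0 \<le> ?g x" and gpos: "norm x < r ==> 0 < ?g x" for x
 proof -
  have c: "norm x < r ==> 0 < cos (x \<bullet> \<xi>)"
  proof -
   assume "norm x < r"
   then have "norm x * norm \<xi> \<le> r * norm \<xi>" by (intro mult_right_mono) auto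
   then have "\<bar>x \<bullet> \<xi>\<bar> < 1" using r Cauchy_Schwarz_ineq2[of x \<xi>] by (simp add: mult.commute)
   then show ?thesis using pi_gt3 by (intro cos_gt_zero_pi) auto
  qed
  show "norm x < r ==> 0 < ?g x" using c r by (auto simp: bump_profile_def power_strict_mono)
  then show "0 \<le> ?g x"
   using bump_zero[of r x 0] r by (cases "norm x < r") (auto simp: bump_def less_imp_le)
 qed
 moreover have "integrable lborel ?g" using integrable_Re[OF I] unfolding Re .
 ultimately have "AE x in lborel. ?g x = 0" by (subst (asm) integral_nonneg_eq_0_iff_AE) auto
 then have "AE x in lborel. x \<notin> ball (0::'a) r" by eventually_elim (use gpos in \<open>force simp: dist_norm\<close>)
 then have "emeasure lborel (ball (0::'a) r) = 0" using AE_iff_measurable[of "ball (0::'a) r" lborel "%x. x \<notin> ball 0 r"] by (auto simp del: mem_ball mem_ball_0)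
 then show False using content_ball_pos[OF r(1), of "0::'a"] by (simp add: measure_def)
qed

section \<open>Weak and mild solutions\<close>

text \<open>The graph of the Laplacian as an unbounded operator on L2; a relation, since only
  elements of H^2 have an image.\<close>

definition has_laplacian :: "'a::euclidean_space L2 => 'a L2 => bool" where
 "has_laplacian \<psi> \<eta> \<longleftrightarrow> (AE \<xi> in lborel. fn (FT (-1) \<eta>) \<xi> = - of_real ((norm \<xi>)^2) * fn (FT (-1) \<psi>) \<xi>)"

lemma has_laplacian_U: assumes "has_laplacian \<psi> \<eta>" shows "has_laplacian (U t \<psi>) (U t \<eta>)"
 using assms unfolding has_laplacian_def FT_U
 using fn_mlt[OF bmeas_Ep, of t "FT (-1) \<psi>"] fn_mlt[OF bmeas_Ep, of t "FT (-1) \<eta>"] by eventually_elim simp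

lemma has_laplacian_const: assumes "has_laplacian \<psi> \<eta>" shows "has_laplacian (mlt (%_. c) \<psi>) (mlt (%_. c) \<eta>)"
 using assms unfolding has_laplacian_def FT_const[of "-1", simplified]
 using fn_mlt[OF bmeas_const, of c "FT (-1) \<psi>"] fn_mlt[OF bmeas_const, of c "FT (-1) \<eta>"] by eventually_elim simp

lemma has_laplacian_unique: "has_laplacian \<psi> \<eta> ==> has_laplacian \<psi> \<eta>' ==> \<eta> = \<eta>'"
proof -
 assume "has_laplacian \<psi> \<eta>" "has_laplacian \<psi> \<eta>'"
 then have "AE \<xi> in lborel. fn (FT (-1) \<eta>) \<xi> = fn (FT (-1) \<eta>') \<xi>" unfolding has_laplacian_def by eventually_elim simp
 from arg_cong[OF L2_eqI[OF this], of "FT 1"] show ?thesis by simp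
qed

lemma Cc_cnj: "Cc \<phi> ==> Cc (%x. cnj (\<phi> x))"
 by (auto simp: Cc_def intro: continuous_on_cnj)

lemma has_laplacian_test:
 assumes \<phi>: "test_function \<phi>"
 shows "has_laplacian (cls (%x. cnj (\<phi> x))) (cls (%x. cnj (laplacian \<phi> x)))"
proof -
 have C: "Cc (%x. cnj (\<phi> x))" "Cc (%x. cnj (laplacian \<phi> x))"
  using \<phi> by (auto intro: Cc_cnj test_function_Cc Cc_laplacian)
 have F: "FT (-1) (cls (%x. cnj (\<phi> x))) = cls (%\<xi>. cnj (ft 1 \<phi> \<xi>))"
  "FT (-1) (cls (%x. cnj (laplacian \<phi> x))) = cls (%\<xi>. cnj (ft 1 (laplacian \<phi>) \<xi>))"
  using FT_cls[OF _ Cc_spaces[OF C(1)], of "-1"] FT_cls[OF _ Cc_spaces[OF C(2)], of "-1"] by (simp_all add: ft_cnj[abs_def])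
 have L: "(%\<xi>. cnj (ft 1 \<phi> \<xi>)) \<in> L2_space" "(%\<xi>. cnj (ft 1 (laplacian \<phi>) \<xi>)) \<in> L2_space"
  using ft_contraction(1)[OF _ Cc_spaces[OF C(1)], of "-1"] ft_contraction(1)[OF _ Cc_spaces[OF C(2)], of "-1"] by (simp_all add: ft_cnj[abs_def])
 show ?thesis unfolding has_laplacian_def F
  using fn_cls[OF L(1)] fn_cls[OF L(2)] by eventually_elim (simp add: ft_laplacian[OF \<phi>])
qed

lemma Ep_quotient_le: "norm (Ep r \<xi> - 1) \<le> \<bar>r\<bar> * ((norm \<xi>)^2 / 2)"
 using iexp_approx1[of "- (r * (norm \<xi>)^2 / 2)" 0] by (simp add: Ep_def abs_mult)

lemma Ep_quotient_tendsto:
 assumes r: "r \<longlonglongrightarrow> 0" "\<And>k. r k \<noteq> 0"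
 shows "(%k. (Ep (r k) \<xi> - 1) / of_real (r k)) \<longlonglongrightarrow> - \<i> * of_real ((norm \<xi>)^2 / 2)"
proof (rule LIM_zero_cancel, rule Lim_null_comparison[OF always_eventually], rule allI)
 let ?y = "(norm \<xi>)^2 / 2"
 have aux: "(a * y)^2 / 2 / \<bar>a\<bar> = y\<^sup>2 / 2 * \<bar>a\<bar>" if "a \<noteq> 0" for a y :: real
  using that by (cases "a > 0") (auto simp: power2_eq_square field_simps)
 fix k
 have "(Ep (r k) \<xi> - 1) / of_real (r k) - - \<i> * of_real ?y
   = (exp (\<i> * complex_of_real (- (r k * ?y))) - (1 + \<i> * of_real (- (r k * ?y)))) / of_real (r k)"
  using r(2)[of k] by (simp add: Ep_def field_simps)
 also have "norm ... \<le> (r k * ?y)^2 / 2 / \<bar>r k\<bar>"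
  using iexp_approx1[of "- (r k * ?y)" 1] unfolding norm_divide norm_of_real
  by (intro divide_right_mono) (auto simp: power2_eq_square)
 also have "... = ?y\<^sup>2 / 2 * \<bar>r k\<bar>"  by (rule aux[OF r(2)])
 finally show "norm ((Ep (r k) \<xi> - 1) / of_real (r k) - - \<i> * of_real ?y) \<le> ?y\<^sup>2 / 2 * \<bar>r k\<bar>" .
next
 show "(%k. ((norm \<xi>)^2 / 2)^2 / 2 * \<bar>r k\<bar>) \<longlonglongrightarrow> 0" by (rule tendsto_mult_right_zero[OF tendsto_rabs_zero[OF r(1)]])
qed

text \<open>On the domain of the Laplacian the difference quotients of the symbol, bounded by half
  the square of |xi|, are dominated by the transform of eta.\<close>

lemma U_has_vector_derivative:
 assumes \<psi>: "has_laplacian \<psi> \<eta>"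
 shows "((%s. U s \<psi>) has_vector_derivative mlt (%_. \<i> / 2) (U t \<eta>)) (at t within S)"
 unfolding has_vector_derivative_iff_quotient tendsto_at_iff_sequentially comp_def
proof (intro allI impI)
 fix s assume sS: "\<forall>k. s k \<in> S - {t}" and s: "s \<longlonglongrightarrow> t"
 define r where "r k = s k - t" for k
 have r: "r \<longlonglongrightarrow> 0" "\<And>k. r k \<noteq> 0" using sS tendsto_diff[OF s tendsto_const[of t]] by (auto simp: r_def[abs_def])
 define F where "F k \<xi> = (Ep (r k) \<xi> - 1) / of_real (r k) * fn (FT (-1) \<psi>) \<xi>" for k \<xi>
 have bm: "bmeas (%\<xi>. (Ep (r k) \<xi> - 1) / of_real (r k))" for k
  using bmeas_mult[OF bmeas_diff[OF bmeas_Ep[of "r k"] bmeas_const[of 1]] bmeas_const[of "inverse (of_real (r k))"]] by (simp add: divide_inverse)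
 have FL: "F k \<in> L2_space" for k unfolding F_def[abs_def] by (rule mlt_in_L2[OF bm])
 have m: "(%\<xi>. \<i> / 2 * fn (FT (-1) \<eta>) \<xi>) \<in> borel_measurable borel" by measurable
 have "(%k. cls (F k)) \<longlonglongrightarrow> cls (%\<xi>. \<i> / 2 * fn (FT (-1) \<eta>) \<xi>)"
 proof (rule cls_tendsto(2)[OF FL m fn_L2[of "FT (-1) \<eta>"]])
  show "AE \<xi> in lborel. (%k. F k \<xi>) \<longlonglongrightarrow> \<i> / 2 * fn (FT (-1) \<eta>) \<xi>"
   using \<psi> unfolding has_laplacian_def
  proof eventually_elim
   case (elim \<xi>)
   show ?case using tendsto_mult_right[OF Ep_quotient_tendsto[OF r, of \<xi>], of "fn (FT (-1) \<psi>) \<xi>"] by (simp add: F_def elim mult_ac)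
  qed
  show "AE \<xi> in lborel. norm (F k \<xi>) \<le> norm (fn (FT (-1) \<eta>) \<xi>)" for k
   using \<psi> unfolding has_laplacian_def
  proof eventually_elim
   case (elim \<xi>)
   have "norm ((Ep (r k) \<xi> - 1) / of_real (r k)) \<le> (norm \<xi>)^2 / 2"
    using Ep_quotient_le[of "r k" \<xi>] r(2)[of k] by (simp add: norm_divide pos_divide_le_eq mult.commute)
   also have "... \<le> (norm \<xi>)^2" by simp
   finally have "norm ((Ep (r k) \<xi> - 1) / of_real (r k)) * norm (fn (FT (-1) \<psi>) \<xi>) \<le> (norm \<xi>)^2 * norm (fn (FT (-1) \<psi>) \<xi>)"
    by (rule mult_right_mono) simp
   then show ?case unfolding F_def elim norm_mult by (simp add: norm_power)
  qed
 qed
 then have "(%k. U t (FT 1 (cls (F k)))) \<longlonglongrightarrow> U t (FT 1 (mlt (%_. \<i> / 2) (FT (-1) \<eta>)))"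
  unfolding mlt_def[symmetric]
  by (intro bounded_linear.tendsto[OF bounded_linear_U] bounded_linear.tendsto[OF bounded_linear_FT]) auto
 moreover have "U t (FT 1 (mlt (%_. \<i> / 2) (FT (-1) \<eta>))) = mlt (%_. \<i> / 2) (U t \<eta>)"
  by (simp add: FT_const U_const)
 moreover have "U t (FT 1 (cls (F k))) = (U (s k) \<psi> - U t \<psi>) /\<^sub>R (s k - t)" for k
 proof -
  have "cls (F k) = (mlt (Ep (r k)) (FT (-1) \<psi>) - FT (-1) \<psi>) /\<^sub>R r k"
  proof (rule L2_eqI, use fn_cls[OF FL[of k]] fn_scaleR[of "inverse (r k)" "mlt (Ep (r k)) (FT (-1) \<psi>) - FT (-1) \<psi>"]
    fn_diff[of "mlt (Ep (r k)) (FT (-1) \<psi>)" "FT (-1) \<psi>"] fn_mlt[OF bmeas_Ep[of "r k"], of "FT (-1) \<psi>"] in eventually_elim)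
   case (elim \<xi>)
   show ?case by (simp only: elim F_def) (simp add: scaleR_conv_of_real divide_inverse algebra_simps)
  qed
  also have "... = FT (-1) ((U (r k) \<psi> - \<psi>) /\<^sub>R r k)"
   by (simp add: FT_U linear_diff[OF bounded_linear.linear[OF bounded_linear_FT]] linear_scale[OF bounded_linear.linear[OF bounded_linear_FT]])
  finally show ?thesis
   by (simp add: linear_scale[OF bounded_linear.linear[OF bounded_linear_U]] U_diff U_U r_def)
 qed
 ultimately show "(%k. (U (s k) \<psi> - U t \<psi>) /\<^sub>R (s k - t)) \<longlonglongrightarrow> mlt (%_. \<i> / 2) (U t \<eta>)" by simp
qed

(* The complex bilinear pairing of f and cnj psi; the inner product of L2 is its real part. *)
definition cpair :: "'a::euclidean_space L2 => 'a L2 => complex" where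
 "cpair f \<psi> = Complex (inner f \<psi>) (inner f (mlt (%_. \<i>) \<psi>))"

lemma cpair_cls:
 assumes f: "f \<in> L2_space" and g: "g \<in> L2_space"
 shows "cpair (cls f) (cls (%x. cnj (g x))) = (LBINT x. f x * g x)"
proof -
 have c: "(%x. cnj (g x)) \<in> L2_space" by (rule L2_space_bound[OF g]) (use g in auto)
 have I: "integrable lborel (%x. f x * g x)" by (rule integrable_L2_prod[OF f g])
 have "inner (cls f) (cls (%x. cnj (g x))) = Re (LBINT x. f x * g x)"
  unfolding inner_cls[OF f c] integral_Re[OF I, symmetric] by (simp add: inner_complex_def)
 moreover have "inner (cls f) (mlt (%_. \<i>) (cls (%x. cnj (g x)))) = Im (LBINT x. f x * g x)"
  unfolding mlt_cls[OF bmeas_const c] inner_cls[OF f L2_space_cmult[OF c]] integral_Im[OF I, symmetric]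
  by (simp add: inner_complex_def algebra_simps)
 ultimately show ?thesis by (simp add: cpair_def complex_eq_iff)
qed

lemma cpair_has_vector_derivative:
 assumes "((%s. inner (w s) \<psi>) has_vector_derivative d1) F" "((%s. inner (w s) (mlt (%_. \<i>) \<psi>)) has_vector_derivative d2) F"
 shows "((%s. cpair (w s) \<psi>) has_vector_derivative Complex d1 d2) F"
proof -
 have C: "Complex a b = a *\<^sub>R 1 + b *\<^sub>R \<i>" for a b by (simp add: complex_eq_iff)
 show ?thesis unfolding cpair_def C
  by (intro has_vector_derivative_add bounded_linear.has_vector_derivative[OF bounded_linear_scaleR_left] assms)
qed

lemma at_within_atLeast_eq:
 fixes t :: real assumes "0 \<le> t" shows "at t within {0..} = at t within {0..t+1}"
 by (rule at_within_nhd[of t "{..<t+1}"]) auto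

context nls
begin

text \<open>U(s) z(s) need not be differentiable in L2. Moving the propagator onto psi, which lies
  in the domain of the Laplacian, leaves two differentiable factors and the product rule.\<close>

lemma sol_inner_derivative:
 assumes z: "\<And>b. sol 0 b z" and t: "0 \<le> t" and \<psi>: "has_laplacian \<psi> \<eta>"
 shows "((%s. inner (U s (z s)) \<psi>) has_vector_derivative
  (inner (mlt (%_. - \<i> * lam) (NL p (U t (z t)))) \<psi> + inner (U t (z t)) (mlt (%_. - \<i> / 2) \<eta>))) (at t within {0..})"
proof -
 have "(uminus has_vector_derivative - 1) (at t within {0..t+1})"
  by (auto intro!: derivative_eq_intros)
 from vector_diff_chain_within[OF this U_has_vector_derivative[OF \<psi>]]
 have d1: "((%s. U (- s) \<psi>) has_vector_derivative - mlt (%_. \<i> / 2) (U (- t) \<eta>)) (at t within {0..t+1})" by (simp add: o_def)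
 have d2: "(z has_vector_derivative vf t (z t)) (at t within {0..t+1})" using z[of "t + 1"] t by (simp add: sol_def)
 have "((%s. inner (z s) (U (- s) \<psi>)) has_vector_derivative (inner (z t) (- mlt (%_. \<i> / 2) (U (- t) \<eta>)) + inner (vf t (z t)) (U (- t) \<psi>))) (at t within {0..t+1})"
  by (rule bounded_bilinear.has_vector_derivative[OF bounded_bilinear_inner d2 d1])
 moreover have "- mlt (%_. \<i> / 2) (U (- t) \<eta>) = U (- t) (mlt (%_. - \<i> / 2) \<eta>)"
  unfolding U_const
 proof (rule L2_eqI, use fn_uminus[of "mlt (%_. \<i> / 2) (U (- t) \<eta>)"] fn_mlt[OF bmeas_const, of "\<i> / 2" "U (- t) \<eta>"]
   fn_mlt[OF bmeas_const, of "- \<i> / 2" "U (- t) \<eta>"] in eventually_elim)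
 qed simp
 moreover have "inner (z t) (U (- t) (mlt (%_. - \<i> / 2) \<eta>)) = inner (U t (z t)) (mlt (%_. - \<i> / 2) \<eta>)"
  by (simp only: inner_U)
 moreover have "inner (vf t (z t)) (U (- t) \<psi>) = inner (mlt (%_. - \<i> * lam) (NL p (U t (z t)))) \<psi>"
  unfolding vf_def U_const[symmetric] inner_U by simp
 ultimately show ?thesis using t by (simp add: at_within_atLeast_eq inner_U add.commute)
qed

lemma sol_NLS_solution:
 assumes z: "\<And>b. sol 0 b z" and fin: "Wj (FT (-1) (z 0)) < \<infinity>" "Wj (z 0) < \<infinity>"
  and u0: "u0 \<in> L2_space" "z 0 = cls u0"
 shows "NLS_solution lam p u0 (%t. fn (U t (z t)))"
 unfolding NLS_solution_def
proof (intro conjI allI impI)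
 show "continuous_into_H11 (%t. fn (U t (z t)))" by (rule continuous_into_H11_sol[OF z fin])
 show "AE x in lborel. fn (U 0 (z 0)) x = u0 x" using fn_cls[OF u0(1)] by (simp add: u0(2))
 fix \<phi> :: "'a => complex" and t :: real assume \<phi>: "test_function \<phi>" and t: "0 \<le> t"
 have L: "\<phi> \<in> L2_space" "laplacian \<phi> \<in> L2_space"
  using Cc_spaces(2) test_function_Cc[OF \<phi>] Cc_laplacian[OF \<phi>] by auto
 obtain K where K: "0 \<le> K" "\<And>s. s \<in> {0..t} ==> U s (z s) \<in> Bq q K" using sol_Bq[OF z] by metis
 have B: "U t (z t) \<in> Bq q K" using K t by simp
 note N = NL_L2[OF B]
 show "integrable lborel (%x. power_nonlinearity p (fn (U t (z t)) x) * \<phi> x)" by (rule integrable_L2_prod[OF N L(1)])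
 let ?\<psi> = "cls (%x. cnj (\<phi> x))" and ?\<eta> = "cls (%x. cnj (laplacian \<phi> x))" and ?w = "U t (z t)"
 let ?N = "mlt (%_. - \<i> * lam) (NL p ?w)"
 have h: "has_laplacian ?\<psi> ?\<eta>" by (rule has_laplacian_test[OF \<phi>])
 have pair: "(LBINT x. fn f x * \<phi> x) = cpair f ?\<psi>" for f using cpair_cls[OF fn_L2 L(1), of f] by simp
 let ?D = "Complex (inner ?N ?\<psi> + inner ?w (mlt (%_. - \<i> / 2) ?\<eta>))
   (inner ?N (mlt (%_. \<i>) ?\<psi>) + inner ?w (mlt (%_. - \<i> / 2) (mlt (%_. \<i>) ?\<eta>)))"
 have der: "((%s. cpair (U s (z s)) ?\<psi>) has_vector_derivative ?D) (at t within {0..})"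
  by (intro cpair_has_vector_derivative sol_inner_derivative[OF z t] h has_laplacian_const)
 have "?D = cpair ?N ?\<psi> + cpair ?w (mlt (%_. - \<i> / 2) ?\<eta>)"
  by (simp add: cpair_def complex_eq_iff mlt_commute[of "%_. \<i>"])
 also have "cpair ?N ?\<psi> = (LBINT x. (- \<i> * lam * power_nonlinearity p (fn ?w x)) * \<phi> x)"
  unfolding NL_def mlt_cls[OF bmeas_const N] by (rule cpair_cls[OF L2_space_cmult[OF N] L(1)])
 also have "... = - \<i> * lam * (LBINT x. power_nonlinearity p (fn ?w x) * \<phi> x)"
  by (subst integral_mult_right_zero[symmetric]) (simp add: mult_ac)
 also have "cpair ?w (mlt (%_. - \<i> / 2) ?\<eta>) = (LBINT x. fn ?w x * (\<i> / 2 * laplacian \<phi> x))"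
 proof -
  have c: "(%x. cnj (laplacian \<phi> x)) \<in> L2_space" using Cc_spaces(2)[OF Cc_cnj[OF Cc_laplacian[OF \<phi>]]] .
  show ?thesis using cpair_cls[OF fn_L2 L2_space_cmult[OF L(2), of "\<i> / 2"], of ?w] by (simp add: mlt_cls[OF bmeas_const c])
 qed
 also have "... = \<i> / 2 * (LBINT x. fn ?w x * laplacian \<phi> x)"
  by (subst integral_mult_right_zero[symmetric]) (simp add: mult_ac)
 finally have D: "?D = - \<i> * lam * (LBINT x. power_nonlinearity p (fn ?w x) * \<phi> x) + \<i> / 2 * (LBINT x. fn ?w x * laplacian \<phi> x)" .
 show "\<exists>D. ((%s. \<integral>x. fn (U s (z s)) x * \<phi> x \<partial>lborel) has_vector_derivative D) (at t within {0..}) \<and>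
   \<i> * D + 1 / 2 * (LBINT x. fn ?w x * laplacian \<phi> x) = lam * (LBINT x. power_nonlinearity p (fn ?w x) * \<phi> x)"
  unfolding pair
 proof (intro exI conjI)
  show "((%s. cpair (U s (z s)) ?\<psi>) has_vector_derivative ?D) (at t within {0..})" by (rule der)
  show "\<i> * ?D + 1 / 2 * (LBINT x. fn ?w x * laplacian \<phi> x) = lam * (LBINT x. power_nonlinearity p (fn ?w x) * \<phi> x)"
   unfolding D by (simp add: algebra_simps)
 qed
qed

end

section \<open>From distributional to mild solutions\<close>

lemma cnj_bump: "cnj (bump r y x) = bump r y x" by (simp add: bump_def)

lemma FT_bump:
 assumes r: "0 \<le> r"
 shows "FT (-1) (cls (bump r y)) = cls (%\<xi>. em (- y) \<xi> * ft (-1) (bump r 0) \<xi>)"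
proof -
 have C: "Cc (bump r y)" "Cc (bump r (0::'a))" using test_function_Cc test_function_bump r by auto
 have "bump r y = (%x. bump r 0 (x + - y))" by (simp add: bump_def fun_eq_iff)
 then have "ft (-1) (bump r y) \<xi> = em (- y) \<xi> * ft (-1) (bump r 0) \<xi>" for \<xi>
  using ft_tr[OF Cc_measurable[OF C(2)], of "-1" "- y" \<xi>] by (simp only:) simp
 then have "ft (-1) (bump r y) = (%\<xi>. em (- y) \<xi> * ft (-1) (bump r 0) \<xi>)" by blast
 then show ?thesis using FT_cls[OF _ Cc_spaces[OF C(1)], of "-1"] by simp
qed

(* Testing with all translates of one bump makes the Fourier transform of an L1 function vanish;
  shrinking the bump removes the zeros of its own transform. *)
lemma weak_laplacian_Fourier:
 fixes a d :: "'a::euclidean_space L2"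
 assumes w: "\<And>r y \<eta>. r > 0 ==> has_laplacian (cls (bump r y)) \<eta> ==>
   inner a (cls (bump r y)) + inner d \<eta> = 0 \<and>
   inner a (mlt (%_. \<i>) (cls (bump r y))) + inner d (mlt (%_. \<i>) \<eta>) = 0"
 shows "AE \<xi> in lborel. fn (FT (-1) a) \<xi> = of_real ((norm \<xi>)^2) * fn (FT (-1) d) \<xi>"
proof -
 let ?A = "fn (FT (-1) a)" and ?D = "fn (FT (-1) d)"
 have main: "AE \<xi> in lborel. norm \<xi> * r < 1 \<longrightarrow> ?A \<xi> = of_real ((norm \<xi>)^2) * ?D \<xi>" if r: "r > 0" for r :: real
 proof -
  let ?\<rho> = "bump r (0::'a)"
  define g0 g2 where "g0 = ft (-1) ?\<rho>" and "g2 = ft (-1) (laplacian ?\<rho>)"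
  have t: "test_function (bump r y)" for y :: 'a using r by (intro test_function_bump) simp
  have C: "Cc ?\<rho>" "Cc (laplacian ?\<rho>)" by (intro test_function_Cc Cc_laplacian t)+
  have g2: "g2 \<xi> = - of_real ((norm \<xi>)^2) * g0 \<xi>" for \<xi> unfolding g2_def g0_def by (rule ft_laplacian[OF t]) simp
  have g0L: "g0 \<in> L2_space" "g2 \<in> L2_space" unfolding g0_def g2_def by (rule ft_contraction(1)[OF _ Cc_spaces[OF C(1)]], simp, rule ft_contraction(1)[OF _ Cc_spaces[OF C(2)]], simp)
  have bg: "bmeas (%\<xi>. cnj (g0 \<xi>))" "bmeas (%\<xi>. cnj (g2 \<xi>))"
   unfolding g0_def g2_def by (intro bmeas_cnj bmeasI[OF ft_measurable[OF Cc_measurable] norm_ft_le] C)+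
  have cL: "(%\<xi>. cnj (g0 \<xi>)) \<in> L2_space" "(%\<xi>. cnj (g2 \<xi>)) \<in> L2_space"
   by (rule L2_space_bound[OF g0L(1)], use g0L in auto)[1] (rule L2_space_bound[OF g0L(2)], use g0L in auto)
  define G where "G \<xi> = cnj (g0 \<xi>) * ?A \<xi> + cnj (g2 \<xi>) * ?D \<xi>" for \<xi>
  have GL: "G \<in> L2_space" unfolding G_def[abs_def] by (intro L2_space_add mlt_in_L2 bg)
  have G1: "G \<in> L1_space" unfolding G_def[abs_def] L1_space_def by (auto intro!: Bochner_Integration.integrable_add integrable_L2_prod cL)
  have emL: "(%\<xi>. em (- y) \<xi> * g \<xi>) \<in> L2_space" if "g \<in> L2_space" for g and y :: 'a
   by (rule L2_space_mult[OF that, where B=1]) auto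
  have ft0: "ft 1 G y = 0" for y
  proof -
   let ?\<psi> = "cls (bump r y)" and ?\<eta> = "cls (%x. cnj (laplacian (bump r y) x))"
   have h: "has_laplacian ?\<psi> ?\<eta>" using has_laplacian_test[OF t, of y] by (simp add: cnj_bump)
   have F1: "FT (-1) ?\<psi> = cls (%\<xi>. em (- y) \<xi> * g0 \<xi>)" unfolding g0_def using r by (intro FT_bump) simp
   have F2: "FT (-1) ?\<eta> = cls (%\<xi>. em (- y) \<xi> * g2 \<xi>)"
   proof (rule L2_eqI)
    show "AE \<xi> in lborel. fn (FT (-1) ?\<eta>) \<xi> = fn (cls (%\<xi>. em (- y) \<xi> * g2 \<xi>)) \<xi>"
     using h[unfolded has_laplacian_def F1] fn_cls[OF emL[OF g0L(1), of y]] fn_cls[OF emL[OF g0L(2), of y]]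
     by eventually_elim (simp add: g2)
   qed
   have e: "cnj (em (- y) \<xi>) = em y \<xi>" for \<xi> by (simp add: cnj_em)
   have pc: "cpair f (cls (%\<xi>. em (- y) \<xi> * g \<xi>)) = (LBINT \<xi>. fn f \<xi> * (em y \<xi> * cnj (g \<xi>)))" if "g \<in> L2_space" for f and g
   proof -
    have "(%\<xi>. em y \<xi> * cnj (g \<xi>)) \<in> L2_space" by (rule L2_space_bound[OF that]) (use that in \<open>auto simp: norm_mult\<close>)
    from cpair_cls[OF fn_L2 this, of f] show ?thesis by (simp add: cnj_em)
   qed
   have FTc: "cpair f \<psi> = cpair (FT (-1) f) (FT (-1) \<psi>)" for f \<psi> :: "'a L2"
    unfolding cpair_def FT_const[of "-1", simplified, symmetric] inner_FT_FT[of "-1", simplified] ..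
   have "0 = cpair a ?\<psi> + cpair d ?\<eta>" using w[OF r h] by (simp add: cpair_def complex_eq_iff)
   also have "... = (LBINT \<xi>. ?A \<xi> * (em y \<xi> * cnj (g0 \<xi>))) + (LBINT \<xi>. ?D \<xi> * (em y \<xi> * cnj (g2 \<xi>)))"
    unfolding FTc[of a] FTc[of d] F1 F2 pc[OF g0L(1)] pc[OF g0L(2)] ..
   also have "... = (LBINT \<xi>. ?A \<xi> * (em y \<xi> * cnj (g0 \<xi>)) + ?D \<xi> * (em y \<xi> * cnj (g2 \<xi>)))"
   proof (rule Bochner_Integration.integral_add[symmetric])
    have "(%\<xi>. em y \<xi> * cnj (g \<xi>)) \<in> L2_space" if "g \<in> L2_space" for g
     by (rule L2_space_bound[OF that]) (use that in \<open>auto simp: norm_mult\<close>)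
    then show "integrable lborel (%\<xi>. ?A \<xi> * (em y \<xi> * cnj (g0 \<xi>)))" "integrable lborel (%\<xi>. ?D \<xi> * (em y \<xi> * cnj (g2 \<xi>)))"
     by (intro integrable_L2_prod g0L fn_L2; blast intro: g0L)+
   qed
   also have "... = (LBINT \<xi>. exp (\<i> * of_real (1 * (\<xi> \<bullet> y))) * G \<xi>)"
    by (intro Bochner_Integration.integral_cong refl) (simp add: G_def em_def algebra_simps)
   finally show ?thesis by (simp add: ft_def)
  qed
  have "norm (cls G) = norm (cls (ft 1 G))" using FT_cls[OF _ G1 GL, of 1] norm_FT[of 1 "cls G"] by simp
  also have "ft 1 G = (%_. 0)" using ft0 by auto
  finally have "cls G = cls (%_. 0)" unfolding zero_L2_def[symmetric] by (simp only: norm_zero norm_eq_zero)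
  then have "AE \<xi> in lborel. G \<xi> = 0" unfolding cls_eq_iff[OF GL L2_space_zero] .
  then show ?thesis
  proof eventually_elim
   case (elim \<xi>)
   show ?case
   proof
    assume "norm \<xi> * r < 1"
    then have "g0 \<xi> \<noteq> 0" unfolding g0_def by (rule ft_bump_nonzero[OF r])
    moreover have "cnj (g0 \<xi>) * (?A \<xi> - of_real ((norm \<xi>)^2) * ?D \<xi>) = 0" using elim by (simp add: G_def g2 algebra_simps)
    ultimately show "?A \<xi> = of_real ((norm \<xi>)^2) * ?D \<xi>" by simp
   qed
  qed
 qed
 have "AE \<xi> in lborel. \<forall>k. norm \<xi> * inverse (real (Suc k)) < 1 \<longrightarrow> ?A \<xi> = of_real ((norm \<xi>)^2) * ?D \<xi>"
  unfolding AE_all_countable by (intro allI main) simp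
 then show ?thesis
 proof eventually_elim
  case (elim \<xi>)
  obtain k where "norm \<xi> < real k" using reals_Archimedean2 by blast
  then have "norm \<xi> < real (Suc k)" by simp
  then have "norm \<xi> * inverse (real (Suc k)) < 1" by (simp add: divide_inverse[symmetric] del: of_nat_Suc)
  then show ?case using elim by blast
 qed
qed

text \<open>Once the relation is known almost everywhere on the Fourier side, it can be paired with
  every element of the domain of the Laplacian. This matters because the domain is invariant under
  U, while the bumps are not.\<close>

lemma weak_laplacian_extend:
 fixes a d :: "'a::euclidean_space L2"
 assumes ae: "AE \<xi> in lborel. fn (FT (-1) a) \<xi> = of_real ((norm \<xi>)^2) * fn (FT (-1) d) \<xi>" and h: "has_laplacian \<psi> \<eta>"
 shows "inner a \<psi> + inner d \<eta> = 0"
proof -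
 have "inner a \<psi> = inner (FT (-1) a) (FT (-1) \<psi>)" by (simp add: inner_FT_FT)
 also have "... = (LBINT \<xi>. - (fn (FT (-1) d) \<xi> \<bullet> fn (FT (-1) \<eta>) \<xi>))"
  unfolding inner_L2_def
 proof (rule integral_cong_AE)
  show "AE \<xi> in lborel. fn (FT (-1) a) \<xi> \<bullet> fn (FT (-1) \<psi>) \<xi> = - (fn (FT (-1) d) \<xi> \<bullet> fn (FT (-1) \<eta>) \<xi>)"
   using ae h unfolding has_laplacian_def
   by eventually_elim (simp only: scaleR_conv_of_real[symmetric] of_real_minus[symmetric] inner_scaleR_left inner_scaleR_right)
 qed measurable
 also have "... = - inner (FT (-1) d) (FT (-1) \<eta>)" by (simp add: inner_L2_def)
 also have "... = - inner d \<eta>" by (simp add: inner_FT_FT)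
 finally show ?thesis by simp
qed

text \<open>The frequency cutoffs of e itself belong to the domain and converge to e.\<close>

lemma has_laplacian_dense:
 fixes e :: "'a::euclidean_space L2"
 assumes "\<And>\<psi> \<eta>. has_laplacian \<psi> \<eta> ==> inner e \<psi> = 0" shows "e = 0"
proof -
 let ?\<psi> = "%k. FT 1 (mlt (indicator (cball 0 (real k))) (FT (-1) e))"
 have "inner e (?\<psi> k) = 0" for k
 proof (rule assms)
  let ?m = "%\<xi>::'a. - of_real ((norm \<xi>)^2) * indicator (cball 0 (real k)) \<xi> :: complex"
  have bm: "bmeas ?m"
  proof (rule bmeasI)
   show "norm (?m \<xi>) \<le> (real k)^2" for \<xi> by (auto simp: indicator_def norm_mult norm_power intro: power_mono)
   have "(%\<xi>::'a. - complex_of_real ((norm \<xi>)^2)) \<in> borel_measurable borel" by measurable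
   moreover have "(indicator (cball 0 (real k)) :: 'a => complex) \<in> borel_measurable borel" by (rule bmeas_measurable) simp
   ultimately show "?m \<in> borel_measurable borel" by (rule borel_measurable_times)
  qed
  have bi: "bmeas (indicator (cball (0::'a) (real k)))" by simp
  show "has_laplacian (?\<psi> k) (FT 1 (mlt ?m (FT (-1) e)))"
   unfolding has_laplacian_def FT_inv1
   using fn_mlt[OF bm, of "FT (-1) e"] fn_mlt[OF bi, of "FT (-1) e"] by eventually_elim simp
 qed
 moreover have "(%k. inner e (?\<psi> k)) \<longlonglongrightarrow> inner e (FT 1 (FT (-1) e))"
  by (rule tendsto_inner[OF tendsto_const bounded_linear.tendsto[OF bounded_linear_FT trunc_tendsto[OF filterlim_real_sequentially]]]) simp
 ultimately have "(%k::nat. 0) \<longlonglongrightarrow> inner e e" by simp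
 then have "inner e e = 0" by (rule LIMSEQ_unique[OF _ tendsto_const])
 then show ?thesis by simp
qed

lemma continuous_on_H11_L2:
 assumes v: "continuous_into_H11 v" shows "continuous_on {0..} (%t. cls (v t))"
 unfolding continuous_on_def
proof
 fix t :: real assume t: "t \<in> {0..}"
 have H: "v s \<in> H11_space" if "0 \<le> s" for s using v that by (auto simp: continuous_into_H11_def)
 have L: "v s \<in> L2_space" if "0 \<le> s" for s using H[OF that] by (simp add: H11_space_iff)
 have lim: "((%s. H11_norm (%x. v s x - v t x)) \<longlongrightarrow> 0) (at t within {0..})" using v t by (auto simp: continuous_into_H11_def)
 have "((%s. cls (v s) - cls (v t)) \<longlongrightarrow> 0) (at t within {0..})"
 proof (rule Lim_null_comparison[OF _ lim])
  show "\<forall>\<^sub>F s in at t within {0..}. norm (cls (v s) - cls (v t)) \<le> H11_norm (%x. v s x - v t x)"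
   unfolding eventually_at_filter
  proof (rule always_eventually, intro allI impI)
   fix s :: real assume "s \<in> {0..}"
   then show "norm (cls (v s) - cls (v t)) \<le> H11_norm (%x. v s x - v t x)"
    using Wj_FT_le_H11_norm(2)[OF H11_space_diff[OF H[of s] H[of t]]] t by (simp add: cls_diff L)
  qed
 qed
 then show "((%t. cls (v t)) \<longlongrightarrow> cls (v t)) (at t within {0..})" by (rule LIM_zero_cancel)
qed

text \<open>The H^{1,1} norm lives on functions and not on a topological type, so boundedness on a
  compact time interval is obtained from local bounds and a finite subcover.\<close>

lemma H11_locally_bounded:
 assumes v: "continuous_into_H11 v" and b: "0 \<le> b"
 obtains M where "0 \<le> M" "\<And>t. t \<in> {0..b} ==> Wj (FT (-1) (cls (v t))) \<le> ennreal (M\<^sup>2)"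
proof -
 have H: "v s \<in> H11_space" if "0 \<le> s" for s using v that by (auto simp: continuous_into_H11_def)
 have L: "v s \<in> L2_space" if "0 \<le> s" for s using H[OF that] by (simp add: H11_space_iff)
 let ?W = "%t. Wj (FT (-1) (cls (v t)))"
 have loc: "\<exists>\<delta>>0. \<exists>M\<ge>0. \<forall>s\<ge>0. dist s t < \<delta> \<longrightarrow> ?W s \<le> ennreal M" if t: "0 \<le> t" for t
 proof -
  have lim: "((%s. H11_norm (%x. v s x - v t x)) \<longlongrightarrow> 0) (at t within {0..})" using v t by (auto simp: continuous_into_H11_def)
  have "\<forall>\<^sub>F s in at t within {0..}. H11_norm (%x. v s x - v t x) < 1" using order_tendstoD(2)[OF lim, of 1] by simp
  then obtain \<delta> where \<delta>: "\<delta> > 0" "\<And>s. 0 \<le> s ==> s \<noteq> t ==> dist s t < \<delta> ==> H11_norm (%x. v s x - v t x) < 1"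
   unfolding eventually_at by auto
  define M where "M = 2 * (H11_norm (v t))^2 + 2"
  have "?W s \<le> ennreal M" if s: "0 \<le> s" "dist s t < \<delta>" for s
  proof (cases "s = t")
   case True
   have "?W t \<le> ennreal ((H11_norm (v t))^2)" by (rule Wj_FT_le_H11_norm(1)[OF H[OF t]])
   also have "... \<le> ennreal M" by (intro ennreal_leI) (simp add: M_def)
   finally show ?thesis using True by simp
  next
   case False
   let ?d = "%x. v s x - v t x"
   have "cls (v s) = cls ?d + cls (v t)" by (simp add: cls_diff L s t)
   then have "?W s = Wj (FT (-1) (cls ?d) + FT (-1) (cls (v t)))"
    by (simp add: linear_add[OF bounded_linear.linear[OF bounded_linear_FT]])
   also have "... \<le> 2 * Wj (FT (-1) (cls ?d)) + 2 * ?W t" by (rule Wj_add)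
   also have "... \<le> 2 * ennreal (1\<^sup>2) + 2 * ennreal ((H11_norm (v t))^2)"
    using \<delta>(2)[OF s(1) False s(2)] H11_norm_nonneg[of ?d]
    by (intro add_mono mult_left_mono Wj_FT_le_H11_norm(1)[OF H[OF t]]
      order_trans[OF Wj_FT_le_H11_norm(1)[OF H11_space_diff[OF H[OF s(1)] H[OF t]]] ennreal_leI] power_mono) auto
   also have "... = ennreal M" by (simp add: M_def ennreal_plus ennreal_mult add.commute)
   finally show ?thesis .
  qed
  moreover have "0 \<le> M" by (simp add: M_def)
  ultimately show ?thesis using \<delta>(1) by blast
 qed
 define P where "P t \<delta> M \<longleftrightarrow> \<delta> > 0 \<and> 0 \<le> M \<and> (\<forall>s\<ge>0. dist s t < \<delta> \<longrightarrow> ?W s \<le> ennreal M)" for t \<delta> M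
 have "\<exists>\<delta> M. P t \<delta> M" if "0 \<le> t" for t using loc[OF that] unfolding P_def by blast
 then have "\<forall>t\<in>{0..}. \<exists>x. P t (fst x) (snd x)" by simp
 from bchoice[OF this] obtain x where x: "\<forall>t\<in>{0..}. P t (fst (x t)) (snd (x t))" ..
 define \<delta> M where "\<delta> t = fst (x t)" and "M t = snd (x t)" for t
 have P: "P t (\<delta> t) (M t)" if "0 \<le> t" for t using bspec[OF x, of t] that by (simp add: \<delta>_def M_def)
 have \<delta>: "\<And>t. 0 \<le> t ==> \<delta> t > 0" and M: "\<And>t. 0 \<le> t ==> 0 \<le> M t"
  and le: "\<And>t s. 0 \<le> t ==> 0 \<le> s ==> dist s t < \<delta> t ==> ?W s \<le> ennreal (M t)"
  using P unfolding P_def by blast+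
 have "compact {0..b}" by simp
 then obtain D where D: "D \<subseteq> {0..b}" "finite D" "{0..b} \<subseteq> (\<Union>t\<in>D. ball t (\<delta> t))"
 proof (rule compactE_image[of "{0..b}" "{0..b}" "%t. ball t (\<delta> t)"])
  show "{0..b} \<subseteq> (\<Union>t\<in>{0..b}. ball t (\<delta> t))"
  proof
   fix s assume "s \<in> {0..b}"
   moreover have "s \<in> ball s (\<delta> s)" using \<delta>[of s] calculation by simp
   ultimately show "s \<in> (\<Union>t\<in>{0..b}. ball t (\<delta> t))" by blast
  qed
 qed simp_all
 define M' where "M' = (\<Sum>t\<in>D. M t)"
 have M'0: "0 \<le> M'" unfolding M'_def using D M by (intro sum_nonneg) auto
 show thesis
 proof (rule that[of "sqrt M'"])
  fix s assume s: "s \<in> {0..b}"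
  then obtain t where t: "t \<in> D" "dist t s < \<delta> t" using D(3) by auto
  have t0: "0 \<le> t" using t D by auto
  have "?W s \<le> ennreal (M t)" using le[OF t0, of s] s t by (simp add: dist_commute)
  also have "... \<le> ennreal M'" unfolding M'_def using D M t by (intro ennreal_leI member_le_sum) auto
  finally show "?W s \<le> ennreal ((sqrt M')^2)" using M'0 by simp
 qed (use M'0 in simp)
qed

lemma Re_cpair: "Re (cpair f \<psi>) = inner f \<psi>" and Im_cpair: "Im (cpair f \<psi>) = inner f (mlt (%_. \<i>) \<psi>)"
 by (simp_all add: cpair_def)

lemma integral_inner_left:
 fixes f :: "real => 'b::euclidean_space L2"
 assumes "continuous_on {a..b} f" shows "((%r. inner (f r) g) has_integral inner (integral {a..b} f) g) {a..b}"
 using has_integral_linear[OF integrable_integral[OF integrable_continuous_real[OF assms]] bounded_linear_inner_left[of g]]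
 by (simp add: o_def)

context nls
begin

lemma NLS_test_derivative:
 fixes v :: "real => 'a => complex"
 assumes v: "NLS_solution lam p u0 v" and \<phi>: "test_function \<phi>" and t: "0 \<le> t" and B: "cls (v t) \<in> Bq q K"
 defines "\<psi> \<equiv> cls (%x. cnj (\<phi> x))" and "\<eta> \<equiv> cls (%x. cnj (laplacian \<phi> x))"
 shows "((%s. cpair (cls (v s)) \<psi>) has_vector_derivative
   (cpair (mlt (%_. - \<i> * lam) (NL p (cls (v t)))) \<psi> + cpair (cls (v t)) (mlt (%_. - \<i> / 2) \<eta>))) (at t within {0..})"
proof -
 have H: "continuous_into_H11 v" using v by (simp add: NLS_solution_def)
 have L: "v s \<in> L2_space" if "0 \<le> s" for s using H that by (auto simp: continuous_into_H11_def H11_space_iff)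
 have P: "\<phi> \<in> L2_space" "laplacian \<phi> \<in> L2_space"
  using Cc_spaces(2) test_function_Cc[OF \<phi>] Cc_laplacian[OF \<phi>] by auto
 obtain D where D: "((%s. \<integral>x. v s x * \<phi> x \<partial>lborel) has_vector_derivative D) (at t within {0..})"
  and eq: "\<i> * D + 1 / 2 * (LBINT x. v t x * laplacian \<phi> x) = lam * (LBINT x. power_nonlinearity p (v t x) * \<phi> x)"
  using v \<phi> t unfolding NLS_solution_def by blast
 have der: "((%s. cpair (cls (v s)) \<psi>) has_vector_derivative D) (at t within {0..})"
  by (rule has_vector_derivative_transform[OF _ _ D]) (use t in \<open>auto simp: \<psi>_def cpair_cls[OF L P(1)]\<close>)
 let ?w = "cls (v t)"
 have N: "(%x. power_nonlinearity p (fn ?w x)) \<in> L2_space" by (rule NL_L2[OF B])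
 have [measurable]: "v t \<in> borel_measurable borel" "\<phi> \<in> borel_measurable borel" using L[OF t] P by auto
 have "cpair (mlt (%_. - \<i> * lam) (NL p ?w)) \<psi> = (LBINT x. (- \<i> * lam * power_nonlinearity p (fn ?w x)) * \<phi> x)"
  unfolding NL_def mlt_cls[OF bmeas_const N] \<psi>_def by (rule cpair_cls[OF L2_space_cmult[OF N] P(1)])
 also have "... = (LBINT x. - \<i> * lam * (power_nonlinearity p (v t x) * \<phi> x))"
 proof (rule integral_cong_AE)
  show "AE x in lborel. - \<i> * lam * power_nonlinearity p (fn ?w x) * \<phi> x = - \<i> * lam * (power_nonlinearity p (v t x) * \<phi> x)"
   using fn_cls[OF L[OF t]] by eventually_elim (simp only: mult.assoc)
 qed measurable
 finally have 1: "cpair (mlt (%_. - \<i> * lam) (NL p ?w)) \<psi> = - \<i> * lam * (LBINT x. power_nonlinearity p (v t x) * \<phi> x)" by simp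
 have "cpair ?w (mlt (%_. - \<i> / 2) \<eta>) = (LBINT x. v t x * (\<i> / 2 * laplacian \<phi> x))"
 proof -
  have c: "(%x. cnj (laplacian \<phi> x)) \<in> L2_space" using Cc_spaces(2)[OF Cc_cnj[OF Cc_laplacian[OF \<phi>]]] .
  show ?thesis using cpair_cls[OF L[OF t] L2_space_cmult[OF P(2), of "\<i> / 2"]] by (simp add: mlt_cls[OF bmeas_const c] \<eta>_def)
 qed
 also have "... = \<i> / 2 * (LBINT x. v t x * laplacian \<phi> x)"
  by (subst integral_mult_right_zero[symmetric]) (simp add: mult_ac)
 finally have 2: "cpair ?w (mlt (%_. - \<i> / 2) \<eta>) = \<i> / 2 * (LBINT x. v t x * laplacian \<phi> x)" .
 have "D = - \<i> * (\<i> * D)" by simp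
 also have "\<i> * D = lam * (LBINT x. power_nonlinearity p (v t x) * \<phi> x) - 1 / 2 * (LBINT x. v t x * laplacian \<phi> x)"
  using eq by (simp add: algebra_simps)
 finally have "D = cpair (mlt (%_. - \<i> * lam) (NL p ?w)) \<psi> + cpair ?w (mlt (%_. - \<i> / 2) \<eta>)"
  unfolding 1 2 by (simp add: algebra_simps)
 then show ?thesis using der by simp
qed

text \<open>A weak solution is differentiable only against test functions. Integrating in time and
  extending to the domain of the Laplacian permits test elements transported by U; then the
  derivative of z no longer contains the Laplacian and is continuous in L2, so it is a strong
  one.\<close>

lemma NLS_solution_sol:
 fixes v :: "real => 'a => complex"
 assumes v: "NLS_solution lam p u0 v" shows "sol 0 b (%t. U (- t) (cls (v t)))"
proof (cases "0 \<le> b")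
 case False
 then show ?thesis by (auto simp: sol_def)
next
 case b: True
 have H: "continuous_into_H11 v" using v by (simp add: NLS_solution_def)
 define w where "w t = cls (v t)" for t
 define Fn where "Fn t = mlt (%_. - \<i> * lam) (NL p (w t))" for t
 define z where "z t = U (- t) (w t)" for t
 let ?m = "mlt (%_. - \<i> / 2) :: 'a L2 => 'a L2"
 have wc: "continuous_on {0..b} w" using continuous_on_H11_L2[OF H] unfolding w_def[abs_def] by (rule continuous_on_subset) auto
 obtain M where M: "0 \<le> M" "\<And>t. t \<in> {0..b} ==> Wj (FT (-1) (w t)) \<le> ennreal (M\<^sup>2)"
  using H11_locally_bounded[OF H b] unfolding w_def by blast
 obtain K where K: "0 \<le> K" "\<And>f :: 'a L2. Wj (FT (-1) f) \<le> ennreal (M\<^sup>2) ==> f \<in> Bq q K" using Wj_imp_Bq[OF M(1)] by blast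
 have B: "w t \<in> Bq q K" if "t \<in> {0..b}" for t by (rule K(2)[OF M(2)[OF that]])
 have Fc: "continuous_on {0..b} Fn" unfolding Fn_def[abs_def]
  by (rule bounded_linear.continuous_on[OF bounded_linear_mlt[OF bmeas_const] continuous_on_NL[OF wc B K(1)]])
 have zc: "continuous_on {0..b} z" unfolding z_def[abs_def] by (intro continuous_on_U wc continuous_intros)
 have c0: "continuous_on {0..t} f" if "continuous_on {0..b} f" "t \<in> {0..b}" for f :: "real => 'a L2" and t
  using that by (auto intro: continuous_on_subset)
 have weak: "inner (w t) \<psi> = inner (w 0) \<psi> + inner (integral {0..t} Fn) \<psi> + inner (integral {0..t} w) (?m \<eta>)"
  if t: "t \<in> {0..b}" and h: "has_laplacian \<psi> \<eta>" for t \<psi> \<eta>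
 proof -
  \<comment> \<open>In terms of a and d the equation integrated over [0, t] says that a plus the
    Laplacian of d vanishes, the form treated by \<open>weak_laplacian_Fourier\<close>.\<close>
  define a where "a = w t - w 0 - integral {0..t} Fn"
  define d where "d = - mlt (%_. \<i> / 2) (integral {0..t} w)"
  have d: "inner d \<eta> = - inner (integral {0..t} w) (?m \<eta>)" for \<eta> unfolding d_def by (simp add: inner_mlt)
  have ftc: "inner a \<psi> + inner d \<eta> = 0"
   if "\<And>r. r \<in> {0..t} ==> ((%s. inner (w s) \<psi>) has_vector_derivative (inner (Fn r) \<psi> + inner (w r) (?m \<eta>))) (at r within {0..t})" for \<psi> \<eta>
  proof -
   have "((%r. inner (Fn r) \<psi> + inner (w r) (?m \<eta>)) has_integral (inner (w t) \<psi> - inner (w 0) \<psi>)) {0..t}"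
    by (rule fundamental_theorem_of_calculus) (use t that in auto)
   moreover have "((%r. inner (Fn r) \<psi> + inner (w r) (?m \<eta>)) has_integral
     (inner (integral {0..t} Fn) \<psi> + inner (integral {0..t} w) (?m \<eta>))) {0..t}"
    by (intro has_integral_add integral_inner_left c0[OF _ t] Fc wc)
   ultimately show ?thesis by (auto simp: d a_def inner_diff_left dest: has_integral_unique)
  qed
  have "inner a (cls (bump r y)) + inner d \<eta> = 0 \<and> inner a (mlt (%_. \<i>) (cls (bump r y))) + inner d (mlt (%_. \<i>) \<eta>) = 0"
   if r: "r > 0" and h: "has_laplacian (cls (bump r y)) \<eta>" for r y \<eta>
  proof -
   have tf: "test_function (bump r y)" using r by (intro test_function_bump) simp
   have \<eta>: "\<eta> = cls (%x. cnj (laplacian (bump r y) x))"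
    using has_laplacian_test[OF tf] h by (intro has_laplacian_unique[of "cls (bump r y)"]) (simp_all add: cnj_bump)
   have der: "((%s. cpair (w s) (cls (bump r y))) has_vector_derivative
     (cpair (Fn r') (cls (bump r y)) + cpair (w r') (?m \<eta>))) (at r' within {0..t})" if "r' \<in> {0..t}" for r'
   proof -
    have r': "0 \<le> r'" "r' \<in> {0..b}" using that t by auto
    show ?thesis
     using has_vector_derivative_within_subset[OF NLS_test_derivative[OF v tf r'(1) B[OF r'(2), unfolded w_def]], of "{0..t}"]
     unfolding \<eta> w_def Fn_def by (simp add: cnj_bump)
   qed
   have d1: "((%s. inner (w s) (cls (bump r y))) has_vector_derivative
     (inner (Fn r') (cls (bump r y)) + inner (w r') (?m \<eta>))) (at r' within {0..t})" if "r' \<in> {0..t}" for r'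
    using bounded_linear.has_vector_derivative[OF bounded_linear_Re der[OF that]] by (simp add: Re_cpair)
   have d2: "((%s. inner (w s) (mlt (%_. \<i>) (cls (bump r y)))) has_vector_derivative
     (inner (Fn r') (mlt (%_. \<i>) (cls (bump r y))) + inner (w r') (?m (mlt (%_. \<i>) \<eta>)))) (at r' within {0..t})" if "r' \<in> {0..t}" for r'
    using bounded_linear.has_vector_derivative[OF bounded_linear_Im der[OF that]] by (simp add: Im_cpair mlt_commute[of "%_. \<i>"])
   show ?thesis by (intro conjI ftc d1 d2)
  qed
  from weak_laplacian_extend[OF weak_laplacian_Fourier[OF this] h]
  have "inner a \<psi> + inner d \<eta> = 0" by blast
  then show ?thesis by (simp add: d a_def inner_diff_left)
 qed
 have wder: "((%s. inner (w s) \<psi>) has_vector_derivative (inner (Fn t) \<psi> + inner (w t) (?m \<eta>))) (at t within {0..b})"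
  if t: "t \<in> {0..b}" and h: "has_laplacian \<psi> \<eta>" for t \<psi> \<eta>
 proof (rule has_vector_derivative_transform[OF t weak[OF _ h]])
  have "((%t. inner (w 0) \<psi> + inner (integral {0..t} Fn) \<psi> + inner (integral {0..t} w) (?m \<eta>)) has_vector_derivative
    (0 + inner (Fn t) \<psi> + inner (w t) (?m \<eta>))) (at t within {0..b})"
   by (intro has_vector_derivative_add has_vector_derivative_const bounded_linear.has_vector_derivative[OF bounded_linear_inner_left]
     integral_has_vector_derivative[OF Fc t] integral_has_vector_derivative[OF wc t])
  then show "((%t. inner (w 0) \<psi> + inner (integral {0..t} Fn) \<psi> + inner (integral {0..t} w) (?m \<eta>)) has_vector_derivative
    (inner (Fn t) \<psi> + inner (w t) (?m \<eta>))) (at t within {0..b})" by simp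
 qed
 have zder: "((%s. inner (z s) \<psi>) has_vector_derivative inner (vf t (z t)) \<psi>) (at t within {0..b})"
  if t: "t \<in> {0..b}" and h: "has_laplacian \<psi> \<eta>" for t \<psi> \<eta>
  unfolding has_vector_derivative_iff_quotient
 proof -
  have hU: "has_laplacian (U t \<psi>) (U t \<eta>)" by (rule has_laplacian_U[OF h])
  have 1: "((%y. (inner (w y) (U t \<psi>) - inner (w t) (U t \<psi>)) /\<^sub>R (y - t)) \<longlongrightarrow> inner (Fn t) (U t \<psi>) + inner (w t) (?m (U t \<eta>))) (at t within {0..b})"
   using wder[OF t hU] unfolding has_vector_derivative_iff_quotient .
  have 2: "((%y. (U y \<psi> - U t \<psi>) /\<^sub>R (y - t)) \<longlongrightarrow> mlt (%_. \<i> / 2) (U t \<eta>)) (at t within {0..b})"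
   using U_has_vector_derivative[OF h] unfolding has_vector_derivative_iff_quotient .
  have 3: "(w \<longlongrightarrow> w t) (at t within {0..b})" using wc t by (simp add: continuous_on_def)
  \<comment> \<open>Discrete product rule: the quotient of U is taken in norm and paired with the
    continuous w, while the quotient of w is only taken against the fixed element U(t) psi.\<close>
  have "((%y. inner (w y) ((U y \<psi> - U t \<psi>) /\<^sub>R (y - t)) + (inner (w y) (U t \<psi>) - inner (w t) (U t \<psi>)) /\<^sub>R (y - t)) \<longlongrightarrow>
    inner (w t) (mlt (%_. \<i> / 2) (U t \<eta>)) + (inner (Fn t) (U t \<psi>) + inner (w t) (?m (U t \<eta>)))) (at t within {0..b})"
   by (rule tendsto_add[OF tendsto_inner[OF 3 2] 1])
  moreover have "inner (w y) ((U y \<psi> - U t \<psi>) /\<^sub>R (y - t)) + (inner (w y) (U t \<psi>) - inner (w t) (U t \<psi>)) /\<^sub>R (y - t)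
   = (inner (z y) \<psi> - inner (z t) \<psi>) /\<^sub>R (y - t)" for y
   by (simp add: z_def inner_U inner_diff_right algebra_simps)
  moreover have "inner (w t) (mlt (%_. \<i> / 2) (U t \<eta>)) + (inner (Fn t) (U t \<psi>) + inner (w t) (?m (U t \<eta>))) = inner (vf t (z t)) \<psi>"
  proof -
   have "?m (U t \<eta>) = - mlt (%_. \<i> / 2) (U t \<eta>)"
   proof (rule L2_eqI, use fn_uminus[of "mlt (%_. \<i> / 2) (U t \<eta>)"] fn_mlt[OF bmeas_const, of "\<i> / 2" "U t \<eta>"]
     fn_mlt[OF bmeas_const, of "- \<i> / 2" "U t \<eta>"] in eventually_elim)
   qed simp
   then show ?thesis by (simp add: vf_def z_def Fn_def U_const[symmetric] inner_U)
  qed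
  ultimately show "((%y. (inner (z y) \<psi> - inner (z t) \<psi>) /\<^sub>R (y - t)) \<longlongrightarrow> inner (vf t (z t)) \<psi>) (at t within {0..b})" by simp
 qed
 have Bz: "U t (z t) \<in> Bq q K" if "t \<in> {0..b}" for t using B[OF that] by (simp add: z_def)
 have vc: "continuous_on {0..b} (%s. vf s (z s))" by (rule continuous_on_vf[OF zc Bz K(1)])
 \<comment> \<open>The weak derivative of z is continuous in L2, so it can be integrated there;
   density of the domain of the Laplacian removes psi.\<close>
 have mild: "z t = z 0 + integral {0..t} (%s. vf s (z s))" if t: "t \<in> {0..b}" for t
 proof -
  have "z t - z 0 - integral {0..t} (%s. vf s (z s)) = 0"
  proof (rule has_laplacian_dense)
   fix \<psi> \<eta> :: "'a L2" assume h: "has_laplacian \<psi> \<eta>"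
   have "((%r. inner (vf r (z r)) \<psi>) has_integral (inner (z t) \<psi> - inner (z 0) \<psi>)) {0..t}"
    by (rule fundamental_theorem_of_calculus) (use t in \<open>auto intro: has_vector_derivative_within_subset[OF zder[OF _ h]]\<close>)
   then show "inner (z t - z 0 - integral {0..t} (%s. vf s (z s))) \<psi> = 0"
    using has_integral_unique[OF integral_inner_left[OF c0[OF vc t], of \<psi>]] by (simp add: inner_diff_left)
  qed
  then show ?thesis by (simp add: algebra_simps)
 qed
 have "(z has_vector_derivative vf t (z t)) (at t within {0..b})" if t: "t \<in> {0..b}" for t
 proof (rule has_vector_derivative_transform[OF t mild])
  have "((%t. z 0 + integral {0..t} (%s. vf s (z s))) has_vector_derivative (0 + vf t (z t))) (at t within {0..b})"
   by (intro has_vector_derivative_add has_vector_derivative_const integral_has_vector_derivative[OF vc t])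
  then show "((%t. z 0 + integral {0..t} (%s. vf s (z s))) has_vector_derivative vf t (z t)) (at t within {0..b})" by simp
 qed
 then have "sol 0 b z" using Bz K(1) unfolding sol_def by blast
 then show ?thesis by (simp add: z_def[abs_def] w_def)
qed

lemma NLS_solution_unique:
 fixes v :: "real => 'a => complex"
 assumes v: "NLS_solution lam p u0 v" and v': "NLS_solution lam p u0 v'" and t: "0 \<le> t"
 shows "AE x in lborel. v t x = v' t x"
proof -
 have L: "f s \<in> L2_space" if "NLS_solution lam p u0 f" "0 \<le> s" for f s
  using that by (auto simp: NLS_solution_def continuous_into_H11_def H11_space_iff)
 have "AE x in lborel. v 0 x = u0 x" "AE x in lborel. v' 0 x = u0 x" using v v' by (auto simp: NLS_solution_def)
 then have "AE x in lborel. v 0 x = v' 0 x" by eventually_elim simp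
 then have "cls (v 0) = cls (v' 0)" by (intro cls_cong L[OF v] L[OF v']) auto
 then have "U (- t) (cls (v t)) = U (- t) (cls (v' t))"
  by (intro sol_unique[OF NLS_solution_sol[OF v] NLS_solution_sol[OF v'] _ t order_refl]) simp
 from arg_cong[OF this, of "U t"] have "cls (v t) = cls (v' t)" by simp
 then show ?thesis using cls_eq_iff[OF L[OF v t] L[OF v' t]] by blast
qed

end

section \<open>Decay\<close>

lemma Xw_sum_eq: "(NBINT x. ennreal ((norm x)^2 * (norm (fn g x))^2)) = (\<Sum>b\<in>Basis. Xw b g)"
proof -
 have "ennreal ((norm x)^2 * (norm (fn g x))^2) = (\<Sum>b\<in>Basis. ennreal ((x \<bullet> b)^2 * (norm (fn g x))^2))" for x
 proof -
  have "(norm x)^2 = (\<Sum>b\<in>Basis. (x \<bullet> b)^2)" by (subst power2_norm_eq_inner, subst euclidean_inner) (simp add: power2_eq_square)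
  then show ?thesis by (simp add: sum_distrib_right)
 qed
 then show ?thesis unfolding Xw_def by (simp only:) (rule nn_integral_sum, measurable)
qed

lemma emeasure_ball_scale:
 assumes "0 \<le> R" shows "emeasure lborel (ball (0::'a::euclidean_space) R) = ennreal (R ^ DIM('a) * measure lborel (ball (0::'a) 1))"
 using emeasure_lborel_ball_finite[of "0::'a" R] content_ball_conv_unit_ball[OF assms, of "0::'a"]
 by (simp add: emeasure_eq_ennreal_measure)

(* Pointwise, |f|^2 is at most eta^(1-p) |f|^(p+1) + eta^2 inside the ball and |x|^2 |f|^2 / R^2 outside. *)
lemma mass_split:
 fixes f :: "'a::euclidean_space L2"
 assumes p: "p > 1" and \<eta>: "\<eta> > 0" and R: "R > 0"
  and P: "(NBINT x. ennreal (norm (fn f x) powr (p + 1))) \<le> ennreal P" "0 \<le> P"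
  and X: "(\<Sum>b\<in>Basis. Xw b f) \<le> ennreal (X\<^sup>2)"
 shows "(norm f)^2 \<le> \<eta> powr (1 - p) * P + \<eta>\<^sup>2 * (R ^ DIM('a) * measure lborel (ball (0::'a) 1)) + X\<^sup>2 / R\<^sup>2"
proof -
 let ?\<omega> = "measure lborel (ball (0::'a) 1)"
 have pw: "(norm (fn f x))^2 \<le> \<eta> powr (1 - p) * norm (fn f x) powr (p + 1) + \<eta>\<^sup>2 * indicator (ball 0 R) x + inverse (R\<^sup>2) * ((norm x)^2 * (norm (fn f x))^2)" for x
 proof (cases "norm x < R")
  case True
  have "(norm (fn f x))^2 \<le> \<eta> powr (1 - p) * norm (fn f x) powr (p + 1) + \<eta>\<^sup>2"
  proof (cases "norm (fn f x) \<le> \<eta>")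
   case True
   then have "(norm (fn f x))^2 \<le> \<eta>\<^sup>2" by (intro power_mono) auto
   then show ?thesis by (simp add: add_increasing)
  next
   case False
   let ?a = "norm (fn f x)"
   have a: "?a > 0" "\<eta> \<le> ?a" using False \<eta> by auto
   have "?a\<^sup>2 = ?a powr (1 - p) * ?a powr (p + 1)" using a by (simp add: powr_add[symmetric] power2_powr)
   also have "... \<le> \<eta> powr (1 - p) * ?a powr (p + 1)" using a p \<eta> by (intro mult_right_mono powr_mono2') auto
   finally show ?thesis by (simp add: add_increasing2)
  qed
  then show ?thesis using True by (simp add: add_increasing2)
 next
  case False
  have "1 * (norm (fn f x))^2 \<le> (inverse (R\<^sup>2) * (norm x)^2) * (norm (fn f x))^2"
  proof (rule mult_right_mono)
   have "R\<^sup>2 \<le> (norm x)^2" using False R by (intro power_mono) auto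
   then show "1 \<le> inverse (R\<^sup>2) * (norm x)^2" using R by (simp add: field_simps)
  qed simp
  then show ?thesis using False by (simp add: mult.assoc add_increasing)
 qed
 have [measurable]: "ball (0::'a) R \<in> sets borel" by simp
 have split: "ennreal (a * x + b * i + c * y) = ennreal a * ennreal x + ennreal b * ennreal i + ennreal c * ennreal y"
  if "0 \<le> a" "0 \<le> x" "0 \<le> b" "0 \<le> i" "0 \<le> c" "0 \<le> y" for a x b i c y :: real
  using that by (simp add: ennreal_mult)
 have "ennreal ((norm f)^2) \<le> (NBINT x. ennreal (\<eta> powr (1 - p)) * ennreal (norm (fn f x) powr (p + 1)) + ennreal (\<eta>\<^sup>2) * indicator (ball 0 R) x
   + ennreal (inverse (R\<^sup>2)) * ennreal ((norm x)^2 * (norm (fn f x))^2))"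
  unfolding nn_norm_L2[symmetric]
 proof (rule nn_integral_mono)
  fix x :: 'a
  have "ennreal ((norm (fn f x))^2) \<le> ennreal (\<eta> powr (1 - p) * norm (fn f x) powr (p + 1) + \<eta>\<^sup>2 * indicator (ball 0 R) x + inverse (R\<^sup>2) * ((norm x)^2 * (norm (fn f x))^2))"
   by (rule ennreal_leI[OF pw])
  also have "... = ennreal (\<eta> powr (1 - p)) * ennreal (norm (fn f x) powr (p + 1)) + ennreal (\<eta>\<^sup>2) * indicator (ball 0 R) x
   + ennreal (inverse (R\<^sup>2)) * ennreal ((norm x)^2 * (norm (fn f x))^2)"
   unfolding ennreal_indicator[symmetric] by (rule split) simp_all
  finally show "ennreal ((norm (fn f x))^2) \<le> ..." .
 qed
 also have "... = ennreal (\<eta> powr (1 - p)) * (NBINT x. ennreal (norm (fn f x) powr (p + 1))) + ennreal (\<eta>\<^sup>2) * emeasure lborel (ball (0::'a) R)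
   + ennreal (inverse (R\<^sup>2)) * (\<Sum>b\<in>Basis. Xw b f)"
  unfolding Xw_sum_eq[symmetric]
  apply (subst nn_integral_add, measurable)
  apply (subst nn_integral_add, measurable)
  apply (simp add: nn_integral_cmult nn_integral_cmult_indicator)
  done
 also have "... \<le> ennreal (\<eta> powr (1 - p)) * ennreal P + ennreal (\<eta>\<^sup>2) * ennreal (R ^ DIM('a) * ?\<omega>) + ennreal (inverse (R\<^sup>2)) * ennreal (X\<^sup>2)"
  using R by (intro add_mono mult_left_mono P X) (auto simp: emeasure_ball_scale)
 also have "... = ennreal (\<eta> powr (1 - p) * P + \<eta>\<^sup>2 * (R ^ DIM('a) * ?\<omega>) + inverse (R\<^sup>2) * X\<^sup>2)"
  by (rule split[symmetric]) (use P R in simp_all)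
 also have "inverse (R\<^sup>2) * X\<^sup>2 = X\<^sup>2 / R\<^sup>2" by (simp add: divide_inverse)
 finally show ?thesis
  using P R by (subst (asm) ennreal_le_iff) (auto intro!: add_nonneg_nonneg mult_nonneg_nonneg)
qed

text \<open>In \<open>mass_split\<close> the radius R = 2 X / sqrt y, with y the squared norm of f,
  leaves y/4 of the mass outside the ball, and eta is chosen so that the values below it inside the
  ball carry at most y/4. The other half of the mass must come from the power p + 1, which gives P
  >= eta^(p-1) y/2.\<close>

lemma mass_lower_bound:
 fixes p :: real
 assumes p: "p > 1"
 obtains c where "c > 0" "\<And>(f :: 'a::euclidean_space L2) P X. (NBINT x. ennreal (norm (fn f x) powr (p + 1))) \<le> ennreal P ==> 0 \<le> P ==>
   (\<Sum>b\<in>Basis. Xw b f) \<le> ennreal (X\<^sup>2) ==> X > 0 ==> f \<noteq> 0 ==>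
   c * ((norm f)^2) powr (1 + (p - 1) * (2 + DIM('a)) / 4) * X powr (- (DIM('a) * (p - 1) / 2)) \<le> P"
proof -
 define \<omega> where "\<omega> = measure lborel (ball (0::'a) 1)"
 have \<omega>: "\<omega> > 0" unfolding \<omega>_def by (rule content_ball_pos) simp
 define N where "N = real DIM('a)"
 define c where "c = 1 / 2 * (4 * \<omega> * 2 powr N) powr (- ((p - 1) / 2))"
 show thesis
 proof (rule that[of c])
  show "c > 0" using \<omega> by (simp add: c_def)
  fix f :: "'a L2" and P X :: real
  assume P: "(NBINT x. ennreal (norm (fn f x) powr (p + 1))) \<le> ennreal P" "0 \<le> P"
   and X: "(\<Sum>b\<in>Basis. Xw b f) \<le> ennreal (X\<^sup>2)" "X > 0" and f: "f \<noteq> 0"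
  define y where "y = (norm f)^2"
  have y: "y > 0" using f by (simp add: y_def)
  define R where "R = 2 * X / sqrt y"
  have R: "R > 0" using X y by (simp add: R_def)
  define \<eta> where "\<eta> = sqrt (y / (4 * (R ^ DIM('a) * \<omega>)))"
  have \<eta>: "\<eta> > 0" using y R \<omega> by (simp add: \<eta>_def)
  have e2: "\<eta>\<^sup>2 * (R ^ DIM('a) * \<omega>) = y / 4"
   using y R \<omega> by (simp add: \<eta>_def)
  have "X\<^sup>2 / R\<^sup>2 = y / 4" using X y by (simp add: R_def power_divide power_mult_distrib)
  then have "y \<le> \<eta> powr (1 - p) * P + y / 4 + y / 4"
   using mass_split[OF p \<eta> R P X(1)] e2 by (simp add: y_def \<omega>_def)
  then have "y / 2 \<le> \<eta> powr (1 - p) * P" by simp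
  then have "\<eta> powr (p - 1) * (y / 2) \<le> \<eta> powr (p - 1) * (\<eta> powr (1 - p) * P)" by (rule mult_left_mono) simp
  also have "... = P" using \<eta> by (simp add: powr_add[symmetric] mult.assoc[symmetric])
  finally have main: "\<eta> powr (p - 1) * (y / 2) \<le> P" .
  have Rn: "R ^ DIM('a) = 2 powr N * X powr N * y powr (- (N / 2))"
  proof -
   have Req: "R = 2 * X * y powr (- (1 / 2))" unfolding R_def powr_minus powr_half_sqrt[OF less_imp_le[OF y]] by (rule divide_inverse)
   have "R ^ DIM('a) = R powr N" using R by (simp add: N_def powr_realpow)
   also have "... = (2 * X * y powr (- (1 / 2))) powr N" by (simp only: Req)
   also have "(2 * X * y powr (- (1 / 2))) powr N = 2 powr N * X powr N * y powr (- (1 / 2) * N)" by (simp only: powr_mult powr_powr)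
   also have "- (1 / 2) * N = - (N / 2)" by simp
   finally show ?thesis .
  qed
  have "\<eta> = (y / (4 * (R ^ DIM('a) * \<omega>))) powr (1 / 2)" using y R \<omega> by (simp add: \<eta>_def powr_half_sqrt)
  also have "y / (4 * (R ^ DIM('a) * \<omega>)) = (4 * \<omega> * 2 powr N) powr (- 1) * X powr (- N) * y powr (1 + N / 2)"
  proof -
   have "y powr (1 + N / 2) = y * y powr (N / 2)" using y by (simp add: powr_add)
   moreover have "(4 * \<omega> * 2 powr N) powr (- 1) = inverse (4 * \<omega> * 2 powr N)" using \<omega> by (simp add: powr_minus)
   ultimately show ?thesis unfolding Rn powr_minus
    by (simp only: divide_inverse inverse_mult_distrib inverse_inverse_eq mult_ac)
  qed
  finally have "\<eta> powr (p - 1) = ((4 * \<omega> * 2 powr N) powr (- 1) * X powr (- N) * y powr (1 + N / 2)) powr ((p - 1) / 2)"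
   by (simp add: powr_powr)
  also have "... = (4 * \<omega> * 2 powr N) powr (- ((p - 1) / 2)) * X powr (- (N * (p - 1) / 2)) * y powr ((p - 1) * (2 + N) / 4)"
   using \<omega> X y by (simp only: powr_mult powr_powr) (simp add: algebra_simps add_divide_distrib diff_divide_distrib)
  finally have e: "\<eta> powr (p - 1) = (4 * \<omega> * 2 powr N) powr (- ((p - 1) / 2)) * X powr (- (N * (p - 1) / 2)) * y powr ((p - 1) * (2 + N) / 4)" .
  have "c * y powr (1 + (p - 1) * (2 + N) / 4) * X powr (- (N * (p - 1) / 2)) = \<eta> powr (p - 1) * (y / 2)"
   unfolding e c_def using y by (simp add: powr_add)
  then show "c * ((norm f)^2) powr (1 + (p - 1) * (2 + DIM('a)) / 4) * X powr (- (DIM('a) * (p - 1) / 2)) \<le> P"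
   using main by (simp add: y_def N_def)
 qed
qed

text \<open>Where y is positive, the derivative of y^(-m) is at least m c t^(-sigma), which
  integrates to a multiple of t^(1-sigma). Monotonicity deals with the times after y has reached
  0.\<close>

lemma ode_decay:
 fixes y y' :: "real => real"
 assumes T0: "T0 > 0" and m: "m > 0" and \<sigma>: "\<sigma> < 1" and c: "c > 0"
  and der: "\<And>t. T0 \<le> t ==> (y has_real_derivative y' t) (at t)"
  and y0: "\<And>t. 0 \<le> y t" and mono: "\<And>s t. T0 \<le> s ==> s \<le> t ==> y t \<le> y s"
  and le: "\<And>t. T0 \<le> t ==> y t > 0 ==> y' t \<le> - c * y t powr (1 + m) * t powr (- \<sigma>)"
 obtains C where "C > 0" "\<And>t. T0 \<le> t ==> y t \<le> C * t powr (- ((1 - \<sigma>) / m))"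
proof (cases "y T0 = 0")
 case True
 show thesis
 proof (rule that[of 1])
  fix t assume "T0 \<le> t"
  then have "y t = 0" using mono[of T0 t] y0[of t] True by simp
  then show "y t \<le> 1 * t powr (- ((1 - \<sigma>) / m))" by simp
 qed simp
next
 case False
 then have yT: "y T0 > 0" using y0[of T0] by simp
 define \<kappa> where "\<kappa> = m * c / (1 - \<sigma>)"
 have \<kappa>: "\<kappa> > 0" using m c \<sigma> by (simp add: \<kappa>_def)
 \<comment> \<open>The first entry makes d t^(1-sigma) grow no faster than y^(-m), the second makes
   it start below y^(-m) at T0. The comparison then holds from T0 on without an additive
   constant.\<close>
 define d where "d = min \<kappa> (y T0 powr (- m) * T0 powr (- (1 - \<sigma>)))"
 have d: "d > 0" "d \<le> \<kappa>" "d * T0 powr (1 - \<sigma>) \<le> y T0 powr (- m)"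
 proof -
  show "d > 0" "d \<le> \<kappa>" using \<kappa> yT T0 by (auto simp: d_def)
  have "d * T0 powr (1 - \<sigma>) \<le> (y T0 powr (- m) * T0 powr (- (1 - \<sigma>))) * T0 powr (1 - \<sigma>)"
   by (intro mult_right_mono) (auto simp: d_def)
  also have "... = y T0 powr (- m)" using T0 by (simp add: mult.assoc powr_add[symmetric])
  finally show "d * T0 powr (1 - \<sigma>) \<le> y T0 powr (- m)" .
 qed
 show thesis
 proof (rule that[of "d powr (- (1 / m))"])
  show "d powr (- (1 / m)) > 0" using d by simp
  fix t assume t: "T0 \<le> t"
  show "y t \<le> d powr (- (1 / m)) * t powr (- ((1 - \<sigma>) / m))"
  proof (cases "y t = 0")
   case False
   then have yt: "y t > 0" using y0[of t] by simp
   have pos: "y s > 0" if "T0 \<le> s" "s \<le> t" for s using mono[OF that] yt by simp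
   let ?G = "%s. y s powr (- m) - d * s powr (1 - \<sigma>)"
   have "?G T0 \<le> ?G t"
   proof (rule DERIV_nonneg_imp_nondecreasing[where f = ?G, OF t])
    fix s assume s: "T0 \<le> s" "s \<le> t"
    have s0: "s > 0" using s T0 by simp
    have d1: "((%s. y s powr (- m)) has_real_derivative (- m * y s powr (- m - 1) * y' s)) (at s)"
     by (rule DERIV_chain2[OF has_real_derivative_powr[OF pos[OF s]] der[OF s(1)]])
    have d2: "((%s. d * s powr (1 - \<sigma>)) has_real_derivative d * ((1 - \<sigma>) * s powr (1 - \<sigma> - 1))) (at s)"
     by (rule DERIV_cmult[OF has_real_derivative_powr[OF s0]])
    have "d * ((1 - \<sigma>) * s powr (- \<sigma>)) \<le> \<kappa> * ((1 - \<sigma>) * s powr (- \<sigma>))" using d \<sigma> by (intro mult_right_mono) auto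
    also have "... = m * y s powr (- m - 1) * (c * y s powr (1 + m) * s powr (- \<sigma>))"
     using \<sigma> pos[OF s] powr_add[of "y s" "- m - 1" "1 + m"] by (simp add: \<kappa>_def mult_ac)
    also have "... \<le> m * y s powr (- m - 1) * (- y' s)"
     using le[OF s(1) pos[OF s]] m by (intro mult_left_mono) auto
    finally have "0 \<le> - m * y s powr (- m - 1) * y' s - d * ((1 - \<sigma>) * s powr (1 - \<sigma> - 1))" by simp
    then show "\<exists>D. (?G has_real_derivative D) (at s) \<and> 0 \<le> D" using DERIV_diff[OF d1 d2] by blast
   qed
   then have le: "d * t powr (1 - \<sigma>) \<le> y t powr (- m)" using d(3) by simp
   have t0: "t > 0" using t T0 by simp
   have "y t = (y t powr (- m)) powr (- (1 / m))" using yt m by (simp add: powr_powr)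
   also have "... \<le> (d * t powr (1 - \<sigma>)) powr (- (1 / m))" using m d t0 by (intro powr_mono2' le) auto
   also have "... = d powr (- (1 / m)) * t powr (- ((1 - \<sigma>) / m))" using d t0 by (simp add: powr_mult powr_powr)
   finally show ?thesis .
  qed simp
 qed
qed

context nls
begin

lemma sol_decay:
 fixes z :: "real => 'a L2"
 assumes z: "\<And>b. sol 0 b z" and fin: "Wj (FT (-1) (z 0)) < \<infinity>" "Wj (z 0) < \<infinity>"
  and T0: "T0 > 0" and \<sigma>: "DIM('a) * (p - 1) / 2 < 1"
 obtains C where "C > 0" "\<And>t. T0 \<le> t ==> norm (z t) \<le> C * t powr (- (2 * (1 - DIM('a) * (p - 1) / 2)) / ((p - 1) * (2 + DIM('a))))"
proof -
 define N where "N = real DIM('a)"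
 define \<sigma> where "\<sigma> = N * (p - 1) / 2"
 define m where "m = (p - 1) * (2 + N) / 4"
 have N: "N \<ge> 1" by (simp add: N_def Suc_le_eq)
 have m: "m > 0" using p1 N by (simp add: m_def)
 obtain A where A: "0 \<le> A" "Wj (FT (-1) (z 0)) = ennreal (A\<^sup>2)" by (rule ennreal_sq_obtain[OF fin(1)])
 obtain B where B: "0 \<le> B" "Wj (z 0) = ennreal (B\<^sup>2)" by (rule ennreal_sq_obtain[OF fin(2)])
 define u where "u t = U t (z t)" for t
 \<comment> \<open>For t >= T0 the bound A t + B of each component is at most (A + B/T0) t. The
   square root of N sums the components, and the added 1 keeps L positive when A = B = 0.\<close>
 define L where "L = sqrt N * (A + B / T0 + 1)"
 have L: "L > 0" unfolding L_def using N A B T0 by (intro mult_pos_pos add_nonneg_pos) auto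
 have X: "(\<Sum>b\<in>Basis. Xw b (u t)) \<le> ennreal ((L * t)^2)" if t: "T0 \<le> t" for t
 proof -
  have t0: "0 \<le> t" using t T0 by simp
  have "Xw b (u t) \<le> ennreal (((A + B / T0 + 1) * t)^2)" if b: "b \<in> Basis" for b
  proof -
   have "Xw b (FT (-1) (z t)) \<le> ennreal (A\<^sup>2)" by (rule sol_Xw_FT_le[OF z t0 order_refl]) (use Xw_le_Wj[OF b, of "FT (-1) (z 0)"] A in auto)
   moreover have "Xw b (z t) \<le> ennreal (B\<^sup>2)" by (rule sol_Xw_le[OF z t0 order_refl]) (use Xw_le_Wj[OF b, of "z 0"] B in auto)
   ultimately have "Xw b (u t) \<le> ennreal ((A * \<bar>t\<bar> + B)^2)" unfolding u_def by (intro Xw_U[OF b] A B)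
   also have "... \<le> ennreal (((A + B / T0 + 1) * t)^2)"
   proof (intro ennreal_leI power_mono)
    have "B * T0 \<le> B * t" using B t by (intro mult_left_mono)
    then have "B \<le> B / T0 * t" using T0 by (simp add: field_simps)
    then show "A * \<bar>t\<bar> + B \<le> (A + B / T0 + 1) * t" using t0 by (simp add: algebra_simps)
   qed (use A B in auto)
   finally show ?thesis .
  qed
  then have "(\<Sum>b\<in>Basis. Xw b (u t)) \<le> (\<Sum>b\<in>(Basis::'a set). ennreal (((A + B / T0 + 1) * t)^2))" by (rule sum_mono)
  also have "... = ennreal (N * ((A + B / T0 + 1) * t)^2)" by (simp add: N_def ennreal_mult ennreal_of_nat_eq_real_of_nat)
  also have "N * ((A + B / T0 + 1) * t)^2 = (L * t)^2" using N by (simp add: L_def power_mult_distrib)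
  finally show ?thesis .
 qed
 define P where "P t = (LBINT x. norm (fn (u t) x) powr (p + 1))" for t
 have pe: "a powr (p + 1) = a * a powr p" if "0 \<le> a" for a :: real
  using that p1 by (cases "a = 0") (simp_all add: powr_add)
 have Ub: "\<exists>K. u t \<in> Bq q K" if "0 \<le> t" for t using z[of t] that by (auto simp: u_def sol_def)
 have Pint: "integrable lborel (%x. norm (fn (u t) x) powr (p + 1))" if t: "0 \<le> t" for t
 proof -
  obtain K where "u t \<in> Bq q K" using Ub[OF t] by blast
  from integrable_L2_times[OF fn_L2[of "u t"] NL_L2[OF this]] show ?thesis by (simp add: pe norm_pn p1)
 qed
 have P0: "0 \<le> P t" for t by (simp add: P_def)
 have Pnn: "(NBINT x. ennreal (norm (fn (u t) x) powr (p + 1))) \<le> ennreal (P t)" if "0 \<le> t" for t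
  unfolding P_def using Pint[OF that] by (subst nn_integral_eq_integral) auto
 have vfP: "inner (z t) (vf t (z t)) = Im lam * P t" if t: "0 \<le> t" for t
 proof -
  obtain K where K: "u t \<in> Bq q K" using Ub[OF t] by blast
  have "inner (z t) (vf t (z t)) = inner (u t) (mlt (%_. - \<i> * lam) (NL p (u t)))"
   by (simp add: vf_def u_def U_const[symmetric] inner_U)
  also have "... = (LBINT x. fn (u t) x \<bullet> (- \<i> * lam * power_nonlinearity p (fn (u t) x)))"
   unfolding NL_def mlt_cls[OF bmeas_const NL_L2[OF K]] by (rule inner_cls_right[OF L2_space_cmult[OF NL_L2[OF K]]])
  also have "... = (LBINT x. Im lam * norm (fn (u t) x) powr (p + 1))"
  proof (rule Bochner_Integration.integral_cong[OF refl])
   fix x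
   let ?v = "fn (u t) x"
   have "?v \<bullet> (- \<i> * lam * power_nonlinearity p ?v) = norm ?v powr (p - 1) * (Im lam * (norm ?v)^2)"
    unfolding power_nonlinearity_def inner_complex_def cmod_power2 by (simp add: algebra_simps power2_eq_square)
   also have "norm ?v powr (p - 1) * (Im lam * (norm ?v)^2) = Im lam * norm ?v powr (p + 1)"
   proof -
    have "norm ?v powr (p + 1) = norm ?v powr (p - 1) * norm ?v powr 2" by (subst powr_add[symmetric]) (simp add: add.commute)
    then show ?thesis by (simp add: power2_powr)
   qed
   finally show "?v \<bullet> (- \<i> * lam * power_nonlinearity p ?v) = Im lam * norm ?v powr (p + 1)" .
  qed
  finally show ?thesis by (simp add: P_def)
 qed
 define y where "y t = inner (z t) (z t)" for t
 have yn: "y t = (norm (u t))^2" "y t = (norm (z t))^2" for t by (simp_all add: y_def u_def power2_norm_eq_inner)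
 have der: "(y has_real_derivative 2 * (Im lam * P t)) (at t)" if t: "T0 \<le> t" for t
 proof -
  have t0: "0 < t" using t T0 by simp
  have "(z has_vector_derivative vf t (z t)) (at t within {0..t+1})" using z[of "t + 1"] t0 by (simp add: sol_def)
  then have d: "(z has_vector_derivative vf t (z t)) (at t)" using at_within_Icc_at[of 0 t "t + 1"] t0 by simp
  have "(y has_vector_derivative (inner (z t) (vf t (z t)) + inner (vf t (z t)) (z t))) (at t)"
   unfolding y_def[abs_def] by (rule bounded_bilinear.has_vector_derivative[OF bounded_bilinear_inner d d])
  then show ?thesis using vfP[of t] t0 by (simp add: has_real_derivative_iff_has_vector_derivative inner_commute)
 qed
 have mono: "y t \<le> y s" if "T0 \<le> s" "s \<le> t" for s t
  unfolding yn(2) using sol_contraction[OF z[of t] sol_zero, of s t] that T0 by (intro power_mono) auto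
 obtain c where c: "c > 0" "\<And>(f :: 'a L2) P X. (NBINT x. ennreal (norm (fn f x) powr (p + 1))) \<le> ennreal P ==> 0 \<le> P ==>
   (\<Sum>b\<in>Basis. Xw b f) \<le> ennreal (X\<^sup>2) ==> X > 0 ==> f \<noteq> 0 ==>
   c * ((norm f)^2) powr (1 + (p - 1) * (2 + DIM('a)) / 4) * X powr (- (DIM('a) * (p - 1) / 2)) \<le> P"
  using mass_lower_bound[OF p1] by blast
 define c' where "c' = 2 * (- Im lam) * c * L powr (- \<sigma>)"
 have c': "c' > 0" using c lam_neg L by (simp add: c'_def mult_neg_pos)
 have le: "2 * (Im lam * P t) \<le> - c' * y t powr (1 + m) * t powr (- \<sigma>)" if t: "T0 \<le> t" and y: "y t > 0" for t
 proof -
  have t0: "t > 0" using t T0 by simp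
  have "u t \<noteq> 0" using y by (auto simp: yn(1))
  then have "c * y t powr (1 + m) * (L * t) powr (- \<sigma>) \<le> P t"
   using c(2)[OF Pnn P0 X[OF t]] t0 L by (simp add: yn(1) m_def \<sigma>_def N_def)
  then have "(- (2 * Im lam)) * (c * y t powr (1 + m) * (L * t) powr (- \<sigma>)) \<le> (- (2 * Im lam)) * P t"
   using lam_neg by (intro mult_left_mono) auto
  then show ?thesis using L t0 by (simp add: c'_def powr_mult algebra_simps)
 qed
 have s1: "\<sigma> < 1" using \<open>DIM('a) * (p - 1) / 2 < 1\<close> by (simp add: \<sigma>_def N_def)
 obtain C where C: "C > 0" "\<And>t. T0 \<le> t ==> y t \<le> C * t powr (- ((1 - \<sigma>) / m))"
  by (rule ode_decay[OF T0 m s1 c' der _ mono le]) (simp_all add: y_def)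
 show thesis
 proof (rule that[of "sqrt C"])
  show "sqrt C > 0" using C by simp
  fix t assume t: "T0 \<le> t"
  have t0: "t > 0" using t T0 by simp
  have "norm (z t) = sqrt (y t)" by (simp add: yn(2))
  also have "... \<le> sqrt (C * t powr (- ((1 - \<sigma>) / m)))" using C(2)[OF t] by simp
  also have "... = sqrt C * t powr (- ((1 - \<sigma>) / m) / 2)" using t0 by (simp add: real_sqrt_mult powr_half_sqrt[symmetric] powr_powr)
  also have "- ((1 - \<sigma>) / m) / 2 = - (2 * (1 - \<sigma>)) / ((p - 1) * (2 + N))"
  proof -
   have "- (a / (k / 4)) / 2 = - (2 * a) / k" for a k :: real by simp
   then show ?thesis unfolding m_def .
  qed
  finally show "norm (z t) \<le> sqrt C * t powr (- (2 * (1 - DIM('a) * (p - 1) / 2)) / ((p - 1) * (2 + DIM('a))))"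
   by (simp add: \<sigma>_def N_def)
 qed
qed

end

text \<open>With w = p - 1 and D the radicand of \<open>p_star\<close>, p < p_star(n) reads (n+2)^2
  w + (n-2) < sqrt D, and D = (n-2)^2 + 8 (n+2)^2. If the left side is not negative, squaring gives
  the quadratic inequality. The other two bounds hold because w >= 2/n, or w >= 3/2 for n = 1, would
  violate it.\<close>

lemma p_star_bounds:
 fixes p :: real and n :: nat
 assumes n: "n \<ge> 1" and p: "1 < p" "p < p_star n"
 shows "n \<ge> 2 ==> (real n + 2)\<^sup>2 * (p - 1)^2 + (2 * real n - 4) * (p - 1) < 8" "p < 1 + 2 / real n" "n = 1 ==> p < 5 / 2"
proof -
 define N where "N = real n"
 define D where "D = 9 * N ^ 2 + 28 * N + 36"
 define M where "M = (N + 2)^2"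
 define w where "w = p - 1"
 have N: "N \<ge> 1" using n by (simp add: N_def)
 have M: "M > 0" "M = N\<^sup>2 + 4 * N + 4" using N by (simp add: M_def, simp add: M_def power2_eq_square algebra_simps)
 have w: "w > 0" using p by (simp add: w_def)
 have "p * M < N ^ 2 + 3 * N + 6 + sqrt D"
  using p(2) M(1) by (simp add: p_star_def N_def[symmetric] D_def[symmetric] M_def[symmetric] pos_less_divide_eq)
 then have r: "M * w + (N - 2) < sqrt D" unfolding w_def M(2) by (simp add: algebra_simps)
 have D: "D = (N - 2)^2 + 8 * M" by (simp add: D_def M(2) power2_eq_square algebra_simps)
 have quad: "M * w\<^sup>2 + (2 * N - 4) * w < 8" if "0 \<le> M * w + (N - 2)"
 proof -
  have "(M * w + (N - 2))^2 < (sqrt D)\<^sup>2" using r that by (intro power_strict_mono) auto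
  also have "... = (N - 2)^2 + 8 * M" using M by (simp add: D)
  finally have "M * (M * w\<^sup>2 + (2 * N - 4) * w) < M * 8" by (simp add: power2_eq_square algebra_simps)
  then show ?thesis using M(1) by (rule mult_left_less_imp_less[OF _ less_imp_le])
 qed
 show "n \<ge> 2 ==> (real n + 2)\<^sup>2 * (p - 1)^2 + (2 * real n - 4) * (p - 1) < 8"
  using quad M w by (simp add: N_def M_def w_def)
 show "p < 1 + 2 / real n"
 proof (rule ccontr)
  assume "\<not> p < 1 + 2 / real n"
  then have h: "2 \<le> w * N" using N by (simp add: w_def N_def field_simps)
  have "0 \<le> M * w + (N - 2)"
  proof -
   have "2 \<le> 4 * w * N" using h unfolding mult.assoc by linarith
   moreover have "M * w = N * w * N + 4 * w * N + 4 * w" by (simp add: M(2) power2_eq_square algebra_simps)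
   moreover have "0 \<le> N * w * N" "0 \<le> 4 * w" using N w by auto
   ultimately show ?thesis using N by linarith
  qed
  then have "M * w\<^sup>2 + (2 * N - 4) * w < 8" by (rule quad)
  moreover have "M * w\<^sup>2 = (w * N) * (w * N) + 4 * w * (w * N) + 4 * w\<^sup>2" by (simp add: M(2) power2_eq_square algebra_simps)
  moreover have "2 * 2 \<le> (w * N) * (w * N)" using h by (intro mult_mono) auto
  moreover have "4 * w * 2 \<le> 4 * w * (w * N)" using h w by (intro mult_left_mono) auto
  moreover have "(2 * N - 4) * w = 2 * (w * N) - 4 * w" by (simp add: algebra_simps)
  moreover have "0 < 4 * w\<^sup>2" using w by simp
  ultimately show False using h w by linarith
 qed
 show "n = 1 ==> p < 5 / 2"
 proof -
  assume "n = 1"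
  then have N1: "N = 1" by (simp add: N_def)
  show ?thesis
  proof (rule ccontr)
   assume "\<not> p < 5 / 2"
   then have h: "w \<ge> 3 / 2" by (simp add: w_def)
   then have "M * w\<^sup>2 + (2 * N - 4) * w < 8" using quad by (simp add: M(2) N1)
   moreover have "3 / 2 * w \<le> w * w" using h by (intro mult_right_mono) auto
   ultimately show False using h by (simp add: M(2) N1 power2_eq_square)
  qed
 qed
qed

text \<open>A suitable theta lies between 2(p-1)/q and the minimum of 1, p-1 and 2/n. This interval
  is nonempty once q exceeds 2p and n(p-1), and for n >= 3 both numbers are below the critical
  exponent 2n/(n-2) exactly when p < n/(n-2).\<close>

lemma nls_exponents:
 fixes p :: real and n :: nat
 assumes n: "n \<ge> 1" and p: "p > 1" "n \<ge> 3 \<longrightarrow> p < real n / (real n - 2)"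
 obtains q \<theta> where "2 * p < q" "n \<ge> 3 \<longrightarrow> q < 2 * real n / (real n - 2)"
  "0 < \<theta>" "\<theta> < 1" "\<theta> < p - 1" "2 * (p - 1) < q * \<theta>" "real n * \<theta> < 2"
proof -
 define l where "l = max (2 * p) (real n * (p - 1))"
 have "\<exists>q>l. n \<ge> 3 \<longrightarrow> q < 2 * real n / (real n - 2)"
 proof (cases "n \<ge> 3")
  case True
  then have n2: "real n - 2 > 0" by simp
  have pn: "p < real n / (real n - 2)" using p True by simp
  have "real n * (p - 1) < 2 * real n / (real n - 2)"
  proof -
   have "p * (real n - 2) < real n" using pn n2 by (simp add: pos_less_divide_eq)
   then have "(p - 1) * (real n - 2) < 2" by (simp add: algebra_simps)
   then have "p - 1 < 2 / (real n - 2)" using n2 by (simp add: pos_less_divide_eq)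
   then have "real n * (p - 1) < real n * (2 / (real n - 2))" using n by (intro mult_strict_left_mono) auto
   then show ?thesis by (simp add: mult.commute)
  qed
  then have "l < 2 * real n / (real n - 2)" using pn by (simp add: l_def)
  then show ?thesis using dense by blast
 qed (auto intro: exI[of _ "l + 1"])
 then obtain q where q: "q > l" "n \<ge> 3 \<longrightarrow> q < 2 * real n / (real n - 2)" by blast
 have q1: "2 * p < q" "real n * (p - 1) < q" using q(1) by (auto simp: l_def)
 have q0: "q > 2" using q1 p by simp
 have "2 * (p - 1) / q < min (min 1 (p - 1)) (2 / real n)"
 proof -
  have "2 * (p - 1) / q < 1" using q1 q0 by (simp add: pos_divide_less_eq)
  moreover have "2 * (p - 1) / q < p - 1"
  proof -
   have "2 * (p - 1) < q * (p - 1)" using q0 p by (intro mult_strict_right_mono) auto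
   then show ?thesis using q0 by (simp add: pos_divide_less_eq mult.commute)
  qed
  moreover have "2 * (p - 1) / q < 2 / real n" using q1(2) q0 n by (simp add: field_simps)
  ultimately show ?thesis by simp
 qed
 then obtain \<theta> where \<theta>: "2 * (p - 1) / q < \<theta>" "\<theta> < min (min 1 (p - 1)) (2 / real n)" using dense by blast
 show thesis
 proof (rule that[OF q1(1) q(2)])
  have "0 < 2 * (p - 1) / q" using p q0 by simp
  then show "0 < \<theta>" using \<theta>(1) by linarith
  show "\<theta> < 1" "\<theta> < p - 1" using \<theta>(2) by auto
  show "2 * (p - 1) < q * \<theta>" using \<theta>(1) q0 by (simp add: pos_divide_less_eq mult.commute)
  show "real n * \<theta> < 2" using \<theta>(2) n by (simp add: field_simps)
 qed
qed

lemma powr_weaken: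
 fixes t T0 a b :: real
 assumes "0 < T0" "T0 \<le> t" "a \<le> b" shows "t powr a \<le> T0 powr (a - b) * t powr b"
proof -
 have "t powr a = t powr (a - b) * t powr b" using assms by (simp add: powr_add[symmetric])
 also have "... \<le> T0 powr (a - b) * t powr b" using assms by (intro mult_right_mono powr_mono2') auto
 finally show ?thesis .
qed

theorem theorem1p4:
  fixes n :: nat and p \<gamma> \<delta> \<delta>s \<theta> T0 :: real and lam :: complex
    and u0 :: "real ^ 'n \<Rightarrow> complex"
  assumes "n = CARD('n)"
    and "p > 1" and "n \<ge> 3 \<longrightarrow> p < real n / (real n - 2)"
    and "\<gamma> = gamma_exponent n"
    and "lam \<noteq> 0" and "Im lam < 0"
    and "(p - 1) / (2 * sqrt p) * \<bar>Re lam\<bar> \<le> \<bar>Im lam\<bar>"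
    and "\<delta> = 1" and "\<delta>s = 1 - real n / 2 * (p - 1)"
    and "0 < \<theta>" and "\<theta> < real n / 2 * (1 - p) + \<gamma> * p"
    and "\<delta>s < \<delta> * \<theta> / 2"
    and "T0 > 0"
    and "u0 \<in> H11_space"
  shows "\<exists>u. NLS_solution lam p u0 u \<and>
           (\<forall>v. NLS_solution lam p u0 v \<longrightarrow> (\<forall>t\<ge>0. AE x in lborel. v t x = u t x)) \<and>
           (\<exists>C>0. \<forall>t\<ge>T0.
              (p_star n \<le> p \<and> p < 1 + 2 / real n \<longrightarrow>
                 L2_norm (u t) \<le> C * t powr (- (2 * \<delta>s) / ((p - 1) * (2 + real n)))) \<and>
              (p_star_star n < p \<and> p < p_star n \<longrightarrow>
                 L2_norm (u t) \<le> C * t powr (\<delta>s - \<delta> * \<theta> / 2)))"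
proof -
 let ?d = "TYPE(real ^ 'n)"
 have n: "n \<ge> 1" using assms(1) by (simp add: Suc_le_eq)
 have dim: "DIM(real ^ 'n) = n" using assms(1) by simp
 obtain q \<tau> where q: "2 * p < q" "n \<ge> 3 \<longrightarrow> q < 2 * real n / (real n - 2)"
  "0 < \<tau>" "\<tau> < 1" "\<tau> < p - 1" "2 * (p - 1) < q * \<tau>" "real n * \<tau> < 2"
  by (rule nls_exponents[OF n assms(2,3)])
 interpret nls p q \<tau> lam ?d
  by unfold_locales (use assms(2,6,7) q in \<open>simp_all only: dim\<close>)
 have u0: "u0 \<in> L2_space" "Wj (cls u0) < \<infinity>" "Wj (FT (-1) (cls u0)) < \<infinity>"
  using assms(14) by (auto simp: H11_space_iff)
 obtain z where z: "z 0 = cls u0" "\<And>b. sol 0 b z" using global_existence[OF u0(3)] by blast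
 have fin: "Wj (FT (-1) (z 0)) < \<infinity>" "Wj (z 0) < \<infinity>" using u0 z by simp_all
 define u where "u t = fn (U t (z t))" for t
 have u: "NLS_solution lam p u0 u" unfolding u_def[abs_def] by (rule sol_NLS_solution[OF z(2) fin u0(1) z(1)])
 have uniq: "\<forall>v. NLS_solution lam p u0 v \<longrightarrow> (\<forall>t\<ge>0. AE x in lborel. v t x = u t x)"
  using NLS_solution_unique[OF _ u] by blast
 have norm_u: "L2_norm (u t) = norm (z t)" for t by (simp add: u_def norm_L2_eq[symmetric])
 define e1 e2 where "e1 = - (2 * \<delta>s) / ((p - 1) * (2 + real n))" and "e2 = \<delta>s - \<delta> * \<theta> / 2"
 have "\<exists>C>0. \<forall>t\<ge>T0. (p_star n \<le> p \<and> p < 1 + 2 / real n \<longrightarrow> L2_norm (u t) \<le> C * t powr e1) \<and>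
   (p_star_star n < p \<and> p < p_star n \<longrightarrow> L2_norm (u t) \<le> C * t powr e2)"
 proof (cases "p < 1 + 2 / real n")
  \<comment> \<open>The first range is excluded by assumption and the second because p_star(n) does
    not exceed 1 + 2/n, so both claims are vacuous and any positive constant serves.\<close>
  case False
  then show ?thesis using p_star_bounds(2)[OF n assms(2)] by (intro exI[of _ 1]) auto
 next
  case True
  then have \<sigma>: "real n * (p - 1) / 2 < 1" using n by (simp add: field_simps)
  obtain C where C: "C > 0" "\<And>t. T0 \<le> t ==> norm (z t) \<le> C * t powr e1"
  proof (rule sol_decay[OF z(2) fin assms(13)])
   show "DIM(real ^ 'n) * (p - 1) / 2 < 1" using \<sigma> by (simp only: dim)
   fix C assume "C > 0" and le: "\<And>t. T0 \<le> t ==> norm (z t) \<le> C * t powr (- (2 * (1 - DIM(real ^ 'n) * (p - 1) / 2)) / ((p - 1) * (2 + DIM(real ^ 'n))))"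
   moreover have "- (2 * (1 - DIM(real ^ 'n) * (p - 1) / 2)) / ((p - 1) * (2 + DIM(real ^ 'n))) = e1"
    unfolding dim e1_def assms(9) by simp
   ultimately show thesis using that by simp
  qed
  have e12: "e1 \<le> e2" if ps: "p < p_star n"
  proof -
   \<comment> \<open>For n = 1 the bounds on theta force theta < 1/2, hence p > 5/2, which
     contradicts p < p_star(1).\<close>
   have n2: "n \<ge> 2"
   proof (rule ccontr)
    assume "\<not> n \<ge> 2"
    then have n1: "n = 1" using n by simp
    have g: "\<gamma> = 1 / 2" using assms(4) n1 by (simp add: gamma_exponent_def)
    have "p > 5 / 2" using assms(9,11,12) unfolding g assms(8) n1 by (simp add: field_simps)
    then show False using p_star_bounds(3)[OF n assms(2) ps n1] by simp
   qed
   define w N where "w = p - 1" and "N = real n"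
   have w: "w > 0" and N: "N \<ge> 2" using assms(2) n2 by (simp_all add: w_def N_def)
   have quad: "(N + 2)^2 * w\<^sup>2 + (2 * N - 4) * w < 8"
    using p_star_bounds(1)[OF n assms(2) ps n2] by (simp add: w_def N_def)
   have \<theta>: "\<theta> < 1 + w - N * w / 2" using assms(4,11) n2 by (simp add: gamma_exponent_def w_def N_def field_simps)
   have \<delta>s: "\<delta>s = 1 - N * w / 2" using assms(9) by (simp add: w_def N_def)
   have "\<theta> / 2 - \<delta>s \<le> ((N + 2) * w - 2) / 4" using \<theta> \<delta>s by (simp add: field_simps)
   \<comment> \<open>After multiplication by w (2 + N) this is the quadratic inequality of
     \<open>p_star_bounds\<close>: the threshold is where the decay rate at the upper limit of theta
     meets the first rate.\<close>
   also have "... \<le> 2 * \<delta>s / (w * (2 + N))"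
   proof -
    have "((N + 2) * w - 2) / 4 * (w * (2 + N)) = ((N + 2)^2 * w\<^sup>2 - 2 * (N + 2) * w) / 4"
     by (simp add: power2_eq_square algebra_simps)
    also have "... \<le> 2 * \<delta>s" 
    proof -
     have e: "(2 * N - 4) * w = 2 * (N * w) - 4 * w" "2 * (N + 2) * w = 2 * (N * w) + 4 * w" by (simp_all add: algebra_simps)
     have "(x - (2 * a + 4 * w)) / 4 \<le> 2 * (1 - a / 2)" if "x + (2 * a - 4 * w) < 8" for x a using that by simp
     from this[OF quad[unfolded e]] show ?thesis unfolding \<delta>s e .
    qed
    finally show ?thesis using w N by (subst pos_le_divide_eq) auto
   qed
   finally show ?thesis using assms(8) by (simp add: e1_def e2_def w_def N_def)
  qed
  \<comment> \<open>One constant for both rates: the second summand is the factor lost in replacing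
    the exponent e1 by e2 on t >= T0.\<close>
  define D where "D = C + C * T0 powr (e1 - e2)"
  have D: "C \<le> D" "C * T0 powr (e1 - e2) \<le> D" "D > 0" using C(1) by (auto simp: D_def add_pos_nonneg)
  show ?thesis
  proof (intro exI[of _ D] conjI allI impI D)
   fix t assume t: "T0 \<le> t"
   show "L2_norm (u t) \<le> D * t powr e1"
    unfolding norm_u using C(2)[OF t] mult_right_mono[OF D(1), of "t powr e1"] by simp
   assume "p_star_star n < p \<and> p < p_star n"
   then have "t powr e1 \<le> T0 powr (e1 - e2) * t powr e2" using e12 assms(13) t by (intro powr_weaken) auto
   then have "C * t powr e1 \<le> C * (T0 powr (e1 - e2) * t powr e2)" using C(1) by (intro mult_left_mono) auto
   also have "... \<le> D * t powr e2" unfolding mult.assoc[symmetric] by (intro mult_right_mono D) simp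
   finally show "L2_norm (u t) \<le> D * t powr e2" unfolding norm_u using C(2)[OF t] by simp
  qed
 qed
 then show ?thesis using u uniq unfolding e1_def e2_def by blast
qed

end
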